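(* Let $n\ge2$, $p\ge1$ and $q\in\{1,\dots,p\}$ be integers. Assume that the operators $C_{i\,i-1}$, $i=2,\dots,n$, satisfy the Coupling hypothesis of order $n$, where the operators $\Pi_i$ satisfy the Coupling observability hypothesis of order $n$; that $C_{i\,j}$ and $C_{i\,j}^{*}$ are in $\mathcal L(H_k)$ for $i\in\{n+1,\dots,n+p\}$, $j\in\{n-1,\dots,i-1\}$ and $k=0,1$; and that $\mathbf{B}_{n+j}^{*}$ satisfies the Admissibility and Observability hypotheses of index $n+j$ for all $j\in\{0,\dots,p\}$. Let $T_{n+p}^{*}>0$ be the observability time defined in the context. Assume that $\mathbf{B}_{n+k}^{*}(w_{n+k},w_{n+k}')=B_{n+k}^{*}w_{n+k}$ with $B_{n+k}\in\mathcal L(G_{n+k},H_2')$ for all $k\in\{0,\dots,q\}$, and that $\mathbf{B}_{n+k}^{*}(w_{n+k},w_{n+k}')=B_{n+k}^{*}w_{n+k}'$ with $B_{n+k}\in\mathcal L(G_{n+k},H)$ for all $k\in\{q+1,\dots,p\}$. Set $$N_{(n+p-1)}^{*}=\Big(\big(\prod_{i=1}^nH_{n-i}\big)\times H^q\times H_1^{p-q}\Big)\times\Big(\big(\prod_{i=1}^nH_{n-i-1}\big)\times H_{-1}^q\times H^{p-q}\Big).$$ Then for all $T>T_{n+p}^{*}$ and all $Y_0\in N_{(n+p-1)}^{*}$ there exist control functions $v_{n+k}\in L^2((0,T);G_{n+k})$, $k=0,\dots,p$, such that the solution $Y=(y_1,\dots,y_{n+p},y_1',\dots,y_{n+p}')$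 of the control system with initial data $Y_0$ satisfies $Y(T)=0$.
   Context: Abstract setting. $H$ is a Hilbert space with norm $|\cdot|$ and scalar product $\langle\cdot,\cdot\rangle$. $A:D(A)\subset H\to H$ is a positive self-adjoint operator with compact resolvent such that, for some $\omega>0$, $|Au|\ge\omega|u|$ for all $u\in D(A)$. For $k\in\mathbb N$, $H_k=D(A^{k/2})$ with norm $|A^{k/2}\cdot|$ ($H_0=H$), and $H_{-k}=H_k'$ is the dual of $H_k$ with pivot space $H$, with norm $|A^{-k/2}\cdot|$. For $k\in\mathbb Z$ and a pair $W=(w,w')$, $e_k(W)=\frac12\big(|A^{k/2}w|^2+|A^{(k-1)/2}w'|^2\big)$. Coupling hypothesis of order $n$. For all $i\in\{2,\dots,n\}$: $C_{i\,i-1}$ is a bounded operator on $H$; $C_{i\,i-1}^{*}\in\mathcal L(H_k)$ for $k\in\{0,1,\dots,n-i+1\}$; $\|C_{i\,i-1}\|=\beta_i$ and $|C_{i\,i-1}w|^2\le\beta_i\langle C_{i\,i-1}w,w\rangle$ for all $w\in H$; there exists $\alpha_i>0$ such that $\alpha_i|\Pi_iw|^2\le\langle C_{i\,i-1}w,w\rangle$ for all $w\in H$. Coupling observability hypothesis of order $n$. For all $i\in\{2,\dots,n\}$: $\Pi_i\in\mathcal L(H)$ and there exists $T_{0,i}>0$ such that for all $T>T_{0,i}$ there exists $\gamma_i(T)>0$ such that all solutions $w$ of $w''+Aw=0$ satisfy $\int_0^T|\Pi_iw'|^2dt\ge\gamma_i(T)e_1(W)(0)$, where $W=(w,w')$.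 Admissibility hypothesis of index $m$. $G_m$ is a Hilbert space (identified with its dual), $\mathbf{B}_m^{*}\in\mathcal L(H_2\times H;G_m)$, and for all $T>0$ there exists $D_m(T)>0$ such that all solutions $w$ of $w''+Aw=f\in L^2([0,T];H)$ satisfy, with $W=(w,w')$, $$\int_0^T\|\mathbf{B}_m^{*}(w,w')\|_{G_m}^2dt\le D_m(T)\Big(e_1(W)(0)+e_1(W)(T)+\int_0^Te_1(W)(t)\,dt+\int_0^T|f|^2dt\Big).$$ Observations of solutions of lower regularity are understood by extension by density. Observability hypothesis of index $m$. There exists $T_{0,m}>0$ such that for all $T>T_{0,m}$ there exists $R_m(T)>0$ such that all solutions $w$ of $w''+Aw=0$ satisfy $\int_0^T\|\mathbf{B}_m^{*}(w,w')\|_{G_m}^2dt\ge R_m(T)e_1(W)(0)$. Dual mixed cascade system: $w_1''+Aw_1=0$; $w_i''+Aw_i+C_{i\,i-1}w_{i-1}=0$ ($2\le i\le n$); $w_i''+Aw_i+\sum_{k=n-1}^{i-1}C_{i\,k}w_k=0$ ($n+1\le i\le n+p$); $W_i=(w_i,w_i')$. Observability time $T_{n+p}^{*}$: a time $T_{n+p}^{*}>0$ such that for all $T>T_{n+p}^{*}$ there are constants $d_{i,n}(T)>0$, $\rho_{n,k}(T)>0$ such that every solution of the dual mixed cascade system with initial data in $H_1^{n+p}\times H^{n+p}$ satisfies $e_{1+i-n}(W_i)(0)\le d_{i,n}(T)\int_0^T\|\mathbf{B}_n^{*}(W_n)\|_{G_n}^2dt$ for $i=1,\dots,n$ (with $d_{i,n}(T)\le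 K/T^3$ for $i\le n-1$, $d_{n,n}(T)\le K/T$, $K$ bounded with respect to $T$), and $e_1(W_{n+k})(0)\le\rho_{n,k}(T)\sum_{l=0}^k\int_0^T\|\mathbf{B}_{n+l}^{*}(W_{n+l})\|_{G_{n+l}}^2dt$ for $k=1,\dots,p$; moreover $T_{n+p}^{*}\ge T_{0,n+j}$ for $1\le j\le p$, where the $T_{0,n+j}$ are the times in the Observability hypotheses. (Under the hypotheses above such a time exists; the paper takes the maximum of the observability time of the first $n$ equations and of the $T_{0,n+j}$, $1\le j\le p$.) Control system, with $Y_0=(y_1^0,\dots,y_{n+p}^0,y_1^1,\dots,y_{n+p}^1)$: $$\begin{cases}y_i''+Ay_i+C_{i+1\,i}^{*}y_{i+1}=0,&1\le i\le n-2,\\ y_{n-1}''+Ay_{n-1}+\sum_{k=n}^{n+p}C_{k\,n-1}^{*}y_k=0,\\ y_i''+Ay_i+\sum_{k=i+1}^{n+p}C_{k\,i}^{*}y_k=B_iv_i,&n\le i\le n+p-1,\\ y_{n+p}''+Ay_{n+p}=B_{n+p}v_{n+p},\\ (y_i,y_i')(0)=(y_i^0,y_i^1),&1\le i\le n+p,\end{cases}$$ where the first line is absent if $n=2$. Solutions are understood in the sense of transposition: $Y$ is continuous in time with values in $N_{(n+p-1)}^{*}$ and, for every $t\in[0,T]$ and every solution $(w_1,\dots,w_{n+p})$ of the dual mixed cascade system with data at time $t$ in $(\prod_{i=1}^nH_{1+i-n}\times H_1^q\times H^{p-q})\times(\prod_{i=1}^nH_{i-n}\times H^q\times H_{-1}^{p-q})$,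 $$\int_0^t\sum_{l=0}^p\langle v_{n+l},B_{n+l}^{*}w_{n+l}\rangle_{G_{n+l}}ds=\sum_{k=1}^{n+p}\big(\langle y_k'(t),w_k(t)\rangle-\langle y_k(t),w_k'(t)\rangle\big)-\sum_{k=1}^{n+p}\big(\langle y_k^1,w_k(0)\rangle-\langle y_k^0,w_k'(0)\rangle\big),$$ with the appropriate duality pairings. *)

theory Defs
  imports "HOL-Analysis.Analysis"
begin

text \<open>An unbounded operator on the (real) Hilbert space \<open>H\<close> is represented by its graph, a subset
  of \<open>H \<times> H\<close>; \<open>D(S)\<close> is then \<open>Domain S\<close>, products are relational compositions and inverses are
  converses.\<close>

type_synonym 'h operator = "('h \<times> 'h) set"

definition app_op :: "'h operator \<Rightarrow> 'h \<Rightarrow> 'h" where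
  "app_op S u = (THE f. (u, f) \<in> S)"

definition adjoint_op :: "'h::real_inner operator \<Rightarrow> 'h operator" where
  "adjoint_op S = {(u, f). \<forall>(v, g)\<in>S. g \<bullet> u = v \<bullet> f}"

definition selfadjoint_op :: "'h::real_inner operator \<Rightarrow> bool" where
  "selfadjoint_op S \<longleftrightarrow>
     subspace S \<and> single_valued S \<and> closure (Domain S) = UNIV \<and> adjoint_op S = S"

definition positive_op :: "'h::real_inner operator \<Rightarrow> bool" where
  "positive_op S \<longleftrightarrow> (\<forall>(u, f)\<in>S. 0 \<le> f \<bullet> u)"

definition resolvent_op :: "'h::real_inner operator \<Rightarrow> real \<Rightarrow> 'h operator" where
  "resolvent_op S \<mu> = {(f - \<mu> *\<^sub>R u, u) |u f. (u, f) \<in> S}"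

definition compact_resolvent :: "'h::real_inner operator \<Rightarrow> bool" where
  "compact_resolvent S \<longleftrightarrow>
     (\<exists>\<mu>. single_valued (resolvent_op S \<mu>) \<and> Domain (resolvent_op S \<mu>) = UNIV \<and>
          compact (closure (resolvent_op S \<mu> `` cball 0 1)))"

definition sqrt_op :: "'h::real_inner operator \<Rightarrow> 'h operator" where
  "sqrt_op A = (THE R. selfadjoint_op R \<and> positive_op R \<and> R O R = A)"

text \<open>The operator \<open>A\<^bsup>k/2\<^esup>\<close> for an integer \<open>k\<close>, as a graph and as a function.\<close>

definition half_pow :: "'h::real_inner operator \<Rightarrow> int \<Rightarrow> 'h operator" where
  "half_pow A k =
     (if 0 \<le> k then sqrt_op A ^^ nat k else (converse (sqrt_op A)) ^^ nat (- k))"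

definition hpow :: "'h::real_inner operator \<Rightarrow> int \<Rightarrow> 'h \<Rightarrow> 'h" where
  "hpow A k = app_op (half_pow A k)"

definition Hdom :: "'h::real_inner operator \<Rightarrow> int \<Rightarrow> 'h set" where
  "Hdom A k = Domain (half_pow A k)"

definition lin_on :: "'a::real_vector set \<Rightarrow> ('a \<Rightarrow> 'b::real_vector) \<Rightarrow> bool" where
  "lin_on S f \<longleftrightarrow>
     (\<forall>x\<in>S. \<forall>y\<in>S. \<forall>a b. f (a *\<^sub>R x + b *\<^sub>R y) = a *\<^sub>R f x + b *\<^sub>R f y)"

text \<open>Membership of an operator on \<open>H\<close> in \<open>\<L>(H\<^sub>k)\<close>, for \<open>k \<ge> 0\<close>.\<close>

definition bounded_on_H :: "'h::real_inner operator \<Rightarrow> int \<Rightarrow> ('h \<Rightarrow> 'h) \<Rightarrow> bool" where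
  "bounded_on_H A k S \<longleftrightarrow>
     lin_on (Hdom A k) S \<and> S ` Hdom A k \<subseteq> Hdom A k \<and>
     (\<exists>M. \<forall>u\<in>Hdom A k. norm (hpow A k (S u)) \<le> M * norm (hpow A k u))"

text \<open>Elements of the spaces \<open>H\<^sub>k\<close>, \<open>k \<in> \<int>\<close>, are all represented by real functions on \<open>H\<close>.
  For \<open>k \<ge> 0\<close>, \<open>u \<in> D(A\<^bsup>k/2\<^esup>)\<close> is represented by \<open>\<langle>u, \<cdot>\<rangle>\<close> (\<open>H\<close> is the pivot space).
  For \<open>k < 0\<close>, \<open>H\<^sub>k\<close> is the dual of \<open>D(A\<^bsup>-k/2\<^esup>)\<close>, a functional being extended by \<open>0\<close> to the rest
  of \<open>H\<close> so that equality of elements is equality of functions. The inclusion \<open>H\<^sub>k \<subseteq> H\<^sub>k\<^sub>-\<^sub>1\<close> is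
  restriction of functionals; accordingly \<open>Hnorm A k\<close> with \<open>k < 0\<close> only looks at values on
  \<open>D(A\<^bsup>-k/2\<^esup>)\<close>.\<close>

type_synonym 'h gvec = "'h \<Rightarrow> real"

definition Hs :: "'h::real_inner operator \<Rightarrow> int \<Rightarrow> 'h gvec set" where
  "Hs A k =
     (if 0 \<le> k then (\<lambda>u v. u \<bullet> v) ` Hdom A k
      else {\<phi>. lin_on (Hdom A (- k)) \<phi> \<and>
               (\<exists>M. \<forall>v\<in>Hdom A (- k). \<bar>\<phi> v\<bar> \<le> M * norm (hpow A (- k) v)) \<and>
               (\<forall>v. v \<notin> Hdom A (- k) \<longrightarrow> \<phi> v = 0)})"

definition riesz :: "'h::real_inner gvec \<Rightarrow> 'h" where
  "riesz \<phi> = (THE u. \<phi> = (\<lambda>v. u \<bullet> v))"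

definition Hnorm :: "'h::real_inner operator \<Rightarrow> int \<Rightarrow> 'h gvec \<Rightarrow> real" where
  "Hnorm A k \<phi> =
     (if 0 \<le> k then norm (hpow A k (riesz \<phi>))
      else Sup {\<bar>\<phi> v\<bar> |v. v \<in> Hdom A (- k) \<and> norm (hpow A (- k) v) \<le> 1})"

text \<open>The duality pairing of \<open>\<phi> \<in> H\<^sub>k\<close> with \<open>\<psi> \<in> H\<^sub>-\<^sub>k\<close>.\<close>

definition dpair :: "int \<Rightarrow> 'h::real_inner gvec \<Rightarrow> 'h gvec \<Rightarrow> real" where
  "dpair k \<phi> \<psi> = (if 0 \<le> k then \<psi> (riesz \<phi>) else \<phi> (riesz \<psi>))"

definition Hcont :: "'h::real_inner operator \<Rightarrow> int \<Rightarrow> real \<Rightarrow> (real \<Rightarrow> 'h gvec) \<Rightarrow> bool" where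
  "Hcont A k T w \<longleftrightarrow>
     (\<forall>t\<in>{0..T}. w t \<in> Hs A k \<and>
        ((\<lambda>s. Hnorm A k (\<lambda>v. w s v - w t v)) \<longlongrightarrow> 0) (at t within {0..T}))"

definition Hderiv ::
  "'h::real_inner operator \<Rightarrow> int \<Rightarrow> real \<Rightarrow> (real \<Rightarrow> 'h gvec) \<Rightarrow> (real \<Rightarrow> 'h gvec) \<Rightarrow> bool" where
  "Hderiv A k T w w' \<longleftrightarrow>
     (\<forall>t\<in>{0..T}.
        ((\<lambda>s. Hnorm A k (\<lambda>v. (w s v - w t v) / (s - t) - w' t v)) \<longlongrightarrow> 0) (at t within {0..T}))"

text \<open>\<open>e\<^sub>k(w, w')\<close> for \<open>w, w'\<close> in \<open>H\<close>, which for \<open>k \<le> 1\<close> and \<open>w \<in> H\<^sub>1\<close> is all that is needed below.\<close>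

definition energy :: "'h::real_inner operator \<Rightarrow> int \<Rightarrow> 'h \<Rightarrow> 'h \<Rightarrow> real" where
  "energy A k w w' = ((norm (hpow A k w))\<^sup>2 + (norm (hpow A (k - 1) w'))\<^sup>2) / 2"

text \<open>Bochner square-integrable functions. The Hilbert spaces need not be separable, so strong
  measurability is spelled out.\<close>

definition L2_fun :: "real \<Rightarrow> (real \<Rightarrow> 'a::real_inner) \<Rightarrow> bool" where
  "L2_fun T f \<longleftrightarrow>
     (\<exists>s. (\<forall>j::nat. simple_function (lebesgue_on {0..T}) (s j)) \<and>
          (AE t in lebesgue_on {0..T}. (\<lambda>j. s j t) \<longlonglongrightarrow> f t)) \<and>
     integrable (lebesgue_on {0..T}) (\<lambda>t. (norm (f t))\<^sup>2)"

definition L2_sq :: "real \<Rightarrow> (real \<Rightarrow> 'a::real_inner) \<Rightarrow> real" where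
  "L2_sq T f = (LINT t|lebesgue_on {0..T}. (norm (f t))\<^sup>2)"

definition smooth_vec :: "'h::real_inner operator \<Rightarrow> 'h set" where
  "smooth_vec A = (\<Inter>k::nat. Hdom A (int k))"

text \<open>\<open>w \<in> C([0,T]; H\<^sub>k) \<inter> C\<^sup>1([0,T]; H\<^sub>k\<^sub>-\<^sub>1)\<close> with derivative \<open>w'\<close> is a solution of
  \<open>w'' + A w = f\<close>, the equation being tested with the smooth vectors \<open>v \<in> \<Inter>\<^sub>m D(A\<^bsup>m/2\<^esup>)\<close>
  (a dense subspace of every \<open>H\<^sub>m\<close>) and integrated once in time.\<close>

definition wave_sol ::
  "'h::real_inner operator \<Rightarrow> int \<Rightarrow> real \<Rightarrow>
   (real \<Rightarrow> 'h gvec) \<Rightarrow> (real \<Rightarrow> 'h gvec) \<Rightarrow> (real \<Rightarrow> 'h gvec) \<Rightarrow> bool" where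
  "wave_sol A k T w w' f \<longleftrightarrow>
     Hcont A k T w \<and> Hcont A (k - 1) T w' \<and> Hderiv A (k - 1) T w w' \<and>
     (\<forall>v\<in>smooth_vec A.
        integrable (lebesgue_on {0..T}) (\<lambda>s. f s v) \<and>
        (\<forall>t\<in>{0..T}. w' t v = w' 0 v + (LINT s|lebesgue_on {0..t}. f s v - w s (app_op A v))))"

text \<open>The same for \<open>H\<close>-valued functions and level \<open>k \<ge> 1\<close>, with source in \<open>L\<^sup>2(0,T;H)\<close>.
  Level \<open>1\<close> is the finite energy level.\<close>

definition wave_vec ::
  "'h::real_inner operator \<Rightarrow> int \<Rightarrow> real \<Rightarrow>
   (real \<Rightarrow> 'h) \<Rightarrow> (real \<Rightarrow> 'h) \<Rightarrow> (real \<Rightarrow> 'h) \<Rightarrow> bool" where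
  "wave_vec A k T w w' f \<longleftrightarrow>
     L2_fun T f \<and>
     wave_sol A k T (\<lambda>t v. w t \<bullet> v) (\<lambda>t v. w' t \<bullet> v) (\<lambda>t v. f t \<bullet> v)"

text \<open>\<open>g \<in> L\<^sup>2(0,T)\<close> is the observation \<open>B\<^sup>*(w, w')\<close> of the finite energy trajectory \<open>w\<close>.
  As \<open>B\<^sup>*\<close> is only defined on \<open>H\<^sub>2 \<times> H\<close>, this is the extension by density: \<open>g\<close> is the limit of the
  observations of solutions in \<open>C([0,T]; H\<^sub>2) \<inter> C\<^sup>1([0,T]; H\<^sub>1)\<close> that, together with their sources,
  converge to \<open>w\<close>.\<close>

definition observation ::
  "'h::real_inner operator \<Rightarrow> ('h \<times> 'h \<Rightarrow> 'g::real_inner) \<Rightarrow> real \<Rightarrow>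
   (real \<Rightarrow> 'h) \<Rightarrow> (real \<Rightarrow> 'h) \<Rightarrow> (real \<Rightarrow> 'g) \<Rightarrow> bool" where
  "observation A Bs T w w' g \<longleftrightarrow>
     L2_fun T g \<and>
     (\<exists>f x x' \<phi>.
        wave_vec A 1 T w w' f \<and>
        (\<forall>j::nat. wave_vec A 2 T (x j) (x' j) (\<phi> j)) \<and>
        uniform_limit {0..T} (\<lambda>j t. hpow A 1 (x j t)) (\<lambda>t. hpow A 1 (w t)) sequentially \<and>
        uniform_limit {0..T} x' w' sequentially \<and>
        (\<lambda>j. L2_sq T (\<lambda>t. \<phi> j t - f t)) \<longlonglongrightarrow> 0 \<and>
        (\<lambda>j. L2_sq T (\<lambda>t. Bs (x j t, x' j t) - g t)) \<longlonglongrightarrow> 0)"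

definition coupling_hyp ::
  "'h::real_inner operator \<Rightarrow> (nat \<Rightarrow> nat \<Rightarrow> 'h \<Rightarrow> 'h) \<Rightarrow> (nat \<Rightarrow> 'h \<Rightarrow> 'h) \<Rightarrow> nat \<Rightarrow> bool" where
  "coupling_hyp A C P n \<longleftrightarrow>
     (\<forall>i\<in>{2..n}.
        bounded_linear (C i (i - 1)) \<and>
        (\<forall>k\<in>{0..n - i + 1}. bounded_on_H A (int k) (adjoint (C i (i - 1)))) \<and>
        (\<exists>\<beta>. onorm (C i (i - 1)) = \<beta> \<and>
             (\<forall>w. (norm (C i (i - 1) w))\<^sup>2 \<le> \<beta> * (C i (i - 1) w \<bullet> w))) \<and>
        (\<exists>\<alpha>>0. \<forall>w. \<alpha> * (norm (P i w))\<^sup>2 \<le> C i (i - 1) w \<bullet> w))"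

definition coupling_observability_hyp ::
  "'h::real_inner operator \<Rightarrow> (nat \<Rightarrow> 'h \<Rightarrow> 'h) \<Rightarrow> nat \<Rightarrow> bool" where
  "coupling_observability_hyp A P n \<longleftrightarrow>
     (\<forall>i\<in>{2..n}.
        bounded_linear (P i) \<and>
        (\<exists>T\<^sub>0>0. \<forall>T>T\<^sub>0. \<exists>\<gamma>>0. \<forall>w w'.
           wave_vec A 1 T w w' (\<lambda>_. 0) \<longrightarrow>
           L2_sq T (\<lambda>t. P i (w' t)) \<ge> \<gamma> * energy A 1 (w 0) (w' 0)))"

text \<open>Each space \<open>G\<^sub>m\<close> is a closed subspace of one ambient Hilbert space; this allows the finitely many spaces \<open>G\<^sub>n, \<dots>, G\<^sub>n\<^sub>+\<^sub>p\<close> to be different, as they embed in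
  their direct sum.\<close>

definition admissibility_hyp ::
  "'h::real_inner operator \<Rightarrow> 'g::real_inner set \<Rightarrow> ('h \<times> 'h \<Rightarrow> 'g) \<Rightarrow> bool" where
  "admissibility_hyp A G Bs \<longleftrightarrow>
     subspace G \<and> closed G \<and>
     lin_on (Hdom A 2 \<times> UNIV) Bs \<and> Bs ` (Hdom A 2 \<times> UNIV) \<subseteq> G \<and>
     (\<exists>M. \<forall>u\<in>Hdom A 2. \<forall>z. norm (Bs (u, z)) \<le> M * (norm (hpow A 2 u) + norm z)) \<and>
     (\<forall>T>0. \<exists>D>0. \<forall>w w' f g.
        wave_vec A 1 T w w' f \<and> observation A Bs T w w' g \<longrightarrow>
        L2_sq T g \<le> D * (energy A 1 (w 0) (w' 0) + energy A 1 (w T) (w' T) +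
                         (LINT t|lebesgue_on {0..T}. energy A 1 (w t) (w' t)) + L2_sq T f))"

definition observability_hyp ::
  "'h::real_inner operator \<Rightarrow> ('h \<times> 'h \<Rightarrow> 'g::real_inner) \<Rightarrow> real \<Rightarrow> bool" where
  "observability_hyp A Bs T\<^sub>0 \<longleftrightarrow>
     T\<^sub>0 > 0 \<and>
     (\<forall>T>T\<^sub>0. \<exists>R>0. \<forall>w w' g.
        wave_vec A 1 T w w' (\<lambda>_. 0) \<and> observation A Bs T w w' g \<longrightarrow>
        L2_sq T g \<ge> R * energy A 1 (w 0) (w' 0))"

text \<open>\<open>B \<in> \<L>(G, H\<^sub>k)\<close>, and the adjoint \<open>B\<^sup>*\<close> with values in \<open>G\<close>. For \<open>k = -2\<close>, \<open>B\<^sup>*\<close> is considered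
  on \<open>H\<^sub>2\<close>, for \<open>k = 0\<close> on \<open>H\<close>.\<close>

definition bounded_into_H ::
  "'h::real_inner operator \<Rightarrow> int \<Rightarrow> 'g::real_inner set \<Rightarrow> ('g \<Rightarrow> 'h gvec) \<Rightarrow> bool" where
  "bounded_into_H A k G B \<longleftrightarrow>
     B ` G \<subseteq> Hs A k \<and> (\<forall>v. lin_on G (\<lambda>g. B g v)) \<and>
     (\<exists>M. \<forall>g\<in>G. Hnorm A k (B g) \<le> M * norm g)"

definition control_adj :: "'g::real_inner set \<Rightarrow> ('g \<Rightarrow> 'h gvec) \<Rightarrow> 'h \<Rightarrow> 'g" where
  "control_adj G B u = (THE z. z \<in> G \<and> (\<forall>g\<in>G. g \<bullet> z = B g u))"

definition coupled_with :: "nat \<Rightarrow> nat \<Rightarrow> nat set" where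
  "coupled_with n i = (if i \<le> 1 then {} else if i \<le> n then {i - 1} else {n - 1..i - 1})"

text \<open>The \<open>i\<close>-th component is required to be in \<open>C([0,T]; H\<^bsub>\<kappa> i\<^esub>) \<inter> C\<^sup>1([0,T]; H\<^bsub>\<kappa> i - 1\<^esub>)\<close>.
  On spaces of negative order \<open>C\<^sub>i\<^sub>j\<close> acts by transposition of \<open>C\<^sub>i\<^sub>j\<^sup>*\<close>.\<close>

definition cascade_sol ::
  "'h::real_inner operator \<Rightarrow> (nat \<Rightarrow> nat \<Rightarrow> 'h \<Rightarrow> 'h) \<Rightarrow> nat \<Rightarrow> nat \<Rightarrow> (nat \<Rightarrow> int) \<Rightarrow> real \<Rightarrow>
   (nat \<Rightarrow> real \<Rightarrow> 'h gvec) \<Rightarrow> (nat \<Rightarrow> real \<Rightarrow> 'h gvec) \<Rightarrow> bool" where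
  "cascade_sol A C n p \<kappa> T w w' \<longleftrightarrow>
     (\<forall>i\<in>{1..n + p}.
        wave_sol A (\<kappa> i) T (w i) (w' i)
          (\<lambda>s v. - (\<Sum>j\<in>coupled_with n i. w j s (adjoint (C i j) v))))"

definition observability_time ::
  "'h::real_inner operator \<Rightarrow> (nat \<Rightarrow> nat \<Rightarrow> 'h \<Rightarrow> 'h) \<Rightarrow> (nat \<Rightarrow> 'h \<times> 'h \<Rightarrow> 'g::real_inner) \<Rightarrow>
   nat \<Rightarrow> nat \<Rightarrow> (nat \<Rightarrow> real) \<Rightarrow> real \<Rightarrow> bool" where
  "observability_time A C Bs n p T\<^sub>0 T' \<longleftrightarrow>
     T' > 0 \<and> (\<forall>j\<in>{1..p}. T\<^sub>0 (n + j) \<le> T') \<and>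
     (\<exists>d \<rho> K. \<forall>T>T'.
        (\<forall>i\<in>{1..n}. d i T > 0) \<and> (\<forall>k\<in>{1..p}. \<rho> k T > 0) \<and>
        (\<forall>i\<in>{1..n - 1}. d i T \<le> K / T ^ 3) \<and> d n T \<le> K / T \<and>
        (\<forall>x x' g.
           cascade_sol A C n p (\<lambda>_. 1) T (\<lambda>i t v. x i t \<bullet> v) (\<lambda>i t v. x' i t \<bullet> v) \<and>
           (\<forall>l\<in>{0..p}. observation A (Bs (n + l)) T (x (n + l)) (x' (n + l)) (g l)) \<longrightarrow>
           (\<forall>i\<in>{1..n}.
              energy A (1 + int i - int n) (x i 0) (x' i 0) \<le> d i T * L2_sq T (g 0)) \<and>
           (\<forall>k\<in>{1..p}.
              energy A 1 (x (n + k) 0) (x' (n + k) 0) \<le> \<rho> k T * (\<Sum>l=0..k. L2_sq T (g l)))))"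

text \<open>The \<open>i\<close>-th factors of the state space \<open>N\<^sup>*\<close> are \<open>H\<^bsub>lev i\<^esub>\<close> for \<open>y\<^sub>i\<close> and \<open>H\<^bsub>lev i - 1\<^esub>\<close> for \<open>y\<^sub>i'\<close>;
  the dual data are in \<open>H\<^bsub>1 - lev i\<^esub>\<close> for \<open>w\<^sub>i\<close> and \<open>H\<^bsub>- lev i\<^esub>\<close> for \<open>w\<^sub>i'\<close>.\<close>

definition lev :: "nat \<Rightarrow> nat \<Rightarrow> nat \<Rightarrow> int" where
  "lev n q i = (if i \<le> n then int n - int i else if i \<le> n + q then 0 else 1)"

definition state_space ::
  "'h::real_inner operator \<Rightarrow> nat \<Rightarrow> nat \<Rightarrow> nat \<Rightarrow> ((nat \<Rightarrow> 'h gvec) \<times> (nat \<Rightarrow> 'h gvec)) set" where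
  "state_space A n p q =
     {(y, y'). \<forall>i\<in>{1..n + p}. y i \<in> Hs A (lev n q i) \<and> y' i \<in> Hs A (lev n q i - 1)}"

definition state_pair ::
  "nat \<Rightarrow> nat \<Rightarrow> nat \<Rightarrow> (nat \<Rightarrow> 'h::real_inner gvec) \<Rightarrow> (nat \<Rightarrow> 'h gvec) \<Rightarrow>
   (nat \<Rightarrow> 'h gvec) \<Rightarrow> (nat \<Rightarrow> 'h gvec) \<Rightarrow> real" where
  "state_pair n p q y y' w w' =
     (\<Sum>k=1..n + p. dpair (lev n q k - 1) (y' k) (w k) - dpair (lev n q k) (y k) (w' k))"

text \<open>Solutions by transposition of the control system
    \<open>y\<^sub>i'' + A y\<^sub>i + \<Sum>\<^sub>k C\<^sub>k\<^sub>i\<^sup>* y\<^sub>k = B\<^sub>i v\<^sub>i\<close> (sum over the \<open>k\<close> with \<open>i \<in> coupled_with n k\<close>, no control for \<open>i < n\<close>),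
  which enters through the identity obtained by multiplying it with solutions of the dual
  system on \<open>[0,t]\<close>, i.e. those with arbitrary data at time \<open>t\<close>. The function
  \<open>g l\<close> is \<open>B\<^sub>n\<^sub>+\<^sub>l\<^sup>* w\<^sub>n\<^sub>+\<^sub>l\<close>: for \<open>l \<le> q\<close>, \<open>w\<^sub>n\<^sub>+\<^sub>l\<close> takes its values in \<open>H\<^sub>1\<close> while \<open>B\<^sub>n\<^sub>+\<^sub>l\<^sup>*\<close> is defined on \<open>H\<^sub>2\<close>, hence
  the extension by density; for \<open>l > q\<close> it is a pointwise value.\<close>

definition transposition_sol ::
  "'h::real_inner operator \<Rightarrow> (nat \<Rightarrow> nat \<Rightarrow> 'h \<Rightarrow> 'h) \<Rightarrow> (nat \<Rightarrow> 'g::real_inner set) \<Rightarrow>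
   (nat \<Rightarrow> 'g \<Rightarrow> 'h gvec) \<Rightarrow> nat \<Rightarrow> nat \<Rightarrow> nat \<Rightarrow> real \<Rightarrow> (nat \<Rightarrow> real \<Rightarrow> 'g) \<Rightarrow>
   (nat \<Rightarrow> 'h gvec) \<Rightarrow> (nat \<Rightarrow> 'h gvec) \<Rightarrow>
   (nat \<Rightarrow> real \<Rightarrow> 'h gvec) \<Rightarrow> (nat \<Rightarrow> real \<Rightarrow> 'h gvec) \<Rightarrow> bool" where
  "transposition_sol A C G B n p q T v y0 y1 y y' \<longleftrightarrow>
     (\<forall>i\<in>{1..n + p}.
        Hcont A (lev n q i) T (y i) \<and> Hcont A (lev n q i - 1) T (y' i) \<and>
        y i 0 = y0 i \<and> y' i 0 = y1 i) \<and>
     (\<forall>t\<in>{0..T}. \<forall>w w' g.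
        cascade_sol A C n p (\<lambda>i. 1 - lev n q i) t w w' \<and>
        (\<forall>l\<in>{0..q}.
           observation A (\<lambda>(u, z). control_adj (G (n + l)) (B (n + l)) u) t
             (\<lambda>s. riesz (w (n + l) s)) (\<lambda>s. riesz (w' (n + l) s)) (g l)) \<and>
        (\<forall>l\<in>{q + 1..p}. \<forall>s\<in>{0..t}.
           g l s = control_adj (G (n + l)) (B (n + l)) (riesz (w (n + l) s))) \<longrightarrow>
        (LINT s|lebesgue_on {0..t}. (\<Sum>l=0..p. v (n + l) s \<bullet> g l s)) =
          state_pair n p q (\<lambda>k. y k t) (\<lambda>k. y' k t) (\<lambda>k. w k t) (\<lambda>k. w' k t) -
          state_pair n p q y0 y1 (\<lambda>k. w k 0) (\<lambda>k. w' k 0))"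

end

theory Submission
  imports Defs
begin

text \<open>In an orthonormal basis of eigenvectors of \<open>A\<close> every \<open>H\<^sub>k\<close> is a copy of \<open>H\<close>, and a wave of any
  regularity becomes a pair of \<open>H\<close>-valued functions solving one and the same first order system.
  The boundedness of the \<open>C\<^sub>i\<^sub>j\<^sup>*\<close> on the \<open>H\<^sub>k\<close> is exactly what turns the dual cascade, with its \<open>i\<close>-th
  component at the level dual to \<open>y\<^sub>i\<close>, into a bounded perturbation of a group on \<open>(H \<times> H)\<^bsup>n+p\<^esup>\<close>.

  The observability time bounds the initial data of the components of index at most \<open>n + q\<close>, first
  for regular solutions. Each further component is at level \<open>0\<close>, where its free part is the velocity
  of a finite energy wave; the observability hypothesis controls this part, and the rest is controlled
  by the preceding components. Hence the total initial norm is bounded by the observations on a dense set of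
  data. By the Hilbert uniqueness method, the observations along a minimising sequence of
  \<open>\<Sum>\<^sub>l \<integral> |B\<^sub>l\<^sup>* w\<^sub>l|\<^sup>2 / 2 + \<langle>Y\<^sub>0, W(0)\<rangle>\<close> converge to controls \<open>v\<^sub>l\<close> with
  \<open>\<Sum>\<^sub>l \<integral> \<langle>v\<^sub>l, B\<^sub>l\<^sup>* w\<^sub>l\<rangle> = - \<langle>Y\<^sub>0, W(0)\<rangle>\<close> for all dual solutions \<open>W\<close>. The transposition identity at time
  \<open>T\<close> then says that \<open>Y(T)\<close> is orthogonal to \<open>W(T)\<close>, which is arbitrary.\<close>

section \<open>Spectral decomposition\<close>

lemma compact_symmetric_eigenvector:
  fixes K :: "'h::{real_inner, complete_space} \<Rightarrow> 'h"
  assumes lin: "linear K" and sym: "\<And>x y. K x \<bullet> y = x \<bullet> K y"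
    and cpt: "compact (closure (K ` cball 0 1))" and inj: "\<And>x. K x = 0 \<Longrightarrow> x = 0"
    and sub: "subspace M" and clM: "closed M" and inv: "K ` M \<subseteq> M" and "x0 \<in> M" "x0 \<noteq> 0"
  shows "\<exists>e \<kappa>. e \<in> M \<and> norm e = 1 \<and> K e = \<kappa> *\<^sub>R e"
proof -
  have "bounded (K ` cball 0 1)"
    by (meson bounded_closure_image bounded_subset closure_subset compact_imp_bounded cpt)
  then obtain b where b: "\<And>x. norm x \<le> 1 \<Longrightarrow> norm (K x) \<le> b"
    by (fastforce simp: bounded_iff)
  have bb: "norm (K x) \<le> b * norm x" for x
  proof (cases "x = 0")
    case False
    have "norm (K ((1/norm x) *\<^sub>R x)) \<le> b" by (rule b) (use False in auto)
    with False show ?thesis by (simp add: linear_cmul[OF lin] field_simps)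
  qed (simp add: linear_0[OF lin])
  have bl: "bounded_linear K"
    by (rule bounded_linear_intro[where K=b]) (auto simp: linear_add[OF lin] linear_cmul[OF lin] bb mult.commute)
  define S where "S = (\<lambda>f. norm (K f)) ` (M \<inter> cball 0 1)"
  define s where "s = Sup S"
  have bdd: "bdd_above S" unfolding S_def by (rule bdd_aboveI[where M=b]) (auto intro: b)
  have le1: "norm (K f) \<le> s" if "f \<in> M" "norm f \<le> 1" for f
    unfolding s_def by (rule cSup_upper[OF _ bdd]) (use that in \<open>auto simp: S_def\<close>)
  have le: "norm (K f) \<le> s * norm f" if "f \<in> M" for f
  proof (cases "f = 0")
    case False
    have "norm (K ((1/norm f) *\<^sub>R f)) \<le> s"
      by (rule le1) (use False that sub in \<open>auto simp: subspace_scale\<close>)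
    with False show ?thesis by (simp add: linear_cmul[OF lin] field_simps)
  qed (simp add: linear_0[OF lin])
  have spos: "s > 0"
    using le[OF \<open>x0 \<in> M\<close>] inj[of x0] \<open>x0 \<noteq> 0\<close>
    by (smt (verit, best) mult_nonpos_nonneg norm_ge_zero zero_less_norm_iff)
  have Sne: "S \<noteq> {}" using subspace_0[OF sub] by (auto simp: S_def)
  have "\<exists>f. f \<in> M \<and> norm f \<le> 1 \<and> norm (K f) > s - 1 / real (Suc j)" for j
  proof -
    have "s - 1 / real (Suc j) < Sup S" by (simp add: s_def)
    then obtain y where "y \<in> S" "s - 1 / real (Suc j) < y" by (meson less_cSupE Sne)
    then show ?thesis by (auto simp: S_def)
  qed
  then obtain f where f: "\<And>j. f j \<in> M" "\<And>j. norm (f j) \<le> 1" "\<And>j. norm (K (f j)) > s - 1 / real (Suc j)"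
    by metis
  have "K (f j) \<in> closure (K ` cball 0 1)" for j
    using f(2)[of j] closure_subset by fastforce
  then obtain g r where r: "strict_mono r" and g: "(\<lambda>j. K (f (r j))) \<longlonglongrightarrow> g"
    using cpt[unfolded compact_def, rule_format, of "\<lambda>j. K (f j)"] by (auto simp: comp_def)
  have lim_norm: "(\<lambda>j. norm (K (f j))) \<longlonglongrightarrow> s"
  proof (rule tendsto_sandwich[where f="\<lambda>j. s - 1 / real (Suc j)" and h="\<lambda>_. s"])
    have "(\<lambda>j. s - 1 / real (Suc j)) \<longlonglongrightarrow> s - 0"
      by (intro tendsto_diff tendsto_const LIMSEQ_Suc[OF lim_1_over_n])
    then show "(\<lambda>j. s - 1 / real (Suc j)) \<longlonglongrightarrow> s" by simp
  qed (use f le1 in \<open>auto intro!: always_eventually simp: less_imp_le\<close>)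
  have est: "(norm (K (K x) - s\<^sup>2 *\<^sub>R x))\<^sup>2 \<le> s^4 - s\<^sup>2 * (norm (K x))\<^sup>2" if "x \<in> M" "norm x \<le> 1" for x
  proof -
    have "norm (K (K x)) \<le> s * norm (K x)" using le[of "K x"] inv that by auto
    then have 1: "(norm (K (K x)))\<^sup>2 \<le> s\<^sup>2 * (norm (K x))\<^sup>2"
      by (metis norm_ge_zero power_mono power_mult_distrib)
    have 2: "(norm x)\<^sup>2 \<le> 1" using that by (simp add: power_le_one)
    have "(norm (K (K x) - s\<^sup>2 *\<^sub>R x))\<^sup>2 = (norm (K (K x)))\<^sup>2 - 2 * s\<^sup>2 * (norm (K x))\<^sup>2 + s^4 * (norm x)\<^sup>2"
      using sym[of "K x" x] unfolding power2_norm_eq_inner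
      by (simp add: inner_diff inner_commute algebra_simps power4_eq_xxxx power2_eq_square)
    also have "\<dots> \<le> s\<^sup>2 * (norm (K x))\<^sup>2 - 2 * s\<^sup>2 * (norm (K x))\<^sup>2 + s^4 * 1"
      using 1 2 by (intro add_mono diff_mono mult_left_mono) auto
    finally show ?thesis by simp
  qed
  have n0: "(\<lambda>j. (norm (K (K (f (r j))) - s\<^sup>2 *\<^sub>R f (r j)))\<^sup>2) \<longlonglongrightarrow> 0"
  proof (rule tendsto_sandwich[where f="\<lambda>_. 0" and h="\<lambda>j. s^4 - s\<^sup>2 * (norm (K (f (r j))))\<^sup>2"])
    have "(\<lambda>j. s^4 - s\<^sup>2 * (norm (K (f (r j))))\<^sup>2) \<longlonglongrightarrow> s^4 - s\<^sup>2 * s\<^sup>2"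
      by (intro tendsto_intros LIMSEQ_subseq_LIMSEQ[OF lim_norm r, unfolded comp_def])
    then show "(\<lambda>j. s^4 - s\<^sup>2 * (norm (K (f (r j))))\<^sup>2) \<longlonglongrightarrow> 0"
      by (simp add: power4_eq_xxxx power2_eq_square)
  qed (use est f in auto)
  then have n1: "(\<lambda>j. K (K (f (r j))) - s\<^sup>2 *\<^sub>R f (r j)) \<longlonglongrightarrow> 0"
    using tendsto_norm_zero_cancel tendsto_real_sqrt[OF n0] by simp
  have n2: "(\<lambda>j. K (K (f (r j)))) \<longlonglongrightarrow> K g"
    by (rule bounded_linear.tendsto[OF bl g])
  have "(\<lambda>j. (1/s\<^sup>2) *\<^sub>R (K (K (f (r j))) - (K (K (f (r j))) - s\<^sup>2 *\<^sub>R f (r j)))) \<longlonglongrightarrow> (1/s\<^sup>2) *\<^sub>R (K g - 0)"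
    by (intro tendsto_intros n1 n2)
  then have fl: "(\<lambda>j. f (r j)) \<longlonglongrightarrow> (1/s\<^sup>2) *\<^sub>R K g" using spos by simp
  define h where "h = (1/s\<^sup>2) *\<^sub>R K g"
  have hM: "h \<in> M" using closed_sequentially[OF clM _ fl] f(1) by (auto simp: h_def)
  have Kh: "K h = g"
    using bounded_linear.tendsto[OF bl fl] g LIMSEQ_unique h_def by blast
  have "norm g = s"
    using tendsto_norm[OF g] LIMSEQ_subseq_LIMSEQ[OF lim_norm r, unfolded comp_def] LIMSEQ_unique by blast
  then have h0: "h \<noteq> 0" using Kh spos linear_0[OF lin] by fastforce
  have KKh: "K (K h) = s\<^sup>2 *\<^sub>R h" using Kh spos by (simp add: h_def)
  have mk: ?thesis if "x \<in> M" "x \<noteq> 0" "K x = k *\<^sub>R x" for x k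
    by (rule exI[of _ "(1 / norm x) *\<^sub>R x"], rule exI[of _ k])
      (use that sub in \<open>auto simp: linear_cmul[OF lin] subspace_scale\<close>)
  define z where "z = K h + s *\<^sub>R h"
  have zM: "z \<in> M" using hM inv sub by (auto simp: z_def subspace_add subspace_scale)
  have Kz: "K z = s *\<^sub>R z"
    by (simp add: z_def linear_add[OF lin] linear_cmul[OF lin] KKh scaleR_add_right power2_eq_square)
  show ?thesis
  proof (cases "z = 0")
    case True
    then have "K h = (- s) *\<^sub>R h" by (simp add: z_def add_eq_0_iff2)
    then show ?thesis using mk hM h0 by blast
  next
    case False
    then show ?thesis using mk zM Kz by blast
  qed
qed

lemma finite_orthonormal_eigenvectors:
  fixes K :: "'h::real_inner \<Rightarrow> 'h"
  assumes cpt: "compact (closure (K ` cball 0 1))" and "\<delta> > 0"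
    and E: "\<And>e. e \<in> E \<Longrightarrow> norm e = 1" "\<And>e e'. e \<in> E \<Longrightarrow> e' \<in> E \<Longrightarrow> e \<noteq> e' \<Longrightarrow> e \<bullet> e' = 0"
    and \<kappa>: "\<And>e. e \<in> E \<Longrightarrow> K e = \<kappa> e *\<^sub>R e" "\<And>e. e \<in> E \<Longrightarrow> \<delta> \<le> \<bar>\<kappa> e\<bar>"
  shows "finite E"
proof -
  obtain k where k: "finite k" "closure (K ` cball 0 1) \<subseteq> (\<Union>x\<in>k. ball x (\<delta>/2))"
    using compact_eq_totally_bounded cpt \<open>\<delta> > 0\<close> by (metis half_gt_zero)
  have "\<exists>x\<in>k. dist x (K e) < \<delta>/2" if "e \<in> E" for e
  proof -
    have "K e \<in> closure (K ` cball 0 1)" using E(1)[OF that] closure_subset by fastforce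
    then obtain x where "x \<in> k" "K e \<in> ball x (\<delta>/2)" using k by blast
    then show ?thesis by (intro bexI[of _ x]) (simp add: mem_ball)
  qed
  then obtain c where c: "\<And>e. e \<in> E \<Longrightarrow> c e \<in> k" "\<And>e. e \<in> E \<Longrightarrow> dist (c e) (K e) < \<delta>/2"
    by metis
  have "inj_on c E"
  proof (rule inj_onI, rule ccontr)
    fix x y assume xy: "x \<in> E" "y \<in> E" "c x = c y" "x \<noteq> y"
    have "dist (K x) (K y) < \<delta>"
      using c(2)[OF xy(1)] c(2)[OF xy(2)] xy(3) by (metis dist_triangle_half_r)
    then have "(norm (\<kappa> x *\<^sub>R x - \<kappa> y *\<^sub>R y))\<^sup>2 < \<delta>\<^sup>2"
      using \<kappa>(1) xy by (simp add: dist_norm power_strict_mono)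
    moreover have "(norm (\<kappa> x *\<^sub>R x - \<kappa> y *\<^sub>R y))\<^sup>2 = (\<kappa> x)\<^sup>2 + (\<kappa> y)\<^sup>2"
      using E(2)[OF xy(1,2,4)] E(1)[OF xy(1)] E(1)[OF xy(2)] unfolding power2_norm_eq_inner
      by (simp add: inner_diff norm_eq_1 inner_commute power2_eq_square)
    moreover have "\<delta>\<^sup>2 \<le> (\<kappa> x)\<^sup>2"
      using \<kappa>(2)[OF xy(1)] \<open>\<delta> > 0\<close> by (metis power2_abs power_mono less_imp_le)
    ultimately show False by (smt (verit) zero_le_power2)
  qed
  then show ?thesis using c(1) k(1) by (meson image_subsetI inj_on_finite)
qed

lemma compact_symmetric_eigenbasis:
  fixes K :: "'h::{real_inner, complete_space} \<Rightarrow> 'h"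
  assumes lin: "linear K" and sym: "\<And>x y. K x \<bullet> y = x \<bullet> K y"
    and cpt: "compact (closure (K ` cball 0 1))" and inj: "\<And>x. K x = 0 \<Longrightarrow> x = 0"
  shows "\<exists>E \<kappa>. countable E \<and> (\<forall>e\<in>E. norm e = 1 \<and> K e = \<kappa> e *\<^sub>R e \<and> \<kappa> e \<noteq> 0) \<and>
    (\<forall>e\<in>E. \<forall>e'\<in>E. e \<noteq> e' \<longrightarrow> e \<bullet> e' = 0) \<and> (\<forall>u. (\<forall>e\<in>E. u \<bullet> e = 0) \<longrightarrow> u = 0)"
proof -
  define \<A> where "\<A> = {E. (\<forall>e\<in>E. norm e = 1 \<and> K e = (K e \<bullet> e) *\<^sub>R e) \<and>
    (\<forall>e\<in>E. \<forall>e'\<in>E. e \<noteq> e' \<longrightarrow> e \<bullet> e' = 0)}"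
  have "\<exists>E\<in>\<A>. \<forall>X\<in>\<A>. E \<subseteq> X \<longrightarrow> X = E"
  proof (rule subset_Zorn')
    fix \<C> assume C: "subset.chain \<A> \<C>"
    show "\<Union>\<C> \<in> \<A>"
      unfolding \<A>_def
    proof (intro CollectI conjI ballI impI)
      fix e e' assume e: "e \<in> \<Union>\<C>" "e' \<in> \<Union>\<C>" "e \<noteq> e'"
      then obtain X Y where "X \<in> \<C>" "e \<in> X" "Y \<in> \<C>" "e' \<in> Y" by auto
      then obtain Z where "Z \<in> \<C>" "e \<in> Z" "e' \<in> Z"
        using C unfolding subset_chain_def by blast
      then show "e \<bullet> e' = 0"
        using C e unfolding subset_chain_def \<A>_def by blast
    qed (use C in \<open>auto simp: subset_chain_def \<A>_def\<close>)
  qed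
  then obtain E where E: "E \<in> \<A>" and mx: "\<And>X. X \<in> \<A> \<Longrightarrow> E \<subseteq> X \<Longrightarrow> X = E" by blast
  define \<kappa> where "\<kappa> e = K e \<bullet> e" for e
  have nrm: "norm e = 1" and eig: "K e = \<kappa> e *\<^sub>R e" if "e \<in> E" for e
    using E that unfolding \<A>_def \<kappa>_def by auto
  have orth: "e \<bullet> e' = 0" if "e \<in> E" "e' \<in> E" "e \<noteq> e'" for e e'
    using E that unfolding \<A>_def by auto
  have nz: "\<kappa> e \<noteq> 0" if "e \<in> E" for e
    using inj[of e] eig[OF that] nrm[OF that] by force
  have tot: "u = 0" if u: "\<forall>e\<in>E. u \<bullet> e = 0" for u
  proof (rule ccontr)
    assume "u \<noteq> 0"
    define M where "M = {x. \<forall>e\<in>E. x \<bullet> e = 0}"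
    have Mc: "M = (\<Inter>e\<in>E. {x. x \<bullet> e = 0})" by (auto simp: M_def)
    have "closed M" unfolding Mc
      by (intro closed_INT ballI closed_Collect_eq continuous_intros)
    moreover have "subspace M" by (auto simp: subspace_def M_def inner_add_left)
    moreover have "K ` M \<subseteq> M" by (auto simp: M_def sym eig)
    ultimately obtain e k where e: "e \<in> M" "norm e = 1" "K e = k *\<^sub>R e"
      using compact_symmetric_eigenvector[OF lin sym cpt inj, of M u] u \<open>u \<noteq> 0\<close> by (auto simp: M_def)
    then have "K e = (K e \<bullet> e) *\<^sub>R e" by (simp add: norm_eq_1)
    then have "insert e E \<in> \<A>"
      using E e unfolding \<A>_def M_def by (auto simp: inner_commute)
    then have "e \<in> E" using mx by blast
    then show False using e by (auto simp: M_def norm_eq_1)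
  qed
  have "countable E"
  proof -
    have *: "\<exists>n::nat. 1 / Suc n \<le> \<bar>\<kappa> e\<bar>" if "e \<in> E" for e
      using reals_Archimedean[of "\<bar>\<kappa> e\<bar>"] nz[OF that] by (auto simp: inverse_eq_divide intro: less_imp_le)
    have "finite {e\<in>E. 1 / Suc n \<le> \<bar>\<kappa> e\<bar>}" for n :: nat
      by (rule finite_orthonormal_eigenvectors[OF cpt, where \<delta>="1 / Suc n" and \<kappa>=\<kappa>])
        (use nrm eig orth in auto)
    then have "countable {e\<in>E. 1 / Suc n \<le> \<bar>\<kappa> e\<bar>}" for n :: nat
      by (rule countable_finite)
    then have "countable (\<Union>n::nat. {e\<in>E. 1 / Suc n \<le> \<bar>\<kappa> e\<bar>})"
      by (rule countable_UN[OF countableI_type])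
    then show ?thesis by (rule countable_subset[rotated]) (use * in auto)
  qed
  then show ?thesis using nrm eig nz orth tot by (intro exI[of _ E] exI[of _ \<kappa>]) auto
qed

text \<open>The basis is padded with zero vectors, so that \<open>H\<close> may have any finite or countable dimension.\<close>

locale eigenbasis =
  fixes A :: "'h::{real_inner, complete_space} operator" and \<epsilon> :: "nat \<Rightarrow> 'h" and m :: "nat \<Rightarrow> real" and c :: real
  assumes orth: "i \<noteq> j \<Longrightarrow> \<epsilon> i \<bullet> \<epsilon> j = 0"
    and nrm: "\<epsilon> j \<noteq> 0 \<Longrightarrow> norm (\<epsilon> j) = 1"
    and total: "(\<And>j. u \<bullet> \<epsilon> j = 0) \<Longrightarrow> u = 0"
    and c_pos: "c > 0" and m_ge: "c \<le> m j"
    and A_symmetric: "(u, f) \<in> A \<Longrightarrow> (v, g) \<in> A \<Longrightarrow> f \<bullet> v = u \<bullet> g"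
    and A_maximal: "(\<And>v g. (v, g) \<in> A \<Longrightarrow> g \<bullet> u = v \<bullet> f) \<Longrightarrow> (u, f) \<in> A"
    and A_eigen: "(\<epsilon> j, (m j)\<^sup>2 *\<^sub>R \<epsilon> j) \<in> A"

theorem eigenbasis_exists:
  fixes A :: "'h::{real_inner, complete_space} operator"
  assumes sa: "selfadjoint_op A" and pos: "positive_op A" and cr: "compact_resolvent A"
    and "\<omega> > 0" and low: "\<forall>(u, f)\<in>A. norm f \<ge> \<omega> * norm u"
  shows "\<exists>\<epsilon> m c. eigenbasis A \<epsilon> m c"
proof -
  have subA: "subspace A" and sv: "single_valued A" and adj: "adjoint_op A = A"
    using sa by (auto simp: selfadjoint_op_def)
  obtain \<mu> where sR: "single_valued (resolvent_op A \<mu>)" and dR: "Domain (resolvent_op A \<mu>) = UNIV"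
    and cR: "compact (closure (resolvent_op A \<mu> `` cball 0 1))"
    using cr by (auto simp: compact_resolvent_def)
  define K where "K x = app_op (resolvent_op A \<mu>) x" for x
  have Kin: "(x, K x) \<in> resolvent_op A \<mu>" for x
  proof -
    obtain y where "(x, y) \<in> resolvent_op A \<mu>" using dR by blast
    then show ?thesis unfolding K_def app_op_def
      by (rule theI) (use sR \<open>(x, y) \<in> _\<close> in \<open>auto simp: single_valued_def\<close>)
  qed
  have KA: "(K x, x + \<mu> *\<^sub>R K x) \<in> A" for x
  proof -
    obtain f where f: "x = f - \<mu> *\<^sub>R K x" "(K x, f) \<in> A" using Kin[of x] by (auto simp: resolvent_op_def)
    have "x + \<mu> *\<^sub>R K x = f" by (subst f(1)) simp
    with f(2) show ?thesis by simp
  qed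
  have Keq: "K x = u" if "(u, x + \<mu> *\<^sub>R u) \<in> A" for x u
  proof -
    have "(x, u) \<in> resolvent_op A \<mu>" using that
      by (auto simp: resolvent_op_def intro!: exI[of _ "x + \<mu> *\<^sub>R u"])
    then show ?thesis using Kin[of x] sR by (auto simp: single_valued_def)
  qed
  have symA: "f \<bullet> v = u \<bullet> g" if "(u, f) \<in> A" "(v, g) \<in> A" for u f v g
  proof -
    have "(u, f) \<in> adjoint_op A" using that adj by simp
    then show ?thesis using that(2) by (auto simp: adjoint_op_def inner_commute)
  qed
  have maxA: "(u, f) \<in> A" if "\<And>v g. (v, g) \<in> A \<Longrightarrow> g \<bullet> u = v \<bullet> f" for u f
    using that adj by (auto simp: adjoint_op_def)
  have addA: "(u + v, f + g) \<in> A" if "(u, f) \<in> A" "(v, g) \<in> A" for u f v g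
    using subspace_add[OF subA that] by simp
  have sclA: "(r *\<^sub>R u, r *\<^sub>R f) \<in> A" if "(u, f) \<in> A" for r u f
    using subspace_scale[OF subA that] by simp
  have lin: "linear K"
  proof (rule linearI)
    show "K (x + y) = K x + K y" for x y
      using addA[OF KA[of x] KA[of y]] by (intro Keq) (simp add: algebra_simps)
    show "K (r *\<^sub>R x) = r *\<^sub>R K x" for r x
      using sclA[OF KA[of x], of r] by (intro Keq) (simp add: algebra_simps)
  qed
  have sym: "K x \<bullet> y = x \<bullet> K y" for x y
    using symA[OF KA[of x] KA[of y]] by (simp add: inner_add)
  have "resolvent_op A \<mu> `` cball 0 1 = K ` cball 0 1"
  proof -
    have "(x, y) \<in> resolvent_op A \<mu> \<longleftrightarrow> y = K x" for x y
      using Kin[of x] single_valuedD[OF sR Kin[of x]] by blast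
    then show ?thesis unfolding Image_def by blast
  qed
  then have cpt: "compact (closure (K ` cball 0 1))" using cR by simp
  have zA: "(0, 0) \<in> A" using subspace_0[OF subA] by (simp add: zero_prod_def)
  have inj: "x = 0" if "K x = 0" for x
    using KA[of x] zA sv that by (auto simp: single_valued_def)
  obtain E \<kappa> where cE: "countable E" and E: "\<forall>e\<in>E. norm e = 1 \<and> K e = \<kappa> e *\<^sub>R e \<and> \<kappa> e \<noteq> 0"
    and orE: "\<forall>e\<in>E. \<forall>e'\<in>E. e \<noteq> e' \<longrightarrow> e \<bullet> e' = 0" and toE: "\<forall>u. (\<forall>e\<in>E. u \<bullet> e = 0) \<longrightarrow> u = 0"
    using compact_symmetric_eigenbasis[OF lin sym cpt inj, simplified] by (elim exE conjE) (rule that)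
  define l where "l e = 1 / \<kappa> e + \<mu>" for e
  have lA: "(e, l e *\<^sub>R e) \<in> A" if "e \<in> E" for e
  proof -
    have "(1 / \<kappa> e) *\<^sub>R (K e, e + \<mu> *\<^sub>R K e) \<in> A" using KA by (rule subspace_scale[OF subA])
    moreover have "(1 / \<kappa> e) *\<^sub>R (K e, e + \<mu> *\<^sub>R K e) = (e, l e *\<^sub>R e)"
      using E that by (simp add: l_def algebra_simps)
    ultimately show ?thesis by simp
  qed
  have lge: "\<omega> \<le> l e" if "e \<in> E" for e
  proof -
    have "\<omega> \<le> \<bar>l e\<bar>" using low lA[OF that] E that by fastforce
    moreover have "0 \<le> l e"
      using pos lA[OF that] E that by (fastforce simp: positive_op_def norm_eq_1)
    ultimately show ?thesis by simp
  qed
  define \<epsilon> where "\<epsilon> j = (if j \<in> to_nat_on E ` E then from_nat_into E j else 0)" for j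
  define m where "m j = (if \<epsilon> j = 0 then sqrt \<omega> else sqrt (l (\<epsilon> j)))" for j
  have eps_nat: "\<epsilon> (to_nat_on E e) = e" if "e \<in> E" for e
    using that cE by (simp add: \<epsilon>_def)
  have ex: "\<exists>e\<in>E. j = to_nat_on E e \<and> \<epsilon> j = e" if "\<epsilon> j \<noteq> 0" for j
  proof -
    have "j \<in> to_nat_on E ` E"
    proof (rule ccontr)
      assume "j \<notin> to_nat_on E ` E"
      then have "\<epsilon> j = 0" by (simp only: \<epsilon>_def if_False)
      with that show False by simp
    qed
    then show ?thesis using eps_nat by blast
  qed
  have eE: "\<epsilon> j \<in> E" if "\<epsilon> j \<noteq> 0" for j
    using ex[OF that] by auto
  have Ee: "\<exists>j. \<epsilon> j = e" if "e \<in> E" for e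
    using eps_nat[OF that] by blast
  have "eigenbasis A \<epsilon> m (sqrt \<omega>)"
  proof
    show "\<epsilon> i \<bullet> \<epsilon> j = 0" if "i \<noteq> j" for i j
    proof (cases "\<epsilon> i = 0 \<or> \<epsilon> j = 0")
      case False
      then have "\<epsilon> i \<noteq> \<epsilon> j" using that ex[of i] ex[of j] by auto
      then show ?thesis using False eE orE by blast
    qed auto
    show "norm (\<epsilon> j) = 1" if "\<epsilon> j \<noteq> 0" for j using eE[OF that] E by auto
    show "u = 0" if "\<And>j. u \<bullet> \<epsilon> j = 0" for u
    proof -
      have "\<forall>e\<in>E. u \<bullet> e = 0"
      proof
        fix e assume "e \<in> E"
        then obtain j where "\<epsilon> j = e" using Ee by blast
        then show "u \<bullet> e = 0" using that[of j] by simp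
      qed
      then show ?thesis using toE by blast
    qed
    show "0 < sqrt \<omega>" using \<open>\<omega> > 0\<close> by simp
    show "sqrt \<omega> \<le> m j" for j using lge eE by (auto simp: m_def)
    show "(\<epsilon> j, (m j)\<^sup>2 *\<^sub>R \<epsilon> j) \<in> A" for j
    proof (cases "\<epsilon> j = 0")
      case False
      then have "(m j)\<^sup>2 = l (\<epsilon> j)" using lge[OF eE[OF False]] \<open>\<omega> > 0\<close> by (simp add: m_def)
      then show ?thesis using lA[OF eE] False by simp
    qed (use zA in auto)
    show "f \<bullet> v = u \<bullet> g" if "(u, f) \<in> A" "(v, g) \<in> A" for u f v g using symA[OF that] .
    show "(u, f) \<in> A" if "\<And>v g. (v, g) \<in> A \<Longrightarrow> g \<bullet> u = v \<bullet> f" for u f using maxA[OF that] .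
  qed
  then show ?thesis by blast
qed

section \<open>Diagonal operators\<close>

context eigenbasis
begin

lemma m_pos: "0 < m j"
  using c_pos m_ge[of j] by linarith

lemma eps_inner: "\<epsilon> i \<bullet> \<epsilon> j = (if i = j \<and> \<epsilon> j \<noteq> 0 then 1 else 0)"
  using orth[of i j] nrm[of j] by (auto simp: norm_eq_1)

lemma coef_ext: "(\<And>j. u \<bullet> \<epsilon> j = v \<bullet> \<epsilon> j) \<Longrightarrow> u = v"
  using total[of "u - v"] by (simp add: inner_diff_left)

definition trunc :: "nat \<Rightarrow> 'h \<Rightarrow> 'h" where
  "trunc N u = (\<Sum>i<N. (u \<bullet> \<epsilon> i) *\<^sub>R \<epsilon> i)"

lemma sum_coef: "(\<Sum>i\<in>I. x i *\<^sub>R \<epsilon> i) \<bullet> \<epsilon> j = (if j \<in> I \<and> \<epsilon> j \<noteq> 0 then x j else 0)" if "finite I"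
proof -
  have "(\<Sum>i\<in>I. x i *\<^sub>R \<epsilon> i) \<bullet> \<epsilon> j = (\<Sum>i\<in>I. if i = j then (if \<epsilon> j \<noteq> 0 then x j else 0) else 0)"
    by (auto simp: inner_sum_left eps_inner intro!: sum.cong)
  then show ?thesis using that by (simp add: sum.delta)
qed

lemma norm_sum_coef: "finite I \<Longrightarrow> (\<And>j. \<epsilon> j = 0 \<Longrightarrow> x j = 0) \<Longrightarrow> (norm (\<Sum>i\<in>I. x i *\<^sub>R \<epsilon> i))\<^sup>2 = (\<Sum>i\<in>I. (x i)\<^sup>2)"
  unfolding power2_norm_eq_inner
  by (subst inner_sum_right) (auto simp: sum_coef power2_eq_square intro!: sum.cong)

lemma trunc_coef: "trunc N u \<bullet> \<epsilon> j = (if j < N then u \<bullet> \<epsilon> j else 0)"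
  by (auto simp: trunc_def sum_coef)

lemma trunc_inner: "trunc N u \<bullet> v = (\<Sum>i<N. (u \<bullet> \<epsilon> i) * (v \<bullet> \<epsilon> i))"
  by (simp add: trunc_def inner_sum_left inner_commute[of v])

lemma bessel: "(\<Sum>i<N. (u \<bullet> \<epsilon> i)\<^sup>2) \<le> (norm u)\<^sup>2"
proof -
  have "trunc N u \<bullet> u = (\<Sum>i<N. (u \<bullet> \<epsilon> i)\<^sup>2)"
    by (simp add: trunc_inner power2_eq_square)
  moreover have "(norm (trunc N u))\<^sup>2 = (\<Sum>i<N. (u \<bullet> \<epsilon> i)\<^sup>2)"
    by (simp add: trunc_def norm_sum_coef)
  moreover have "0 \<le> (norm (u - trunc N u))\<^sup>2" by simp
  ultimately show ?thesis
    unfolding power2_norm_eq_inner by (simp add: inner_diff inner_commute)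
qed

lemma synthesis:
  assumes s: "summable (\<lambda>j. (x j)\<^sup>2)" and z: "\<And>j. \<epsilon> j = 0 \<Longrightarrow> x j = 0"
  shows "\<exists>u. (\<forall>j. u \<bullet> \<epsilon> j = x j) \<and> (\<lambda>N. \<Sum>i<N. x i *\<^sub>R \<epsilon> i) \<longlonglongrightarrow> u"
proof -
  define S where "S N = (\<Sum>i<N. x i *\<^sub>R \<epsilon> i)" for N
  have "Cauchy S"
  proof (rule metric_CauchyI)
    fix e :: real assume "e > 0"
    then obtain N where N: "\<And>a b. N \<le> a \<Longrightarrow> norm (\<Sum>j=a..<b. (x j)\<^sup>2) < e\<^sup>2"
      using s[unfolded summable_Cauchy] by (meson zero_less_power)
    have *: "norm (S b - S a) < e" if "N \<le> a" "a \<le> b" for a b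
    proof -
      have "S b - S a = (\<Sum>i=a..<b. x i *\<^sub>R \<epsilon> i)"
        unfolding S_def lessThan_atLeast0 using that by (simp add: sum_diff_nat_ivl)
      then have "(norm (S b - S a))\<^sup>2 = (\<Sum>j=a..<b. (x j)\<^sup>2)" by (simp add: norm_sum_coef z)
      then have "(norm (S b - S a))\<^sup>2 < e\<^sup>2" using N[OF that(1), of b] by simp
      then show ?thesis using \<open>e > 0\<close> by (simp add: power2_less_imp_less)
    qed
    show "\<exists>M. \<forall>a\<ge>M. \<forall>b\<ge>M. dist (S a) (S b) < e"
    proof (intro exI[of _ N] allI impI)
      fix a b assume "N \<le> a" "N \<le> b"
      then show "dist (S a) (S b) < e"
        using *[of a b] *[of b a] by (cases "a \<le> b") (auto simp: dist_norm norm_minus_commute)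
    qed
  qed
  then obtain u where u: "S \<longlonglongrightarrow> u" using Cauchy_convergent convergent_def by blast
  have "u \<bullet> \<epsilon> j = x j" for j
  proof -
    have "(\<lambda>N. S N \<bullet> \<epsilon> j) \<longlonglongrightarrow> u \<bullet> \<epsilon> j" by (intro tendsto_intros u)
    moreover have "\<forall>\<^sub>F N in sequentially. S N \<bullet> \<epsilon> j = x j"
      using eventually_gt_at_top[of j] by eventually_elim (auto simp: S_def sum_coef z)
    ultimately show ?thesis by (metis LIMSEQ_unique tendsto_eventually)
  qed
  then show ?thesis using u unfolding S_def by blast
qed

lemma summable_coef: "summable (\<lambda>j. (u \<bullet> \<epsilon> j)\<^sup>2)"
  by (rule summableI_nonneg_bounded[where x="(norm u)\<^sup>2"]) (auto simp: bessel)

lemma trunc_tendsto: "(\<lambda>N. trunc N u) \<longlonglongrightarrow> u"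
proof -
  obtain v where v: "\<And>j. v \<bullet> \<epsilon> j = u \<bullet> \<epsilon> j" "(\<lambda>N. \<Sum>i<N. (u \<bullet> \<epsilon> i) *\<^sub>R \<epsilon> i) \<longlonglongrightarrow> v"
    using synthesis[OF summable_coef, of u] by auto
  then show ?thesis using coef_ext unfolding trunc_def by blast
qed

lemma parseval: "(\<lambda>j. (u \<bullet> \<epsilon> j) * (v \<bullet> \<epsilon> j)) sums (u \<bullet> v)"
proof -
  have "(\<lambda>N. trunc N u \<bullet> v) \<longlonglongrightarrow> u \<bullet> v" by (intro tendsto_intros trunc_tendsto)
  then show ?thesis by (simp add: sums_def trunc_inner)
qed

lemma parseval_norm: "(\<lambda>j. (u \<bullet> \<epsilon> j)\<^sup>2) sums (norm u)\<^sup>2"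
  using parseval[of u u] by (simp add: power2_eq_square power2_norm_eq_inner[unfolded power2_eq_square])

lemma norm_le_coef:
  assumes "0 \<le> M" "\<And>j. \<bar>u \<bullet> \<epsilon> j\<bar> \<le> M * \<bar>v \<bullet> \<epsilon> j\<bar>" shows "norm u \<le> M * norm v"
proof -
  have "(u \<bullet> \<epsilon> j)\<^sup>2 \<le> M\<^sup>2 * (v \<bullet> \<epsilon> j)\<^sup>2" for j
    using power_mono[OF assms(2)[of j], of 2] by (simp add: power_mult_distrib)
  then have "(norm u)\<^sup>2 \<le> M\<^sup>2 * (norm v)\<^sup>2"
    by (rule sums_le[OF _ parseval_norm sums_mult[OF parseval_norm]])
  then have "(norm u)\<^sup>2 \<le> (M * norm v)\<^sup>2" by (simp add: power_mult_distrib)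
  then show ?thesis by (rule power2_le_imp_le) (use assms(1) in auto)
qed

lemma trunc_linear: "bounded_linear (trunc N)"
  unfolding trunc_def by (intro bounded_linear_sum bounded_linear_intros bounded_linear_ident) 

lemma norm_trunc_le: "norm (trunc N u) \<le> norm u"
  using norm_le_coef[of 1 "trunc N u" u] by (simp add: trunc_coef)

lemma riesz_repr:
  assumes l: "bounded_linear (\<phi> :: 'h \<Rightarrow> real)" shows "\<exists>u. \<forall>v. \<phi> v = u \<bullet> v"
proof -
  obtain M where M: "\<And>v. norm (\<phi> v) \<le> norm v * M" using bounded_linear.bounded[OF l] by blast
  have "summable (\<lambda>j. (\<phi> (\<epsilon> j))\<^sup>2)"
  proof (rule summableI_nonneg_bounded)
    fix N
    define w where "w = (\<Sum>i<N. \<phi> (\<epsilon> i) *\<^sub>R \<epsilon> i)"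
    have nw: "(norm w)\<^sup>2 = (\<Sum>i<N. (\<phi> (\<epsilon> i))\<^sup>2)"
      unfolding w_def by (rule norm_sum_coef) (auto simp: linear_0[OF bounded_linear.linear[OF l]])
    also have "\<dots> = \<phi> w"
      by (simp add: w_def linear_sum[OF bounded_linear.linear[OF l]] linear_cmul[OF bounded_linear.linear[OF l]] power2_eq_square)
    finally have "(norm w)\<^sup>2 \<le> norm w * M" using M[of w] by simp
    then have "norm w \<le> M \<or> norm w = 0" by (auto simp: power2_eq_square)
    then have "norm w \<le> \<bar>M\<bar>" by linarith
    then show "(\<Sum>i<N. (\<phi> (\<epsilon> i))\<^sup>2) \<le> \<bar>M\<bar>\<^sup>2"
      unfolding nw[symmetric] by (intro power_mono) auto
  qed simp
  then obtain u where u: "\<And>j. u \<bullet> \<epsilon> j = \<phi> (\<epsilon> j)"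
    using synthesis[of "\<lambda>j. \<phi> (\<epsilon> j)"] linear_0[OF bounded_linear.linear[OF l]] by metis
  have "\<phi> v = u \<bullet> v" for v
  proof -
    have "(\<lambda>N. \<phi> (trunc N v)) \<longlonglongrightarrow> \<phi> v" by (intro bounded_linear.tendsto[OF l] trunc_tendsto)
    moreover have "\<phi> (trunc N v) = u \<bullet> trunc N v" for N
      by (simp add: trunc_def linear_sum[OF bounded_linear.linear[OF l]] linear_cmul[OF bounded_linear.linear[OF l]] inner_sum_right u)
    moreover have "(\<lambda>N. u \<bullet> trunc N v) \<longlonglongrightarrow> u \<bullet> v" by (intro tendsto_intros trunc_tendsto)
    ultimately show ?thesis using LIMSEQ_unique by auto
  qed
  then show ?thesis by blast
qed

lemma adjoint_repr:
  assumes Q: "bounded_linear (Q :: 'h \<Rightarrow> 'h)"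
  shows "\<exists>K. bounded_linear K \<and> (\<forall>h g. h \<bullet> Q g = K h \<bullet> g)"
proof -
  obtain M where M: "\<And>v. norm (Q v) \<le> norm v * M" "M > 0"
    using bounded_linear.pos_bounded[OF Q] by blast
  have "\<exists>u. \<forall>g. h \<bullet> Q g = u \<bullet> g" for h
    by (rule riesz_repr) (rule bounded_linear_compose[OF bounded_linear_inner_right Q])
  then obtain K where K: "\<And>h g. h \<bullet> Q g = K h \<bullet> g" by metis
  have "bounded_linear K"
  proof (rule bounded_linear_intro[where K=M])
    show "K (x + y) = K x + K y" for x y
      by (rule coef_ext) (simp add: K[symmetric] inner_add_left)
    show "K (r *\<^sub>R x) = r *\<^sub>R K x" for r x
      by (rule coef_ext) (simp add: K[symmetric])
    show "norm (K x) \<le> norm x * M" for x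
    proof -
      have "(norm (K x))\<^sup>2 = x \<bullet> Q (K x)" by (simp add: K power2_norm_eq_inner)
      also have "\<dots> \<le> norm x * norm (Q (K x))" by (rule norm_cauchy_schwarz)
      also have "\<dots> \<le> norm x * (norm (K x) * M)" by (intro mult_left_mono M) auto
      finally have "norm (K x) * norm (K x) \<le> norm (K x) * (norm x * M)" by (simp add: power2_eq_square algebra_simps)
      then show ?thesis using M by (cases "norm (K x) = 0") (auto intro: mult_nonneg_nonneg less_imp_le)
    qed
  qed
  then show ?thesis using K by blast
qed

definition gr :: "(nat \<Rightarrow> real) \<Rightarrow> 'h operator" where
  "gr h = {(u, f). \<forall>j. f \<bullet> \<epsilon> j = h j * (u \<bullet> \<epsilon> j)}"

lemma gr_iff: "(u, f) \<in> gr h \<longleftrightarrow> (\<forall>j. f \<bullet> \<epsilon> j = h j * (u \<bullet> \<epsilon> j))"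
  by (simp add: gr_def)

lemma Domain_gr: "u \<in> Domain (gr h) \<longleftrightarrow> summable (\<lambda>j. (h j * (u \<bullet> \<epsilon> j))\<^sup>2)"
proof
  assume "u \<in> Domain (gr h)"
  then obtain f where "(u, f) \<in> gr h" by blast
  then have "f \<bullet> \<epsilon> j = h j * (u \<bullet> \<epsilon> j)" for j by (simp add: gr_iff)
  then show "summable (\<lambda>j. (h j * (u \<bullet> \<epsilon> j))\<^sup>2)" using summable_coef[of f] by simp
next
  assume "summable (\<lambda>j. (h j * (u \<bullet> \<epsilon> j))\<^sup>2)"
  from synthesis[OF this] show "u \<in> Domain (gr h)" by (auto simp: gr_iff)
qed

lemma gr_single_valued: "single_valued (gr h)"
  unfolding single_valued_def gr_iff by (metis coef_ext)

lemma app_gr: "(u, f) \<in> gr h \<Longrightarrow> app_op (gr h) u = f"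
  unfolding app_op_def using gr_single_valued[of h] by (auto simp: single_valued_def)

lemma gr_dominated:
  assumes "(u, f) \<in> gr h" "\<And>j. \<bar>g j\<bar> \<le> M * \<bar>h j\<bar>" shows "u \<in> Domain (gr g)"
  unfolding Domain_gr
proof (rule summable_comparison_test'[where N=0])
  show "summable (\<lambda>j. M\<^sup>2 * (h j * (u \<bullet> \<epsilon> j))\<^sup>2)"
    using assms(1) by (intro summable_mult) (auto simp flip: Domain_gr)
  show "norm ((g j * (u \<bullet> \<epsilon> j))\<^sup>2) \<le> M\<^sup>2 * (h j * (u \<bullet> \<epsilon> j))\<^sup>2" for j
  proof -
    have "(g j)\<^sup>2 \<le> (M * \<bar>h j\<bar>)\<^sup>2" using power_mono[OF assms(2)[of j], of 2] by simp
    then show ?thesis by (simp add: power_mult_distrib mult_right_mono flip: mult.assoc)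
  qed
qed

lemma gr_bounded: "(\<And>j. \<bar>g j\<bar> \<le> M) \<Longrightarrow> u \<in> Domain (gr g)"
  by (rule gr_dominated[of u u "\<lambda>_. 1"]) (auto simp: gr_iff)

lemma A_eq_gr: "A = gr (\<lambda>j. (m j)\<^sup>2)"
proof (intro set_eqI iffI)
  fix x assume "x \<in> A"
  then show "x \<in> gr (\<lambda>j. (m j)\<^sup>2)"
    using A_symmetric[OF _ A_eigen] by (cases x) (auto simp: gr_iff)
next
  fix x assume x: "x \<in> gr (\<lambda>j. (m j)\<^sup>2)"
  obtain u f where xx: "x = (u, f)" by (cases x)
  show "x \<in> A" unfolding xx
  proof (rule A_maximal)
    fix v g assume "(v, g) \<in> A"
    then have "g \<bullet> \<epsilon> j = (m j)\<^sup>2 * (v \<bullet> \<epsilon> j)" for j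
      using A_symmetric[OF _ A_eigen] by auto
    moreover have "f \<bullet> \<epsilon> j = (m j)\<^sup>2 * (u \<bullet> \<epsilon> j)" for j using x by (auto simp: xx gr_iff)
    ultimately have "(g \<bullet> \<epsilon> j) * (u \<bullet> \<epsilon> j) = (v \<bullet> \<epsilon> j) * (f \<bullet> \<epsilon> j)" for j by simp
    then show "g \<bullet> u = v \<bullet> f" using parseval[of g u] parseval[of v f] sums_unique2 by simp
  qed
qed

lemma gr_symmetric:
  assumes "(u, f) \<in> gr h" "(v, g) \<in> gr h" shows "f \<bullet> v = u \<bullet> g"
proof -
  have "(f \<bullet> \<epsilon> j) * (v \<bullet> \<epsilon> j) = (u \<bullet> \<epsilon> j) * (g \<bullet> \<epsilon> j)" for j using assms by (simp add: gr_iff)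
  then show ?thesis using parseval[of f v] parseval[of u g] sums_unique2 by simp
qed

lemma eps_gr: "(\<epsilon> j, h j *\<^sub>R \<epsilon> j) \<in> gr h"
  by (auto simp: gr_iff eps_inner)

lemma gr_selfadjoint: "selfadjoint_op (gr h)"
  unfolding selfadjoint_op_def
proof (intro conjI)
  show "subspace (gr h)"
    by (auto simp: subspace_def gr_def inner_add_left algebra_simps zero_prod_def)
  show "single_valued (gr h)" by (rule gr_single_valued)
  have "u \<in> closure (Domain (gr h))" for u
  proof -
    have "trunc N u \<in> Domain (gr h)" for N
      unfolding Domain_gr by (rule summable_finite[of "{..<N}"]) (auto simp: trunc_coef)
    then show ?thesis using trunc_tendsto[of u] unfolding closure_sequential by (intro exI[of _ "\<lambda>N. trunc N u"]) auto
  qed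
  then show "closure (Domain (gr h)) = UNIV" by auto
  show "adjoint_op (gr h) = gr h"
  proof (intro set_eqI iffI)
    fix x assume "x \<in> adjoint_op (gr h)"
    then have "v \<bullet> snd x = g \<bullet> fst x" if "(v, g) \<in> gr h" for v g
      using that by (auto simp: adjoint_op_def)
    from this[OF eps_gr] have "\<forall>j. snd x \<bullet> \<epsilon> j = h j * (fst x \<bullet> \<epsilon> j)"
      by (simp add: inner_commute[of "\<epsilon> _"])
    then show "x \<in> gr h" by (cases x) (simp add: gr_iff)
  next
    fix x assume "x \<in> gr h"
    then show "x \<in> adjoint_op (gr h)"
      using gr_symmetric by (cases x) (fastforce simp: adjoint_op_def)
  qed
qed

lemma gr_positive: "(\<And>j. 0 \<le> h j) \<Longrightarrow> positive_op (gr h)"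
  unfolding positive_op_def
proof clarify
  fix u f assume h: "\<And>j. 0 \<le> h j" and uf: "(u, f) \<in> gr h"
  show "0 \<le> f \<bullet> u"
    by (rule sums_le[OF _ sums_zero parseval]) (use h uf in \<open>auto simp: gr_iff mult.assoc\<close>)
qed

lemma gr_comp:
  assumes "\<And>j. \<bar>h j\<bar> \<le> M * \<bar>g j * h j\<bar>" shows "gr h O gr g = gr (\<lambda>j. g j * h j)"
proof (intro set_eqI iffI)
  fix x assume "x \<in> gr (\<lambda>j. g j * h j)"
  then obtain u f where x: "x = (u, f)" "(u, f) \<in> gr (\<lambda>j. g j * h j)" by (cases x) auto
  then have "u \<in> Domain (gr h)" using gr_dominated assms by blast
  then obtain w where w: "(u, w) \<in> gr h" by auto
  then have "(w, f) \<in> gr g" using x by (simp add: gr_iff)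
  then show "x \<in> gr h O gr g" using w x by blast
qed (auto simp: gr_iff)

lemma sqrt_op_eq: "sqrt_op A = gr m"
  unfolding sqrt_op_def
proof (rule the_equality)
  have "gr m O gr m = gr (\<lambda>j. m j * m j)"
  proof (rule gr_comp[where M="1/c"])
    show "\<bar>m j\<bar> \<le> (1/c) * \<bar>m j * m j\<bar>" for j
      using m_ge[of j] c_pos m_pos[of j] by (simp add: field_simps abs_mult mult_mono')
  qed
  then show "selfadjoint_op (gr m) \<and> positive_op (gr m) \<and> gr m O gr m = A"
    using gr_selfadjoint gr_positive m_pos A_eq_gr by (simp add: power2_eq_square less_imp_le)
next
  fix R assume R: "selfadjoint_op R \<and> positive_op R \<and> R O R = A"
  have sub: "subspace R" and sv: "single_valued R" and adj: "adjoint_op R = R"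
    using R by (auto simp: selfadjoint_op_def)
  have symR: "f \<bullet> v = u \<bullet> g" if "(u, f) \<in> R" "(v, g) \<in> R" for u f v g
  proof -
    have "(u, f) \<in> adjoint_op R" using that adj by simp
    then show ?thesis using that(2) by (auto simp: adjoint_op_def inner_commute)
  qed
  have eR: "(\<epsilon> j, m j *\<^sub>R \<epsilon> j) \<in> R" for j
  proof -
    have "(\<epsilon> j, (m j)\<^sup>2 *\<^sub>R \<epsilon> j) \<in> R O R" using A_eigen R by simp
    then obtain y where y: "(\<epsilon> j, y) \<in> R" "(y, (m j)\<^sup>2 *\<^sub>R \<epsilon> j) \<in> R" by auto
    define z where "z = y - m j *\<^sub>R \<epsilon> j"
    have "m j *\<^sub>R (\<epsilon> j, y) \<in> R" using y(1) by (rule subspace_scale[OF sub])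
    from subspace_diff[OF sub y(2) this]
    have "(z, (- m j) *\<^sub>R z) \<in> R" by (simp add: z_def algebra_simps power2_eq_square)
    then have "0 \<le> ((- m j) *\<^sub>R z) \<bullet> z" using R unfolding positive_op_def by fast
    then have "z \<bullet> z \<le> 0" using m_pos[of j] by (simp add: mult_le_0_iff)
    then have "z = 0" by (metis inner_eq_zero_iff inner_ge_zero antisym)
    then show ?thesis using y(1) by (simp add: z_def)
  qed
  have sub1: "R \<subseteq> gr m" using symR[OF _ eR] by (auto simp: gr_iff)
  have "gr m \<subseteq> R"
  proof
    fix x assume x: "x \<in> gr m"
    then have "x \<in> adjoint_op R"
      using gr_symmetric[of _ _ m] sub1 by (cases x) (fastforce simp: adjoint_op_def)
    then show "x \<in> R" using adj by simp
  qed
  with sub1 show "R = gr m" by blast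
qed

lemma converse_gr: "converse (gr m) = gr (\<lambda>j. inverse (m j))"
  using m_pos by (auto simp: gr_iff field_simps less_imp_neq[THEN not_sym])

lemma half_pow_eq: "half_pow A k = gr (\<lambda>j. m j powi k)"
proof -
  have 1: "gr m ^^ n = gr (\<lambda>j. m j ^ n)" for n
  proof (induction n)
    case 0
    show ?case by (auto simp: gr_iff intro: coef_ext)
  next
    case (Suc n)
    have "gr (\<lambda>j. m j ^ n) O gr m = gr (\<lambda>j. m j * m j ^ n)"
    proof (rule gr_comp[where M="1/c"])
      show "\<bar>m j ^ n\<bar> \<le> 1/c * \<bar>m j * m j ^ n\<bar>" for j
        using m_ge[of j] c_pos m_pos[of j] by (simp add: field_simps abs_mult mult_right_mono)
    qed
    then show ?case by (simp add: Suc)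
  qed
  have 2: "gr (\<lambda>j. inverse (m j)) ^^ n = gr (\<lambda>j. inverse (m j) ^ n)" for n
  proof (induction n)
    case 0
    show ?case by (auto simp: gr_iff intro: coef_ext)
  next
    case (Suc n)
    have "gr (\<lambda>j. inverse (m j) ^ n) O gr (\<lambda>j. inverse (m j)) = gr (\<lambda>j. inverse (m j) * inverse (m j) ^ n)"
    proof (intro set_eqI iffI)
      fix x assume "x \<in> gr (\<lambda>j. inverse (m j) * inverse (m j) ^ n)"
      then obtain u f where x: "x = (u, f)" "(u, f) \<in> gr (\<lambda>j. inverse (m j) * inverse (m j) ^ n)" by (cases x) auto
      have "\<bar>inverse (m j) ^ n\<bar> \<le> inverse c ^ n" for j
        using m_ge[of j] c_pos m_pos[of j] by (auto intro!: power_mono le_imp_inverse_le)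
      then have "u \<in> Domain (gr (\<lambda>j. inverse (m j) ^ n))" by (rule gr_bounded)
      then obtain w where w: "(u, w) \<in> gr (\<lambda>j. inverse (m j) ^ n)" by auto
      then have "(w, f) \<in> gr (\<lambda>j. inverse (m j))" using x by (simp add: gr_iff)
      then show "x \<in> gr (\<lambda>j. inverse (m j) ^ n) O gr (\<lambda>j. inverse (m j))" using w x by blast
    qed (auto simp: gr_iff)
    then show ?case by (simp add: Suc)
  qed
  show ?thesis
    unfolding half_pow_def sqrt_op_eq converse_gr
    by (auto simp: 1 2 power_int_def)
qed

lemma Hdom_eq: "Hdom A k = Domain (gr (\<lambda>j. m j powi k))"
  by (simp add: Hdom_def half_pow_eq)

lemma hpow_gr: "u \<in> Hdom A k \<Longrightarrow> (u, hpow A k u) \<in> gr (\<lambda>j. m j powi k)"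
  unfolding Hdom_eq hpow_def half_pow_eq using app_gr by fastforce

lemma hpow_coef: "u \<in> Hdom A k \<Longrightarrow> hpow A k u \<bullet> \<epsilon> j = m j powi k * (u \<bullet> \<epsilon> j)"
  using hpow_gr by (simp add: gr_iff)

lemma hpow_eqI:
  assumes "\<And>j. f \<bullet> \<epsilon> j = m j powi k * (u \<bullet> \<epsilon> j)" shows "u \<in> Hdom A k" "hpow A k u = f"
proof -
  have "(u, f) \<in> gr (\<lambda>j. m j powi k)" using assms by (simp add: gr_iff)
  then show "u \<in> Hdom A k" "hpow A k u = f" by (auto simp: Hdom_eq hpow_def half_pow_eq app_gr)
qed

lemma powi_le: "k \<le> 0 \<Longrightarrow> m j powi k \<le> c powi k"
  using m_ge[of j] c_pos m_pos[of j]
  by (auto simp: power_int_def intro!: power_mono le_imp_inverse_le)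

lemma powi_pos: "0 < m j powi k"
  using m_pos by (simp add: zero_less_power_int)

lemma powi_add: "m j powi (k + l) = m j powi k * m j powi l"
  using m_pos[of j] by (intro power_int_add) auto

lemma Hdom_nonpos: "k \<le> 0 \<Longrightarrow> Hdom A k = UNIV"
  unfolding Hdom_eq using gr_bounded[of "\<lambda>j. m j powi k" "c powi k"] powi_le powi_pos
  by (auto simp: less_imp_le)

lemma Hdom_0 [simp]: "Hdom A 0 = UNIV" by (rule Hdom_nonpos) simp

lemma Hdom_hpow_iff: "u \<in> Hdom A k \<Longrightarrow> hpow A k u \<in> Hdom A l \<longleftrightarrow> u \<in> Hdom A (l + k)"
  by (simp add: Hdom_eq Domain_gr hpow_coef powi_add mult.assoc)

lemma hpow_hpow: "u \<in> Hdom A k \<Longrightarrow> u \<in> Hdom A (l + k) \<Longrightarrow> hpow A l (hpow A k u) = hpow A (l + k) u"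
  by (rule hpow_eqI) (simp add: hpow_coef powi_add)

lemma Hdom_mono: "k \<le> l \<Longrightarrow> Hdom A l \<subseteq> Hdom A k"
  using Hdom_hpow_iff[of _ l "k - l"] Hdom_nonpos[of "k - l"] by auto

lemma hpow_0 [simp]: "hpow A 0 u = u"
  by (rule hpow_eqI) simp

lemma hpow_inv: "u \<in> Hdom A k \<Longrightarrow> hpow A (- k) (hpow A k u) = u"
  using hpow_hpow[of u k "- k"] by simp

lemma hpow_neg_in: "0 \<le> k \<Longrightarrow> hpow A (- k) u \<in> Hdom A k"
  using Hdom_hpow_iff[of u "- k" k] Hdom_nonpos[of "- k"] by simp

lemma Hdom_add: "u \<in> Hdom A k \<Longrightarrow> v \<in> Hdom A k \<Longrightarrow> u + v \<in> Hdom A k"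
  and hpow_add: "u \<in> Hdom A k \<Longrightarrow> v \<in> Hdom A k \<Longrightarrow> hpow A k (u + v) = hpow A k u + hpow A k v"
  using hpow_eqI[of "hpow A k u + hpow A k v" k "u + v"] by (auto simp: hpow_coef inner_add_left algebra_simps)

lemma Hdom_scaleR: "u \<in> Hdom A k \<Longrightarrow> r *\<^sub>R u \<in> Hdom A k"
  and hpow_scaleR: "u \<in> Hdom A k \<Longrightarrow> hpow A k (r *\<^sub>R u) = r *\<^sub>R hpow A k u"
  using hpow_eqI[of "r *\<^sub>R hpow A k u" k "r *\<^sub>R u"] by (auto simp: hpow_coef)

lemma hpow_symmetric: "u \<in> Hdom A k \<Longrightarrow> v \<in> Hdom A k \<Longrightarrow> hpow A k u \<bullet> v = u \<bullet> hpow A k v"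
  by (rule gr_symmetric[OF hpow_gr hpow_gr])

lemma hpow_bounded_linear: "k \<le> 0 \<Longrightarrow> bounded_linear (hpow A k)"
proof (rule bounded_linear_intro[where K="c powi k"])
  assume k: "k \<le> 0"
  show "norm (hpow A k x) \<le> norm x * (c powi k)" for x
    using norm_le_coef[of "c powi k" "hpow A k x" x] powi_le[OF k] powi_pos c_pos k
    by (simp add: hpow_coef Hdom_nonpos abs_mult mult_right_mono mult.commute less_imp_le)
qed (simp_all add: hpow_add hpow_scaleR Hdom_nonpos)

lemma eps_Hdom: "\<epsilon> j \<in> Hdom A k" and hpow_eps: "hpow A k (\<epsilon> j) = (m j powi k) *\<^sub>R \<epsilon> j"
  using hpow_eqI[of "(m j powi k) *\<^sub>R \<epsilon> j" k "\<epsilon> j"] by (auto simp: eps_inner)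

lemma smooth_iff: "v \<in> smooth_vec A \<longleftrightarrow> (\<forall>k. v \<in> Hdom A k)"
proof
  assume v: "v \<in> smooth_vec A"
  show "\<forall>k. v \<in> Hdom A k"
  proof
    fix k :: int
    show "v \<in> Hdom A k"
    proof (cases "0 \<le> k")
      case True
      then obtain n where "k = int n" using zero_le_imp_eq_int by blast
      then show ?thesis using v by (auto simp: smooth_vec_def)
    qed (simp add: Hdom_nonpos)
  qed
qed (auto simp: smooth_vec_def)

lemma eps_smooth: "\<epsilon> j \<in> smooth_vec A"
  by (simp add: smooth_iff eps_Hdom)

lemma app_A: "v \<in> Hdom A 2 \<Longrightarrow> app_op A v = hpow A 2 v"
  by (subst A_eq_gr) (rule app_gr, use hpow_gr[of v 2] in simp)

abbreviation S :: "'h \<Rightarrow> 'h" where "S \<equiv> hpow A (- 1)"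

lemma S_coef: "S u \<bullet> \<epsilon> j = (u \<bullet> \<epsilon> j) / m j"
  by (simp add: hpow_coef Hdom_nonpos power_int_minus field_simps)

lemma S_bounded_linear: "bounded_linear S"
  by (rule hpow_bounded_linear) simp

end

section \<open>The scale of spaces as copies of \<open>H\<close>\<close>

lemma riesz_inner [simp]: "riesz (\<lambda>v. u \<bullet> v) = u"
  unfolding riesz_def
proof (rule the_equality)
  fix w assume "(\<lambda>v. u \<bullet> v) = (\<lambda>v. w \<bullet> v)"
  then have "u \<bullet> v = w \<bullet> v" for v by (rule fun_cong)
  then have "(u - w) \<bullet> (u - w) = 0" by (simp only: inner_diff_left)
  then show "w = u" by simp
qed simp

context eigenbasis
begin

definition emb :: "int \<Rightarrow> 'h \<Rightarrow> 'h gvec" where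
  "emb k h = (\<lambda>v. if v \<in> Hdom A (- k) then h \<bullet> hpow A (- k) v else 0)"

lemma emb_nonneg: "0 \<le> k \<Longrightarrow> emb k h = (\<lambda>v. hpow A (- k) h \<bullet> v)"
  by (auto simp: emb_def Hdom_nonpos hpow_symmetric)

lemma emb_eps: "emb k h (\<epsilon> j) = m j powi (- k) * (h \<bullet> \<epsilon> j)"
  by (simp add: emb_def eps_Hdom hpow_eps)

lemma emb_inj: "emb k h = emb k g \<longleftrightarrow> h = g"
proof
  assume "emb k h = emb k g"
  then have "m j powi (- k) * (h \<bullet> \<epsilon> j) = m j powi (- k) * (g \<bullet> \<epsilon> j)" for j
    by (metis emb_eps)
  then have "h \<bullet> \<epsilon> j = g \<bullet> \<epsilon> j" for j
    using powi_pos[of j "- k"] by (metis less_irrefl mult_left_cancel)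
  then show "h = g" by (rule coef_ext)
qed simp

lemma emb_0_iff: "emb k h = (\<lambda>_. 0) \<longleftrightarrow> h = 0"
proof -
  have "emb k 0 = (\<lambda>_. 0)" by (auto simp: emb_def)
  then show ?thesis by (metis emb_inj)
qed

lemma emb_diff: "emb k (h - g) v = emb k h v - emb k g v"
  by (auto simp: emb_def inner_diff_left)

lemma hpow_onto: "v \<in> Hdom A k \<and> hpow A k v = g" if "v = hpow A (- k) g" "0 \<le> k" for v g
  using that hpow_neg_in[of k g] hpow_inv[of g "- k"] Hdom_nonpos[of "- k"] by auto

lemma Hs_eq: "Hs A k = range (emb k)"
proof (cases "0 \<le> k")
  case True
  have "(\<lambda>u v. u \<bullet> v) ` Hdom A k = range (emb k)"
  proof (intro set_eqI iffI)
    fix \<phi> assume "\<phi> \<in> (\<lambda>u v. u \<bullet> v) ` Hdom A k"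
    then obtain u where u: "u \<in> Hdom A k" "\<phi> = (\<lambda>v. u \<bullet> v)" by auto
    then have "\<phi> = emb k (hpow A k u)" using True by (simp add: emb_nonneg hpow_inv)
    then show "\<phi> \<in> range (emb k)" by blast
  next
    fix \<phi> assume "\<phi> \<in> range (emb k)"
    then show "\<phi> \<in> (\<lambda>u v. u \<bullet> v) ` Hdom A k"
      using True hpow_neg_in[of k] by (auto simp: emb_nonneg)
  qed
  then show ?thesis using True by (simp add: Hs_def)
next
  case False
  have "\<phi> \<in> range (emb k)"
    if l: "lin_on (Hdom A (- k)) \<phi>" and b: "\<forall>v\<in>Hdom A (- k). \<bar>\<phi> v\<bar> \<le> M * norm (hpow A (- k) v)"
      and z: "\<forall>v. v \<notin> Hdom A (- k) \<longrightarrow> \<phi> v = 0" for \<phi> M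
  proof -
    have bl: "bounded_linear (\<lambda>g. \<phi> (hpow A k g))"
    proof (rule bounded_linear_intro[where K=M])
      have in': "hpow A k g \<in> Hdom A (- k)" for g using hpow_neg_in[of "- k" g] False by simp
      show "\<phi> (hpow A k (x + y)) = \<phi> (hpow A k x) + \<phi> (hpow A k y)" for x y
        using l[unfolded lin_on_def, rule_format, OF in' in', of 1 x 1 y] False
        by (simp add: hpow_add Hdom_nonpos)
      show "\<phi> (hpow A k (r *\<^sub>R x)) = r *\<^sub>R \<phi> (hpow A k x)" for r x
        using l[unfolded lin_on_def, rule_format, OF in' in', of r x 0 x] False
        by (simp add: hpow_scaleR Hdom_nonpos)
      show "norm (\<phi> (hpow A k x)) \<le> norm x * M" for x
        using b in'[of x] hpow_inv[of x k] False by (auto simp: Hdom_nonpos mult.commute)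
    qed
    obtain h where h: "\<And>g. \<phi> (hpow A k g) = h \<bullet> g" using riesz_repr[OF bl] by blast
    have "\<phi> v = emb k h v" for v
      using z h[of "hpow A (- k) v"] hpow_inv[of v "- k"] by (auto simp: emb_def)
    then show ?thesis by blast
  qed
  moreover have "lin_on (Hdom A (- k)) (emb k h)" for h
    by (auto simp: lin_on_def emb_def Hdom_add Hdom_scaleR hpow_add hpow_scaleR inner_add_right)
  moreover have "\<exists>M. \<forall>v\<in>Hdom A (- k). \<bar>emb k h v\<bar> \<le> M * norm (hpow A (- k) v)" for h
    by (rule exI[of _ "norm h"]) (auto simp: emb_def Cauchy_Schwarz_ineq2)
  moreover have "emb k h v = 0" if "v \<notin> Hdom A (- k)" for h v
    using that by (simp add: emb_def)
  ultimately show ?thesis using False unfolding Hs_def by auto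
qed

lemma Hnorm_eqI:
  assumes "\<And>v. v \<in> Hdom A (- k) \<Longrightarrow> \<phi> v = h \<bullet> hpow A (- k) v"
  shows "Hnorm A k \<phi> = norm h"
proof (cases "0 \<le> k")
  case True
  then have "\<phi> = emb k h" using assms by (auto simp: emb_def Hdom_nonpos)
  then have "riesz \<phi> = hpow A (- k) h" using True by (simp add: emb_nonneg)
  then show ?thesis using hpow_onto[OF refl True, of h] True by (simp add: Hnorm_def)
next
  case False
  have "Sup {\<bar>\<phi> v\<bar> |v. v \<in> Hdom A (- k) \<and> norm (hpow A (- k) v) \<le> 1} = norm h"
  proof (rule cSup_eq_maximum)
    define g where "g = (1 / norm h) *\<^sub>R h"
    have g: "norm g \<le> 1" "\<bar>h \<bullet> g\<bar> = norm h"
      by (auto simp: g_def power2_norm_eq_inner[symmetric] power2_eq_square)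
    have "hpow A k g \<in> Hdom A (- k)" "hpow A (- k) (hpow A k g) = g"
      using hpow_onto[of "hpow A k g" "- k" g] False by auto
    then show "norm h \<in> {\<bar>\<phi> v\<bar> |v. v \<in> Hdom A (- k) \<and> norm (hpow A (- k) v) \<le> 1}"
      using g assms by (intro CollectI exI[of _ "hpow A k g"]) auto
  next
    fix x assume "x \<in> {\<bar>\<phi> v\<bar> |v. v \<in> Hdom A (- k) \<and> norm (hpow A (- k) v) \<le> 1}"
    then obtain v where v: "x = \<bar>h \<bullet> hpow A (- k) v\<bar>" "norm (hpow A (- k) v) \<le> 1" using assms by auto
    have "x \<le> norm h * norm (hpow A (- k) v)" unfolding v(1) by (rule Cauchy_Schwarz_ineq2)
    also have "\<dots> \<le> norm h * 1" using v(2) by (intro mult_left_mono) auto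
    finally show "x \<le> norm h" by simp
  qed
  then show ?thesis using False by (simp add: Hnorm_def)
qed

lemma riesz_level: "riesz (emb 1 a) = hpow A (- 1) a" "riesz (emb 0 b) = b"
  by (simp_all add: emb_nonneg riesz_inner)

lemma dpair_emb: "dpair k (emb k h) (emb (- k) g) = h \<bullet> g"
proof (cases "0 \<le> k")
  case True
  then show ?thesis
    using hpow_onto[OF refl True, of h] by (simp add: dpair_def emb_nonneg) (simp add: emb_def inner_commute)
next
  case False
  then have k: "0 \<le> - k" by simp
  show ?thesis
    using False hpow_onto[OF refl k, of g] emb_nonneg[OF k, of g] by (simp add: dpair_def) (simp add: emb_def)
qed

lemma emb_restrict:
  assumes "l \<le> k" "v \<in> Hdom A (- l)" shows "emb l (hpow A (l - k) h) v = emb k h v"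
proof -
  have "v \<in> Hdom A (- k)" using assms Hdom_mono[of "- k" "- l"] by auto
  moreover have "hpow A (l - k) h \<bullet> hpow A (- l) v = h \<bullet> hpow A (- k) v"
    using assms \<open>v \<in> Hdom A (- k)\<close> hpow_hpow[of v "- l" "l - k"]
    by (subst hpow_symmetric) (auto simp: Hdom_nonpos)
  ultimately show ?thesis using assms by (simp add: emb_def)
qed

lemma Hcont_iff:
  "Hcont A k T w \<longleftrightarrow> (\<exists>a. continuous_on {0..T} a \<and> (\<forall>t\<in>{0..T}. w t = emb k (a t)))"
proof -
  have *: "((\<lambda>s. Hnorm A k (\<lambda>v. w s v - w t v)) \<longlongrightarrow> 0) (at t within {0..T}) \<longleftrightarrow>
      (a \<longlongrightarrow> a t) (at t within {0..T})"
    if a: "\<forall>t\<in>{0..T}. w t = emb k (a t)" and t: "t \<in> {0..T}" for a t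
  proof -
    have "Hnorm A k (\<lambda>v. w s v - w t v) = norm (a s - a t)" if "s \<in> {0..T}" for s
      by (rule Hnorm_eqI) (use a t that in \<open>auto simp: emb_def inner_diff_left\<close>)
    then have "((\<lambda>s. Hnorm A k (\<lambda>v. w s v - w t v)) \<longlongrightarrow> 0) (at t within {0..T}) \<longleftrightarrow>
        ((\<lambda>s. norm (a s - a t)) \<longlongrightarrow> 0) (at t within {0..T})"
      by (intro Lim_cong_within) auto
    then show ?thesis by (simp add: tendsto_norm_zero_iff LIM_zero_iff)
  qed
  show ?thesis
  proof
    assume w: "Hcont A k T w"
    then have "\<forall>t\<in>{0..T}. \<exists>h. w t = emb k h" by (auto simp: Hcont_def Hs_eq)
    then obtain a where a: "\<forall>t\<in>{0..T}. w t = emb k (a t)" by metis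
    then have "continuous_on {0..T} a" using w * unfolding Hcont_def continuous_on_def by blast
    then show "\<exists>a. continuous_on {0..T} a \<and> (\<forall>t\<in>{0..T}. w t = emb k (a t))" using a by blast
  next
    assume "\<exists>a. continuous_on {0..T} a \<and> (\<forall>t\<in>{0..T}. w t = emb k (a t))"
    then obtain a where "continuous_on {0..T} a" and a: "\<forall>t\<in>{0..T}. w t = emb k (a t)" by blast
    then show "Hcont A k T w" using *[OF a] unfolding Hcont_def continuous_on_def by (auto simp: Hs_eq)
  qed
qed

lemma vector_derivative_iff_quotient:
  fixes f :: "real \<Rightarrow> 'b::real_normed_vector"
  shows "(f has_vector_derivative d) (at t within I) \<longleftrightarrow>
    ((\<lambda>s. norm ((1 / (s - t)) *\<^sub>R (f s - f t) - d)) \<longlongrightarrow> 0) (at t within I)"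
proof -
  have "norm ((1 / norm (s - t)) *\<^sub>R (f s - (f t + (s - t) *\<^sub>R d))) = norm ((1 / (s - t)) *\<^sub>R (f s - f t) - d)"
    if "s \<noteq> t" for s
  proof -
    have "(1 / (s - t)) *\<^sub>R (f s - f t) - d = (1 / (s - t)) *\<^sub>R (f s - (f t + (s - t) *\<^sub>R d))"
      using that by (simp add: scaleR_diff_right scaleR_add_right)
    then show ?thesis by simp
  qed
  then have "((\<lambda>s. norm ((1 / norm (s - t)) *\<^sub>R (f s - (f t + (s - t) *\<^sub>R d)))) \<longlongrightarrow> 0) (at t within I) \<longleftrightarrow>
     ((\<lambda>s. norm ((1 / (s - t)) *\<^sub>R (f s - f t) - d)) \<longlongrightarrow> 0) (at t within I)"
    by (intro Lim_cong_within) auto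
  then show ?thesis
    unfolding has_vector_derivative_def has_derivative_within tendsto_norm_zero_iff
    by (simp add: bounded_linear_scaleR_left)
qed

lemma Hderiv_iff:
  assumes w: "\<forall>t\<in>{0..T}. w t = emb k (a t)" and w': "\<forall>t\<in>{0..T}. w' t = emb (k - 1) (b t)"
  shows "Hderiv A (k - 1) T w w' \<longleftrightarrow>
    (\<forall>t\<in>{0..T}. ((\<lambda>t. S (a t)) has_vector_derivative b t) (at t within {0..T}))"
proof -
  have "((\<lambda>s. Hnorm A (k - 1) (\<lambda>v. (w s v - w t v) / (s - t) - w' t v)) \<longlongrightarrow> 0) (at t within {0..T}) \<longleftrightarrow>
    ((\<lambda>s. norm ((1 / (s - t)) *\<^sub>R (S (a s) - S (a t)) - b t)) \<longlongrightarrow> 0) (at t within {0..T})"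
    if t: "t \<in> {0..T}" for t
  proof (rule Lim_cong_within)
    fix s assume s: "s \<in> {0..T}"
    show "Hnorm A (k - 1) (\<lambda>v. (w s v - w t v) / (s - t) - w' t v) =
      norm ((1 / (s - t)) *\<^sub>R (S (a s) - S (a t)) - b t)"
    proof (rule Hnorm_eqI)
      fix v assume v: "v \<in> Hdom A (- (k - 1))"
      have r: "emb k h v = S h \<bullet> hpow A (- (k - 1)) v" for h
        using emb_restrict[of "k - 1" k v h] v by (simp add: emb_def)
      show "(w s v - w t v) / (s - t) - w' t v =
          ((1 / (s - t)) *\<^sub>R (S (a s) - S (a t)) - b t) \<bullet> hpow A (- (k - 1)) v"
      proof -
        have "w s v = S (a s) \<bullet> hpow A (- (k - 1)) v" "w t v = S (a t) \<bullet> hpow A (- (k - 1)) v"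
          using w s t r by auto
        moreover have "w' t v = b t \<bullet> hpow A (- (k - 1)) v" using w' t v by (simp add: emb_def)
        ultimately show ?thesis by (simp add: inner_diff_left)
      qed
    qed
  qed auto
  then show ?thesis unfolding Hderiv_def vector_derivative_iff_quotient by blast
qed

end

section \<open>The wave equation\<close>

lemma antiderivative_line:
  fixes \<phi> :: "real \<Rightarrow> real"
  assumes c: "continuous_on UNIV \<phi>"
  shows "((\<lambda>x. integral {0..x} \<phi> - integral {x..0} \<phi>) has_real_derivative \<phi> t) (at t)"
proof -
  define M where "M = \<bar>t\<bar> + 1"
  have ci: "\<phi> integrable_on {a..b}" for a b
    by (rule integrable_continuous_real) (rule continuous_on_subset[OF c], simp)
  have eq: "integral {- M..x} \<phi> - integral {- M..0} \<phi> = integral {0..x} \<phi> - integral {x..0} \<phi>"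
    if "x \<in> {- M<..<M}" for x
  proof (cases "0 \<le> x")
    case True
    have "integral {- M..0} \<phi> + integral {0..x} \<phi> = integral {- M..x} \<phi>"
      by (rule Henstock_Kurzweil_Integration.integral_combine) (use True ci in \<open>auto simp: M_def\<close>)
    moreover have "integral {x..0} \<phi> = 0" using True by (cases "x = 0") auto
    ultimately show ?thesis by simp
  next
    case False
    have "integral {- M..x} \<phi> + integral {x..0} \<phi> = integral {- M..0} \<phi>"
      by (rule Henstock_Kurzweil_Integration.integral_combine) (use False that ci in auto)
    moreover have "integral {0..x} \<phi> = 0" using False by auto
    ultimately show ?thesis by simp
  qed
  have t: "t \<in> {- M<..<M}" by (auto simp: M_def)
  have "((\<lambda>x. integral {- M..x} \<phi>) has_real_derivative \<phi> t) (at t within {- M..M})"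
    by (rule integral_has_real_derivative) (use t continuous_on_subset[OF c] in auto)
  then have "((\<lambda>x. integral {- M..x} \<phi>) has_real_derivative \<phi> t) (at t)"
    using t by (simp add: at_within_Icc_at)
  then have "((\<lambda>x. integral {- M..x} \<phi> - integral {- M..0} \<phi>) has_real_derivative \<phi> t) (at t)"
    by (auto intro!: derivative_eq_intros)
  then show ?thesis
    by (rule has_field_derivative_transform_within_open[where S="{- M<..<M}"]) (use t eq in auto)
qed

lemma norm_le_of_vector_derivative:
  fixes f :: "real \<Rightarrow> 'b::real_normed_vector"
  assumes d: "\<And>x. x \<in> closed_segment s t \<Longrightarrow> (f has_vector_derivative f' x) (at x within closed_segment s t)"
    and M: "\<And>x. x \<in> closed_segment s t \<Longrightarrow> norm (f' x) \<le> M"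
  shows "norm (f t - f s) \<le> M * \<bar>t - s\<bar>"
proof -
  have "norm (f t - f s) \<le> M * norm (t - s)"
  proof (rule differentiable_bound[where f'="\<lambda>x h. h *\<^sub>R f' x" and S="closed_segment s t"])
    show "onorm (\<lambda>h. h *\<^sub>R f' x) \<le> M" if "x \<in> closed_segment s t" for x
      by (rule onorm_le) (use mult_left_mono[OF M[OF that]] in \<open>simp add: mult.commute[of M]\<close>)
  qed (use d in \<open>auto simp: has_vector_derivative_def\<close>)
  then show ?thesis by simp
qed

lemma lebesgue_on_integral_continuous:
  fixes \<phi> :: "real \<Rightarrow> real"
  assumes "continuous_on {a..b} \<phi>"
  shows "(LINT s|lebesgue_on {a..b}. \<phi> s) = integral {a..b} \<phi>"
  by (rule lebesgue_integral_eq_integral) (use continuous_imp_integrable_real[OF assms] in auto)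

context eigenbasis
begin

text \<open>The library integrates only functions with values in the class of Banach spaces, which the
  sort of \<open>'h\<close> does not provide; the primitive is obtained from the scalar ones by duality.\<close>

lemma vector_antiderivative_line:
  fixes g :: "real \<Rightarrow> 'h"
  assumes g: "continuous_on UNIV g"
  shows "\<exists>G. G 0 = 0 \<and> (\<forall>t. (G has_vector_derivative g t) (at t))"
proof -
  define I where "I z x = integral {0..x} (\<lambda>s. g s \<bullet> z) - integral {x..0} (\<lambda>s. g s \<bullet> z)" for z x
  have I': "(I z has_real_derivative g t \<bullet> z) (at t)" for z t
    unfolding I_def by (rule antiderivative_line) (intro continuous_intros g)
  have I0: "I z 0 = 0" for z by (simp add: I_def)
  have ci: "(\<lambda>s. g s \<bullet> z) integrable_on {a..b}" for a b z
    by (rule integrable_continuous_real) (intro continuous_intros continuous_on_subset[OF g], auto)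
  have "\<exists>u. \<forall>z. I z x = u \<bullet> z" for x
  proof (rule riesz_repr)
    have "bounded (g ` closed_segment 0 x)"
      by (intro compact_imp_bounded compact_continuous_image continuous_on_subset[OF g]) auto
    then obtain B where B: "\<And>s. s \<in> closed_segment 0 x \<Longrightarrow> norm (g s) \<le> B"
      by (auto simp: bounded_iff)
    show "bounded_linear (\<lambda>z. I z x)"
    proof (rule bounded_linear_intro[where K="B * \<bar>x\<bar>"])
      show "I (y + z) x = I y x + I z x" for y z
        by (simp add: I_def inner_add_right Henstock_Kurzweil_Integration.integral_add ci)
      show "I (r *\<^sub>R z) x = r *\<^sub>R I z x" for r z
        by (simp add: I_def algebra_simps)
      show "norm (I z x) \<le> norm z * (B * \<bar>x\<bar>)" for z
      proof -
        have "norm (I z x - I z 0) \<le> (B * norm z) * \<bar>x - 0\<bar>"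
        proof (rule norm_le_of_vector_derivative)
          fix s assume s: "s \<in> closed_segment 0 x"
          show "(I z has_vector_derivative g s \<bullet> z) (at s within closed_segment 0 x)"
            using I' has_real_derivative_iff_has_vector_derivative has_vector_derivative_at_within by blast
          show "norm (g s \<bullet> z) \<le> B * norm z"
            using Cauchy_Schwarz_ineq2[of "g s" z] B[OF s] by (metis mult_right_mono norm_ge_zero order_trans real_norm_def)
        qed
        then show ?thesis by (simp add: I0 algebra_simps)
      qed
    qed
  qed
  then obtain G where G: "\<And>z x. I z x = G x \<bullet> z" by metis
  have "G 0 = 0" by (rule coef_ext) (simp add: G[symmetric] I0)
  moreover have "(G has_vector_derivative g t) (at t)" for t
    unfolding vector_derivative_iff_quotient
  proof (rule LIM_I)
    fix e :: real assume "0 < e"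
    have "isCont g t" using g by (simp add: continuous_on_eq_continuous_at)
    then obtain d where d: "d > 0" "\<And>r. dist r t < d \<Longrightarrow> dist (g r) (g t) < e/2"
      unfolding continuous_at_eps_delta using \<open>0 < e\<close> by (metis half_gt_zero)
    show "\<exists>d>0. \<forall>s. s \<noteq> t \<and> norm (s - t) < d \<longrightarrow> norm (norm ((1 / (s - t)) *\<^sub>R (G s - G t) - g t) - 0) < e"
    proof (intro exI[of _ d] conjI allI impI, fact)
      fix s assume s: "s \<noteq> t \<and> norm (s - t) < d"
      define z where "z = G s - G t - (s - t) *\<^sub>R g t"
      have "norm ((I z s - s * (g t \<bullet> z)) - (I z t - t * (g t \<bullet> z))) \<le> (e/2 * norm z) * \<bar>s - t\<bar>"
      proof (rule norm_le_of_vector_derivative)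
        fix r assume r: "r \<in> closed_segment t s"
        have "((\<lambda>r. I z r - r * (g t \<bullet> z)) has_real_derivative (g r - g t) \<bullet> z) (at r)"
          by (auto intro!: derivative_eq_intros I' simp: inner_diff_left)
        then show "((\<lambda>r. I z r - r * (g t \<bullet> z)) has_vector_derivative (g r - g t) \<bullet> z) (at r within closed_segment t s)"
          using has_real_derivative_iff_has_vector_derivative has_vector_derivative_at_within by blast
        have "dist r t < d" using r s by (auto simp: closed_segment_eq_real_ivl dist_real_def split: if_splits)
        then have "norm (g r - g t) \<le> e/2" using d(2) by (metis dist_norm less_imp_le)
        then show "norm ((g r - g t) \<bullet> z) \<le> e/2 * norm z"
          using Cauchy_Schwarz_ineq2[of "g r - g t" z] by (metis mult_right_mono norm_ge_zero order_trans real_norm_def)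
      qed
      moreover have "(I z s - s * (g t \<bullet> z)) - (I z t - t * (g t \<bullet> z)) = z \<bullet> z"
      proof -
        have "z \<bullet> z = (G s - G t - (s - t) *\<^sub>R g t) \<bullet> z" by (simp only: z_def)
        then show ?thesis unfolding G by (simp add: inner_diff_left algebra_simps)
      qed
      ultimately have "norm z * norm z \<le> norm z * (e/2 * \<bar>s - t\<bar>)"
        by (simp add: dot_square_norm power2_eq_square algebra_simps)
      then have "norm z \<le> e/2 * \<bar>s - t\<bar>"
        using \<open>0 < e\<close> by (cases "norm z = 0") auto
      moreover have "(1 / (s - t)) *\<^sub>R (G s - G t) - g t = (1 / (s - t)) *\<^sub>R z"
        using s by (simp add: z_def scaleR_diff_right)
      ultimately have "norm ((1 / (s - t)) *\<^sub>R (G s - G t) - g t) \<le> e/2"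
        using s by (simp add: field_simps)
      then show "norm (norm ((1 / (s - t)) *\<^sub>R (G s - G t) - g t) - 0) < e" using \<open>0 < e\<close> by simp
    qed
  qed
  ultimately show ?thesis by blast
qed

lemma clamp_continuous:
  fixes g :: "real \<Rightarrow> 'b::topological_space"
  assumes "continuous_on {0..T} g" "0 \<le> T"
  shows "continuous_on UNIV (\<lambda>s. g (max 0 (min T s)))"
  by (rule continuous_on_compose2[OF assms(1)]) (use assms(2) in \<open>auto intro!: continuous_intros\<close>)

lemma coef_vector_derivative:
  fixes h g :: "real \<Rightarrow> 'h"
  assumes T: "0 \<le> T" and g: "continuous_on {0..T} g"
    and d: "\<And>j t. t \<in> {0..T} \<Longrightarrow> ((\<lambda>s. h s \<bullet> \<epsilon> j) has_real_derivative g t \<bullet> \<epsilon> j) (at t within {0..T})"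
    and t: "t \<in> {0..T}"
  shows "(h has_vector_derivative g t) (at t within {0..T})"
proof -
  obtain G where "\<And>t. (G has_vector_derivative g (max 0 (min T t))) (at t)"
    using vector_antiderivative_line[OF clamp_continuous[OF g T]] by blast
  then have G: "(G has_vector_derivative g t) (at t within {0..T})" if "t \<in> {0..T}" for t
    using that by (metis atLeastAtMost_iff has_vector_derivative_at_within max_absorb2 min_absorb2)
  have Gd: "((\<lambda>s. G s \<bullet> \<epsilon> j) has_real_derivative g t \<bullet> \<epsilon> j) (at t within {0..T})" if "t \<in> {0..T}" for t j
    using bounded_linear.has_vector_derivative[OF bounded_linear_inner_left G[OF that]]
    by (simp add: has_real_derivative_iff_has_vector_derivative)
  have eq: "h t = G t + (h 0 - G 0)" if "t \<in> {0..T}" for t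
  proof (rule coef_ext)
    fix j
    have "((\<lambda>s. h s \<bullet> \<epsilon> j - G s \<bullet> \<epsilon> j) has_real_derivative 0) (at s within {0..T})" if "s \<in> {0..T}" for s
      using DERIV_diff[OF d[OF that] Gd[OF that], of j j] by simp
    then obtain c where "\<And>s. s \<in> {0..T} \<Longrightarrow> h s \<bullet> \<epsilon> j - G s \<bullet> \<epsilon> j = c"
      using has_field_derivative_zero_constant[of "{0..T}" "\<lambda>s. h s \<bullet> \<epsilon> j - G s \<bullet> \<epsilon> j"] by auto
    then have "h t \<bullet> \<epsilon> j - G t \<bullet> \<epsilon> j = h 0 \<bullet> \<epsilon> j - G 0 \<bullet> \<epsilon> j" using T that by simp
    then show "h t \<bullet> \<epsilon> j = (G t + (h 0 - G 0)) \<bullet> \<epsilon> j" by (simp add: inner_add_left inner_diff_left)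
  qed
  have "((\<lambda>s. G s + (h 0 - G 0)) has_vector_derivative g t + 0) (at t within {0..T})"
    by (intro has_vector_derivative_add G t has_vector_derivative_const)
  then have "((\<lambda>s. G s + (h 0 - G 0)) has_vector_derivative g t) (at t within {0..T})" by simp
  then show ?thesis
    by (rule has_vector_derivative_transform[where f="\<lambda>s. G s + (h 0 - G 0)" and g=h, OF t eq, rotated])
qed

text \<open>For \<open>w \<in> H\<^sub>k\<close>, \<open>w' \<in> H\<^sub>k\<^sub>-\<^sub>1\<close> and a source in \<open>H\<^sub>k\<^sub>-\<^sub>1\<close> write \<open>w = A\<^bsup>-k/2\<^esup> a\<close>, \<open>w' = A\<^bsup>(1-k)/2\<^esup> b\<close>,
  \<open>f = A\<^bsup>(1-k)/2\<^esup> F\<close>: then \<open>w'' + A w = f\<close> becomes \<open>a' = A\<^bsup>1/2\<^esup> b\<close>, \<open>b' = F - A\<^bsup>1/2\<^esup> a\<close>, whatever \<open>k\<close> is.\<close>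

definition mild :: "real set \<Rightarrow> (real \<Rightarrow> 'h) \<Rightarrow> (real \<Rightarrow> 'h) \<Rightarrow> (real \<Rightarrow> 'h) \<Rightarrow> bool" where
  "mild I a b F \<longleftrightarrow> continuous_on I a \<and> continuous_on I b \<and>
    (\<forall>j. \<forall>t\<in>I. ((\<lambda>s. a s \<bullet> \<epsilon> j) has_real_derivative m j * (b t \<bullet> \<epsilon> j)) (at t within I) \<and>
      ((\<lambda>s. b s \<bullet> \<epsilon> j) has_real_derivative F t \<bullet> \<epsilon> j - m j * (a t \<bullet> \<epsilon> j)) (at t within I))"

lemma mild_subset: "mild I a b F \<Longrightarrow> J \<subseteq> I \<Longrightarrow> mild J a b F"
  unfolding mild_def by (meson DERIV_subset continuous_on_subset subsetD)

lemma mild_cong: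
  assumes "\<And>t. t \<in> I \<Longrightarrow> a t = a' t" "\<And>t. t \<in> I \<Longrightarrow> b t = b' t" "\<And>t. t \<in> I \<Longrightarrow> F t = F' t"
  shows "mild I a b F \<longleftrightarrow> mild I a' b' F'"
proof -
  have st: "mild I a' b' F'" if "mild I a b F" "\<And>t. t \<in> I \<Longrightarrow> a t = a' t" "\<And>t. t \<in> I \<Longrightarrow> b t = b' t" "\<And>t. t \<in> I \<Longrightarrow> F t = F' t"
    for a b F a' b' F'
    unfolding mild_def
  proof (intro conjI allI ballI)
    show "continuous_on I a'" "continuous_on I b'"
      using that continuous_on_cong[of I I a a'] continuous_on_cong[of I I b b'] by (auto simp: mild_def)
    fix j t assume t: "t \<in> I"
    show "((\<lambda>s. a' s \<bullet> \<epsilon> j) has_real_derivative m j * (b' t \<bullet> \<epsilon> j)) (at t within I)"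
      by (rule has_field_derivative_transform_within[where d=1 and f="\<lambda>s. a s \<bullet> \<epsilon> j"]) (use that t in \<open>auto simp: mild_def\<close>)
    show "((\<lambda>s. b' s \<bullet> \<epsilon> j) has_real_derivative F' t \<bullet> \<epsilon> j - m j * (a' t \<bullet> \<epsilon> j)) (at t within I)"
      by (rule has_field_derivative_transform_within[where d=1 and f="\<lambda>s. b s \<bullet> \<epsilon> j"]) (use that t in \<open>auto simp: mild_def\<close>)
  qed
  show ?thesis
  proof
    show "mild I a' b' F'" if "mild I a b F" by (rule st[OF that assms])
    show "mild I a b F" if "mild I a' b' F'" by (rule st[OF that assms[symmetric]])
  qed
qed

lemma mild_lin:
  assumes "mild I a b F" "mild I a' b' F'"
  shows "mild I (\<lambda>t. x *\<^sub>R a t + y *\<^sub>R a' t) (\<lambda>t. x *\<^sub>R b t + y *\<^sub>R b' t) (\<lambda>t. x *\<^sub>R F t + y *\<^sub>R F' t)"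
  unfolding mild_def
proof (intro conjI allI ballI)
  fix j t assume t: "t \<in> I"
  have A: "((\<lambda>s. a s \<bullet> \<epsilon> j) has_real_derivative m j * (b t \<bullet> \<epsilon> j)) (at t within I)"
    "((\<lambda>s. a' s \<bullet> \<epsilon> j) has_real_derivative m j * (b' t \<bullet> \<epsilon> j)) (at t within I)"
    "((\<lambda>s. b s \<bullet> \<epsilon> j) has_real_derivative F t \<bullet> \<epsilon> j - m j * (a t \<bullet> \<epsilon> j)) (at t within I)"
    "((\<lambda>s. b' s \<bullet> \<epsilon> j) has_real_derivative F' t \<bullet> \<epsilon> j - m j * (a' t \<bullet> \<epsilon> j)) (at t within I)"
    using assms t by (auto simp: mild_def)
  show "((\<lambda>s. (x *\<^sub>R a s + y *\<^sub>R a' s) \<bullet> \<epsilon> j) has_real_derivative m j * ((x *\<^sub>R b t + y *\<^sub>R b' t) \<bullet> \<epsilon> j)) (at t within I)"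
    using DERIV_add[OF DERIV_cmult[OF A(1), of x] DERIV_cmult[OF A(2), of y]]
    by (simp add: inner_add_left algebra_simps)
  show "((\<lambda>s. (x *\<^sub>R b s + y *\<^sub>R b' s) \<bullet> \<epsilon> j) has_real_derivative
      (x *\<^sub>R F t + y *\<^sub>R F' t) \<bullet> \<epsilon> j - m j * ((x *\<^sub>R a t + y *\<^sub>R a' t) \<bullet> \<epsilon> j)) (at t within I)"
    using DERIV_add[OF DERIV_cmult[OF A(3), of x] DERIV_cmult[OF A(4), of y]]
    by (simp add: inner_add_left algebra_simps)
qed (use assms in \<open>auto simp: mild_def intro!: continuous_intros\<close>)

lemma mild_diff:
  assumes "mild I a b F" "mild I a' b' F'"
  shows "mild I (\<lambda>t. a t - a' t) (\<lambda>t. b t - b' t) (\<lambda>t. F t - F' t)"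
  using mild_lin[OF assms, of 1 "- 1"] by simp

lemma mild_diagonal:
  assumes D: "bounded_linear D" "\<And>u j. D u \<bullet> \<epsilon> j = h j * (u \<bullet> \<epsilon> j)" and "mild I a b F"
  shows "mild I (\<lambda>t. D (a t)) (\<lambda>t. D (b t)) (\<lambda>t. D (F t))"
  unfolding mild_def
proof (intro conjI allI ballI)
  fix j t assume t: "t \<in> I"
  have A: "((\<lambda>s. a s \<bullet> \<epsilon> j) has_real_derivative m j * (b t \<bullet> \<epsilon> j)) (at t within I)"
    "((\<lambda>s. b s \<bullet> \<epsilon> j) has_real_derivative F t \<bullet> \<epsilon> j - m j * (a t \<bullet> \<epsilon> j)) (at t within I)"
    using assms t by (auto simp: mild_def)
  show "((\<lambda>s. D (a s) \<bullet> \<epsilon> j) has_real_derivative m j * (D (b t) \<bullet> \<epsilon> j)) (at t within I)"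
    using DERIV_cmult[OF A(1), of "h j"] by (simp add: D algebra_simps)
  show "((\<lambda>s. D (b s) \<bullet> \<epsilon> j) has_real_derivative D (F t) \<bullet> \<epsilon> j - m j * (D (a t) \<bullet> \<epsilon> j)) (at t within I)"
    using DERIV_cmult[OF A(2), of "h j"] by (simp add: D algebra_simps)
qed (use assms(3) in \<open>auto simp: mild_def intro!: bounded_linear.continuous_on[OF D(1)]\<close>)

lemma mild_unique:
  assumes m1: "mild I a b F" and m2: "mild I a' b' F" and I: "convex I" "t0 \<in> I" "t \<in> I"
    and "a t0 = a' t0" "b t0 = b' t0"
  shows "a t = a' t" "b t = b' t"
proof -
  have d: "mild I (\<lambda>t. a t - a' t) (\<lambda>t. b t - b' t) (\<lambda>t. F t - F t)" by (rule mild_diff[OF m1 m2])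
  have "(a t - a' t) \<bullet> \<epsilon> j = 0 \<and> (b t - b' t) \<bullet> \<epsilon> j = 0" for j
  proof -
    have A: "((\<lambda>s. (a s - a' s) \<bullet> \<epsilon> j) has_real_derivative m j * ((b s - b' s) \<bullet> \<epsilon> j)) (at s within I)"
      "((\<lambda>s. (b s - b' s) \<bullet> \<epsilon> j) has_real_derivative - m j * ((a s - a' s) \<bullet> \<epsilon> j)) (at s within I)"
      if "s \<in> I" for s
      using d that unfolding mild_def by auto
    have "((\<lambda>s. ((a s - a' s) \<bullet> \<epsilon> j)\<^sup>2 + ((b s - b' s) \<bullet> \<epsilon> j)\<^sup>2) has_real_derivative 0) (at s within I)" if "s \<in> I" for s
      by (rule derivative_eq_intros A that refl)+ (simp add: algebra_simps)
    then obtain c where c: "\<And>s. s \<in> I \<Longrightarrow> ((a s - a' s) \<bullet> \<epsilon> j)\<^sup>2 + ((b s - b' s) \<bullet> \<epsilon> j)\<^sup>2 = c"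
      using has_field_derivative_zero_constant[OF I(1), of "\<lambda>s. ((a s - a' s) \<bullet> \<epsilon> j)\<^sup>2 + ((b s - b' s) \<bullet> \<epsilon> j)\<^sup>2"]
      by auto
    have "c = 0" using c[OF I(2)] assms by simp
    then show ?thesis using c[OF I(3)] by (simp add: sum_power2_eq_zero_iff)
  qed
  then show "a t = a' t" "b t = b' t" by (auto intro!: coef_ext simp: inner_diff_left)
qed

lemma mild_shift:
  assumes "mild UNIV a b F" shows "mild UNIV (\<lambda>t. a (t + s)) (\<lambda>t. b (t + s)) (\<lambda>t. F (t + s))"
  unfolding mild_def
proof (intro conjI allI ballI)
  have ca: "continuous_on UNIV a" and cb: "continuous_on UNIV b" using assms by (auto simp: mild_def)
  show "continuous_on UNIV (\<lambda>t. a (t + s))"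
    by (rule continuous_on_compose2[OF ca]) (auto intro!: continuous_intros)
  show "continuous_on UNIV (\<lambda>t. b (t + s))"
    by (rule continuous_on_compose2[OF cb]) (auto intro!: continuous_intros)
  fix j t
  have "((\<lambda>s. a s \<bullet> \<epsilon> j) has_real_derivative m j * (b (t + s) \<bullet> \<epsilon> j)) (at (t + s))"
    "((\<lambda>s. b s \<bullet> \<epsilon> j) has_real_derivative F (t + s) \<bullet> \<epsilon> j - m j * (a (t + s) \<bullet> \<epsilon> j)) (at (t + s))"
    using assms by (auto simp: mild_def)
  then show "((\<lambda>t. a (t + s) \<bullet> \<epsilon> j) has_real_derivative m j * (b (t + s) \<bullet> \<epsilon> j)) (at t)"
    "((\<lambda>t. b (t + s) \<bullet> \<epsilon> j) has_real_derivative F (t + s) \<bullet> \<epsilon> j - m j * (a (t + s) \<bullet> \<epsilon> j)) (at t)"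
    by (simp_all only: DERIV_shift[of "\<lambda>s. a s \<bullet> \<epsilon> j"] DERIV_shift[of "\<lambda>s. b s \<bullet> \<epsilon> j"])
qed

text \<open>For \<open>h j = cos (t m\<^sub>j)\<close> this is \<open>cos (t A\<^bsup>1/2\<^esup>)\<close>.\<close>

definition mul :: "(nat \<Rightarrow> real) \<Rightarrow> 'h \<Rightarrow> 'h" where
  "mul h u = app_op (gr h) u"

lemma mul_coef: "(\<And>j. \<bar>h j\<bar> \<le> 1) \<Longrightarrow> mul h u \<bullet> \<epsilon> j = h j * (u \<bullet> \<epsilon> j)"
  using gr_bounded[of h 1 u] app_gr[of u _ h] by (auto simp: mul_def gr_iff)

lemma mul_diff_le:
  assumes "\<And>j. \<bar>h j\<bar> \<le> 1" shows "norm (mul h u - mul h v) \<le> norm (u - v)"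
  using norm_le_coef[of 1 "mul h u - mul h v" "u - v"] assms
  by (auto simp: inner_diff_left mul_coef[OF assms] abs_mult mult_left_le_one_le simp flip: right_diff_distrib)

lemma norm_mul_le: "(\<And>j. \<bar>h j\<bar> \<le> 1) \<Longrightarrow> norm (mul h u) \<le> norm u"
  using norm_le_coef[of 1 "mul h u" u] by (auto simp: mul_coef abs_mult mult_left_le_one_le)

lemma mul_continuous:
  assumes h: "\<And>t j. \<bar>h t j\<bar> \<le> 1" and c: "\<And>j. continuous_on UNIV (\<lambda>t. h t j)" and F: "continuous_on UNIV F"
  shows "continuous_on UNIV (\<lambda>t::real. mul (h t) (F t))"
proof -
  have fixed: "continuous_on UNIV (\<lambda>t. mul (h t) u)" for u
  proof (rule uniform_limit_theorem[where f="\<lambda>N t. \<Sum>i<N. (h t i * (u \<bullet> \<epsilon> i)) *\<^sub>R \<epsilon> i" and F=sequentially])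
    show "\<forall>\<^sub>F N in sequentially. continuous_on UNIV (\<lambda>t. \<Sum>i<N. (h t i * (u \<bullet> \<epsilon> i)) *\<^sub>R \<epsilon> i)"
      by (intro always_eventually allI continuous_intros c)
    have eq: "(\<Sum>i<N. (h t i * (u \<bullet> \<epsilon> i)) *\<^sub>R \<epsilon> i) = mul (h t) (trunc N u)" for N t
      by (rule coef_ext) (auto simp: sum_coef mul_coef[OF h] trunc_coef)
    show "uniform_limit UNIV (\<lambda>N t. \<Sum>i<N. (h t i * (u \<bullet> \<epsilon> i)) *\<^sub>R \<epsilon> i) (\<lambda>t. mul (h t) u) sequentially"
      unfolding eq
    proof (rule uniform_limitI)
      fix e :: real assume "e > 0"
      then have "\<forall>\<^sub>F N in sequentially. dist (trunc N u) u < e" using tendstoD[OF trunc_tendsto] by blast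
      then show "\<forall>\<^sub>F N in sequentially. \<forall>t\<in>UNIV. dist (mul (h t) (trunc N u)) (mul (h t) u) < e"
        by eventually_elim (auto simp: dist_norm intro: le_less_trans[OF mul_diff_le[OF h]])
    qed
  qed simp
  show ?thesis
    unfolding continuous_on_def
  proof
    fix t
    have "(\<lambda>s. mul (h s) (F s) - mul (h s) (F t)) \<midarrow>t\<rightarrow> 0"
    proof (rule Lim_null_comparison[where g="\<lambda>s. norm (F s - F t)"])
      have "F \<midarrow>t\<rightarrow> F t" using F by (auto simp: continuous_on_def)
      then show "((\<lambda>s. norm (F s - F t)) \<longlongrightarrow> 0) (at t)" using LIM_zero tendsto_norm_zero by blast
    qed (use mul_diff_le[OF h] in auto)
    moreover have "(\<lambda>s. mul (h s) (F t)) \<midarrow>t\<rightarrow> mul (h t) (F t)" using fixed by (auto simp: continuous_on_def)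
    ultimately have "(\<lambda>s. (mul (h s) (F s) - mul (h s) (F t)) + mul (h s) (F t)) \<midarrow>t\<rightarrow> 0 + mul (h t) (F t)"
      by (rule tendsto_add)
    then show "((\<lambda>s. mul (h s) (F s)) \<longlongrightarrow> mul (h t) (F t)) (at t within UNIV)" by simp
  qed
qed

lemma mild_exists:
  assumes F: "continuous_on UNIV F"
  shows "\<exists>a b. mild UNIV a b F \<and> a 0 = a0 \<and> b 0 = b0 \<and>
    (\<forall>T M. (\<forall>s. \<bar>s\<bar> \<le> T \<longrightarrow> norm (F s) \<le> M) \<longrightarrow>
      (\<forall>t. \<bar>t\<bar> \<le> T \<longrightarrow> norm (a t) \<le> norm a0 + norm b0 + 2 * T * M \<and> norm (b t) \<le> norm a0 + norm b0 + 2 * T * M))"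
proof -
  define C where "C t = mul (\<lambda>j. cos (m j * t))" for t
  define Z where "Z t = mul (\<lambda>j. sin (m j * t))" for t
  have Cc: "C t u \<bullet> \<epsilon> j = cos (m j * t) * (u \<bullet> \<epsilon> j)" and Zc: "Z t u \<bullet> \<epsilon> j = sin (m j * t) * (u \<bullet> \<epsilon> j)" for t u j
    unfolding C_def Z_def by (rule mul_coef; simp)+
  have Cn: "norm (C t u) \<le> norm u" and Zn: "norm (Z t u) \<le> norm u" for t u
    unfolding C_def Z_def by (rule norm_mul_le; simp)+
  have Cco: "continuous_on UNIV (\<lambda>t. C t (f t))" if "continuous_on UNIV f" for f
    unfolding C_def by (rule mul_continuous[OF _ _ that]) (auto intro!: continuous_intros)
  have Zco: "continuous_on UNIV (\<lambda>t. Z t (f t))" if "continuous_on UNIV f" for f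
    unfolding Z_def by (rule mul_continuous[OF _ _ that]) (auto intro!: continuous_intros)
  obtain G where G0: "G 0 = 0" and G: "\<And>t. (G has_vector_derivative Z t (F t)) (at t)"
    using vector_antiderivative_line[OF Zco[OF F]] by blast
  obtain K where K0: "K 0 = 0" and K: "\<And>t. (K has_vector_derivative C t (F t)) (at t)"
    using vector_antiderivative_line[OF Cco[OF F]] by blast
  define \<alpha> where "\<alpha> t = a0 - G t" for t
  define \<beta> where "\<beta> t = b0 + K t" for t
  define a where "a t = C t (\<alpha> t) + Z t (\<beta> t)" for t
  define b where "b t = C t (\<beta> t) - Z t (\<alpha> t)" for t
  have cG: "continuous_on UNIV G" "continuous_on UNIV K"
    by (auto intro!: continuous_at_imp_continuous_on has_vector_derivative_continuous[OF G] has_vector_derivative_continuous[OF K])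
  have co: "continuous_on UNIV \<alpha>" "continuous_on UNIV \<beta>"
    unfolding \<alpha>_def \<beta>_def by (intro continuous_intros cG)+
  have Gj: "((\<lambda>s. G s \<bullet> \<epsilon> j) has_real_derivative sin (m j * t) * (F t \<bullet> \<epsilon> j)) (at t)" for t j
    using bounded_linear.has_vector_derivative[OF bounded_linear_inner_left G, of "\<epsilon> j" t]
    by (simp add: has_real_derivative_iff_has_vector_derivative Zc)
  have Kj: "((\<lambda>s. K s \<bullet> \<epsilon> j) has_real_derivative cos (m j * t) * (F t \<bullet> \<epsilon> j)) (at t)" for t j
    using bounded_linear.has_vector_derivative[OF bounded_linear_inner_left K, of "\<epsilon> j" t]
    by (simp add: has_real_derivative_iff_has_vector_derivative Cc)
  have "mild UNIV a b F"
    unfolding mild_def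
  proof (intro conjI allI ballI)
    show "continuous_on UNIV a" "continuous_on UNIV b"
      unfolding a_def b_def by (intro continuous_intros Cco Zco co)+
    fix j t
    have 1: "(\<lambda>s. a s \<bullet> \<epsilon> j) = (\<lambda>s. cos (m j * s) * (a0 \<bullet> \<epsilon> j - G s \<bullet> \<epsilon> j) + sin (m j * s) * (b0 \<bullet> \<epsilon> j + K s \<bullet> \<epsilon> j))"
      by (simp add: a_def \<alpha>_def \<beta>_def inner_add_left inner_diff_left Cc Zc)
    have 2: "(\<lambda>s. b s \<bullet> \<epsilon> j) = (\<lambda>s. cos (m j * s) * (b0 \<bullet> \<epsilon> j + K s \<bullet> \<epsilon> j) - sin (m j * s) * (a0 \<bullet> \<epsilon> j - G s \<bullet> \<epsilon> j))"
      by (simp add: b_def \<alpha>_def \<beta>_def inner_add_left inner_diff_left Cc Zc)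
    show "((\<lambda>s. a s \<bullet> \<epsilon> j) has_real_derivative m j * (b t \<bullet> \<epsilon> j)) (at t)"
      unfolding 1 fun_cong[OF 2, of t] by (rule derivative_eq_intros Gj Kj refl)+ (simp add: algebra_simps)
    have sc: "cos (m j * t) * cos (m j * t) = 1 - sin (m j * t) * sin (m j * t)"
      using sin_cos_squared_add[of "m j * t"] by (simp add: power2_eq_square)
    have Fe: "F t \<bullet> \<epsilon> j = cos (m j * t) * (cos (m j * t) * (F t \<bullet> \<epsilon> j)) + sin (m j * t) * (sin (m j * t) * (F t \<bullet> \<epsilon> j))"
      unfolding mult.assoc[symmetric] sc by (simp add: algebra_simps)
    show "((\<lambda>s. b s \<bullet> \<epsilon> j) has_real_derivative F t \<bullet> \<epsilon> j - m j * (a t \<bullet> \<epsilon> j)) (at t)"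
      unfolding 2 fun_cong[OF 1, of t]
      by (rule derivative_eq_intros Gj Kj refl)+ (use Fe in algebra)
  qed
  moreover have "a 0 = a0" "b 0 = b0"
    by (rule coef_ext; simp add: a_def b_def \<alpha>_def \<beta>_def G0 K0 Cc Zc inner_add_left inner_diff_left)+
  moreover have "norm (a t) \<le> norm a0 + norm b0 + 2 * T * M \<and> norm (b t) \<le> norm a0 + norm b0 + 2 * T * M"
    if M: "\<forall>s. \<bar>s\<bar> \<le> T \<longrightarrow> norm (F s) \<le> M" and t: "\<bar>t\<bar> \<le> T" for T M t
  proof -
    have in': "\<bar>x\<bar> \<le> T" if "x \<in> closed_segment 0 t" for x
      using that t by (auto simp: closed_segment_eq_real_ivl split: if_splits)
    have "norm (G t - G 0) \<le> M * \<bar>t - 0\<bar>"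
      by (rule norm_le_of_vector_derivative[OF has_vector_derivative_at_within[OF G]])
        (use M in' Zn order_trans in blast)
    moreover have "norm (K t - K 0) \<le> M * \<bar>t - 0\<bar>"
      by (rule norm_le_of_vector_derivative[OF has_vector_derivative_at_within[OF K]])
        (use M in' Cn order_trans in blast)
    moreover have "0 \<le> M" using t M norm_ge_zero[of "F t"] order_trans by blast
    then have "M * \<bar>t\<bar> \<le> M * T" using t by (intro mult_left_mono)
    ultimately have "norm (G t) \<le> M * T" "norm (K t) \<le> M * T" by (simp_all add: G0 K0)
    then have "norm (\<alpha> t) \<le> norm a0 + M * T" "norm (\<beta> t) \<le> norm b0 + M * T"
      unfolding \<alpha>_def \<beta>_def using norm_triangle_ineq4[of a0 "G t"] norm_triangle_ineq[of b0 "K t"] by linarith+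
    then show ?thesis
      unfolding a_def b_def
      using norm_triangle_ineq[of "C t (\<alpha> t)" "Z t (\<beta> t)"] norm_triangle_ineq4[of "C t (\<beta> t)" "Z t (\<alpha> t)"]
        Cn[of t "\<alpha> t"] Zn[of t "\<beta> t"] Cn[of t "\<beta> t"] Zn[of t "\<alpha> t"]
      by (auto simp: algebra_simps)
  qed
  ultimately show ?thesis by blast
qed

lemma wave_sol_of_mild:
  assumes T: "0 \<le> T" and mi: "mild {0..T} a b F" and Fc: "continuous_on {0..T} F"
    and f: "\<And>s v. s \<in> {0..T} \<Longrightarrow> v \<in> smooth_vec A \<Longrightarrow> f s v = F s \<bullet> hpow A (1 - k) v"
    and w: "\<And>t. t \<in> {0..T} \<Longrightarrow> w t = emb k (a t)" and w': "\<And>t. t \<in> {0..T} \<Longrightarrow> w' t = emb (k - 1) (b t)"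
  shows "wave_sol A k T w w' f"
proof -
  have ca: "continuous_on {0..T} a" and cb: "continuous_on {0..T} b" using mi by (auto simp: mild_def)
  have da: "((\<lambda>s. a s \<bullet> \<epsilon> j) has_real_derivative m j * (b t \<bullet> \<epsilon> j)) (at t within {0..T})"
    and db: "((\<lambda>s. b s \<bullet> \<epsilon> j) has_real_derivative F t \<bullet> \<epsilon> j - m j * (a t \<bullet> \<epsilon> j)) (at t within {0..T})"
    if "t \<in> {0..T}" for t j
    using mi that by (auto simp: mild_def)
  have cS: "continuous_on {0..T} (\<lambda>t. S (F t) - a t)"
    by (intro continuous_intros ca bounded_linear.continuous_on[OF S_bounded_linear] Fc)
  have mn: "m j \<noteq> 0" for j using m_pos[of j] by simp
  have Saj: "((\<lambda>s. S (a s) \<bullet> \<epsilon> j) has_real_derivative b t \<bullet> \<epsilon> j) (at t within {0..T})" if "t \<in> {0..T}" for t j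
    using DERIV_cdivide[OF da[OF that, of j], of "m j"] mn[of j] by (simp add: S_coef)
  have Sa: "((\<lambda>t. S (a t)) has_vector_derivative b t) (at t within {0..T})" if "t \<in> {0..T}" for t
    by (rule coef_vector_derivative[OF T cb Saj that])
  have Sbj: "((\<lambda>s. S (b s) \<bullet> \<epsilon> j) has_real_derivative (S (F t) - a t) \<bullet> \<epsilon> j) (at t within {0..T})" if "t \<in> {0..T}" for t j
    using DERIV_cdivide[OF db[OF that, of j], of "m j"] mn[of j] by (simp add: S_coef inner_diff_left diff_divide_distrib)
  have Sb: "((\<lambda>t. S (b t)) has_vector_derivative S (F t) - a t) (at t within {0..T})" if "t \<in> {0..T}" for t
    by (rule coef_vector_derivative[OF T cS Sbj that])
  show ?thesis
    unfolding wave_sol_def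
  proof (intro conjI ballI)
    show "Hcont A k T w" using ca w by (auto simp: Hcont_iff)
    show "Hcont A (k - 1) T w'" using cb w' by (auto simp: Hcont_iff)
    show "Hderiv A (k - 1) T w w'" using Hderiv_iff[of T w k a w' b] w w' Sa by blast
    fix v assume v: "v \<in> smooth_vec A"
    then have vH: "v \<in> Hdom A k" for k by (simp add: smooth_iff)
    have "continuous_on {0..T} (\<lambda>s. F s \<bullet> hpow A (1 - k) v)" by (intro continuous_intros Fc)
    then have "integrable (lebesgue_on {0..T}) (\<lambda>s. F s \<bullet> hpow A (1 - k) v)"
      by (rule continuous_imp_integrable_real)
    then show "integrable (lebesgue_on {0..T}) (\<lambda>s. f s v)"
      using f[OF _ v] by (subst Bochner_Integration.integrable_cong[OF refl]) auto
    fix t assume t: "t \<in> {0..T}"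
    define y where "y = hpow A (2 - k) v"
    have z: "b s \<bullet> hpow A (1 - k) v = S (b s) \<bullet> y" for s
      using hpow_symmetric[of "b s" "- 1" y] hpow_hpow[OF vH vH, of "- 1" "2 - k"]
      by (simp add: y_def Hdom_nonpos)
    have "((\<lambda>s. S (b s) \<bullet> y) has_vector_derivative (S (F s) - a s) \<bullet> y) (at s within {0..t})" if "s \<in> {0..t}" for s
    proof -
      have "s \<in> {0..T}" using that t by auto
      from bounded_linear.has_vector_derivative[OF bounded_linear_inner_left Sb[OF this], of y]
      show ?thesis by (rule has_vector_derivative_within_subset) (use t in auto)
    qed
    then have "((\<lambda>s. (S (F s) - a s) \<bullet> y) has_integral S (b t) \<bullet> y - S (b 0) \<bullet> y) {0..t}"
      by (intro fundamental_theorem_of_calculus) (use t in auto)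
    then have i: "integral {0..t} (\<lambda>s. (S (F s) - a s) \<bullet> y) = S (b t) \<bullet> y - S (b 0) \<bullet> y"
      by (rule integral_unique)
    have "(LINT s|lebesgue_on {0..t}. f s v - w s (app_op A v)) = (LINT s|lebesgue_on {0..t}. (S (F s) - a s) \<bullet> y)"
    proof (rule Bochner_Integration.integral_cong[OF refl])
      fix s assume "s \<in> space (lebesgue_on {0..t})"
      then have s: "s \<in> {0..T}" using t by auto
      have "S (F s) \<bullet> y = F s \<bullet> hpow A (1 - k) v"
        using hpow_symmetric[of "F s" "- 1" y] hpow_hpow[OF vH vH, of "- 1" "2 - k"]
        by (simp add: y_def Hdom_nonpos)
      moreover have "w s (app_op A v) = a s \<bullet> y"
        using w[OF s] vH Hdom_hpow_iff[OF vH, of 2 "- k"] hpow_hpow[OF vH vH, of "- k" 2]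
        by (simp add: app_A emb_def y_def add.commute)
      ultimately show "f s v - w s (app_op A v) = (S (F s) - a s) \<bullet> y"
        using f[OF s v] by (simp add: inner_diff_left)
    qed
    also have "\<dots> = integral {0..t} (\<lambda>s. (S (F s) - a s) \<bullet> y)"
      by (rule lebesgue_on_integral_continuous)
        (intro continuous_intros continuous_on_subset[OF cS], use t in auto)
    finally show "w' t v = w' 0 v + (LINT s|lebesgue_on {0..t}. f s v - w s (app_op A v))"
      using w' t T vH z i by (simp add: emb_def)
  qed
qed

lemma mild_of_wave_sol:
  assumes T: "0 \<le> T" and ws: "wave_sol A k T w w' f" and Fc: "\<And>a. continuous_on {0..T} a \<Longrightarrow> (\<And>t. t \<in> {0..T} \<Longrightarrow> w t = emb k (a t)) \<Longrightarrow> continuous_on {0..T} F"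
    and f: "\<And>s j. s \<in> {0..T} \<Longrightarrow> f s (\<epsilon> j) = F s \<bullet> hpow A (1 - k) (\<epsilon> j)"
  shows "\<exists>a b. mild {0..T} a b F \<and> (\<forall>t\<in>{0..T}. w t = emb k (a t) \<and> w' t = emb (k - 1) (b t))"
proof -
  obtain a where ca: "continuous_on {0..T} a" and w: "\<forall>t\<in>{0..T}. w t = emb k (a t)"
    using ws unfolding wave_sol_def Hcont_iff by blast
  obtain b where cb: "continuous_on {0..T} b" and w': "\<forall>t\<in>{0..T}. w' t = emb (k - 1) (b t)"
    using ws unfolding wave_sol_def Hcont_iff by blast
  have cF: "continuous_on {0..T} F" using Fc[OF ca] w by blast
  have Sa: "((\<lambda>t. S (a t)) has_vector_derivative b t) (at t within {0..T})" if "t \<in> {0..T}" for t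
    using Hderiv_iff[OF w w'] ws that by (auto simp: wave_sol_def)
  have "mild {0..T} a b F"
    unfolding mild_def
  proof (intro conjI allI ballI ca cb)
    fix j t assume t: "t \<in> {0..T}"
    have "((\<lambda>s. S (a s) \<bullet> \<epsilon> j) has_real_derivative b t \<bullet> \<epsilon> j) (at t within {0..T})"
      using bounded_linear.has_vector_derivative[OF bounded_linear_inner_left Sa[OF t]]
      by (simp add: has_real_derivative_iff_has_vector_derivative)
    from DERIV_cmult[OF this, of "m j"]
    show "((\<lambda>s. a s \<bullet> \<epsilon> j) has_real_derivative m j * (b t \<bullet> \<epsilon> j)) (at t within {0..T})"
      using m_pos[of j] by (simp add: S_coef)
    define \<psi> where "\<psi> s = F s \<bullet> \<epsilon> j - m j * (a s \<bullet> \<epsilon> j)" for s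
    have c\<psi>: "continuous_on {0..T} \<psi>" unfolding \<psi>_def by (intro continuous_intros cF ca)
    have bi: "b s \<bullet> \<epsilon> j = b 0 \<bullet> \<epsilon> j + integral {0..s} \<psi>" if s: "s \<in> {0..T}" for s
    proof -
      have p: "m j powi (2 - k) = m j powi (1 - k) * m j"
        using powi_add[of j "1 - k" 1] by simp
      have "w' s (\<epsilon> j) = w' 0 (\<epsilon> j) + (LINT r|lebesgue_on {0..s}. f r (\<epsilon> j) - w r (app_op A (\<epsilon> j)))"
        using ws eps_smooth s unfolding wave_sol_def by blast
      moreover have "(LINT r|lebesgue_on {0..s}. f r (\<epsilon> j) - w r (app_op A (\<epsilon> j))) =
          (LINT r|lebesgue_on {0..s}. m j powi (1 - k) * \<psi> r)"
      proof (rule Bochner_Integration.integral_cong[OF refl])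
        fix r assume "r \<in> space (lebesgue_on {0..s})"
        then have r: "r \<in> {0..T}" using s by auto
        have "w r (app_op A (\<epsilon> j)) = m j powi (2 - k) * (a r \<bullet> \<epsilon> j)"
          using w r Hdom_scaleR[OF eps_Hdom] powi_add[of j 2 "- k"]
          by (simp add: app_A eps_Hdom hpow_eps emb_def hpow_scaleR)
        then show "f r (\<epsilon> j) - w r (app_op A (\<epsilon> j)) = m j powi (1 - k) * \<psi> r"
          using f[OF r, of j] by (simp add: hpow_eps \<psi>_def p algebra_simps)
      qed
      moreover have "(LINT r|lebesgue_on {0..s}. m j powi (1 - k) * \<psi> r) = m j powi (1 - k) * integral {0..s} \<psi>"
        using lebesgue_on_integral_continuous[of 0 s \<psi>] continuous_on_subset[OF c\<psi>] s by simp
      ultimately have "m j powi (1 - k) * (b s \<bullet> \<epsilon> j) = m j powi (1 - k) * (b 0 \<bullet> \<epsilon> j + integral {0..s} \<psi>)"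
        using w' s T by (simp add: emb_eps algebra_simps)
      then show ?thesis using powi_pos[of j "1 - k"] by (metis less_irrefl mult_left_cancel)
    qed
    have di: "((\<lambda>s. b 0 \<bullet> \<epsilon> j + integral {0..s} \<psi>) has_real_derivative \<psi> t) (at t within {0..T})"
      using integral_has_real_derivative[OF c\<psi> t] by (auto intro!: derivative_eq_intros)
    show "((\<lambda>s. b s \<bullet> \<epsilon> j) has_real_derivative F t \<bullet> \<epsilon> j - m j * (a t \<bullet> \<epsilon> j)) (at t within {0..T})"
      unfolding \<psi>_def[of t, symmetric]
      by (rule has_field_derivative_transform_within[OF di zero_less_one t]) (rule bi[symmetric])
  qed
  then show ?thesis using w w' by blast
qed

end

section \<open>Square-integrable functions with values in a Hilbert space\<close>

definition strongly_measurable :: "real \<Rightarrow> (real \<Rightarrow> 'a::real_normed_vector) \<Rightarrow> bool" where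
  "strongly_measurable T f \<longleftrightarrow>
     (\<exists>s. (\<forall>j::nat. simple_function (lebesgue_on {0..T}) (s j)) \<and>
          (AE t in lebesgue_on {0..T}. (\<lambda>j. s j t) \<longlonglongrightarrow> f t))"

lemma L2_fun_iff:
  "L2_fun T f \<longleftrightarrow> strongly_measurable T f \<and> integrable (lebesgue_on {0..T}) (\<lambda>t. (norm (f t))\<^sup>2)"
  by (simp add: L2_fun_def strongly_measurable_def)

lemma strongly_measurable_simple: "simple_function (lebesgue_on {0..T}) f \<Longrightarrow> strongly_measurable T f"
  unfolding strongly_measurable_def by (intro exI[of _ "\<lambda>_. f"]) auto

lemma strongly_measurable_comp:
  assumes "strongly_measurable T f" "strongly_measurable T g"
    and h: "\<And>X Y x y. X \<longlonglongrightarrow> x \<Longrightarrow> Y \<longlonglongrightarrow> y \<Longrightarrow> (\<lambda>j::nat. h (X j) (Y j)) \<longlonglongrightarrow> h x y"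
  shows "strongly_measurable T (\<lambda>t. h (f t) (g t))"
proof -
  obtain s r where s: "\<And>j::nat. simple_function (lebesgue_on {0..T}) (s j)" "AE t in lebesgue_on {0..T}. (\<lambda>j. s j t) \<longlonglongrightarrow> f t"
    and r: "\<And>j::nat. simple_function (lebesgue_on {0..T}) (r j)" "AE t in lebesgue_on {0..T}. (\<lambda>j. r j t) \<longlonglongrightarrow> g t"
    using assms(1,2) unfolding strongly_measurable_def by blast
  have "AE t in lebesgue_on {0..T}. (\<lambda>j. h (s j t) (r j t)) \<longlonglongrightarrow> h (f t) (g t)"
    using s(2) r(2) by eventually_elim (rule h)
  moreover have "simple_function (lebesgue_on {0..T}) (\<lambda>t. h (s j t) (r j t))" for j
    by (rule simple_function_compose2[OF s(1) r(1)])
  ultimately show ?thesis unfolding strongly_measurable_def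
    by (intro exI[of _ "\<lambda>j t. h (s j t) (r j t)"]) simp
qed

lemma strongly_measurable_real:
  fixes f :: "real \<Rightarrow> real"
  assumes "strongly_measurable T f" shows "f \<in> borel_measurable (lebesgue_on {0..T})"
proof -
  obtain s where s: "\<And>j::nat. simple_function (lebesgue_on {0..T}) (s j)" "AE t in lebesgue_on {0..T}. (\<lambda>j. s j t) \<longlonglongrightarrow> f t"
    using assms unfolding strongly_measurable_def by blast
  define F where "F t = lim (\<lambda>j. s j t)" for t
  have F: "F \<in> borel_measurable (lebesgue_on {0..T})"
    unfolding F_def by (intro borel_measurable_lim_metric borel_measurable_simple_function s)
  have ae: "AE t in lebesgue_on {0..T}. F t = f t"
    using s(2) by eventually_elim (simp add: F_def limI)
  have "(\<lambda>t. indicator {0..T} t *\<^sub>R f t) \<in> borel_measurable lebesgue"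
  proof (rule borel_measurable_AE)
    show "(\<lambda>t. indicator {0..T} t *\<^sub>R F t) \<in> borel_measurable lebesgue"
      using F by (subst (asm) borel_measurable_restrict_space_iff) auto
    show "AE t in lebesgue. indicator {0..T} t *\<^sub>R F t = indicator {0..T} t *\<^sub>R f t"
      using ae by (subst (asm) AE_restrict_space_iff) (auto simp: indicator_def elim!: eventually_mono)
  qed
  then show ?thesis by (subst borel_measurable_restrict_space_iff) auto
qed

lemma strongly_measurable_continuous:
  fixes f :: "real \<Rightarrow> 'a::real_normed_vector"
  assumes f: "continuous_on {0..T} f" shows "strongly_measurable T f"
  unfolding strongly_measurable_def
proof (intro exI[of _ "\<lambda>j t. f (real_of_int \<lfloor>t * real (Suc j)\<rfloor> / real (Suc j))"] conjI allI)
  fix j :: nat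
  have "(\<lambda>t. \<lfloor>t * real (Suc j)\<rfloor>) ` {0..T} \<subseteq> {0..\<lfloor>T * real (Suc j)\<rfloor>}"
    by (auto intro!: floor_mono mult_right_mono)
  then have "finite ((\<lambda>t. \<lfloor>t * real (Suc j)\<rfloor>) ` {0..T})" by (rule finite_subset) simp
  moreover have "(\<lambda>t. \<lfloor>t * real (Suc j)\<rfloor>) \<in> measurable (lebesgue_on {0..T}) (count_space UNIV)"
    by (rule measurable_compose[OF _ measurable_real_floor]) (auto intro!: borel_measurable_continuous_onI measurable_restrict_space1 measurable_completion continuous_intros)
  ultimately have "simple_function (lebesgue_on {0..T}) (\<lambda>t. \<lfloor>t * real (Suc j)\<rfloor>)"
    by (simp add: simple_function_eq_measurable)
  then show "simple_function (lebesgue_on {0..T}) (\<lambda>t. f (real_of_int \<lfloor>t * real (Suc j)\<rfloor> / real (Suc j)))"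
    by (rule simple_function_compose1)
next
  have "(\<lambda>j. f (real_of_int \<lfloor>t * real (Suc j)\<rfloor> / real (Suc j))) \<longlonglongrightarrow> f t" if t: "t \<in> {0..T}" for t
  proof (rule continuous_on_tendsto_compose[OF f _ t])
    define x where "x j = real_of_int \<lfloor>t * real (Suc j)\<rfloor> / real (Suc j)" for j
    have x: "x j \<le> t" "t - 1 / real (Suc j) \<le> x j" for j
    proof -
      have p: "real (Suc j) > 0" by simp
      have 1: "real_of_int \<lfloor>t * real (Suc j)\<rfloor> \<le> t * real (Suc j)"
        "t * real (Suc j) - 1 \<le> real_of_int \<lfloor>t * real (Suc j)\<rfloor>" by linarith+
      show "x j \<le> t" unfolding x_def pos_divide_le_eq[OF p] by (rule 1)
      have "t - 1 / real (Suc j) = (t * real (Suc j) - 1) / real (Suc j)" by (simp add: diff_divide_distrib)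
      also have "\<dots> \<le> x j" unfolding x_def by (rule divide_right_mono[OF 1(2)]) simp
      finally show "t - 1 / real (Suc j) \<le> x j" .
    qed
    have "x \<longlonglongrightarrow> t"
    proof (rule tendsto_sandwich[where f="\<lambda>j. t - 1 / real (Suc j)" and h="\<lambda>_. t"])
      have "(\<lambda>j. t - 1 / real (Suc j)) \<longlonglongrightarrow> t - 0"
        by (intro tendsto_diff tendsto_const LIMSEQ_Suc[OF lim_1_over_n])
      then show "(\<lambda>j. t - 1 / real (Suc j)) \<longlonglongrightarrow> t" by simp
    qed (use x in auto)
    then show "(\<lambda>j. real_of_int \<lfloor>t * real (Suc j)\<rfloor> / real (Suc j)) \<longlonglongrightarrow> t" unfolding x_def[abs_def] .
    have "0 \<le> x j" for j using t by (simp add: x_def)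
    then show "\<forall>\<^sub>F j in sequentially. real_of_int \<lfloor>t * real (Suc j)\<rfloor> / real (Suc j) \<in> {0..T}"
      using x(1) t unfolding x_def by (intro always_eventually allI) (meson atLeastAtMost_iff order_trans)
  qed
  then show "AE t in lebesgue_on {0..T}. (\<lambda>j. f (real_of_int \<lfloor>t * real (Suc j)\<rfloor> / real (Suc j))) \<longlonglongrightarrow> f t"
    by (intro AE_I2) auto
qed

lemma L2_fun_continuous:
  fixes f :: "real \<Rightarrow> 'a::real_inner"
  assumes "continuous_on {0..T} f" shows "L2_fun T f"
  unfolding L2_fun_iff
  by (intro conjI strongly_measurable_continuous continuous_imp_integrable_real continuous_intros assms)

lemma L2_measurable:
  fixes f g :: "real \<Rightarrow> 'a::real_inner"
  assumes "L2_fun T f" "L2_fun T g"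
  shows "(\<lambda>t. f t \<bullet> g t) \<in> borel_measurable (lebesgue_on {0..T})"
  using assms unfolding L2_fun_iff
  by (intro strongly_measurable_real strongly_measurable_comp[where h="(\<bullet>)"]) (auto intro: tendsto_inner)

lemma norm_lin_sq_le:
  fixes x y :: "'a::real_inner"
  shows "(norm (a *\<^sub>R x + b *\<^sub>R y))\<^sup>2 \<le> 2 * a\<^sup>2 * (norm x)\<^sup>2 + 2 * b\<^sup>2 * (norm y)\<^sup>2"
proof -
  have "norm (a *\<^sub>R x + b *\<^sub>R y) \<le> \<bar>a\<bar> * norm x + \<bar>b\<bar> * norm y"
    using norm_triangle_ineq[of "a *\<^sub>R x" "b *\<^sub>R y"] by simp
  then have "(norm (a *\<^sub>R x + b *\<^sub>R y))\<^sup>2 \<le> (\<bar>a\<bar> * norm x + \<bar>b\<bar> * norm y)\<^sup>2"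
    by (intro power_mono) auto
  also have "\<dots> \<le> 2 * (\<bar>a\<bar> * norm x)\<^sup>2 + 2 * (\<bar>b\<bar> * norm y)\<^sup>2"
    using zero_le_power2[of "\<bar>a\<bar> * norm x - \<bar>b\<bar> * norm y"] by (simp add: power2_eq_square algebra_simps)
  finally show ?thesis by (simp add: power_mult_distrib)
qed

lemma L2_fun_lin:
  fixes f g :: "real \<Rightarrow> 'a::real_inner"
  assumes "L2_fun T f" "L2_fun T g" shows "L2_fun T (\<lambda>t. a *\<^sub>R f t + b *\<^sub>R g t)"
proof -
  have sm: "strongly_measurable T (\<lambda>t. a *\<^sub>R f t + b *\<^sub>R g t)"
    using assms unfolding L2_fun_iff
    by (intro strongly_measurable_comp[where h="\<lambda>x y. a *\<^sub>R x + b *\<^sub>R y"]) (auto intro!: tendsto_intros)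
  have "(\<lambda>t. (norm (a *\<^sub>R f t + b *\<^sub>R g t))\<^sup>2) \<in> borel_measurable (lebesgue_on {0..T})"
    unfolding power2_norm_eq_inner
    by (intro strongly_measurable_real strongly_measurable_comp[where h="(\<bullet>)"] sm) (auto intro: tendsto_inner)
  note meas = this
  have i: "integrable (lebesgue_on {0..T}) (\<lambda>t. 2 * a\<^sup>2 * (norm (f t))\<^sup>2 + 2 * b\<^sup>2 * (norm (g t))\<^sup>2)"
    using assms by (auto simp: L2_fun_iff)
  have "integrable (lebesgue_on {0..T}) (\<lambda>t. (norm (a *\<^sub>R f t + b *\<^sub>R g t))\<^sup>2)"
  proof (rule Bochner_Integration.integrable_bound[OF i meas], rule AE_I2)
    show "norm ((norm (a *\<^sub>R f t + b *\<^sub>R g t))\<^sup>2) \<le> norm (2 * a\<^sup>2 * (norm (f t))\<^sup>2 + 2 * b\<^sup>2 * (norm (g t))\<^sup>2)" for t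
      using norm_lin_sq_le[of a "f t" b "g t"] by simp
  qed
  then show ?thesis using sm by (simp add: L2_fun_iff)
qed

lemma L2_fun_diff: "L2_fun T f \<Longrightarrow> L2_fun T g \<Longrightarrow> L2_fun T (\<lambda>t. f t - g t)"
  using L2_fun_lin[of T f g 1 "- 1"] by simp

lemma L2_sq_nonneg [simp]: "0 \<le> L2_sq T f"
  by (simp add: L2_sq_def)

lemma L2_sq_zero [simp]: "L2_sq T (\<lambda>_. 0) = 0"
  by (simp add: L2_sq_def)

lemma L2_inner_integrable:
  fixes f g :: "real \<Rightarrow> 'a::real_inner"
  assumes "L2_fun T f" "L2_fun T g" shows "integrable (lebesgue_on {0..T}) (\<lambda>t. f t \<bullet> g t)"
proof (rule Bochner_Integration.integrable_bound)
  show "integrable (lebesgue_on {0..T}) (\<lambda>t. (norm (f t))\<^sup>2 + (norm (g t))\<^sup>2)"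
    using assms by (auto simp: L2_fun_iff)
  show "(\<lambda>t. f t \<bullet> g t) \<in> borel_measurable (lebesgue_on {0..T})" by (rule L2_measurable[OF assms])
  have "norm (f t \<bullet> g t) \<le> norm ((norm (f t))\<^sup>2 + (norm (g t))\<^sup>2)" for t
    using Cauchy_Schwarz_ineq2[of "f t" "g t"] sum_squares_bound[of "norm (f t)" "norm (g t)"]
      mult_nonneg_nonneg[OF norm_ge_zero norm_ge_zero, of "f t" "g t"] by simp
  then show "AE t in lebesgue_on {0..T}. norm (f t \<bullet> g t) \<le> norm ((norm (f t))\<^sup>2 + (norm (g t))\<^sup>2)"
    by (intro AE_I2)
qed

lemma L2_sq_lin_eq:
  fixes f g :: "real \<Rightarrow> 'a::real_inner"
  assumes "L2_fun T f" "L2_fun T g"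
  shows "L2_sq T (\<lambda>t. a *\<^sub>R f t + b *\<^sub>R g t) =
    a\<^sup>2 * L2_sq T f + 2 * a * b * (LINT t|lebesgue_on {0..T}. f t \<bullet> g t) + b\<^sup>2 * L2_sq T g"
proof -
  have "(norm (a *\<^sub>R f t + b *\<^sub>R g t))\<^sup>2 = a\<^sup>2 * (norm (f t))\<^sup>2 + 2 * a * b * (f t \<bullet> g t) + b\<^sup>2 * (norm (g t))\<^sup>2" for t
    unfolding power2_norm_eq_inner
    by (simp add: inner_add_left inner_add_right inner_commute power2_eq_square algebra_simps)
  then show ?thesis
    unfolding L2_sq_def using assms L2_inner_integrable[OF assms] by (simp add: L2_fun_iff)
qed

lemma L2_sq_lin_le:
  fixes f g :: "real \<Rightarrow> 'a::real_inner"
  assumes "L2_fun T f" "L2_fun T g"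
  shows "L2_sq T (\<lambda>t. a *\<^sub>R f t + b *\<^sub>R g t) \<le> 2 * a\<^sup>2 * L2_sq T f + 2 * b\<^sup>2 * L2_sq T g"
proof -
  have "0 \<le> a\<^sup>2 * L2_sq T f + 2 * a * (- b) * (LINT t|lebesgue_on {0..T}. f t \<bullet> g t) + (- b)\<^sup>2 * L2_sq T g"
    unfolding L2_sq_lin_eq[OF assms, of a "- b", symmetric] by simp
  then show ?thesis unfolding L2_sq_lin_eq[OF assms] by (simp add: algebra_simps)
qed

lemma L2_sq_triangle:
  fixes f g h :: "real \<Rightarrow> 'a::real_inner"
  assumes "L2_fun T f" "L2_fun T g" "L2_fun T h"
  shows "L2_sq T (\<lambda>t. f t - h t) \<le> 2 * L2_sq T (\<lambda>t. f t - g t) + 2 * L2_sq T (\<lambda>t. g t - h t)"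
  using L2_sq_lin_le[OF L2_fun_diff[OF assms(1,2)] L2_fun_diff[OF assms(2,3)], of 1 1] by simp

lemma L2_sq_commute: "L2_sq T (\<lambda>t. f t - g t) = L2_sq T (\<lambda>t. g t - f t)"
  by (simp add: L2_sq_def norm_minus_commute)

lemma L2_sq_le2: "L2_fun T f \<Longrightarrow> L2_fun T g \<Longrightarrow> L2_sq T f \<le> 2 * L2_sq T g + 2 * L2_sq T (\<lambda>t. f t - g t)"
  using L2_sq_lin_le[OF _ L2_fun_diff[of T f g], of g 1 1] by simp

lemma L2_cauchy_schwarz:
  fixes f g :: "real \<Rightarrow> 'a::real_inner"
  assumes "L2_fun T f" "L2_fun T g"
  shows "(LINT t|lebesgue_on {0..T}. f t \<bullet> g t)\<^sup>2 \<le> L2_sq T f * L2_sq T g"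
proof -
  define x where "x = (LINT t|lebesgue_on {0..T}. f t \<bullet> g t)"
  have q: "0 \<le> a\<^sup>2 * L2_sq T f + 2 * a * b * x + b\<^sup>2 * L2_sq T g" for a b
    using L2_sq_lin_eq[OF assms, of a b] L2_sq_nonneg unfolding x_def by metis
  show ?thesis
  proof (cases "L2_sq T f = 0")
    case False
    then have p: "L2_sq T f > 0" using L2_sq_nonneg[of T f] by linarith
    have "0 \<le> L2_sq T f * (L2_sq T f * L2_sq T g - x\<^sup>2)"
      using q[of "- x" "L2_sq T f"] by (simp add: power2_eq_square algebra_simps)
    then show ?thesis using p by (simp add: zero_le_mult_iff x_def)
  next
    case True
    have "0 \<le> 2 * (- (L2_sq T g + 1) * x) * x + x\<^sup>2 * L2_sq T g"
      using q[of "- (L2_sq T g + 1)" x] True by (simp add: power2_eq_square algebra_simps)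
    then have "0 \<le> - (x\<^sup>2 * (L2_sq T g + 2))" by (simp add: power2_eq_square algebra_simps)
    then have "x\<^sup>2 * (L2_sq T g + 2) \<le> 0" by simp
    moreover have "L2_sq T g + 2 > 0" using L2_sq_nonneg[of T g] by linarith
    ultimately have "x\<^sup>2 \<le> 0" by (simp add: mult_le_0_iff)
    then show ?thesis using True by (simp add: x_def)
  qed
qed

lemma L2_cauchy_schwarz_abs:
  fixes f g :: "real \<Rightarrow> 'a::real_inner"
  assumes "L2_fun T f" "L2_fun T g"
  shows "\<bar>LINT t|lebesgue_on {0..T}. f t \<bullet> g t\<bar> \<le> sqrt (L2_sq T f) * sqrt (L2_sq T g)"
  using real_sqrt_le_mono[OF L2_cauchy_schwarz[OF assms]] by (simp add: real_sqrt_mult)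

lemma L2_inner_lin:
  fixes f g v :: "real \<Rightarrow> 'a::real_inner"
  assumes "L2_fun T v" "L2_fun T f" "L2_fun T g"
  shows "(LINT t|lebesgue_on {0..T}. v t \<bullet> (a *\<^sub>R f t + b *\<^sub>R g t)) =
    a * (LINT t|lebesgue_on {0..T}. v t \<bullet> f t) + b * (LINT t|lebesgue_on {0..T}. v t \<bullet> g t)"
  using L2_inner_integrable[OF assms(1,2)] L2_inner_integrable[OF assms(1,3)] by (simp add: inner_add_right)

lemma L2_inner_eq:
  fixes f g v :: "real \<Rightarrow> 'a::real_inner"
  assumes "L2_fun T v" "L2_fun T f" "L2_fun T g" "L2_sq T (\<lambda>t. f t - g t) = 0"
  shows "(LINT t|lebesgue_on {0..T}. v t \<bullet> f t) = (LINT t|lebesgue_on {0..T}. v t \<bullet> g t)"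
  using L2_cauchy_schwarz_abs[OF assms(1) L2_fun_diff[OF assms(2,3)]] L2_inner_lin[OF assms(1-3), of 1 "- 1"] assms(4)
  by simp

lemma L2_inner_tendsto:
  fixes v g :: "real \<Rightarrow> 'a::real_inner" and f :: "nat \<Rightarrow> real \<Rightarrow> 'a"
  assumes v: "L2_fun T v" and f: "\<And>j. L2_fun T (f j)" and g: "L2_fun T g"
    and lim: "(\<lambda>j. L2_sq T (\<lambda>t. f j t - g t)) \<longlonglongrightarrow> 0"
  shows "(\<lambda>j. LINT t|lebesgue_on {0..T}. v t \<bullet> f j t) \<longlonglongrightarrow> (LINT t|lebesgue_on {0..T}. v t \<bullet> g t)"
proof -
  have "(\<lambda>j. (LINT t|lebesgue_on {0..T}. v t \<bullet> f j t) - (LINT t|lebesgue_on {0..T}. v t \<bullet> g t)) \<longlonglongrightarrow> 0"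
  proof (rule Lim_null_comparison)
    show "\<forall>\<^sub>F j in sequentially. norm ((LINT t|lebesgue_on {0..T}. v t \<bullet> f j t) - (LINT t|lebesgue_on {0..T}. v t \<bullet> g t))
        \<le> sqrt (L2_sq T v) * sqrt (L2_sq T (\<lambda>t. f j t - g t))"
      using L2_cauchy_schwarz_abs[OF v L2_fun_diff[OF f g]] L2_inner_lin[OF v f g, of 1 _ "- 1"]
      by (intro always_eventually allI) simp
    have "(\<lambda>j. sqrt (L2_sq T v) * sqrt (L2_sq T (\<lambda>t. f j t - g t))) \<longlonglongrightarrow> sqrt (L2_sq T v) * sqrt 0"
      by (intro tendsto_intros lim)
    then show "(\<lambda>j. sqrt (L2_sq T v) * sqrt (L2_sq T (\<lambda>t. f j t - g t))) \<longlonglongrightarrow> 0" by simp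
  qed
  then show ?thesis by (rule LIM_zero_cancel)
qed

lemma L2_restrict:
  fixes f :: "real \<Rightarrow> 'a::real_inner"
  assumes f: "L2_fun T f" and t: "t \<le> T"
  shows "L2_fun t f" "L2_sq t f \<le> L2_sq T f"
proof -
  have sub: "{0..t} \<subseteq> {0..T}" using t by auto
  obtain s where s: "\<And>j::nat. simple_function (lebesgue_on {0..T}) (s j)" "AE t in lebesgue_on {0..T}. (\<lambda>j. s j t) \<longlonglongrightarrow> f t"
    using f unfolding L2_fun_def by blast
  have "simple_function (lebesgue_on {0..t}) (s j)" for j
  proof -
    have "finite (s j ` {0..T})" "s j \<in> measurable (lebesgue_on {0..T}) (count_space UNIV)"
      using s(1)[of j] by (auto simp: simple_function_eq_measurable)
    then have "finite (s j ` {0..t})" "s j \<in> measurable (lebesgue_on {0..t}) (count_space UNIV)"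
      using finite_subset[OF image_mono[OF sub]] measurable_restrict_mono[OF _ sub] by blast+
    then show ?thesis by (simp add: simple_function_eq_measurable)
  qed
  moreover have "AE x in lebesgue_on {0..t}. (\<lambda>j. s j x) \<longlonglongrightarrow> f x"
    using s(2) sub by (subst (asm) AE_restrict_space_iff, simp, subst AE_restrict_space_iff) (auto elim!: eventually_mono)
  moreover have i: "integrable (lebesgue_on {0..T}) (\<lambda>t. (norm (f t))\<^sup>2)" using f by (simp add: L2_fun_iff)
  then have i': "integrable (lebesgue_on {0..t}) (\<lambda>t. (norm (f t))\<^sup>2)"
    by (rule Equivalence_Lebesgue_Henstock_Integration.integrable_subinterval) (rule sub)
  ultimately show "L2_fun t f" unfolding L2_fun_def by blast
  show "L2_sq t f \<le> L2_sq T f"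
    unfolding L2_sq_def
    using i i' sub by (subst (1 2) integral_restrict_space, simp, simp, intro integral_mono)
      (auto simp: integrable_restrict_space indicator_def)
qed

lemma AE_zero_of_initial_integrals:
  fixes h :: "real \<Rightarrow> real"
  assumes i: "integrable (lebesgue_on {0..T}) h"
    and z: "\<And>t. t \<in> {0..T} \<Longrightarrow> (LINT s|lebesgue_on {0..t}. h s) = 0"
  shows "AE t in lebesgue_on {0..T}. h t = 0"
proof -
  define g where "g s = indicator {0..T} s * h s" for s
  have gi: "integrable lebesgue g" using i by (simp add: integrable_restrict_space g_def[abs_def])
  have base: "(LINT s:{..a}|lebesgue. g s) = 0" for a
  proof (cases "0 \<le> a \<and> 0 \<le> T")
    case True
    have "(LINT s:{..a}|lebesgue. g s) = (LINT s|lebesgue. indicator {0..min a T} s *\<^sub>R h s)"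
      unfolding set_lebesgue_integral_def g_def
      by (intro Bochner_Integration.integral_cong) (auto simp: indicator_def)
    also have "\<dots> = (LINT s|lebesgue_on {0..min a T}. h s)" by (subst integral_restrict_space) auto
    finally show ?thesis using z[of "min a T"] True by simp
  next
    case False
    then have "(\<lambda>s. indicator {..a} s *\<^sub>R g s) = (\<lambda>_. 0)" by (auto simp: g_def indicator_def)
    then show ?thesis by (simp add: set_lebesgue_integral_def)
  qed
  have si: "set_integrable lebesgue B g" if "B \<in> sets borel" for B
    unfolding set_integrable_def by (rule integrable_mult_indicator) (use that gi in auto)
  have all: "(LINT s:UNIV|lebesgue. g s) = 0"
  proof -
    have "(LINT s:UNIV|lebesgue. g s) = (LINT s:{..T}|lebesgue. g s)"
      unfolding set_lebesgue_integral_def g_def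
      by (intro Bochner_Integration.integral_cong) (auto simp: indicator_def)
    then show ?thesis by (simp add: base)
  qed
  have ist: "Int_stable (range (\<lambda>a::real. {..a}))"
    by (auto simp: Int_stable_def image_iff intro!: exI[of _ "min _ _"])
  have "(LINT s:B|lebesgue. g s) = 0" if "B \<in> sigma_sets UNIV (range (\<lambda>a::real. {..a}))" for B
  proof (rule sigma_sets_induct_disjoint[OF ist _ that])
    show "range (\<lambda>a::real. {..a}) \<subseteq> Pow UNIV" by auto
    show "(LINT s:A|lebesgue. g s) = 0" if "A \<in> range (\<lambda>a::real. {..a})" for A using that base by auto
    show "(LINT s:{}|lebesgue. g s) = 0" by (simp add: set_lebesgue_integral_def)
    fix A assume A: "A \<in> sigma_sets UNIV (range (\<lambda>a::real. {..a}))" "(LINT s:A|lebesgue. g s) = 0"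
    then have Ab: "A \<in> sets borel" by (simp add: borel_eq_atMost)
    have "(LINT s:A \<union> (UNIV - A)|lebesgue. g s) = (LINT s:A|lebesgue. g s) + (LINT s:UNIV - A|lebesgue. g s)"
      by (rule set_integral_Un) (use si Ab in auto)
    then show "(LINT s:UNIV - A|lebesgue. g s) = 0" using A all by simp
  next
    fix A :: "nat \<Rightarrow> real set"
    assume A: "disjoint_family A" "range A \<subseteq> sigma_sets UNIV (range (\<lambda>a::real. {..a}))"
      "\<And>i. (LINT s:A i|lebesgue. g s) = 0"
    have Ab: "A i \<in> sets borel" for i using A(2) by (auto simp: borel_eq_atMost)
    have "(LINT s:(\<Union>i. A i)|lebesgue. g s) = (\<Sum>i. (LINT s:A i|lebesgue. g s))"
      by (rule lebesgue_integral_countable_add) (use Ab A(1) si in \<open>auto simp: disjoint_family_on_def\<close>)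
    then show "(LINT s:(\<Union>i. A i)|lebesgue. g s) = 0" using A(3) by simp
  qed
  then have zero: "(LINT s:B|lebesgue. g s) = 0" if "B \<in> sets borel" for B
    using that by (simp add: borel_eq_atMost)
  obtain g' where g': "g' \<in> borel_measurable lborel" "AE x in lborel. g x = g' x"
    using completion_ex_borel_measurable_real[of g lborel] gi by auto
  then have ae: "AE x in lebesgue. g x = g' x" by (simp add: AE_completion)
  have bor: "{x. g' x > 0} \<in> sets borel" "{x. g' x < 0} \<in> sets borel"
    using g' by (auto intro!: borel_measurable_less simp: measurable_lborel1)
  have "AE x in lebesgue. indicator {x. g' x > 0} x *\<^sub>R g x = 0"
  proof (subst integral_nonneg_eq_0_iff_AE[symmetric])
    show "integrable lebesgue (\<lambda>x. indicator {x. g' x > 0} x *\<^sub>R g x)"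
      using si[OF bor(1)] by (simp add: set_integrable_def)
    show "AE x in lebesgue. 0 \<le> indicator {x. g' x > 0} x *\<^sub>R g x"
      using ae by eventually_elim (auto simp: indicator_def)
    show "(LINT x|lebesgue. indicator {x. g' x > 0} x *\<^sub>R g x) = 0"
      using zero[OF bor(1)] by (simp add: set_lebesgue_integral_def)
  qed
  moreover have "AE x in lebesgue. - (indicator {x. g' x < 0} x *\<^sub>R g x) = 0"
  proof (subst integral_nonneg_eq_0_iff_AE[symmetric])
    show "integrable lebesgue (\<lambda>x. - (indicator {x. g' x < 0} x *\<^sub>R g x))"
      using si[OF bor(2)] by (simp add: set_integrable_def)
    show "AE x in lebesgue. 0 \<le> - (indicator {x. g' x < 0} x *\<^sub>R g x)"
      using ae by eventually_elim (auto simp: indicator_def)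
    show "(LINT x|lebesgue. - (indicator {x. g' x < 0} x *\<^sub>R g x)) = 0"
      using zero[OF bor(2)] by (simp add: set_lebesgue_integral_def)
  qed
  ultimately have "AE x in lebesgue. x \<in> {0..T} \<longrightarrow> h x = 0"
    using ae by eventually_elim (auto simp: indicator_def g_def split: if_splits)
  then show ?thesis by (subst AE_restrict_space_iff) auto
qed

lemma L2_bounded_simple:
  fixes f s :: "real \<Rightarrow> 'a::real_inner"
  assumes s: "simple_function (lebesgue_on {0..T}) s" and f: "L2_fun T f"
    and le: "\<And>t. norm (s t) \<le> 2 * norm (f t)"
  shows "L2_fun T s"
  unfolding L2_fun_iff
proof
  show "strongly_measurable T s" by (rule strongly_measurable_simple[OF s])
  show "integrable (lebesgue_on {0..T}) (\<lambda>t. (norm (s t))\<^sup>2)"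
  proof (rule Bochner_Integration.integrable_bound)
    show "integrable (lebesgue_on {0..T}) (\<lambda>t. 4 * (norm (f t))\<^sup>2)" using f by (simp add: L2_fun_iff)
    show "(\<lambda>t. (norm (s t))\<^sup>2) \<in> borel_measurable (lebesgue_on {0..T})"
      by (rule borel_measurable_simple_function) (rule simple_function_compose1[OF s])
    have "(norm (s t))\<^sup>2 \<le> 4 * (norm (f t))\<^sup>2" for t
      using power_mono[OF le[of t] norm_ge_zero, of 2] by (simp add: power_mult_distrib)
    then show "AE t in lebesgue_on {0..T}. norm ((norm (s t))\<^sup>2) \<le> norm (4 * (norm (f t))\<^sup>2)"
      by (intro AE_I2) simp
  qed
qed

lemma L2_simple_approx:
  fixes f :: "real \<Rightarrow> 'a::real_inner"
  assumes f: "L2_fun T f" and "e > 0"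
  shows "\<exists>s. simple_function (lebesgue_on {0..T}) s \<and> L2_fun T s \<and> L2_sq T (\<lambda>t. f t - s t) < e"
proof -
  obtain s where s: "\<And>j::nat. simple_function (lebesgue_on {0..T}) (s j)" "AE t in lebesgue_on {0..T}. (\<lambda>j. s j t) \<longlonglongrightarrow> f t"
    using f unfolding L2_fun_def by blast
  define r where "r j t = (if norm (s j t) \<le> 2 * norm (f t) then s j t else 0)" for j t
  have nf: "(\<lambda>t. norm (f t)) \<in> borel_measurable (lebesgue_on {0..T})"
    using f unfolding L2_fun_iff
    by (intro strongly_measurable_real strongly_measurable_comp[where h="\<lambda>x y. norm x" and g=f]) (auto intro: tendsto_norm)
  have rs: "simple_function (lebesgue_on {0..T}) (r j)" for j
  proof -
    have "(\<lambda>t. norm (s j t)) \<in> borel_measurable (lebesgue_on {0..T})"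
      by (rule borel_measurable_simple_function) (rule simple_function_compose1[OF s(1)])
    then have "{t \<in> space (lebesgue_on {0..T}). norm (s j t) \<le> 2 * norm (f t)} \<in> sets (lebesgue_on {0..T})"
      using nf by (intro borel_measurable_le borel_measurable_times) auto
    from simple_function_If[OF s(1) simple_function_const this] show ?thesis by (simp add: r_def[abs_def])
  qed
  have rle: "norm (r j t) \<le> 2 * norm (f t)" for j t by (simp add: r_def)
  have rL: "L2_fun T (r j)" for j by (rule L2_bounded_simple[OF rs f rle])
  have "(\<lambda>j. L2_sq T (\<lambda>t. f t - r j t)) \<longlonglongrightarrow> (LINT t|lebesgue_on {0..T}. 0)"
    unfolding L2_sq_def
  proof (rule integral_dominated_convergence[where w="\<lambda>t. 9 * (norm (f t))\<^sup>2"])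
    show "(\<lambda>t. (norm (f t - r j t))\<^sup>2) \<in> borel_measurable (lebesgue_on {0..T})" for j
      using L2_fun_diff[OF f rL[of j]] by (simp add: L2_fun_iff borel_measurable_integrable)
    show "integrable (lebesgue_on {0..T}) (\<lambda>t. 9 * (norm (f t))\<^sup>2)" using f by (simp add: L2_fun_iff)
    show "AE t in lebesgue_on {0..T}. (\<lambda>j. (norm (f t - r j t))\<^sup>2) \<longlonglongrightarrow> 0"
      using s(2)
    proof eventually_elim
      case (elim t)
      have "(\<lambda>j. r j t) \<longlonglongrightarrow> f t"
      proof (cases "f t = 0")
        case True
        then have "r j t = 0" for j by (simp add: r_def)
        then show ?thesis using True by simp
      next
        case False
        have "\<forall>\<^sub>F j in sequentially. norm (s j t) < 2 * norm (f t)"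
          by (rule order_tendstoD(2)[OF tendsto_norm[OF elim]]) (use False in auto)
        then have "\<forall>\<^sub>F j in sequentially. s j t = r j t" by eventually_elim (auto simp: r_def)
        then show ?thesis using elim tendsto_cong by force
      qed
      then have "(\<lambda>j. (norm (f t - r j t))\<^sup>2) \<longlonglongrightarrow> (norm (f t - f t))\<^sup>2" by (intro tendsto_intros)
      then show ?case by simp
    qed
    show "AE t in lebesgue_on {0..T}. norm ((norm (f t - r j t))\<^sup>2) \<le> 9 * (norm (f t))\<^sup>2" for j
    proof (rule AE_I2)
      fix t
      have "norm (f t - r j t) \<le> 3 * norm (f t)" using norm_triangle_ineq4[of "f t" "r j t"] rle[of j t] by linarith
      from power_mono[OF this norm_ge_zero, of 2] show "norm ((norm (f t - r j t))\<^sup>2) \<le> 9 * (norm (f t))\<^sup>2"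
        by (simp add: power_mult_distrib)
    qed
  qed simp
  then have "\<forall>\<^sub>F j in sequentially. L2_sq T (\<lambda>t. f t - r j t) < e"
    using \<open>e > 0\<close> by (intro order_tendstoD(2)) auto
  then obtain j where "L2_sq T (\<lambda>t. f t - r j t) < e" by (auto simp: eventually_sequentially)
  then show ?thesis using rs rL by blast
qed

lemma AE_geometric_of_L2:
  fixes d :: "nat \<Rightarrow> real \<Rightarrow> 'a::real_inner"
  assumes L: "\<And>k. L2_fun T (d k)" and le: "\<And>k. L2_sq T (d k) \<le> (1/8) ^ k"
  shows "AE t in lebesgue_on {0..T}. \<exists>B. \<forall>k. norm (d k t) \<le> B * (1/2) ^ k"
proof -
  define \<phi> where "\<phi> k t = ennreal (4 ^ k * (norm (d k t))\<^sup>2)" for k t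
  have i: "integrable (lebesgue_on {0..T}) (\<lambda>t. 4 ^ k * (norm (d k t))\<^sup>2)" for k
    using L by (simp add: L2_fun_iff)
  have m: "\<phi> k \<in> borel_measurable (lebesgue_on {0..T})" for k
    unfolding \<phi>_def using borel_measurable_integrable[OF i] by measurable
  have "(\<integral>\<^sup>+t. \<phi> k t \<partial>lebesgue_on {0..T}) = ennreal (4 ^ k * L2_sq T (d k))" for k
    unfolding \<phi>_def using i by (subst nn_integral_eq_integral) (auto simp: L2_sq_def)
  moreover have "4 ^ k * L2_sq T (d k) \<le> (1/2) ^ k" for k
  proof -
    have "4 ^ k * L2_sq T (d k) \<le> 4 ^ k * (1/8) ^ k" by (intro mult_left_mono le) auto
    also have "\<dots> = (1/2) ^ k" by (simp flip: power_mult_distrib)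
    finally show ?thesis .
  qed
  ultimately have le: "(\<integral>\<^sup>+t. \<phi> k t \<partial>lebesgue_on {0..T}) \<le> ennreal ((1/2) ^ k)" for k
    by (simp add: ennreal_leI)
  have "(\<integral>\<^sup>+t. (\<Sum>k. \<phi> k t) \<partial>lebesgue_on {0..T}) = (\<Sum>k. \<integral>\<^sup>+t. \<phi> k t \<partial>lebesgue_on {0..T})"
    by (rule nn_integral_suminf[OF m])
  also have "\<dots> \<le> (\<Sum>k. ennreal ((1/2) ^ k))" by (intro suminf_le le) auto
  also have "\<dots> < \<infinity>"
  proof -
    have "summable (\<lambda>k. (1/2::real) ^ k)" by (rule summable_geometric) simp
    then have "(\<Sum>k. ennreal ((1/2) ^ k)) \<noteq> top" by (rule ennreal_suminf_neq_top) simp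
    then show ?thesis unfolding infinity_ennreal_def by (simp only: less_top)
  qed
  finally have "AE t in lebesgue_on {0..T}. (\<Sum>k. \<phi> k t) \<noteq> \<infinity>"
    by (intro nn_integral_PInf_AE borel_measurable_suminf_order m) auto
  then show ?thesis
  proof eventually_elim
    case (elim t)
    define r where "r = enn2real (\<Sum>k. \<phi> k t)"
    have r: "(\<Sum>k. \<phi> k t) = ennreal r" "0 \<le> r" using elim by (auto simp: r_def less_top)
    have "norm (d k t) \<le> sqrt r * (1/2) ^ k" for k
    proof -
      have "\<phi> k t \<le> (\<Sum>k. \<phi> k t)" using sum_le_suminf[of "\<lambda>k. \<phi> k t" "{k}"] by auto
      then have "\<phi> k t \<le> ennreal r" by (simp only: r(1))
      then have "4 ^ k * (norm (d k t))\<^sup>2 \<le> r" using r(2) by (simp add: \<phi>_def)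
      moreover have "(2 ^ k * norm (d k t))\<^sup>2 = 4 ^ k * (norm (d k t))\<^sup>2"
        by (simp add: power_mult_distrib flip: power_mult) (simp add: power_mult power2_eq_square mult.commute[of k 2])
      ultimately have "(2 ^ k * norm (d k t))\<^sup>2 \<le> r" by simp
      then have "2 ^ k * norm (d k t) \<le> sqrt r" by (rule real_le_rsqrt)
      then show ?thesis by (simp add: field_simps power_one_over)
    qed
    then show ?case by blast
  qed
qed

lemma geometric_Cauchy:
  fixes x :: "nat \<Rightarrow> 'a::{real_normed_vector, complete_space}"
  assumes le: "\<And>k. norm (x (Suc k) - x k) \<le> B * (1/2) ^ k"
  shows "convergent x"
proof -
  have 1: "norm (x (i + k) - x i) \<le> 2 * B * (1/2) ^ i * (1 - (1/2) ^ k)" for i k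
  proof (induction k)
    case (Suc k)
    have "norm (x (i + Suc k) - x i) \<le> norm (x (Suc (i + k)) - x (i + k)) + norm (x (i + k) - x i)"
      using norm_triangle_ineq[of "x (Suc (i + k)) - x (i + k)" "x (i + k) - x i"] by simp
    also have "\<dots> \<le> B * (1/2) ^ (i + k) + 2 * B * (1/2) ^ i * (1 - (1/2) ^ k)"
      by (intro add_mono le Suc)
    also have "\<dots> = 2 * B * (1/2) ^ i * (1 - (1/2) ^ Suc k)" by (simp add: power_add algebra_simps)
    finally show ?case .
  qed simp
  have B: "0 \<le> B" using order_trans[OF norm_ge_zero le[of 0]] by simp
  have 2: "norm (x (i + k) - x i) \<le> 2 * B * (1/2) ^ i" for i k
  proof -
    have "2 * B * (1/2) ^ i * (1 - (1/2) ^ k) \<le> 2 * B * (1/2) ^ i * 1"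
      by (intro mult_left_mono) (use B in auto)
    then show ?thesis using 1[of i k] by simp
  qed
  have "(\<lambda>i. 2 * B * (1/2) ^ i) \<longlonglongrightarrow> 2 * B * 0" by (intro tendsto_intros LIMSEQ_power_zero) auto
  then have l: "(\<lambda>i. 2 * B * (1/2) ^ i) \<longlonglongrightarrow> 0" by simp
  have "Cauchy x"
  proof (rule metric_CauchyI)
    fix e :: real assume "e > 0"
    then obtain N where N: "2 * B * (1/2) ^ N < e / 2"
      using order_tendstoD(2)[OF l, of "e/2"] by (auto simp: eventually_sequentially)
    have n: "dist (x i) (x N) < e / 2" if "i \<ge> N" for i
      using 2[of N "i - N"] N that by (simp add: dist_norm)
    show "\<exists>M. \<forall>m\<ge>M. \<forall>n\<ge>M. dist (x m) (x n) < e"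
      using dist_triangle_half_l[OF n n] by blast
  qed
  then show ?thesis by (rule Cauchy_convergent)
qed

theorem L2_complete:
  fixes f :: "nat \<Rightarrow> real \<Rightarrow> 'a::{real_inner, complete_space}"
  assumes L: "\<And>j. L2_fun T (f j)" and C: "\<And>e. e > 0 \<Longrightarrow> \<exists>N. \<forall>i\<ge>N. \<forall>j\<ge>N. L2_sq T (\<lambda>t. f i t - f j t) < e"
    and G: "closed G" "subspace G" "\<And>j t. f j t \<in> G"
  shows "\<exists>g. L2_fun T g \<and> (\<forall>t. g t \<in> G) \<and> (\<lambda>j. L2_sq T (\<lambda>t. f j t - g t)) \<longlonglongrightarrow> 0"
proof -
  have "\<forall>k. \<exists>N. \<forall>i\<ge>N. \<forall>j\<ge>N. L2_sq T (\<lambda>t. f i t - f j t) < (1/8) ^ k" by (intro allI C) simp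
  then obtain N where N: "\<And>k i j. i \<ge> N k \<Longrightarrow> j \<ge> N k \<Longrightarrow> L2_sq T (\<lambda>t. f i t - f j t) < (1/8) ^ k" by metis
  define r where "r k = (\<Sum>i\<le>k. N i) + k" for k
  have rN: "N k \<le> r k" for k unfolding r_def by (simp add: member_le_sum trans_le_add1)
  have rS: "r k \<le> r (Suc k)" and rk: "k \<le> r k" for k by (auto simp: r_def)
  have "\<exists>s. simple_function (lebesgue_on {0..T}) s \<and> L2_fun T s \<and> L2_sq T (\<lambda>t. f (r k) t - s t) < (1/8) ^ k" for k
    by (rule L2_simple_approx[OF L]) simp
  then obtain u where u: "\<And>k. simple_function (lebesgue_on {0..T}) (u k)" "\<And>k. L2_fun T (u k)"
    "\<And>k. L2_sq T (\<lambda>t. f (r k) t - u k t) < (1/8) ^ k" by metis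
  have ae1: "AE t in lebesgue_on {0..T}. \<exists>B. \<forall>k. norm (f (r (Suc k)) t - f (r k) t) \<le> B * (1/2) ^ k"
  proof (rule AE_geometric_of_L2)
    show "L2_sq T (\<lambda>t. f (r (Suc k)) t - f (r k) t) \<le> (1/8) ^ k" for k
      using N[OF order_trans[OF rN rS] rN] by (rule less_imp_le)
  qed (intro L2_fun_diff L)
  have ae2: "AE t in lebesgue_on {0..T}. \<exists>B. \<forall>k. norm (f (r k) t - u k t) \<le> B * (1/2) ^ k"
  proof (rule AE_geometric_of_L2)
    show "L2_sq T (\<lambda>t. f (r k) t - u k t) \<le> (1/8) ^ k" for k using u(3) by (rule less_imp_le)
  qed (intro L2_fun_diff L u(2))
  define g where "g t = (if convergent (\<lambda>k. f (r k) t) then lim (\<lambda>k. f (r k) t) else 0)" for t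
  have gl: "AE t in lebesgue_on {0..T}. (\<lambda>k. f (r k) t) \<longlonglongrightarrow> g t"
    using ae1
  proof eventually_elim
    case (elim t)
    then have "convergent (\<lambda>k. f (r k) t)" using geometric_Cauchy[of "\<lambda>k. f (r k) t"] by blast
    then show ?case by (simp add: g_def convergent_LIMSEQ_iff)
  qed
  have gG: "g t \<in> G" for t
  proof (cases "convergent (\<lambda>k. f (r k) t)")
    case True
    then have *: "(\<lambda>k. f (r k) t) \<longlonglongrightarrow> g t" by (simp add: g_def convergent_LIMSEQ_iff)
    show ?thesis by (rule closed_sequentially[OF G(1) G(3) *])
  qed (simp add: g_def subspace_0[OF G(2)])
  have "AE t in lebesgue_on {0..T}. (\<lambda>k. u k t) \<longlonglongrightarrow> g t"
    using gl ae2
  proof eventually_elim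
    case (elim t)
    then obtain B where B: "\<And>k. norm (f (r k) t - u k t) \<le> B * (1/2) ^ k" by blast
    have "(\<lambda>k. B * (1/2) ^ k) \<longlonglongrightarrow> B * 0" by (intro tendsto_intros LIMSEQ_power_zero) auto
    then have "(\<lambda>k. B * (1/2) ^ k) \<longlonglongrightarrow> 0" by simp
    then have "(\<lambda>k. f (r k) t - u k t) \<longlonglongrightarrow> 0"
      by (rule Lim_null_comparison[rotated]) (use B in auto)
    from tendsto_diff[OF elim(1) this] show ?case by simp
  qed
  then have gm: "strongly_measurable T g" unfolding strongly_measurable_def using u(1) by blast
  have key: "L2_fun T (\<lambda>t. f j t - g t) \<and> L2_sq T (\<lambda>t. f j t - g t) \<le> e"
    if e: "e > 0" and M: "\<And>i. i \<ge> M \<Longrightarrow> L2_sq T (\<lambda>t. f j t - f i t) \<le> e" for j e M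
  proof -
    have sm: "strongly_measurable T (\<lambda>t. f j t - g t)"
      using L[of j] gm by (intro strongly_measurable_comp[where h="(-)"]) (auto simp: L2_fun_iff intro: tendsto_diff)
    have mes: "(\<lambda>t. (norm (f j t - g t))\<^sup>2) \<in> borel_measurable (lebesgue_on {0..T})"
      unfolding power2_norm_eq_inner
      by (intro strongly_measurable_real strongly_measurable_comp[where h="(\<bullet>)"] sm) (auto intro: tendsto_inner)
    have i: "integrable (lebesgue_on {0..T}) (\<lambda>t. (norm (f j t - f (r k) t))\<^sup>2)" for k
      using L2_fun_diff[OF L L] by (simp add: L2_fun_iff)
    have "(\<integral>\<^sup>+t. ennreal ((norm (f j t - g t))\<^sup>2) \<partial>lebesgue_on {0..T}) =
        (\<integral>\<^sup>+t. liminf (\<lambda>k. ennreal ((norm (f j t - f (r k) t))\<^sup>2)) \<partial>lebesgue_on {0..T})"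
    proof (rule nn_integral_cong_AE)
      show "AE t in lebesgue_on {0..T}. ennreal ((norm (f j t - g t))\<^sup>2) = liminf (\<lambda>k. ennreal ((norm (f j t - f (r k) t))\<^sup>2))"
        using gl
      proof eventually_elim
        case (elim t)
        then have "(\<lambda>k. ennreal ((norm (f j t - f (r k) t))\<^sup>2)) \<longlonglongrightarrow> ennreal ((norm (f j t - g t))\<^sup>2)"
          by (intro tendsto_intros)
        from lim_imp_Liminf[OF trivial_limit_sequentially this] show ?case by (rule sym)
      qed
    qed
    also have "\<dots> \<le> liminf (\<lambda>k. \<integral>\<^sup>+t. ennreal ((norm (f j t - f (r k) t))\<^sup>2) \<partial>lebesgue_on {0..T})"
    proof (rule nn_integral_liminf)
      show "(\<lambda>t. ennreal ((norm (f j t - f (r k) t))\<^sup>2)) \<in> borel_measurable (lebesgue_on {0..T})" for k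
        using borel_measurable_integrable[OF i] by measurable
    qed
    also have "\<dots> \<le> ennreal e"
    proof (rule Liminf_le)
      show "\<forall>\<^sub>F k in sequentially. (\<integral>\<^sup>+t. ennreal ((norm (f j t - f (r k) t))\<^sup>2) \<partial>lebesgue_on {0..T}) \<le> ennreal e"
        using eventually_ge_at_top[of M]
      proof eventually_elim
        case (elim k)
        have "(\<integral>\<^sup>+t. ennreal ((norm (f j t - f (r k) t))\<^sup>2) \<partial>lebesgue_on {0..T}) = ennreal (L2_sq T (\<lambda>t. f j t - f (r k) t))"
          by (subst nn_integral_eq_integral[OF i]) (auto simp: L2_sq_def)
        then show ?case using M[of "r k"] rk[of k] elim by (simp add: ennreal_leI)
      qed
    qed simp
    finally have le: "(\<integral>\<^sup>+t. ennreal ((norm (f j t - g t))\<^sup>2) \<partial>lebesgue_on {0..T}) \<le> ennreal e" .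
    have int: "integrable (lebesgue_on {0..T}) (\<lambda>t. (norm (f j t - g t))\<^sup>2)"
      by (rule integrableI_nonneg[OF mes]) (use le in \<open>auto intro: le_less_trans\<close>)
    moreover have "ennreal (L2_sq T (\<lambda>t. f j t - g t)) \<le> ennreal e"
      using le nn_integral_eq_integral[OF int] by (simp add: L2_sq_def)
    ultimately show ?thesis using sm e by (simp add: L2_fun_iff ennreal_le_iff)
  qed
  obtain M where M: "\<And>i j. i \<ge> M \<Longrightarrow> j \<ge> M \<Longrightarrow> L2_sq T (\<lambda>t. f i t - f j t) < 1"
    using C[OF zero_less_one] by blast
  have "L2_fun T (\<lambda>t. f M t - g t)" using key[of 1 M M] M by (auto intro: less_imp_le)
  from L2_fun_diff[OF L[of M] this] have gL: "L2_fun T g" by simp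
  have "(\<lambda>j. L2_sq T (\<lambda>t. f j t - g t)) \<longlonglongrightarrow> 0"
  proof (rule LIMSEQ_I)
    fix e :: real assume e: "e > 0"
    obtain M where M: "\<And>i j. i \<ge> M \<Longrightarrow> j \<ge> M \<Longrightarrow> L2_sq T (\<lambda>t. f i t - f j t) < e/2"
      using C[OF half_gt_zero[OF e]] by blast
    have "L2_sq T (\<lambda>t. f j t - g t) \<le> e/2" if "j \<ge> M" for j
      using key[of "e/2" M j] M that e by (auto intro: less_imp_le)
    then show "\<exists>no. \<forall>n\<ge>no. norm (L2_sq T (\<lambda>t. f n t - g t) - 0) < e"
      using e by (intro exI[of _ M]) fastforce
  qed
  then show ?thesis using gL gG by blast
qed

section \<open>Observations of finite energy trajectories\<close>

lemma integral_le_bound: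
  fixes \<phi> :: "real \<Rightarrow> real"
  assumes T: "0 \<le> T" and c: "0 \<le> c" and le: "\<And>t. t \<in> {0..T} \<Longrightarrow> \<phi> t \<le> c"
  shows "(LINT t|lebesgue_on {0..T}. \<phi> t) \<le> T * c"
proof (cases "integrable (lebesgue_on {0..T}) \<phi>")
  case True
  have "(LINT t|lebesgue_on {0..T}. \<phi> t) \<le> (LINT t|lebesgue_on {0..T}. c)"
    by (rule integral_mono[OF True continuous_imp_integrable_real[OF continuous_on_const]]) (use le in simp)
  also have "\<dots> = T * c"
    using T by (subst lebesgue_on_integral_continuous[OF continuous_on_const]) simp
  finally show ?thesis .
qed (use T c in \<open>simp add: not_integrable_integral_eq\<close>)

lemma L2_sq_le_bound:
  assumes "0 \<le> T" "0 \<le> c" "\<And>t. t \<in> {0..T} \<Longrightarrow> norm (f t) \<le> c"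
  shows "L2_sq T f \<le> T * c\<^sup>2"
  unfolding L2_sq_def by (rule integral_le_bound) (use assms power_mono in auto)

lemma L2_sq_cong: "(\<And>t. t \<in> {0..T} \<Longrightarrow> f t = g t) \<Longrightarrow> L2_sq T f = L2_sq T g"
  unfolding L2_sq_def by (rule Bochner_Integration.integral_cong) auto

lemma L2_sq_eq_0:
  fixes f :: "real \<Rightarrow> 'a::real_inner"
  assumes t: "0 \<le> t" and f: "t = 0 \<or> (\<forall>s\<in>{0..t}. f s = 0)" shows "L2_sq t f = 0"
proof -
  have "L2_sq t f \<le> t * (if t = 0 then norm (f 0) else 0)\<^sup>2"
    by (rule L2_sq_le_bound[OF t]) (use f in auto)
  then have "L2_sq t f \<le> 0" by (simp split: if_splits)
  then show ?thesis by (rule antisym) simp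
qed

lemma L2_fun_cong:
  assumes "\<And>t. t \<in> {0..T} \<Longrightarrow> f t = g t" "L2_fun T f" shows "L2_fun T g"
proof -
  obtain s where s: "\<And>j::nat. simple_function (lebesgue_on {0..T}) (s j)" "AE t in lebesgue_on {0..T}. (\<lambda>j. s j t) \<longlonglongrightarrow> f t"
    using assms(2) unfolding L2_fun_def by blast
  have "AE t in lebesgue_on {0..T}. t \<in> {0..T}" by (rule AE_I2) simp
  with s(2) have "AE t in lebesgue_on {0..T}. (\<lambda>j. s j t) \<longlonglongrightarrow> g t"
    by eventually_elim (use assms(1) in simp)
  moreover have "integrable (lebesgue_on {0..T}) (\<lambda>t. (norm (g t))\<^sup>2)"
    using assms(2) unfolding L2_fun_def
    by (subst Bochner_Integration.integrable_cong[OF refl, of _ _ "\<lambda>t. (norm (f t))\<^sup>2"]) (use assms(1) in auto)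
  ultimately show ?thesis unfolding L2_fun_def using s(1) by blast
qed

lemma admissibility_subspace: "admissibility_hyp A G Bs \<Longrightarrow> subspace G" "admissibility_hyp A G Bs \<Longrightarrow> closed G"
  by (auto simp: admissibility_hyp_def)

context eigenbasis
begin

lemma wave_vec_rep:
  assumes "wave_vec A k T w w' f" "1 \<le> k"
  shows "\<exists>a b. continuous_on {0..T} a \<and> continuous_on {0..T} b \<and>
    (\<forall>t\<in>{0..T}. w t = hpow A (- k) (a t) \<and> w' t = hpow A (1 - k) (b t) \<and>
      (\<lambda>v. w t \<bullet> v) = emb k (a t) \<and> (\<lambda>v. w' t \<bullet> v) = emb (k - 1) (b t) \<and>
      ((\<lambda>t. S (a t)) has_vector_derivative b t) (at t within {0..T}))"
proof -
  have ws: "wave_sol A k T (\<lambda>t v. w t \<bullet> v) (\<lambda>t v. w' t \<bullet> v) (\<lambda>t v. f t \<bullet> v)"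
    using assms by (simp add: wave_vec_def)
  obtain a where a: "continuous_on {0..T} a" "\<forall>t\<in>{0..T}. (\<lambda>v. w t \<bullet> v) = emb k (a t)"
    using ws unfolding wave_sol_def Hcont_iff by blast
  obtain b where b: "continuous_on {0..T} b" "\<forall>t\<in>{0..T}. (\<lambda>v. w' t \<bullet> v) = emb (k - 1) (b t)"
    using ws unfolding wave_sol_def Hcont_iff by blast
  have "w t = hpow A (- k) (a t)" if "t \<in> {0..T}" for t
  proof -
    have "riesz (\<lambda>v. w t \<bullet> v) = riesz (\<lambda>v. hpow A (- k) (a t) \<bullet> v)"
      using a(2) that assms(2) by (simp add: emb_nonneg)
    then show ?thesis by simp
  qed
  moreover have "w' t = hpow A (1 - k) (b t)" if "t \<in> {0..T}" for t
  proof -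
    have "riesz (\<lambda>v. w' t \<bullet> v) = riesz (\<lambda>v. hpow A (1 - k) (b t) \<bullet> v)"
      using b(2) that assms(2) by (simp add: emb_nonneg)
    then show ?thesis by simp
  qed
  moreover have "\<forall>t\<in>{0..T}. ((\<lambda>t. S (a t)) has_vector_derivative b t) (at t within {0..T})"
    using Hderiv_iff[OF a(2) b(2)] ws unfolding wave_sol_def by blast
  ultimately show ?thesis using a b by blast
qed

lemma wave_vec_of_mild:
  assumes T: "0 \<le> T" and k: "1 \<le> k" and m: "mild {0..T} a b F" and F: "continuous_on {0..T} F"
  shows "wave_vec A k T (\<lambda>t. hpow A (- k) (a t)) (\<lambda>t. hpow A (1 - k) (b t)) (\<lambda>t. hpow A (1 - k) (F t))"
  unfolding wave_vec_def
proof
  show "L2_fun T (\<lambda>t. hpow A (1 - k) (F t))"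
    by (intro L2_fun_continuous bounded_linear.continuous_on[OF hpow_bounded_linear] F) (use k in simp)
  show "wave_sol A k T (\<lambda>t v. hpow A (- k) (a t) \<bullet> v) (\<lambda>t v. hpow A (1 - k) (b t) \<bullet> v) (\<lambda>t v. hpow A (1 - k) (F t) \<bullet> v)"
    by (rule wave_sol_of_mild[OF T m F])
      (use k in \<open>auto simp: emb_nonneg hpow_symmetric Hdom_nonpos smooth_iff\<close>)
qed

lemma wave_vec_2_1:
  assumes "wave_vec A 2 T w w' f" shows "wave_vec A 1 T w w' f"
proof -
  obtain a b where ab: "continuous_on {0..T} a" "continuous_on {0..T} b"
    and r: "\<And>t. t \<in> {0..T} \<Longrightarrow> w t = hpow A (- 2) (a t) \<and> w' t = S (b t) \<and>
      ((\<lambda>t. S (a t)) has_vector_derivative b t) (at t within {0..T})"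
    using wave_vec_rep[OF assms] by auto
  have 1: "(\<lambda>v. w t \<bullet> v) = emb 1 (S (a t))" if "t \<in> {0..T}" for t
    using r[OF that] hpow_hpow[of "a t" "- 1" "- 1"] by (simp add: emb_nonneg Hdom_nonpos)
  have 2: "(\<lambda>v. w' t \<bullet> v) = emb (1 - 1) (S (b t))" if "t \<in> {0..T}" for t
    using r[OF that] by (simp add: emb_nonneg)
  have "Hcont A 1 T (\<lambda>t v. w t \<bullet> v)"
    unfolding Hcont_iff by (intro exI[of _ "\<lambda>t. S (a t)"] conjI bounded_linear.continuous_on[OF S_bounded_linear] ab) (use 1 in auto)
  moreover have "Hcont A (1 - 1) T (\<lambda>t v. w' t \<bullet> v)"
    unfolding Hcont_iff by (intro exI[of _ "\<lambda>t. S (b t)"] conjI bounded_linear.continuous_on[OF S_bounded_linear] ab) (use 2 in auto)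
  moreover have "Hderiv A (1 - 1) T (\<lambda>t v. w t \<bullet> v) (\<lambda>t v. w' t \<bullet> v)"
    using bounded_linear.has_vector_derivative[OF S_bounded_linear] r
    by (subst Hderiv_iff[where a="\<lambda>t. S (a t)" and b="\<lambda>t. S (b t)"]) (use 1 2 in auto)
  ultimately show ?thesis
    using assms unfolding wave_vec_def wave_sol_def by (elim conjE) (intro conjI)
qed

lemma wave_vec_diff:
  assumes k: "1 \<le> k" and w: "wave_vec A k T w w' f" and x: "wave_vec A k T x x' g"
  shows "wave_vec A k T (\<lambda>t. w t - x t) (\<lambda>t. w' t - x' t) (\<lambda>t. f t - g t)"
proof -
  obtain a b where ab: "continuous_on {0..T} a" "continuous_on {0..T} b"
    and r: "\<And>t. t \<in> {0..T} \<Longrightarrow> w t = hpow A (- k) (a t) \<and> w' t = hpow A (1 - k) (b t) \<and>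
      (\<lambda>v. w t \<bullet> v) = emb k (a t) \<and> (\<lambda>v. w' t \<bullet> v) = emb (k - 1) (b t) \<and>
      ((\<lambda>t. S (a t)) has_vector_derivative b t) (at t within {0..T})"
    using wave_vec_rep[OF w k] by blast
  obtain c d where cd: "continuous_on {0..T} c" "continuous_on {0..T} d"
    and s: "\<And>t. t \<in> {0..T} \<Longrightarrow> x t = hpow A (- k) (c t) \<and> x' t = hpow A (1 - k) (d t) \<and>
      (\<lambda>v. x t \<bullet> v) = emb k (c t) \<and> (\<lambda>v. x' t \<bullet> v) = emb (k - 1) (d t) \<and>
      ((\<lambda>t. S (c t)) has_vector_derivative d t) (at t within {0..T})"
    using wave_vec_rep[OF x k] by blast
  have cw: "continuous_on {0..T} w" "continuous_on {0..T} x"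
  proof -
    have "continuous_on {0..T} (\<lambda>t. hpow A (- k) (a t))" "continuous_on {0..T} (\<lambda>t. hpow A (- k) (c t))"
      by (intro bounded_linear.continuous_on[OF hpow_bounded_linear] ab cd; use k in simp)+
    then show "continuous_on {0..T} w" "continuous_on {0..T} x"
      using continuous_on_eq[of "{0..T}" _ w] continuous_on_eq[of "{0..T}" _ x] r s by simp_all
  qed
  have 1: "(\<lambda>v. (w t - x t) \<bullet> v) = emb k (a t - c t)" if t: "t \<in> {0..T}" for t
  proof
    fix v
    have "w t \<bullet> v = emb k (a t) v" "x t \<bullet> v = emb k (c t) v" using r[OF t] s[OF t] by metis+
    then show "(w t - x t) \<bullet> v = emb k (a t - c t) v" by (simp add: emb_diff inner_diff_left)
  qed
  have 2: "(\<lambda>v. (w' t - x' t) \<bullet> v) = emb (k - 1) (b t - d t)" if t: "t \<in> {0..T}" for t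
  proof
    fix v
    have "w' t \<bullet> v = emb (k - 1) (b t) v" "x' t \<bullet> v = emb (k - 1) (d t) v" using r[OF t] s[OF t] by metis+
    then show "(w' t - x' t) \<bullet> v = emb (k - 1) (b t - d t) v" by (simp add: emb_diff inner_diff_left)
  qed
  have "Hcont A k T (\<lambda>t v. (w t - x t) \<bullet> v)"
    unfolding Hcont_iff by (intro exI[of _ "\<lambda>t. a t - c t"] conjI continuous_intros ab cd) (use 1 in auto)
  moreover have "Hcont A (k - 1) T (\<lambda>t v. (w' t - x' t) \<bullet> v)"
    unfolding Hcont_iff by (intro exI[of _ "\<lambda>t. b t - d t"] conjI continuous_intros ab cd) (use 2 in auto)
  moreover have "Hderiv A (k - 1) T (\<lambda>t v. (w t - x t) \<bullet> v) (\<lambda>t v. (w' t - x' t) \<bullet> v)"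
  proof -
    have "((\<lambda>t. S (a t - c t)) has_vector_derivative b t - d t) (at t within {0..T})" if t: "t \<in> {0..T}" for t
    proof -
      have "((\<lambda>t. S (a t)) has_vector_derivative b t) (at t within {0..T})"
        "((\<lambda>t. S (c t)) has_vector_derivative d t) (at t within {0..T})"
        using r[OF t] s[OF t] by blast+
      from has_vector_derivative_diff[OF this] show ?thesis
        by (simp add: linear_diff[OF bounded_linear.linear[OF S_bounded_linear]])
    qed
    then show ?thesis
      by (subst Hderiv_iff[where a="\<lambda>t. a t - c t" and b="\<lambda>t. b t - d t"]) (use 1 2 in auto)
  qed
  moreover have "integrable (lebesgue_on {0..T}) (\<lambda>s. (f s - g s) \<bullet> v) \<and>
      (\<forall>t\<in>{0..T}. (w' t - x' t) \<bullet> v = (w' 0 - x' 0) \<bullet> v +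
        (LINT s|lebesgue_on {0..t}. (f s - g s) \<bullet> v - (w s - x s) \<bullet> app_op A v))" if v: "v \<in> smooth_vec A" for v
  proof (intro conjI ballI)
    have i: "integrable (lebesgue_on {0..T}) (\<lambda>s. f s \<bullet> v)" "integrable (lebesgue_on {0..T}) (\<lambda>s. g s \<bullet> v)"
      using w x v by (auto simp: wave_vec_def wave_sol_def)
    then show "integrable (lebesgue_on {0..T}) (\<lambda>s. (f s - g s) \<bullet> v)" by (simp add: inner_diff_left)
    fix t assume t: "t \<in> {0..T}"
    have sub: "{0..t} \<subseteq> {0..T}" using t by auto
    have j: "integrable (lebesgue_on {0..t}) (\<lambda>s. f s \<bullet> v)" "integrable (lebesgue_on {0..t}) (\<lambda>s. g s \<bullet> v)"
      by (rule Equivalence_Lebesgue_Henstock_Integration.integrable_subinterval[OF i(1) sub]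
          Equivalence_Lebesgue_Henstock_Integration.integrable_subinterval[OF i(2) sub])+
    have l: "integrable (lebesgue_on {0..t}) (\<lambda>s. w s \<bullet> app_op A v)" "integrable (lebesgue_on {0..t}) (\<lambda>s. x s \<bullet> app_op A v)"
      by (intro continuous_imp_integrable_real continuous_intros continuous_on_subset[OF cw(1) sub] continuous_on_subset[OF cw(2) sub])+
    have "w' t \<bullet> v = w' 0 \<bullet> v + (LINT s|lebesgue_on {0..t}. f s \<bullet> v - w s \<bullet> app_op A v)"
      using w v t unfolding wave_vec_def wave_sol_def by blast
    moreover have "x' t \<bullet> v = x' 0 \<bullet> v + (LINT s|lebesgue_on {0..t}. g s \<bullet> v - x s \<bullet> app_op A v)"
      using x v t unfolding wave_vec_def wave_sol_def by blast
    ultimately show "(w' t - x' t) \<bullet> v = (w' 0 - x' 0) \<bullet> v +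
        (LINT s|lebesgue_on {0..t}. (f s - g s) \<bullet> v - (w s - x s) \<bullet> app_op A v)"
      using j l by (simp add: inner_diff_left)
  qed
  ultimately show ?thesis
    using L2_fun_diff[of T f g] w x unfolding wave_vec_def wave_sol_def by blast
qed

lemma observation_operator:
  assumes "admissibility_hyp A G Bs"
  shows "bounded_linear (\<lambda>p. Bs (hpow A (- 2) (fst p), snd p))" "\<And>u z. u \<in> Hdom A 2 \<Longrightarrow> Bs (u, z) \<in> G"
    "\<And>u z u' z'. u \<in> Hdom A 2 \<Longrightarrow> u' \<in> Hdom A 2 \<Longrightarrow> Bs (u - u', z - z') = Bs (u, z) - Bs (u', z')"
proof -
  have l: "lin_on (Hdom A 2 \<times> UNIV) Bs" and G: "Bs ` (Hdom A 2 \<times> UNIV) \<subseteq> G"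
    using assms by (auto simp: admissibility_hyp_def)
  obtain M where M: "\<forall>u\<in>Hdom A 2. \<forall>z. norm (Bs (u, z)) \<le> M * (norm (hpow A 2 u) + norm z)"
    using assms by (auto simp: admissibility_hyp_def)
  have lin: "Bs (r *\<^sub>R u + s *\<^sub>R u', r *\<^sub>R z + s *\<^sub>R z') = r *\<^sub>R Bs (u, z) + s *\<^sub>R Bs (u', z')"
    if "u \<in> Hdom A 2" "u' \<in> Hdom A 2" for r s u u' z z'
    using l[unfolded lin_on_def, rule_format, of "(u, z)" "(u', z')" r s] that by simp
  have in2: "hpow A (- 2) u \<in> Hdom A 2" for u by (rule hpow_neg_in) simp
  note bl2 = bounded_linear.linear[OF hpow_bounded_linear[of "- 2"]]
  show "bounded_linear (\<lambda>p. Bs (hpow A (- 2) (fst p), snd p))"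
  proof (rule bounded_linear_intro[where K="2 * \<bar>M\<bar>"])
    show "Bs (hpow A (- 2) (fst (x + y)), snd (x + y)) = Bs (hpow A (- 2) (fst x), snd x) + Bs (hpow A (- 2) (fst y), snd y)" for x y
      using lin[OF in2 in2, of 1 "fst x" 1 "fst y" "snd x" "snd y"] by (simp add: linear_add[OF bl2])
    show "Bs (hpow A (- 2) (fst (r *\<^sub>R x)), snd (r *\<^sub>R x)) = r *\<^sub>R Bs (hpow A (- 2) (fst x), snd x)" for r x
      using lin[OF in2 in2, of r "fst x" 0 "fst x" "snd x" "snd x"] by (simp add: linear_cmul[OF bl2])
    show "norm (Bs (hpow A (- 2) (fst x), snd x)) \<le> norm x * (2 * \<bar>M\<bar>)" for x
    proof -
      have "norm (Bs (hpow A (- 2) (fst x), snd x)) \<le> M * (norm (fst x) + norm (snd x))"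
        using M in2[of "fst x"] hpow_onto[OF refl, of 2 "fst x"] by auto
      also have "\<dots> \<le> \<bar>M\<bar> * (norm x + norm x)"
        using norm_fst_le[of "fst x" "snd x"] norm_snd_le[of "snd x" "fst x"]
        by (intro mult_mono add_mono) auto
      finally show ?thesis by (simp add: algebra_simps)
    qed
  qed
  show "Bs (u, z) \<in> G" if "u \<in> Hdom A 2" for u z using G that by auto
  show "Bs (u - u', z - z') = Bs (u, z) - Bs (u', z')" if "u \<in> Hdom A 2" "u' \<in> Hdom A 2" for u u' z z'
    using lin[OF that, of 1 "- 1" z z'] by simp
qed

lemma observation_level_2:
  assumes adm: "admissibility_hyp A G Bs" and x: "wave_vec A 2 T x x' \<phi>"
  shows "continuous_on {0..T} (\<lambda>t. Bs (x t, x' t))" "observation A Bs T x x' (\<lambda>t. Bs (x t, x' t))"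
    "\<And>t. t \<in> {0..T} \<Longrightarrow> x t \<in> Hdom A 2"
proof -
  obtain a b where ab: "continuous_on {0..T} a" "continuous_on {0..T} b"
    and r: "\<And>t. t \<in> {0..T} \<Longrightarrow> x t = hpow A (- 2) (a t) \<and> x' t = S (b t)"
    using wave_vec_rep[OF x] by auto
  have "continuous_on {0..T} (\<lambda>t. Bs (hpow A (- 2) (fst (a t, S (b t))), snd (a t, S (b t))))"
    by (rule bounded_linear.continuous_on[OF observation_operator(1)[OF adm]])
      (intro continuous_intros ab bounded_linear.continuous_on[OF S_bounded_linear])
  then show c: "continuous_on {0..T} (\<lambda>t. Bs (x t, x' t))"
    by (rule continuous_on_eq) (use r in simp)
  show "observation A Bs T x x' (\<lambda>t. Bs (x t, x' t))"
    unfolding observation_def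
    by (intro conjI L2_fun_continuous c exI[of _ \<phi>] exI[of _ "\<lambda>_. x"] exI[of _ "\<lambda>_. x'"] exI[of _ "\<lambda>_. \<phi>"])
      (auto simp: wave_vec_2_1[OF x] x intro!: uniform_limit_const)
  show "x t \<in> Hdom A 2" if "t \<in> {0..T}" for t using r[OF that] hpow_neg_in[of 2 "a t"] by simp
qed

definition obs_diff_bound :: "('h \<times> 'h \<Rightarrow> 'g::real_inner) \<Rightarrow> real \<Rightarrow> real \<Rightarrow> bool" where
  "obs_diff_bound Bs T D \<longleftrightarrow> D > 0 \<and> (\<forall>x x' \<phi> y y' \<psi> c. wave_vec A 2 T x x' \<phi> \<longrightarrow> wave_vec A 2 T y y' \<psi> \<longrightarrow>
    (\<forall>t\<in>{0..T}. norm (hpow A 1 (x t) - hpow A 1 (y t)) \<le> c \<and> norm (x' t - y' t) \<le> c) \<longrightarrow>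
    L2_sq T (\<lambda>t. Bs (x t, x' t) - Bs (y t, y' t)) \<le> D * (c\<^sup>2 + L2_sq T (\<lambda>t. \<phi> t - \<psi> t)))"

lemma obs_diff_boundD:
  assumes "obs_diff_bound Bs T D" "wave_vec A 2 T x x' \<phi>" "wave_vec A 2 T y y' \<psi>"
    and "\<And>t. t \<in> {0..T} \<Longrightarrow> norm (hpow A 1 (x t) - hpow A 1 (y t)) \<le> r \<and> norm (x' t - y' t) \<le> r"
  shows "L2_sq T (\<lambda>t. Bs (x t, x' t) - Bs (y t, y' t)) \<le> D * (r\<^sup>2 + L2_sq T (\<lambda>t. \<phi> t - \<psi> t))"
  using assms unfolding obs_diff_bound_def by blast

lemma observation_diff_le:
  assumes adm: "admissibility_hyp A G Bs" and T: "T > 0"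
  shows "\<exists>D. obs_diff_bound Bs T D"
proof -
  obtain D where D: "D > 0" "\<And>w w' f g. wave_vec A 1 T w w' f \<Longrightarrow> observation A Bs T w w' g \<Longrightarrow>
        L2_sq T g \<le> D * (energy A 1 (w 0) (w' 0) + energy A 1 (w T) (w' T) +
                         (LINT t|lebesgue_on {0..T}. energy A 1 (w t) (w' t)) + L2_sq T f)"
    using adm T by (auto simp: admissibility_hyp_def)
  have "L2_sq T (\<lambda>t. Bs (x t, x' t) - Bs (y t, y' t)) \<le> (D * (2 + T)) * (c\<^sup>2 + L2_sq T (\<lambda>t. \<phi> t - \<psi> t))"
    if x: "wave_vec A 2 T x x' \<phi>" and y: "wave_vec A 2 T y y' \<psi>"
      and c: "\<And>t. t \<in> {0..T} \<Longrightarrow> norm (hpow A 1 (x t) - hpow A 1 (y t)) \<le> c \<and> norm (x' t - y' t) \<le> c"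
    for x x' \<phi> y y' \<psi> c
  proof -
    have d: "wave_vec A 2 T (\<lambda>t. x t - y t) (\<lambda>t. x' t - y' t) (\<lambda>t. \<phi> t - \<psi> t)"
      by (rule wave_vec_diff[OF _ x y]) simp
    have e: "energy A 1 (x t - y t) (x' t - y' t) \<le> c\<^sup>2" if t: "t \<in> {0..T}" for t
    proof -
      have x2: "x t \<in> Hdom A 1" "y t \<in> Hdom A 1"
        using observation_level_2(3)[OF adm x t] observation_level_2(3)[OF adm y t] Hdom_mono[of 1 2] by auto
      have "hpow A 1 (x t - y t) = hpow A 1 (x t) - hpow A 1 (y t)"
        using hpow_add[OF x2(1) Hdom_scaleR[OF x2(2), of "- 1"]] hpow_scaleR[OF x2(2), of "- 1"] by simp
      then have "energy A 1 (x t - y t) (x' t - y' t) =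
          ((norm (hpow A 1 (x t) - hpow A 1 (y t)))\<^sup>2 + (norm (x' t - y' t))\<^sup>2) / 2" by (simp add: energy_def)
      also have "\<dots> \<le> (c\<^sup>2 + c\<^sup>2) / 2"
        using c[OF t] by (intro divide_right_mono add_mono power_mono) auto
      finally show ?thesis by simp
    qed
    have "L2_sq T (\<lambda>t. Bs (x t, x' t) - Bs (y t, y' t)) = L2_sq T (\<lambda>t. Bs (x t - y t, x' t - y' t))"
      using observation_operator(3)[OF adm] observation_level_2(3)[OF adm x] observation_level_2(3)[OF adm y]
      by (intro L2_sq_cong) auto
    also have "\<dots> \<le> D * (energy A 1 (x 0 - y 0) (x' 0 - y' 0) + energy A 1 (x T - y T) (x' T - y' T) +
         (LINT t|lebesgue_on {0..T}. energy A 1 (x t - y t) (x' t - y' t)) + L2_sq T (\<lambda>t. \<phi> t - \<psi> t))"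
      by (rule D(2)[OF wave_vec_2_1[OF d] observation_level_2(2)[OF adm d]])
    also have "\<dots> \<le> D * (c\<^sup>2 + c\<^sup>2 + T * c\<^sup>2 + L2_sq T (\<lambda>t. \<phi> t - \<psi> t))"
      using T D(1) e by (intro mult_left_mono add_mono integral_le_bound) auto
    also have "\<dots> \<le> D * ((2 + T) * (c\<^sup>2 + L2_sq T (\<lambda>t. \<phi> t - \<psi> t)))"
      using T D(1) mult_nonneg_nonneg[of "1 + T" "L2_sq T (\<lambda>t. \<phi> t - \<psi> t)"]
      by (intro mult_left_mono) (auto simp: algebra_simps)
    finally show ?thesis by (simp add: mult.assoc)
  qed
  moreover have "D * (2 + T) > 0" using D T by simp
  ultimately have "obs_diff_bound Bs T (D * (2 + T))" unfolding obs_diff_bound_def by blast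
  then show ?thesis ..
qed

lemma trunc_uniform:
  fixes a :: "real \<Rightarrow> 'h"
  assumes a: "continuous_on {0..T} a"
  shows "uniform_limit {0..T} (\<lambda>N t. trunc N (a t)) a sequentially"
proof (rule uniform_limitI)
  fix e :: real assume e: "e > 0"
  have "compact (a ` {0..T})" by (rule compact_continuous_image[OF a compact_Icc])
  then obtain k where k: "finite k" "a ` {0..T} \<subseteq> (\<Union>u\<in>k. ball u (e/4))"
    using e unfolding compact_eq_totally_bounded by (metis zero_less_divide_iff zero_less_numeral)
  have "\<forall>\<^sub>F N in sequentially. \<forall>u\<in>k. dist (trunc N u) u < e/4"
    using k(1) e by (intro eventually_ball_finite ballI tendstoD[OF trunc_tendsto]) auto
  then show "\<forall>\<^sub>F N in sequentially. \<forall>t\<in>{0..T}. dist (trunc N (a t)) (a t) < e"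
  proof eventually_elim
    case (elim N)
    show ?case
    proof
      fix t assume "t \<in> {0..T}"
      then have "a t \<in> (\<Union>u\<in>k. ball u (e/4))" using k(2) by blast
      then obtain u where u: "u \<in> k" "dist u (a t) < e/4" unfolding UN_iff mem_ball by blast
      have "dist (trunc N (a t)) (trunc N u) \<le> dist (a t) u"
        using norm_trunc_le[of N "a t - u"] by (simp add: dist_norm linear_diff[OF bounded_linear.linear[OF trunc_linear]])
      then have "dist (trunc N (a t)) (a t) \<le> dist (a t) u + dist (trunc N u) u + dist u (a t)"
        using dist_triangle[of "trunc N (a t)" "a t" u] dist_triangle[of "trunc N (a t)" u "trunc N u"] by linarith
      then show "dist (trunc N (a t)) (a t) < e"
        using u elim e by (fastforce simp: dist_commute)
    qed
  qed
qed

lemma trunc_smooth: "trunc N u \<in> Hdom A k"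
  unfolding Hdom_eq Domain_gr by (rule summable_finite[of "{..<N}"]) (auto simp: trunc_coef)

lemma truncated_wave:
  assumes T: "0 \<le> T" and m: "mild {0..T} a b F" and F: "continuous_on {0..T} F"
  shows "wave_vec A 2 T (\<lambda>t. S (trunc N (a t))) (\<lambda>t. trunc N (b t)) (\<lambda>t. trunc N (F t))"
proof -
  define D where "D u = hpow A 1 (trunc N u)" for u
  have Dc: "D u \<bullet> \<epsilon> j = (if j < N then m j else 0) * (u \<bullet> \<epsilon> j)" for u j
    by (simp add: D_def hpow_coef trunc_smooth trunc_coef)
  have D2: "D u = (\<Sum>i<N. (m i * (u \<bullet> \<epsilon> i)) *\<^sub>R \<epsilon> i)" for u
    by (rule coef_ext) (auto simp: Dc sum_coef)
  have Dl: "bounded_linear D"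
    unfolding D2[abs_def]
    by (intro bounded_linear_sum bounded_linear_scaleR_left[THEN bounded_linear_compose] bounded_linear_const_mult bounded_linear_inner_left)
  have SD: "S (D u) = trunc N u" for u
    using hpow_inv[OF trunc_smooth, of 1] by (simp add: D_def)
  have S2: "hpow A (- 2) (D u) = S (trunc N u)" for u
    using hpow_hpow[of "D u" "- 1" "- 1"] SD by (simp add: Hdom_nonpos)
  have "wave_vec A 2 T (\<lambda>t. hpow A (- 2) (D (a t))) (\<lambda>t. hpow A (1 - 2) (D (b t))) (\<lambda>t. hpow A (1 - 2) (D (F t)))"
    by (rule wave_vec_of_mild[OF T _ mild_diagonal[OF Dl Dc m]]) (auto intro: bounded_linear.continuous_on[OF Dl F])
  then show ?thesis by (simp add: SD S2)
qed

definition obs_lim :: "('h \<times> 'h \<Rightarrow> 'g::real_inner) \<Rightarrow> real \<Rightarrow> (real \<Rightarrow> 'h) \<Rightarrow> (real \<Rightarrow> 'h) \<Rightarrow> (real \<Rightarrow> 'g) \<Rightarrow> bool" where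
  "obs_lim Bs T a b g \<longleftrightarrow> L2_fun T g \<and>
    (\<lambda>N. L2_sq T (\<lambda>t. Bs (S (trunc N (a t)), trunc N (b t)) - g t)) \<longlonglongrightarrow> 0"

lemma observation_of_obs_lim:
  assumes T: "0 \<le> T" and m: "mild {0..T} a b F" and F: "continuous_on {0..T} F" and g: "obs_lim Bs T a b g"
  shows "observation A Bs T (\<lambda>t. S (a t)) b g"
  unfolding observation_def
proof (intro conjI exI)
  show "L2_fun T g" using g by (simp add: obs_lim_def)
  show "wave_vec A 1 T (\<lambda>t. S (a t)) b F"
    using wave_vec_of_mild[OF T _ m F, of 1] by simp
  show "\<forall>N. wave_vec A 2 T (\<lambda>t. S (trunc N (a t))) (\<lambda>t. trunc N (b t)) (\<lambda>t. trunc N (F t))"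
    using truncated_wave[OF T m F] by blast
  have h: "hpow A 1 (S u) = u" for u using hpow_inv[of u "- 1"] by (simp add: Hdom_nonpos)
  show "uniform_limit {0..T} (\<lambda>N t. hpow A 1 (S (trunc N (a t)))) (\<lambda>t. hpow A 1 (S (a t))) sequentially"
    unfolding h by (rule trunc_uniform) (use m in \<open>simp add: mild_def\<close>)
  show "uniform_limit {0..T} (\<lambda>N t. trunc N (b t)) b sequentially"
    by (rule trunc_uniform) (use m in \<open>simp add: mild_def\<close>)
  show "(\<lambda>N. L2_sq T (\<lambda>t. Bs (S (trunc N (a t)), trunc N (b t)) - g t)) \<longlonglongrightarrow> 0"
    using g by (simp add: obs_lim_def)
  show "(\<lambda>N. L2_sq T (\<lambda>t. trunc N (F t) - F t)) \<longlonglongrightarrow> 0"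
  proof (rule LIMSEQ_I)
    fix e :: real assume e: "e > 0"
    define d where "d = sqrt (e / (2 * (T + 1)))"
    have d: "d > 0" "T * d\<^sup>2 < e" using e T by (auto simp: d_def field_simps intro!: add_nonneg_pos)
    obtain N0 where N0: "\<And>N t. N \<ge> N0 \<Longrightarrow> t \<in> {0..T} \<Longrightarrow> norm (trunc N (F t) - F t) < d"
      using uniform_limitD[OF trunc_uniform[OF F] d(1)] unfolding eventually_sequentially dist_norm by blast
    have "L2_sq T (\<lambda>t. trunc N (F t) - F t) < e" if "N \<ge> N0" for N
      using L2_sq_le_bound[OF T, of d "\<lambda>t. trunc N (F t) - F t"] N0[OF that] d by (fastforce intro: less_imp_le)
    then show "\<exists>no. \<forall>n\<ge>no. norm (L2_sq T (\<lambda>t. trunc n (F t) - F t) - 0) < e" by auto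
  qed
qed

lemma obs_lim_exists:
  fixes Bs :: "'h \<times> 'h \<Rightarrow> 'g::{real_inner, complete_space}"
  assumes adm: "admissibility_hyp A G Bs" and T: "0 < T" and m: "mild {0..T} a b F" and F: "continuous_on {0..T} F"
  shows "\<exists>g. obs_lim Bs T a b g \<and> (\<forall>t. g t \<in> G)"
proof -
  obtain D where ob: "obs_diff_bound Bs T D" using observation_diff_le[OF adm T] ..
  have D: "D > 0" using ob by (simp add: obs_diff_bound_def)
  define f where "f N t = Bs (S (trunc N (a t)), trunc N (b t))" for N t
  have tw: "wave_vec A 2 T (\<lambda>t. S (trunc N (a t))) (\<lambda>t. trunc N (b t)) (\<lambda>t. trunc N (F t))" for N
    by (rule truncated_wave[OF _ m F]) (use T in simp)
  have h: "hpow A 1 (S u) = u" for u using hpow_inv[of u "- 1"] by (simp add: Hdom_nonpos)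
  have S2: "S (trunc N u) \<in> Hdom A 2" for N u
    using Hdom_hpow_iff[of "trunc N u" "- 1" 2] trunc_smooth by (simp add: Hdom_nonpos)
  have co: "continuous_on {0..T} a" "continuous_on {0..T} b" using m by (auto simp: mild_def)
  have "\<exists>g. L2_fun T g \<and> (\<forall>t. g t \<in> G) \<and> (\<lambda>N. L2_sq T (\<lambda>t. f N t - g t)) \<longlonglongrightarrow> 0"
  proof (rule L2_complete)
    show "L2_fun T (f N)" for N unfolding f_def by (rule L2_fun_continuous[OF observation_level_2(1)[OF adm tw]])
    show "f N t \<in> G" for N t unfolding f_def by (rule observation_operator(2)[OF adm S2])
    show "closed G" "subspace G" using adm by (auto simp: admissibility_hyp_def)
    fix e :: real assume e: "e > 0"
    define d where "d = sqrt (e / (2 * D * (T + 1)))"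
    have d: "d > 0" using e T D by (auto simp: d_def)
    have d2: "d\<^sup>2 * (2 * D * (T + 1)) = e" using e T D by (simp add: d_def)
    have "D * (d\<^sup>2 + T * d\<^sup>2) < e" using d2 e by (simp add: algebra_simps)
    note d = d this
    have "d/2 > 0" using d by simp
    have "\<forall>\<^sub>F N in sequentially. (\<forall>t\<in>{0..T}. dist (trunc N (a t)) (a t) < d/2) \<and>
        (\<forall>t\<in>{0..T}. dist (trunc N (b t)) (b t) < d/2) \<and> (\<forall>t\<in>{0..T}. dist (trunc N (F t)) (F t) < d/2)"
      by (intro eventually_conj uniform_limitD trunc_uniform co F) (use d in auto)
    then obtain K where K: "\<And>N t. N \<ge> K \<Longrightarrow> t \<in> {0..T} \<Longrightarrow>
      dist (trunc N (a t)) (a t) < d/2 \<and> dist (trunc N (b t)) (b t) < d/2 \<and> dist (trunc N (F t)) (F t) < d/2"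
      unfolding eventually_sequentially by blast
    have "L2_sq T (\<lambda>t. f i t - f j t) < e" if "i \<ge> K" "j \<ge> K" for i j
    proof -
      have n: "norm (trunc i (a t) - trunc j (a t)) \<le> d" "norm (trunc i (b t) - trunc j (b t)) \<le> d"
        "norm (trunc i (F t) - trunc j (F t)) \<le> d" if t: "t \<in> {0..T}" for t
        using K[OF \<open>i \<ge> K\<close> t] K[OF \<open>j \<ge> K\<close> t]
        by (auto simp flip: dist_norm intro!: less_imp_le intro: dist_triangle_half_l)
      have "L2_sq T (\<lambda>t. f i t - f j t) \<le> D * (d\<^sup>2 + L2_sq T (\<lambda>t. trunc i (F t) - trunc j (F t)))"
        unfolding f_def by (rule obs_diff_boundD[OF ob tw[of i] tw[of j], where r=d]) (use n in \<open>simp add: h\<close>)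
      also have "\<dots> \<le> D * (d\<^sup>2 + T * d\<^sup>2)"
        using D T d n by (intro mult_left_mono add_left_mono L2_sq_le_bound) auto
      finally show ?thesis using d by simp
    qed
    then show "\<exists>N. \<forall>i\<ge>N. \<forall>j\<ge>N. L2_sq T (\<lambda>t. f i t - f j t) < e" by blast
  qed
  then show ?thesis unfolding obs_lim_def f_def by blast
qed

lemma AE_eq_of_coefs:
  assumes f: "L2_fun T f" and g: "L2_fun T g"
    and z: "\<And>j t. t \<in> {0..T} \<Longrightarrow> (LINT s|lebesgue_on {0..t}. (f s - g s) \<bullet> \<epsilon> j) = 0"
  shows "L2_sq T (\<lambda>t. f t - g t) = 0"
proof -
  have "AE t in lebesgue_on {0..T}. (f t - g t) \<bullet> \<epsilon> j = 0" for j
    by (rule AE_zero_of_initial_integrals[OF _ z])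
      (rule L2_inner_integrable[OF L2_fun_diff[OF f g] L2_fun_continuous], auto)
  then have "AE t in lebesgue_on {0..T}. \<forall>j. (f t - g t) \<bullet> \<epsilon> j = 0" by (simp add: AE_all_countable)
  then have "AE t in lebesgue_on {0..T}. (norm (f t - g t))\<^sup>2 = 0"
  proof eventually_elim
    case (elim t)
    then have "f t - g t = 0" by (intro total) auto
    then show ?case by simp
  qed
  then show ?thesis unfolding L2_sq_def by (rule integral_eq_zero_AE)
qed

lemma source_unique:
  assumes w: "wave_vec A 1 T w w' f" and x: "wave_vec A 1 T x x' g"
    and eq: "\<And>t. t \<in> {0..T} \<Longrightarrow> w t = x t" "\<And>t. t \<in> {0..T} \<Longrightarrow> w' t = x' t"
  shows "L2_sq T (\<lambda>t. f t - g t) = 0"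
proof (rule AE_eq_of_coefs)
  show "L2_fun T f" "L2_fun T g" using w x by (auto simp: wave_vec_def)
  fix j t assume t: "t \<in> {0..T}"
  have d: "wave_vec A 1 T (\<lambda>t. w t - x t) (\<lambda>t. w' t - x' t) (\<lambda>t. f t - g t)"
    by (rule wave_vec_diff[OF _ w x]) simp
  then have "(w' t - x' t) \<bullet> \<epsilon> j = (w' 0 - x' 0) \<bullet> \<epsilon> j +
      (LINT s|lebesgue_on {0..t}. (f s - g s) \<bullet> \<epsilon> j - (w s - x s) \<bullet> app_op A (\<epsilon> j))"
    using t eps_smooth unfolding wave_vec_def wave_sol_def by blast
  moreover have "(LINT s|lebesgue_on {0..t}. (f s - g s) \<bullet> \<epsilon> j - (w s - x s) \<bullet> app_op A (\<epsilon> j)) =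
      (LINT s|lebesgue_on {0..t}. (f s - g s) \<bullet> \<epsilon> j)"
    by (rule Bochner_Integration.integral_cong) (use eq t in auto)
  moreover have "0 \<in> {0..T}" using t by auto
  ultimately show "(LINT s|lebesgue_on {0..t}. (f s - g s) \<bullet> \<epsilon> j) = 0" using eq t by simp
qed

lemma observation_unique:
  assumes adm: "admissibility_hyp A G Bs" and T: "0 < T"
    and w: "observation A Bs T w w' g" and v: "observation A Bs T v v' k"
    and eq: "\<And>t. t \<in> {0..T} \<Longrightarrow> w t = v t" "\<And>t. t \<in> {0..T} \<Longrightarrow> w' t = v' t"
  shows "L2_sq T (\<lambda>t. g t - k t) = 0"
proof -
  obtain D where ob: "obs_diff_bound Bs T D" using observation_diff_le[OF adm T] ..
  have D: "D > 0" using ob by (simp add: obs_diff_bound_def)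
  obtain f x x' \<phi> where f: "L2_fun T g" "wave_vec A 1 T w w' f" and x: "\<And>j::nat. wave_vec A 2 T (x j) (x' j) (\<phi> j)"
    and xl: "uniform_limit {0..T} (\<lambda>j t. hpow A 1 (x j t)) (\<lambda>t. hpow A 1 (w t)) sequentially"
        "uniform_limit {0..T} x' w' sequentially"
    and xs: "(\<lambda>j. L2_sq T (\<lambda>t. \<phi> j t - f t)) \<longlonglongrightarrow> 0" "(\<lambda>j. L2_sq T (\<lambda>t. Bs (x j t, x' j t) - g t)) \<longlonglongrightarrow> 0"
    using w unfolding observation_def by blast
  obtain h y y' \<psi> where h: "L2_fun T k" "wave_vec A 1 T v v' h" and y: "\<And>j::nat. wave_vec A 2 T (y j) (y' j) (\<psi> j)"
    and yl: "uniform_limit {0..T} (\<lambda>j t. hpow A 1 (y j t)) (\<lambda>t. hpow A 1 (v t)) sequentially"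
        "uniform_limit {0..T} y' v' sequentially"
    and ys: "(\<lambda>j. L2_sq T (\<lambda>t. \<psi> j t - h t)) \<longlonglongrightarrow> 0" "(\<lambda>j. L2_sq T (\<lambda>t. Bs (y j t, y' j t) - k t)) \<longlonglongrightarrow> 0"
    using v unfolding observation_def by blast
  have L: "L2_fun T f" "L2_fun T h" "L2_fun T (\<phi> j)" "L2_fun T (\<psi> j)" for j
    using f h x y by (auto simp: wave_vec_def)
  have LB: "L2_fun T (\<lambda>t. Bs (x j t, x' j t))" "L2_fun T (\<lambda>t. Bs (y j t, y' j t))" for j
    using L2_fun_continuous observation_level_2(1)[OF adm] x y by blast+
  have s0: "L2_sq T (\<lambda>t. f t - h t) = 0" by (rule source_unique[OF f(2) h(2) eq])
  have "L2_sq T (\<lambda>t. g t - k t) \<le> e" if e: "e > 0" for e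
  proof -
    define d where "d = e / (2 * (4 + 4 * D * 8))"
    have den: "2 * (4 + 4 * D * 8) > 0" using D by simp
    have d: "d > 0" and d': "(2 * (4 + 4 * D * 8)) * d = e"
      using e den D by (simp_all add: d_def)
    define r where "r = sqrt d / 2"
    have r: "r > 0" "(2 * r)\<^sup>2 = d" using d by (auto simp: r_def)
    have "\<forall>\<^sub>F j in sequentially. (\<forall>t\<in>{0..T}. dist (hpow A 1 (x j t)) (hpow A 1 (w t)) < r) \<and>
        (\<forall>t\<in>{0..T}. dist (x' j t) (w' t) < r) \<and> (\<forall>t\<in>{0..T}. dist (hpow A 1 (y j t)) (hpow A 1 (v t)) < r) \<and>
        (\<forall>t\<in>{0..T}. dist (y' j t) (v' t) < r) \<and> L2_sq T (\<lambda>t. \<phi> j t - f t) < d \<and> L2_sq T (\<lambda>t. \<psi> j t - h t) < d \<and>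
        L2_sq T (\<lambda>t. Bs (x j t, x' j t) - g t) < d \<and> L2_sq T (\<lambda>t. Bs (y j t, y' j t) - k t) < d"
      by (intro eventually_conj uniform_limitD xl yl order_tendstoD(2)[OF xs(1)] order_tendstoD(2)[OF xs(2)]
          order_tendstoD(2)[OF ys(1)] order_tendstoD(2)[OF ys(2)] r d)
    then obtain j where j: "\<forall>t\<in>{0..T}. dist (hpow A 1 (x j t)) (hpow A 1 (w t)) < r"
        "\<forall>t\<in>{0..T}. dist (x' j t) (w' t) < r" "\<forall>t\<in>{0..T}. dist (hpow A 1 (y j t)) (hpow A 1 (v t)) < r"
        "\<forall>t\<in>{0..T}. dist (y' j t) (v' t) < r" "L2_sq T (\<lambda>t. \<phi> j t - f t) < d" "L2_sq T (\<lambda>t. \<psi> j t - h t) < d"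
        "L2_sq T (\<lambda>t. Bs (x j t, x' j t) - g t) < d" "L2_sq T (\<lambda>t. Bs (y j t, y' j t) - k t) < d"
      unfolding eventually_sequentially by blast
    have "L2_sq T (\<lambda>t. \<phi> j t - \<psi> j t) \<le> 2 * L2_sq T (\<lambda>t. \<phi> j t - f t) + 2 * L2_sq T (\<lambda>t. f t - \<psi> j t)"
      by (rule L2_sq_triangle[OF L(3) L(1) L(4)])
    moreover have "L2_sq T (\<lambda>t. f t - \<psi> j t) \<le> 2 * L2_sq T (\<lambda>t. f t - h t) + 2 * L2_sq T (\<lambda>t. h t - \<psi> j t)"
      by (rule L2_sq_triangle[OF L(1) L(2) L(4)])
    ultimately have phi: "L2_sq T (\<lambda>t. \<phi> j t - \<psi> j t) \<le> 6 * d"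
      using j(5,6) s0 L2_sq_commute[of T h "\<psi> j"] by linarith
    have "L2_sq T (\<lambda>t. Bs (x j t, x' j t) - Bs (y j t, y' j t)) \<le> D * ((2 * r)\<^sup>2 + L2_sq T (\<lambda>t. \<phi> j t - \<psi> j t))"
    proof (rule obs_diff_boundD[OF ob x y])
      fix t assume t: "t \<in> {0..T}"
      have "dist (hpow A 1 (x j t)) (hpow A 1 (y j t)) \<le> dist (hpow A 1 (x j t)) (hpow A 1 (w t)) + dist (hpow A 1 (y j t)) (hpow A 1 (v t))"
        using dist_triangle2[of "hpow A 1 (x j t)" "hpow A 1 (y j t)" "hpow A 1 (w t)"] eq(1)[OF t] by simp
      moreover have "dist (x' j t) (y' j t) \<le> dist (x' j t) (w' t) + dist (y' j t) (v' t)"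
        using dist_triangle2[of "x' j t" "y' j t" "w' t"] eq(2)[OF t] by simp
      moreover have "dist (hpow A 1 (x j t)) (hpow A 1 (w t)) < r" "dist (x' j t) (w' t) < r"
        "dist (hpow A 1 (y j t)) (hpow A 1 (v t)) < r" "dist (y' j t) (v' t) < r"
        using j(1-4) t by blast+
      ultimately show "norm (hpow A 1 (x j t) - hpow A 1 (y j t)) \<le> 2 * r \<and> norm (x' j t - y' j t) \<le> 2 * r"
        unfolding dist_norm by linarith
    qed
    also have "\<dots> \<le> D * (8 * d)" using phi r(2) D d by (intro mult_left_mono) auto
    finally have B: "L2_sq T (\<lambda>t. Bs (x j t, x' j t) - Bs (y j t, y' j t)) \<le> D * (8 * d)" .
    have "L2_sq T (\<lambda>t. g t - k t) \<le> 2 * L2_sq T (\<lambda>t. g t - Bs (x j t, x' j t)) + 2 * L2_sq T (\<lambda>t. Bs (x j t, x' j t) - k t)"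
      by (rule L2_sq_triangle[OF f(1) LB(1) h(1)])
    moreover have "L2_sq T (\<lambda>t. Bs (x j t, x' j t) - k t) \<le> 2 * L2_sq T (\<lambda>t. Bs (x j t, x' j t) - Bs (y j t, y' j t)) + 2 * L2_sq T (\<lambda>t. Bs (y j t, y' j t) - k t)"
      by (rule L2_sq_triangle[OF LB(1) LB(2) h(1)])
    moreover have "L2_sq T (\<lambda>t. g t - Bs (x j t, x' j t)) < d" using j(7) by (simp add: L2_sq_commute)
    ultimately have "L2_sq T (\<lambda>t. g t - k t) \<le> 2 * d + 4 * (D * (8 * d)) + 4 * d" using B j(8) by linarith
    then show ?thesis using d d' mult_pos_pos[OF D d] by (simp add: algebra_simps)
  qed
  then have "L2_sq T (\<lambda>t. g t - k t) \<le> 0" by (meson field_le_epsilon add_0 dense_ge)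
  then show ?thesis by (simp add: antisym)
qed

end

section \<open>Cascades\<close>

locale cascade = eigenbasis A \<epsilon> m c
  for A :: "'h::{real_inner, complete_space} operator" and \<epsilon> m c +
  fixes K :: "nat \<Rightarrow> nat \<Rightarrow> 'h \<Rightarrow> 'h" and cw :: "nat \<Rightarrow> nat set" and N :: nat
  assumes K_bounded: "i \<in> {1..N} \<Longrightarrow> j \<in> cw i \<Longrightarrow> bounded_linear (K i j)"
    and cw_less: "i \<in> {1..N} \<Longrightarrow> cw i \<subseteq> {1..<i}"
begin

definition src :: "(nat \<Rightarrow> real \<Rightarrow> 'h \<times> 'h) \<Rightarrow> nat \<Rightarrow> real \<Rightarrow> 'h" where
  "src U i t = - (\<Sum>j\<in>cw i. K i j (fst (U j t)))"

definition csol :: "real set \<Rightarrow> (nat \<Rightarrow> real \<Rightarrow> 'h \<times> 'h) \<Rightarrow> bool" where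
  "csol I U \<longleftrightarrow> (\<forall>i\<in>{1..N}. mild I (\<lambda>t. fst (U i t)) (\<lambda>t. snd (U i t)) (src U i))"

definition tot :: "(nat \<Rightarrow> 'h \<times> 'h) \<Rightarrow> real" where
  "tot U = (\<Sum>i=1..N. norm (U i))"

lemma cw_in: "i \<in> {1..N} \<Longrightarrow> j \<in> cw i \<Longrightarrow> j \<in> {1..N} \<and> j < i"
  using cw_less by fastforce

lemma tot_nonneg: "0 \<le> tot U"
  by (simp add: tot_def sum_nonneg)

lemma norm_le_tot: "i \<in> {1..N} \<Longrightarrow> norm (U i) \<le> tot U"
  unfolding tot_def by (rule member_le_sum) auto

lemma src_continuous:
  assumes "i \<in> {1..N}" "\<And>j. j \<in> cw i \<Longrightarrow> continuous_on I (\<lambda>t. fst (U j t))"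
  shows "continuous_on I (src U i)"
  unfolding src_def
  by (intro continuous_on_minus continuous_on_sum bounded_linear.continuous_on[OF K_bounded] assms)

lemma csol_src_continuous:
  assumes "csol I U" "i \<in> {1..N}" shows "continuous_on I (src U i)"
proof (rule src_continuous[OF assms(2)])
  fix j assume "j \<in> cw i"
  then have "j \<in> {1..N}" using cw_in assms(2) by blast
  then show "continuous_on I (\<lambda>t. fst (U j t))" using assms(1) by (auto simp: csol_def mild_def)
qed

lemma src_cong: "i \<in> {1..N} \<Longrightarrow> (\<And>j. j \<in> {1..<i} \<Longrightarrow> U j t = V j t) \<Longrightarrow> src U i t = src V i t"
  unfolding src_def using cw_less[of i] by (intro arg_cong[of _ _ uminus] sum.cong refl) (metis subsetD)

lemma csol_exists: "\<exists>U. csol UNIV U \<and> (\<forall>i\<in>{1..N}. U i 0 = U0 i)"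
proof -
  have "n \<le> N \<Longrightarrow> \<exists>U. \<forall>i\<in>{1..n}. mild UNIV (\<lambda>t. fst (U i t)) (\<lambda>t. snd (U i t)) (src U i) \<and> U i 0 = U0 i" for n
  proof (induction n)
    case (Suc n)
    from Suc.IH[OF Suc_leD[OF Suc.prems]]
    obtain U where U: "\<And>i. i \<in> {1..n} \<Longrightarrow> mild UNIV (\<lambda>t. fst (U i t)) (\<lambda>t. snd (U i t)) (src U i) \<and> U i 0 = U0 i"
      by blast
    have S: "Suc n \<in> {1..N}" using Suc.prems by simp
    have "continuous_on UNIV (src U (Suc n))"
    proof (rule src_continuous[OF S])
      fix j assume "j \<in> cw (Suc n)"
      then have "j \<in> {1..n}" using cw_less[OF S] by auto
      then show "continuous_on UNIV (\<lambda>t. fst (U j t))" using U by (auto simp: mild_def)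
    qed
    then obtain a b where ab: "mild UNIV a b (src U (Suc n))" "a 0 = fst (U0 (Suc n))" "b 0 = snd (U0 (Suc n))"
      using mild_exists[of "src U (Suc n)" "fst (U0 (Suc n))" "snd (U0 (Suc n))"] by blast
    define V where "V = U(Suc n := \<lambda>t. (a t, b t))"
    have sV: "src V i = src U i" if i: "i \<in> {1..Suc n}" for i
    proof
      have "i \<in> {1..N}" using i Suc.prems by auto
      then show "src V i t = src U i t" for t by (rule src_cong) (use i in \<open>auto simp: V_def\<close>)
    qed
    have "mild UNIV (\<lambda>t. fst (V i t)) (\<lambda>t. snd (V i t)) (src V i) \<and> V i 0 = U0 i" if i: "i \<in> {1..Suc n}" for i
    proof (cases "i = Suc n")
      case True
      then show ?thesis using ab sV[OF i] by (simp add: V_def)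
    next
      case False
      then have "i \<in> {1..n}" using i by auto
      then show ?thesis using U False sV[OF i] by (simp add: V_def)
    qed
    then show ?case by blast
  qed simp
  from this[OF order_refl] show ?thesis unfolding csol_def by blast
qed

lemma csol_unique:
  assumes U: "csol I U" and V: "csol I V" and I: "convex I" "t0 \<in> I"
    and eq: "\<And>i. i \<in> {1..N} \<Longrightarrow> U i t0 = V i t0" and i: "i \<in> {1..N}" and t: "t \<in> I"
  shows "U i t = V i t"
proof -
  have "i \<in> {1..N} \<longrightarrow> (\<forall>t\<in>I. U i t = V i t)" for i
  proof (induction i rule: less_induct)
    case (less i)
    show ?case
    proof (intro impI ballI)
      fix t assume i: "i \<in> {1..N}" and t: "t \<in> I"
      have "src U i t = src V i t" if "t \<in> I" for t
        by (rule src_cong[OF i]) (use less i that in auto)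
      then have "mild I (\<lambda>t. fst (V i t)) (\<lambda>t. snd (V i t)) (src U i)"
        using V i mild_cong[of I "\<lambda>t. fst (V i t)" "\<lambda>t. fst (V i t)" "\<lambda>t. snd (V i t)" "\<lambda>t. snd (V i t)" "src U i" "src V i"]
        by (simp add: csol_def)
      moreover have "mild I (\<lambda>t. fst (U i t)) (\<lambda>t. snd (U i t)) (src U i)" using U i by (simp add: csol_def)
      ultimately show "U i t = V i t"
        using mild_unique[of I "\<lambda>t. fst (U i t)" "\<lambda>t. snd (U i t)" "src U i" "\<lambda>t. fst (V i t)" "\<lambda>t. snd (V i t)" t0 t] I t eq[OF i]
        by (simp add: prod_eq_iff)
    qed
  qed
  then show ?thesis using i t by blast
qed

definition flow :: "real \<Rightarrow> (nat \<Rightarrow> 'h \<times> 'h) \<Rightarrow> nat \<Rightarrow> 'h \<times> 'h" where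
  "flow t U0 i = (SOME U. csol UNIV U \<and> (\<forall>i\<in>{1..N}. U i 0 = U0 i)) i t"

lemma flow_csol: "csol UNIV (\<lambda>i t. flow t U0 i)" and flow_0: "i \<in> {1..N} \<Longrightarrow> flow 0 U0 i = U0 i"
  using someI_ex[OF csol_exists[of U0]] by (simp_all add: flow_def)

lemma csol_subset: "csol I U \<Longrightarrow> J \<subseteq> I \<Longrightarrow> csol J U"
  unfolding csol_def using mild_subset by blast

lemma flow_unique:
  assumes "csol I U" "convex I" "0 \<in> I" "\<And>i. i \<in> {1..N} \<Longrightarrow> U i 0 = U0 i" "i \<in> {1..N}" "t \<in> I"
  shows "U i t = flow t U0 i"
  by (rule csol_unique[OF assms(1) csol_subset[OF flow_csol] assms(2,3)]) (use assms flow_0 in auto)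

lemma csol_shift:
  assumes "csol UNIV U" shows "csol UNIV (\<lambda>i t. U i (t + s))"
proof -
  have "src (\<lambda>i t. U i (t + s)) i = (\<lambda>t. src U i (t + s))" for i by (auto simp: src_def)
  then show ?thesis using assms mild_shift unfolding csol_def by fastforce
qed

lemma flow_flow: "i \<in> {1..N} \<Longrightarrow> flow t (flow s U0) i = flow (t + s) U0 i"
  by (rule flow_unique[OF csol_shift[OF flow_csol], symmetric]) auto

lemma csol_lin:
  assumes U: "csol I U" and V: "csol I V" shows "csol I (\<lambda>i t. x *\<^sub>R U i t + y *\<^sub>R V i t)"
  unfolding csol_def
proof
  fix i assume i: "i \<in> {1..N}"
  have "src (\<lambda>i t. x *\<^sub>R U i t + y *\<^sub>R V i t) i t = x *\<^sub>R src U i t + y *\<^sub>R src V i t" for t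
  proof -
    have "K i j (x *\<^sub>R u + y *\<^sub>R v) = x *\<^sub>R K i j u + y *\<^sub>R K i j v" if "j \<in> cw i" for j u v
      using bounded_linear.linear[OF K_bounded[OF i that]] by (simp add: linear_add linear_cmul)
    then show ?thesis by (simp add: src_def sum.distrib scaleR_sum_right)
  qed
  then show "mild I (\<lambda>t. fst (x *\<^sub>R U i t + y *\<^sub>R V i t)) (\<lambda>t. snd (x *\<^sub>R U i t + y *\<^sub>R V i t)) (src (\<lambda>i t. x *\<^sub>R U i t + y *\<^sub>R V i t) i)"
    using mild_lin[of I "\<lambda>t. fst (U i t)" "\<lambda>t. snd (U i t)" "src U i" "\<lambda>t. fst (V i t)" "\<lambda>t. snd (V i t)" "src V i" x y]
      U V i by (simp add: csol_def cong: mild_cong)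
qed

lemma flow_lin: "i \<in> {1..N} \<Longrightarrow> flow t (\<lambda>i. x *\<^sub>R U i + y *\<^sub>R V i) i = x *\<^sub>R flow t U i + y *\<^sub>R flow t V i"
  by (rule flow_unique[OF csol_lin[OF flow_csol flow_csol], symmetric]) (auto simp: flow_0)

lemma flow_bound: "\<exists>M\<ge>0. \<forall>t U. \<bar>t\<bar> \<le> T \<longrightarrow> (\<forall>i\<in>{1..N}. norm (flow t U i) \<le> M * (\<Sum>j=1..i. norm (U j)))"
proof -
  have "n \<le> N \<Longrightarrow> \<exists>M\<ge>0. \<forall>t U. \<bar>t\<bar> \<le> T \<longrightarrow> (\<forall>i\<in>{1..n}. norm (flow t U i) \<le> M * (\<Sum>j=1..i. norm (U j)))" for n
  proof (induction n)
    case (Suc n)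
    then obtain M where M0: "M \<ge> 0" and M: "\<And>t U i. \<bar>t\<bar> \<le> T \<Longrightarrow> i \<in> {1..n} \<Longrightarrow> norm (flow t U i) \<le> M * (\<Sum>j=1..i. norm (U j))"
      by auto
    have S: "Suc n \<in> {1..N}" using Suc.prems by simp
    define C where "C = (\<Sum>j\<in>cw (Suc n). onorm (K (Suc n) j))"
    have C0: "C \<ge> 0" unfolding C_def by (intro sum_nonneg onorm_pos_le K_bounded[OF S])
    define M' where "M' = M + 4 + 4 * \<bar>T\<bar> * C * M"
    have M': "M' \<ge> M" "M' \<ge> 0" using M0 C0 by (auto simp: M'_def)
    have "norm (flow t U i) \<le> M' * (\<Sum>j=1..i. norm (U j))" if t: "\<bar>t\<bar> \<le> T" and i: "i \<in> {1..Suc n}" for t U i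
    proof (cases "i = Suc n")
      case False
      then have "norm (flow t U i) \<le> M * (\<Sum>j=1..i. norm (U j))" using M[OF t] i by auto
      also have "\<dots> \<le> M' * (\<Sum>j=1..i. norm (U j))" by (intro mult_right_mono M' sum_nonneg) auto
      finally show ?thesis .
    next
      case True
      define Q where "Q = (\<Sum>j=1..n. norm (U j))"
      have Q0: "Q \<ge> 0" by (simp add: Q_def sum_nonneg)
      define F where "F = src (\<lambda>i t. flow t U i) (Suc n)"
      have Fb: "norm (F s) \<le> C * (M * Q)" if s: "\<bar>s\<bar> \<le> T" for s
      proof -
        have "norm (F s) \<le> (\<Sum>j\<in>cw (Suc n). norm (K (Suc n) j (fst (flow s U j))))"
          unfolding F_def src_def norm_minus_cancel by (rule norm_sum)
        also have "\<dots> \<le> (\<Sum>j\<in>cw (Suc n). onorm (K (Suc n) j) * (M * Q))"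
        proof (rule sum_mono)
          fix j assume j: "j \<in> cw (Suc n)"
          then have jn: "j \<in> {1..n}" using cw_less[OF S] by auto
          have "norm (K (Suc n) j (fst (flow s U j))) \<le> onorm (K (Suc n) j) * norm (fst (flow s U j))"
            by (rule onorm[OF K_bounded[OF S j]])
          also have "\<dots> \<le> onorm (K (Suc n) j) * (M * Q)"
          proof (rule mult_left_mono)
            have "norm (fst (flow s U j)) \<le> norm (flow s U j)"
              using norm_fst_le[of "fst (flow s U j)" "snd (flow s U j)"] by simp
            also have "\<dots> \<le> M * (\<Sum>k=1..j. norm (U k))" by (rule M[OF s jn])
            also have "\<dots> \<le> M * Q" unfolding Q_def by (intro mult_left_mono sum_mono2 M0) (use jn in auto)
            finally show "norm (fst (flow s U j)) \<le> M * Q" .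
          qed (rule onorm_pos_le[OF K_bounded[OF S j]])
          finally show "norm (K (Suc n) j (fst (flow s U j))) \<le> onorm (K (Suc n) j) * (M * Q)" .
        qed
        also have "\<dots> = C * (M * Q)" by (simp add: C_def sum_distrib_right)
        finally show ?thesis .
      qed
      have mf: "mild UNIV (\<lambda>t. fst (flow t U (Suc n))) (\<lambda>t. snd (flow t U (Suc n))) F"
        using flow_csol[of U] S unfolding F_def csol_def by blast
      have "continuous_on UNIV F" unfolding F_def by (rule csol_src_continuous[OF flow_csol S])
      from mild_exists[OF this, of "fst (U (Suc n))" "snd (U (Suc n))"]
      obtain a b where ab: "mild UNIV a b F" "a 0 = fst (U (Suc n))" "b 0 = snd (U (Suc n))"
        and bd: "\<forall>T M. (\<forall>s. \<bar>s\<bar> \<le> T \<longrightarrow> norm (F s) \<le> M) \<longrightarrow> (\<forall>t. \<bar>t\<bar> \<le> T \<longrightarrow>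
          norm (a t) \<le> norm (fst (U (Suc n))) + norm (snd (U (Suc n))) + 2 * T * M \<and>
          norm (b t) \<le> norm (fst (U (Suc n))) + norm (snd (U (Suc n))) + 2 * T * M)"
        by blast
      define X where "X = T * (C * (M * Q))"
      have fl: "fst (flow t U (Suc n)) = a t" "snd (flow t U (Suc n)) = b t"
        using mild_unique[OF mf ab(1) convex_UNIV, of 0 t] flow_0[OF S] ab by auto
      have "norm (a t) \<le> norm (fst (U (Suc n))) + norm (snd (U (Suc n))) + 2 * T * (C * (M * Q)) \<and>
          norm (b t) \<le> norm (fst (U (Suc n))) + norm (snd (U (Suc n))) + 2 * T * (C * (M * Q))"
        using bd Fb t by blast
      note this[unfolded mult.assoc, folded X_def, THEN conjunct1] this[unfolded mult.assoc, folded X_def, THEN conjunct2]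
      moreover have "norm (fst (U (Suc n))) \<le> norm (U (Suc n))" "norm (snd (U (Suc n))) \<le> norm (U (Suc n))"
        using norm_fst_le[of "fst (U (Suc n))" "snd (U (Suc n))"] norm_snd_le[of "snd (U (Suc n))" "fst (U (Suc n))"] by auto
      moreover have "norm (flow t U (Suc n)) \<le> norm (a t) + norm (b t)"
        using norm_Pair_le[of "fst (flow t U (Suc n))" "snd (flow t U (Suc n))"] unfolding fl[symmetric] prod.collapse .
      ultimately have "norm (flow t U (Suc n)) \<le> 4 * norm (U (Suc n)) + 4 * X" by linarith
      also have "\<dots> \<le> M' * norm (U (Suc n)) + M' * Q"
      proof (rule add_mono)
        have "0 \<le> \<bar>T\<bar> * C * M" using C0 M0 by simp
        then show "4 * norm (U (Suc n)) \<le> M' * norm (U (Suc n))"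
          using M0 by (intro mult_right_mono) (simp_all add: M'_def)
        have "4 * X = (4 * T * C * M) * Q" by (simp add: X_def)
        also have "\<dots> \<le> M' * Q" using t M0 Q0 by (intro mult_right_mono) (simp_all add: M'_def)
        finally show "4 * X \<le> M' * Q" .
      qed
      also have "\<dots> = M' * (\<Sum>j=1..Suc n. norm (U j))" by (simp add: Q_def algebra_simps)
      finally show ?thesis using True by simp
    qed
    then show ?case using M' by blast
  qed auto
  from this[OF order_refl] show ?thesis .
qed

lemma flow_tot_bound: "\<exists>M\<ge>0. \<forall>t U. \<bar>t\<bar> \<le> T \<longrightarrow> (\<forall>i\<in>{1..N}. norm (flow t U i) \<le> M * tot U)"
proof -
  obtain M where M0: "M \<ge> 0" and M: "\<And>t U i. \<bar>t\<bar> \<le> T \<Longrightarrow> i \<in> {1..N} \<Longrightarrow> norm (flow t U i) \<le> M * (\<Sum>j=1..i. norm (U j))"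
    using flow_bound[of T] by blast
  have "norm (flow t U i) \<le> M * tot U" if "\<bar>t\<bar> \<le> T" "i \<in> {1..N}" for t U i
  proof -
    have "norm (flow t U i) \<le> M * (\<Sum>j=1..i. norm (U j))" by (rule M[OF that])
    also have "\<dots> \<le> M * tot U" unfolding tot_def by (intro mult_left_mono sum_mono2 M0) (use that in auto)
    finally show ?thesis .
  qed
  then show ?thesis using M0 by blast
qed

text \<open>Uniform continuity in time of \<open>t \<mapsto> flow(t)\<^sup>* z\<close>: immediate from the equation for \<open>z\<close> in the
  dense span of the eigenvectors, where the time derivative is bounded by the state.\<close>

definition weakly_uniform :: "real \<Rightarrow> nat \<Rightarrow> 'h \<times> 'h \<Rightarrow> bool" where
  "weakly_uniform T i z \<longleftrightarrow> (\<forall>e>0. \<exists>d>0. \<forall>s t U. \<bar>s\<bar> \<le> T \<longrightarrow> \<bar>t\<bar> \<le> T \<longrightarrow> \<bar>s - t\<bar> < d \<longrightarrow>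
    \<bar>z \<bullet> (flow s U i - flow t U i)\<bar> \<le> e * tot U)"

lemma weakly_uniform_eps:
  assumes i: "i \<in> {1..N}" shows "weakly_uniform T i (\<epsilon> j, 0)" "weakly_uniform T i (0, \<epsilon> j)"
proof -
  obtain M where M0: "M \<ge> 0" and M: "\<And>t U i. \<bar>t\<bar> \<le> T \<Longrightarrow> i \<in> {1..N} \<Longrightarrow> norm (flow t U i) \<le> M * tot U"
    using flow_tot_bound[of T] by blast
  define C where "C = (\<Sum>j\<in>cw i. onorm (K i j))"
  have C0: "C \<ge> 0" unfolding C_def by (intro sum_nonneg onorm_pos_le K_bounded[OF i])
  define B where "B = m j * M + C * M"
  have B0: "B \<ge> 0" using m_pos[of j] M0 C0 by (simp add: B_def)
  have ne: "norm (\<epsilon> j) \<le> 1" using nrm[of j] by (cases "\<epsilon> j = 0") auto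
  have ie: "\<bar>x \<bullet> \<epsilon> j\<bar> \<le> norm x" for x
    using Cauchy_Schwarz_ineq2[of x "\<epsilon> j"] mult_left_mono[OF ne norm_ge_zero[of x]] by simp
  have bs: "\<bar>fst (flow r U i) \<bullet> \<epsilon> j\<bar> \<le> M * tot U" "\<bar>snd (flow r U i) \<bullet> \<epsilon> j\<bar> \<le> M * tot U" if "\<bar>r\<bar> \<le> T" for r U
    using M[OF that i, of U] ie[of "fst (flow r U i)"] ie[of "snd (flow r U i)"]
      norm_fst_le[of "fst (flow r U i)" "snd (flow r U i)"] norm_snd_le[of "snd (flow r U i)" "fst (flow r U i)"]
    by auto
  have sb: "norm (src (\<lambda>i t. flow t U i) i r) \<le> C * (M * tot U)" if r: "\<bar>r\<bar> \<le> T" for r U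
  proof -
    have "norm (src (\<lambda>i t. flow t U i) i r) \<le> (\<Sum>j\<in>cw i. norm (K i j (fst (flow r U j))))"
      unfolding src_def norm_minus_cancel by (rule norm_sum)
    also have "\<dots> \<le> (\<Sum>j\<in>cw i. onorm (K i j) * (M * tot U))"
    proof (rule sum_mono)
      fix j assume j: "j \<in> cw i"
      have "norm (K i j (fst (flow r U j))) \<le> onorm (K i j) * norm (fst (flow r U j))"
        by (rule onorm[OF K_bounded[OF i j]])
      also have "\<dots> \<le> onorm (K i j) * (M * tot U)"
        using M[OF r, of j U] cw_in[OF i j] norm_fst_le[of "fst (flow r U j)" "snd (flow r U j)"]
        by (intro mult_left_mono onorm_pos_le[OF K_bounded[OF i j]]) auto
      finally show "norm (K i j (fst (flow r U j))) \<le> onorm (K i j) * (M * tot U)" .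
    qed
    also have "\<dots> = C * (M * tot U)" by (simp add: C_def sum_distrib_right)
    finally show ?thesis .
  qed
  have seg: "\<bar>r\<bar> \<le> T" if "r \<in> closed_segment t s" "\<bar>s\<bar> \<le> T" "\<bar>t\<bar> \<le> T" for r s t
    using that by (auto simp: closed_segment_eq_real_ivl split: if_splits)
  have l1: "\<bar>(fst (flow s U i) - fst (flow t U i)) \<bullet> \<epsilon> j\<bar> \<le> (B * tot U) * \<bar>s - t\<bar>" if st: "\<bar>s\<bar> \<le> T" "\<bar>t\<bar> \<le> T" for s t U
  proof -
    have "norm (fst (flow s U i) \<bullet> \<epsilon> j - fst (flow t U i) \<bullet> \<epsilon> j) \<le> (B * tot U) * \<bar>s - t\<bar>"
    proof (rule norm_le_of_vector_derivative)
      fix r assume r: "r \<in> closed_segment t s"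
      have "((\<lambda>r. fst (flow r U i) \<bullet> \<epsilon> j) has_real_derivative m j * (snd (flow r U i) \<bullet> \<epsilon> j)) (at r)"
        using flow_csol[of U] i by (auto simp: csol_def mild_def)
      then show "((\<lambda>r. fst (flow r U i) \<bullet> \<epsilon> j) has_vector_derivative m j * (snd (flow r U i) \<bullet> \<epsilon> j)) (at r within closed_segment t s)"
        using has_real_derivative_iff_has_vector_derivative has_vector_derivative_at_within by blast
      have "\<bar>m j * (snd (flow r U i) \<bullet> \<epsilon> j)\<bar> \<le> m j * (M * tot U)"
        using bs(2)[OF seg[OF r st], of U] m_pos[of j] by (simp add: abs_mult)
      also have "\<dots> \<le> B * tot U"
        using mult_nonneg_nonneg[OF mult_nonneg_nonneg[OF C0 M0] tot_nonneg[of U]] by (simp add: B_def algebra_simps)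
      finally show "norm (m j * (snd (flow r U i) \<bullet> \<epsilon> j)) \<le> B * tot U" by simp
    qed
    then show ?thesis by (simp add: inner_diff_left)
  qed
  have l2: "\<bar>(snd (flow s U i) - snd (flow t U i)) \<bullet> \<epsilon> j\<bar> \<le> (B * tot U) * \<bar>s - t\<bar>" if st: "\<bar>s\<bar> \<le> T" "\<bar>t\<bar> \<le> T" for s t U
  proof -
    have "norm (snd (flow s U i) \<bullet> \<epsilon> j - snd (flow t U i) \<bullet> \<epsilon> j) \<le> (B * tot U) * \<bar>s - t\<bar>"
    proof (rule norm_le_of_vector_derivative)
      fix r assume r: "r \<in> closed_segment t s"
      have "((\<lambda>r. snd (flow r U i) \<bullet> \<epsilon> j) has_real_derivative src (\<lambda>i t. flow t U i) i r \<bullet> \<epsilon> j - m j * (fst (flow r U i) \<bullet> \<epsilon> j)) (at r)"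
        using flow_csol[of U] i by (auto simp: csol_def mild_def)
      then show "((\<lambda>r. snd (flow r U i) \<bullet> \<epsilon> j) has_vector_derivative src (\<lambda>i t. flow t U i) i r \<bullet> \<epsilon> j - m j * (fst (flow r U i) \<bullet> \<epsilon> j)) (at r within closed_segment t s)"
        using has_real_derivative_iff_has_vector_derivative has_vector_derivative_at_within by blast
      have "\<bar>m j * (fst (flow r U i) \<bullet> \<epsilon> j)\<bar> \<le> m j * (M * tot U)"
        using bs(1)[OF seg[OF r st], of U] m_pos[of j] by (simp add: abs_mult)
      moreover have "\<bar>src (\<lambda>i t. flow t U i) i r \<bullet> \<epsilon> j\<bar> \<le> C * (M * tot U)"
        using ie[of "src (\<lambda>i t. flow t U i) i r"] sb[OF seg[OF r st], of U] by linarith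
      moreover have "B * tot U = m j * (M * tot U) + C * (M * tot U)" by (simp add: B_def algebra_simps)
      ultimately show "norm (src (\<lambda>i t. flow t U i) i r \<bullet> \<epsilon> j - m j * (fst (flow r U i) \<bullet> \<epsilon> j)) \<le> B * tot U"
        unfolding real_norm_def by linarith
    qed
    then show ?thesis by (simp add: inner_diff_left)
  qed
  have fin: "(B * tot U) * \<bar>s - t\<bar> \<le> e * tot U" if "\<bar>s - t\<bar> < e / (B + 1)" "e > 0" for s t e U
  proof -
    have "B * \<bar>s - t\<bar> \<le> B * (e / (B + 1))" using that B0 by (intro mult_left_mono) auto
    also have "\<dots> \<le> e" using B0 that by (simp add: field_simps)
    finally have "B * \<bar>s - t\<bar> * tot U \<le> e * tot U" by (rule mult_right_mono[OF _ tot_nonneg])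
    then show ?thesis by (simp add: algebra_simps)
  qed
  show "weakly_uniform T i (\<epsilon> j, 0)"
    unfolding weakly_uniform_def
  proof (intro allI impI)
    fix e :: real assume e: "e > 0"
    have "\<bar>(\<epsilon> j, 0) \<bullet> (flow s U i - flow t U i)\<bar> \<le> e * tot U"
      if "\<bar>s\<bar> \<le> T" "\<bar>t\<bar> \<le> T" "\<bar>s - t\<bar> < e / (B + 1)" for s t U
      using order_trans[OF l1[OF that(1,2)] fin[OF that(3) e]] by (simp add: inner_prod_def inner_commute)
    then show "\<exists>d>0. \<forall>s t U. \<bar>s\<bar> \<le> T \<longrightarrow> \<bar>t\<bar> \<le> T \<longrightarrow> \<bar>s - t\<bar> < d \<longrightarrow> \<bar>(\<epsilon> j, 0) \<bullet> (flow s U i - flow t U i)\<bar> \<le> e * tot U"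
      using e B0 by (intro exI[of _ "e / (B + 1)"]) auto
  qed
  show "weakly_uniform T i (0, \<epsilon> j)"
    unfolding weakly_uniform_def
  proof (intro allI impI)
    fix e :: real assume e: "e > 0"
    have "\<bar>(0, \<epsilon> j) \<bullet> (flow s U i - flow t U i)\<bar> \<le> e * tot U"
      if "\<bar>s\<bar> \<le> T" "\<bar>t\<bar> \<le> T" "\<bar>s - t\<bar> < e / (B + 1)" for s t U
      using order_trans[OF l2[OF that(1,2)] fin[OF that(3) e]] by (simp add: inner_prod_def inner_commute)
    then show "\<exists>d>0. \<forall>s t U. \<bar>s\<bar> \<le> T \<longrightarrow> \<bar>t\<bar> \<le> T \<longrightarrow> \<bar>s - t\<bar> < d \<longrightarrow> \<bar>(0, \<epsilon> j) \<bullet> (flow s U i - flow t U i)\<bar> \<le> e * tot U"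
      using e B0 by (intro exI[of _ "e / (B + 1)"]) auto
  qed
qed

lemma weakly_uniform_add:
  assumes y: "weakly_uniform T i y" and z: "weakly_uniform T i z" shows "weakly_uniform T i (y + z)"
  unfolding weakly_uniform_def
proof (intro allI impI)
  fix e :: real assume "e > 0"
  then have e: "e/2 > 0" by simp
  obtain d where d: "d > 0" "\<And>s t U. \<bar>s\<bar> \<le> T \<Longrightarrow> \<bar>t\<bar> \<le> T \<Longrightarrow> \<bar>s - t\<bar> < d \<Longrightarrow> \<bar>y \<bullet> (flow s U i - flow t U i)\<bar> \<le> e/2 * tot U"
    using y e unfolding weakly_uniform_def by blast
  obtain d' where d': "d' > 0" "\<And>s t U. \<bar>s\<bar> \<le> T \<Longrightarrow> \<bar>t\<bar> \<le> T \<Longrightarrow> \<bar>s - t\<bar> < d' \<Longrightarrow> \<bar>z \<bullet> (flow s U i - flow t U i)\<bar> \<le> e/2 * tot U"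
    using z e unfolding weakly_uniform_def by blast
  have "\<bar>(y + z) \<bullet> (flow s U i - flow t U i)\<bar> \<le> e * tot U"
    if "\<bar>s\<bar> \<le> T" "\<bar>t\<bar> \<le> T" "\<bar>s - t\<bar> < min d d'" for s t U
  proof -
    have "\<bar>y \<bullet> (flow s U i - flow t U i)\<bar> \<le> e/2 * tot U" "\<bar>z \<bullet> (flow s U i - flow t U i)\<bar> \<le> e/2 * tot U"
      using d(2) d'(2) that by auto
    moreover have "e * tot U = e/2 * tot U + e/2 * tot U" by simp
    ultimately show ?thesis unfolding inner_add_left by linarith
  qed
  then show "\<exists>d>0. \<forall>s t U. \<bar>s\<bar> \<le> T \<longrightarrow> \<bar>t\<bar> \<le> T \<longrightarrow> \<bar>s - t\<bar> < d \<longrightarrow> \<bar>(y + z) \<bullet> (flow s U i - flow t U i)\<bar> \<le> e * tot U"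
    using d(1) d'(1) by (intro exI[of _ "min d d'"]) auto
qed

lemma weakly_uniform_scaleR:
  assumes z: "weakly_uniform T i z" shows "weakly_uniform T i (r *\<^sub>R z)"
  unfolding weakly_uniform_def
proof (intro allI impI)
  fix e :: real assume "e > 0"
  then have e: "e / (\<bar>r\<bar> + 1) > 0" by simp
  obtain d where d: "d > 0" "\<And>s t U. \<bar>s\<bar> \<le> T \<Longrightarrow> \<bar>t\<bar> \<le> T \<Longrightarrow> \<bar>s - t\<bar> < d \<Longrightarrow> \<bar>z \<bullet> (flow s U i - flow t U i)\<bar> \<le> e / (\<bar>r\<bar> + 1) * tot U"
    using z e unfolding weakly_uniform_def by blast
  have le: "\<bar>r\<bar> * (e / (\<bar>r\<bar> + 1)) \<le> e" using \<open>e > 0\<close> by (simp add: field_simps)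
  have "\<bar>(r *\<^sub>R z) \<bullet> (flow s U i - flow t U i)\<bar> \<le> e * tot U"
    if "\<bar>s\<bar> \<le> T" "\<bar>t\<bar> \<le> T" "\<bar>s - t\<bar> < d" for s t U
  proof -
    have "\<bar>(r *\<^sub>R z) \<bullet> (flow s U i - flow t U i)\<bar> \<le> \<bar>r\<bar> * (e / (\<bar>r\<bar> + 1) * tot U)"
      unfolding inner_scaleR_left abs_mult by (intro mult_left_mono d(2) that) simp
    also have "\<dots> \<le> e * tot U" using mult_right_mono[OF le tot_nonneg[of U]] by (simp add: mult.assoc)
    finally show ?thesis .
  qed
  then show "\<exists>d>0. \<forall>s t U. \<bar>s\<bar> \<le> T \<longrightarrow> \<bar>t\<bar> \<le> T \<longrightarrow> \<bar>s - t\<bar> < d \<longrightarrow> \<bar>(r *\<^sub>R z) \<bullet> (flow s U i - flow t U i)\<bar> \<le> e * tot U"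
    using d(1) by blast
qed

lemma weakly_uniform_trunc:
  assumes i: "i \<in> {1..N}" shows "weakly_uniform T i (trunc P x, trunc P y)"
proof -
  have 0: "weakly_uniform T i 0"
    unfolding weakly_uniform_def using tot_nonneg by (auto intro!: exI[of _ 1] mult_nonneg_nonneg)
  have "weakly_uniform T i (\<Sum>k<P. (x \<bullet> \<epsilon> k) *\<^sub>R (\<epsilon> k, 0) + (y \<bullet> \<epsilon> k) *\<^sub>R (0, \<epsilon> k))"
  proof (induction P)
    case (Suc P)
    show ?case unfolding sum.lessThan_Suc
      by (intro weakly_uniform_add Suc weakly_uniform_scaleR weakly_uniform_eps[OF i])
  qed (simp add: 0)
  moreover have "(\<Sum>k<P. (x \<bullet> \<epsilon> k) *\<^sub>R (\<epsilon> k, 0) + (y \<bullet> \<epsilon> k) *\<^sub>R (0, \<epsilon> k)) = (trunc P x, trunc P y)"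
    by (simp add: trunc_def prod_eq_iff fst_sum snd_sum)
  ultimately show ?thesis by simp
qed

lemma weakly_uniform_all:
  assumes i: "i \<in> {1..N}" shows "weakly_uniform T i z"
  unfolding weakly_uniform_def
proof (intro allI impI)
  fix e :: real assume e: "e > 0"
  obtain M where M0: "M \<ge> 0" and M: "\<And>t U i. \<bar>t\<bar> \<le> T \<Longrightarrow> i \<in> {1..N} \<Longrightarrow> norm (flow t U i) \<le> M * tot U"
    using flow_tot_bound[of T] by blast
  have "(\<lambda>P. (trunc P (fst z), trunc P (snd z))) \<longlonglongrightarrow> (fst z, snd z)"
    by (intro tendsto_Pair trunc_tendsto)
  then have "\<forall>\<^sub>F P in sequentially. dist (trunc P (fst z), trunc P (snd z)) z < e / (4 * (M + 1))"
    using e M0 by (intro tendstoD) auto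
  then obtain P where P: "norm (z - (trunc P (fst z), trunc P (snd z))) < e / (4 * (M + 1))"
    unfolding eventually_sequentially dist_norm by (metis norm_minus_commute order_refl)
  define y where "y = (trunc P (fst z), trunc P (snd z))"
  obtain d where d: "d > 0" "\<And>s t U. \<bar>s\<bar> \<le> T \<Longrightarrow> \<bar>t\<bar> \<le> T \<Longrightarrow> \<bar>s - t\<bar> < d \<Longrightarrow> \<bar>y \<bullet> (flow s U i - flow t U i)\<bar> \<le> e/2 * tot U"
    using weakly_uniform_trunc[OF i, of T P "fst z" "snd z"] e unfolding weakly_uniform_def y_def by (meson half_gt_zero)
  have "\<bar>z \<bullet> (flow s U i - flow t U i)\<bar> \<le> e * tot U"
    if st: "\<bar>s\<bar> \<le> T" "\<bar>t\<bar> \<le> T" "\<bar>s - t\<bar> < d" for s t U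
  proof -
    have "norm (flow s U i - flow t U i) \<le> 2 * (M + 1) * tot U"
      using norm_triangle_ineq4[of "flow s U i" "flow t U i"] M[OF st(1) i, of U] M[OF st(2) i, of U] tot_nonneg[of U]
      by (simp add: algebra_simps)
    then have "\<bar>(z - y) \<bullet> (flow s U i - flow t U i)\<bar> \<le> e / (4 * (M + 1)) * (2 * (M + 1) * tot U)"
      using P e M0 unfolding y_def
      by (intro order_trans[OF Cauchy_Schwarz_ineq2] mult_mono) auto
    also have "\<dots> = e/2 * tot U" using M0 by (simp add: field_simps)
    finally have "\<bar>(z - y) \<bullet> (flow s U i - flow t U i)\<bar> \<le> e/2 * tot U" .
    moreover have "\<bar>y \<bullet> (flow s U i - flow t U i)\<bar> \<le> e/2 * tot U" by (rule d(2)[OF st])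
    moreover have "z \<bullet> (flow s U i - flow t U i) = (z - y) \<bullet> (flow s U i - flow t U i) + y \<bullet> (flow s U i - flow t U i)"
      by (simp add: inner_diff_left)
    moreover have "e * tot U = e/2 * tot U + e/2 * tot U" by simp
    ultimately show ?thesis by linarith
  qed
  then show "\<exists>d>0. \<forall>s t U. \<bar>s\<bar> \<le> T \<longrightarrow> \<bar>t\<bar> \<le> T \<longrightarrow> \<bar>s - t\<bar> < d \<longrightarrow> \<bar>z \<bullet> (flow s U i - flow t U i)\<bar> \<le> e * tot U"
    using d(1) by blast
qed

end

section \<open>Duality between observation and control\<close>

text \<open>The minimising sequence of \<open>\<Lambda> x x / 2 - \<phi> x\<close>; neither completeness nor definiteness is needed.\<close>

lemma quadratic_minimizing_sequence:
  fixes \<Lambda> :: "'x \<Rightarrow> 'x \<Rightarrow> real" and \<phi> :: "'x \<Rightarrow> real" and comb :: "real \<Rightarrow> 'x \<Rightarrow> real \<Rightarrow> 'x \<Rightarrow> 'x"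
  assumes x0: "x0 \<in> D" and comb: "\<And>a x b y. x \<in> D \<Longrightarrow> y \<in> D \<Longrightarrow> comb a x b y \<in> D"
    and sym: "\<And>x y. x \<in> D \<Longrightarrow> y \<in> D \<Longrightarrow> \<Lambda> x y = \<Lambda> y x"
    and lin: "\<And>a x b y z. x \<in> D \<Longrightarrow> y \<in> D \<Longrightarrow> z \<in> D \<Longrightarrow> \<Lambda> (comb a x b y) z = a * \<Lambda> x z + b * \<Lambda> y z"
    and \<phi>lin: "\<And>a x b y. x \<in> D \<Longrightarrow> y \<in> D \<Longrightarrow> \<phi> (comb a x b y) = a * \<phi> x + b * \<phi> y"
    and pos: "\<And>x. x \<in> D \<Longrightarrow> 0 \<le> \<Lambda> x x"
    and C: "C \<ge> 0" "\<And>x. x \<in> D \<Longrightarrow> (\<phi> x)\<^sup>2 \<le> C * \<Lambda> x x"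
  shows "\<exists>u::nat \<Rightarrow> 'x. (\<forall>k. u k \<in> D) \<and>
    (\<forall>e>0. \<exists>n. \<forall>i\<ge>n. \<forall>j\<ge>n. \<Lambda> (comb 1 (u i) (- 1) (u j)) (comb 1 (u i) (- 1) (u j)) < e) \<and>
    (\<forall>z\<in>D. (\<lambda>k. \<Lambda> (u k) z) \<longlonglongrightarrow> \<phi> z)"
proof -
  define J where "J x = \<Lambda> x x - 2 * \<phi> x" for x
  have low: "- C \<le> J x" if x: "x \<in> D" for x
  proof -
    have "(\<phi> x)\<^sup>2 \<le> ((C + \<Lambda> x x) / 2)\<^sup>2"
    proof -
      have "C * \<Lambda> x x \<le> ((C + \<Lambda> x x) / 2)\<^sup>2"
        using zero_le_power2[of "C - \<Lambda> x x"] by (simp add: power2_eq_square algebra_simps)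
      then show ?thesis using C(2)[OF x] by linarith
    qed
    then have "\<bar>\<phi> x\<bar> \<le> \<bar>(C + \<Lambda> x x) / 2\<bar>" by (simp only: abs_le_square_iff)
    moreover have "\<bar>(C + \<Lambda> x x) / 2\<bar> = (C + \<Lambda> x x) / 2" using C(1) pos[OF x] by simp
    ultimately have "\<phi> x \<le> (C + \<Lambda> x x) / 2" by linarith
    then show ?thesis by (simp add: J_def)
  qed
  define I where "I = Inf (J ` D)"
  have bd: "bdd_below (J ` D)" by (rule bdd_belowI[where m="- C"]) (use low in auto)
  have I: "I \<le> J x" if "x \<in> D" for x unfolding I_def using that bd by (intro cInf_lower) auto
  have "\<exists>x\<in>D. J x < I + 1 / real (Suc k)" for k
  proof -
    have lt: "Inf (J ` D) < I + 1 / real (Suc k)" by (simp add: I_def)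
    have "J ` D \<noteq> {}" using x0 by blast
    from cInf_lessD[OF this lt] obtain y where "y \<in> J ` D" "y < I + 1 / real (Suc k)" by blast
    then show ?thesis by auto
  qed
  then obtain u where u': "\<And>k. u k \<in> D" "\<And>k. J (u k) < I + 1 / real (Suc k)" by metis
  define h where "h k = 1 / real (Suc k)" for k
  have u: "u k \<in> D" "J (u k) < I + h k" for k using u' by (simp_all add: h_def)
  have Lcomb: "\<Lambda> (comb a x b y) (comb a x b y) = a\<^sup>2 * \<Lambda> x x + 2 * a * b * \<Lambda> x y + b\<^sup>2 * \<Lambda> y y"
    if "x \<in> D" "y \<in> D" for a b x y
  proof -
    note c = comb[OF that, of a b]
    have "\<Lambda> (comb a x b y) (comb a x b y) = a * \<Lambda> (comb a x b y) x + b * \<Lambda> (comb a x b y) y"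
      using lin[OF that c] sym[OF that(1) c] sym[OF that(2) c] by simp
    then show ?thesis using lin[OF that that(1)] lin[OF that that(2)] sym[OF that]
      by (simp add: power2_eq_square algebra_simps)
  qed
  have par: "\<Lambda> (comb 1 x (- 1) y) (comb 1 x (- 1) y) \<le> 2 * J x + 2 * J y - 4 * I" if xy: "x \<in> D" "y \<in> D" for x y
  proof -
    have "I \<le> J (comb (1/2) x (1/2) y)" by (rule I[OF comb[OF xy]])
    then show ?thesis unfolding J_def Lcomb[OF xy] \<phi>lin[OF xy] by (simp add: power2_eq_square field_simps)
  qed
  have cau: "\<exists>n. \<forall>i\<ge>n. \<forall>j\<ge>n. \<Lambda> (comb 1 (u i) (- 1) (u j)) (comb 1 (u i) (- 1) (u j)) < e" if e: "e > 0" for e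
  proof -
    obtain n where n: "h n < e / 4"
      unfolding h_def using e by (metis nat_approx_posE zero_less_divide_iff zero_less_numeral)
    have "\<Lambda> (comb 1 (u i) (- 1) (u j)) (comb 1 (u i) (- 1) (u j)) < e" if "i \<ge> n" "j \<ge> n" for i j
    proof -
      have "h i \<le> h n" "h j \<le> h n"
        unfolding h_def using that by (auto intro!: divide_left_mono)
      then show ?thesis using par[OF u(1) u(1), of i j] u(2)[of i] u(2)[of j] n by linarith
    qed
    then show ?thesis by blast
  qed
  have lim: "(\<lambda>k. \<Lambda> (u k) z) \<longlonglongrightarrow> \<phi> z" if z: "z \<in> D" for z
  proof -
    have est: "(\<Lambda> (u k) z - \<phi> z)\<^sup>2 \<le> (\<Lambda> z z + 1) * h k" for k
    proof -
      define r where "r = \<Lambda> (u k) z - \<phi> z"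
      define s where "s = - r / (\<Lambda> z z + 1)"
      have p: "\<Lambda> z z + 1 > 0" using pos[OF z] by linarith
      have sr: "s * (\<Lambda> z z + 1) = - r" using p by (simp add: s_def)
      have "I \<le> J (comb 1 (u k) s z)" by (rule I[OF comb[OF u(1) z]])
      also have "\<dots> = J (u k) + 2 * s * r + s\<^sup>2 * \<Lambda> z z"
        unfolding J_def Lcomb[OF u(1) z] \<phi>lin[OF u(1) z] r_def by (simp add: algebra_simps)
      also have "\<dots> \<le> J (u k) + 2 * s * r + s\<^sup>2 * (\<Lambda> z z + 1)" by (simp add: algebra_simps)
      also have "s\<^sup>2 * (\<Lambda> z z + 1) = - s * r" using sr by (simp add: power2_eq_square mult.assoc)
      finally have "- s * r \<le> h k" using u(2)[of k] by linarith
      then have "(\<Lambda> z z + 1) * (- s * r) \<le> (\<Lambda> z z + 1) * h k" using p by (intro mult_left_mono) auto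
      moreover have "r\<^sup>2 = (\<Lambda> z z + 1) * (- s * r)"
      proof -
        have "r\<^sup>2 = (- r) * (- r)" by (simp add: power2_eq_square)
        also have "\<dots> = (- r) * (s * (\<Lambda> z z + 1))" by (simp only: sr)
        finally show ?thesis by (simp add: algebra_simps)
      qed
      ultimately show ?thesis unfolding r_def[symmetric] by linarith
    qed
    have "h \<longlonglongrightarrow> 0" unfolding h_def[abs_def] by (rule LIMSEQ_Suc[OF lim_1_over_n])
    then have "(\<lambda>k. (\<Lambda> z z + 1) * h k) \<longlonglongrightarrow> 0" by (rule tendsto_mult_right_zero)
    then have "(\<lambda>k. (\<Lambda> (u k) z - \<phi> z)\<^sup>2) \<longlonglongrightarrow> 0"
      by (rule Lim_null_comparison[rotated]) (use est in auto)
    then have "(\<lambda>k. sqrt ((\<Lambda> (u k) z - \<phi> z)\<^sup>2)) \<longlonglongrightarrow> sqrt 0" by (rule tendsto_real_sqrt)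
    then have "(\<lambda>k. \<Lambda> (u k) z - \<phi> z) \<longlonglongrightarrow> 0" by (simp add: tendsto_rabs_zero_iff)
    then show ?thesis by (rule LIM_zero_cancel)
  qed
  show ?thesis using u(1) cau lim by blast
qed

context cascade
begin

definition ip :: "(nat \<Rightarrow> 'h \<times> 'h) \<Rightarrow> (nat \<Rightarrow> 'h \<times> 'h) \<Rightarrow> real" where
  "ip Z U = (\<Sum>i=1..N. Z i \<bullet> U i)"

lemma ip_lin: "ip Z (\<lambda>i. x *\<^sub>R U i + y *\<^sub>R V i) = x * ip Z U + y * ip Z V"
  by (simp add: ip_def inner_add_right sum.distrib sum_distrib_left)

lemma abs_ip_le: "\<bar>ip Z U\<bar> \<le> tot Z * tot U"
proof -
  have "\<bar>ip Z U\<bar> \<le> (\<Sum>i=1..N. \<bar>Z i \<bullet> U i\<bar>)" unfolding ip_def by (rule sum_abs)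
  also have "\<dots> \<le> (\<Sum>i=1..N. norm (Z i) * tot U)"
  proof (rule sum_mono)
    fix i assume i: "i \<in> {1..N}"
    have "\<bar>Z i \<bullet> U i\<bar> \<le> norm (Z i) * norm (U i)" by (rule Cauchy_Schwarz_ineq2)
    also have "\<dots> \<le> norm (Z i) * tot U" by (intro mult_left_mono norm_le_tot i) simp
    finally show "\<bar>Z i \<bullet> U i\<bar> \<le> norm (Z i) * tot U" .
  qed
  finally show ?thesis by (simp add: tot_def sum_distrib_right)
qed

definition single :: "nat \<Rightarrow> 'h \<times> 'h \<Rightarrow> nat \<Rightarrow> 'h \<times> 'h" where
  "single k z i = (if i = k then z else 0)"

lemma tot_single: "k \<in> {1..N} \<Longrightarrow> tot (single k z) = norm z"
proof -
  assume k: "k \<in> {1..N}"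
  have "tot (single k z) = (\<Sum>i=1..N. if i = k then norm z else 0)"
    unfolding tot_def single_def by (rule sum.cong) auto
  then show ?thesis using k by simp
qed

lemma ip_single: "k \<in> {1..N} \<Longrightarrow> ip Y (single k z) = Y k \<bullet> z"
proof -
  assume k: "k \<in> {1..N}"
  have "ip Y (single k z) = (\<Sum>i=1..N. if i = k then Y k \<bullet> z else 0)"
    unfolding ip_def single_def by (rule sum.cong) auto
  then show ?thesis using k by simp
qed

lemma ip_ext:
  assumes "\<And>V. ip Y V = ip Z V" "i \<in> {1..N}" shows "Y i = Z i"
proof -
  have "(Y i - Z i) \<bullet> (Y i - Z i) = 0"
    using assms(1)[of "single i (Y i - Z i)"] assms(2) by (simp add: ip_single inner_diff_left)
  then show ?thesis by simp
qed

lemma riesz_pair: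
  assumes l: "bounded_linear (\<phi> :: 'h \<times> 'h \<Rightarrow> real)" shows "\<exists>y. \<forall>z. \<phi> z = y \<bullet> z"
proof -
  have "bounded_linear (\<lambda>x. \<phi> (x, 0))"
    by (rule bounded_linear_compose[OF l]) (intro bounded_linear_Pair bounded_linear_ident bounded_linear_zero)
  then obtain u where u: "\<And>x. \<phi> (x, 0) = u \<bullet> x" using riesz_repr by blast
  have "bounded_linear (\<lambda>x. \<phi> (0, x))"
    by (rule bounded_linear_compose[OF l]) (intro bounded_linear_Pair bounded_linear_ident bounded_linear_zero)
  then obtain v where v: "\<And>x. \<phi> (0, x) = v \<bullet> x" using riesz_repr by blast
  have "\<phi> z = (u, v) \<bullet> z" for z
    using linear_add[OF bounded_linear.linear[OF l], of "(fst z, 0)" "(0, snd z)"] u v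
    by (simp add: inner_prod_def)
  then show ?thesis by blast
qed

lemma functional_repr:
  assumes lin: "\<And>x U y V. \<psi> (\<lambda>i. x *\<^sub>R U i + y *\<^sub>R V i) = x * \<psi> U + y * \<psi> V"
    and bd: "\<And>U. \<bar>\<psi> U\<bar> \<le> B * tot U"
  shows "\<exists>Y. \<forall>V. \<psi> V = ip Y V"
proof -
  have cong: "\<psi> U = \<psi> V" if "\<And>i. i \<in> {1..N} \<Longrightarrow> U i = V i" for U V
  proof -
    have "tot (\<lambda>i. 1 *\<^sub>R U i + (- 1) *\<^sub>R V i) = 0" using that by (simp add: tot_def)
    then show ?thesis using bd[of "\<lambda>i. 1 *\<^sub>R U i + (- 1) *\<^sub>R V i"] lin[of 1 U "- 1" V] by simp
  qed
  have "\<exists>y. \<forall>z. \<psi> (single k z) = y \<bullet> z" if k: "k \<in> {1..N}" for k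
  proof (rule riesz_pair, rule bounded_linear_intro[where K=B])
    have s: "single k (x *\<^sub>R y + r *\<^sub>R z) = (\<lambda>i. x *\<^sub>R single k y i + r *\<^sub>R single k z i)" for x y r z
      by (auto simp: single_def)
    show "\<psi> (single k (y + z)) = \<psi> (single k y) + \<psi> (single k z)" for y z
      using lin[of 1 "single k y" 1 "single k z"] s[of 1 y 1 z] by simp
    show "\<psi> (single k (r *\<^sub>R z)) = r *\<^sub>R \<psi> (single k z)" for r z
      using lin[of r "single k z" 0 "single k z"] s[of r z 0 z] by simp
    show "norm (\<psi> (single k z)) \<le> norm z * B" for z
      using bd[of "single k z"] tot_single[OF k] by (simp add: mult.commute)
  qed
  then obtain Y where Y: "\<And>k z. k \<in> {1..N} \<Longrightarrow> \<psi> (single k z) = Y k \<bullet> z" by metis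
  have "n \<le> N \<Longrightarrow> \<psi> (\<lambda>i. if i \<in> {1..n} then V i else 0) = (\<Sum>i=1..n. Y i \<bullet> V i)" for n V
  proof (induction n)
    case 0
    show ?case using lin[of 0 "\<lambda>_. 0" 0 "\<lambda>_. 0"] by simp
  next
    case (Suc n)
    have "(\<lambda>i. if i \<in> {1..Suc n} then V i else 0) =
        (\<lambda>i. 1 *\<^sub>R (if i \<in> {1..n} then V i else 0) + 1 *\<^sub>R single (Suc n) (V (Suc n)) i)"
      by (auto simp: single_def)
    then have "\<psi> (\<lambda>i. if i \<in> {1..Suc n} then V i else 0) =
        1 * \<psi> (\<lambda>i. if i \<in> {1..n} then V i else 0) + 1 * \<psi> (single (Suc n) (V (Suc n)))"
      by (simp only: lin)
    then show ?case using Suc Y by simp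
  qed
  from this[OF order_refl] have "\<psi> V = ip Y V" for V
    using cong[of V "\<lambda>i. if i \<in> {1..N} then V i else 0"] by (simp add: ip_def)
  then show ?thesis by blast
qed

end

locale observed_cascade = cascade A \<epsilon> m c K cw N
  for A :: "'h::{real_inner, complete_space} operator" and \<epsilon> m c K cw N +
  fixes T :: real and p :: nat and G :: "nat \<Rightarrow> 'g::{real_inner, complete_space} set"
    and obs :: "(nat \<Rightarrow> 'h \<times> 'h) \<Rightarrow> nat \<Rightarrow> real \<Rightarrow> 'g" and D :: "(nat \<Rightarrow> 'h \<times> 'h) set"
  assumes T_pos: "0 < T"
    and G: "l \<le> p \<Longrightarrow> closed (G l)" "l \<le> p \<Longrightarrow> subspace (G l)" "l \<le> p \<Longrightarrow> obs U l t \<in> G l"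
    and obs_L2: "l \<le> p \<Longrightarrow> L2_fun T (obs U l)"
    and obs_lin: "l \<le> p \<Longrightarrow>
      L2_sq T (\<lambda>t. obs (\<lambda>i. x *\<^sub>R U i + y *\<^sub>R V i) l t - (x *\<^sub>R obs U l t + y *\<^sub>R obs V l t)) = 0"
    and obs_bound: "\<exists>M\<ge>0. \<forall>U. \<forall>l\<le>p. L2_sq T (obs U l) \<le> M * (tot U)\<^sup>2"
    and D_comb: "U \<in> D \<Longrightarrow> V \<in> D \<Longrightarrow> (\<lambda>i. x *\<^sub>R U i + y *\<^sub>R V i) \<in> D"
    and D_dense: "\<exists>V. (\<forall>k. V k \<in> D) \<and> (\<lambda>k::nat. tot (\<lambda>i. 1 *\<^sub>R U i + (- 1) *\<^sub>R V k i)) \<longlonglongrightarrow> 0"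
    and observable: "\<exists>C\<ge>0. \<forall>U\<in>D. (tot U)\<^sup>2 \<le> C * (\<Sum>l\<le>p. L2_sq T (obs U l))"
begin

lemma inner_obs_lin:
  assumes l: "l \<le> p" and w: "L2_fun T w"
  shows "(LINT t|lebesgue_on {0..T}. w t \<bullet> obs (\<lambda>i. x *\<^sub>R U i + y *\<^sub>R V i) l t) =
    x * (LINT t|lebesgue_on {0..T}. w t \<bullet> obs U l t) + y * (LINT t|lebesgue_on {0..T}. w t \<bullet> obs V l t)"
  using L2_inner_eq[OF w obs_L2[OF l] L2_fun_lin[OF obs_L2[OF l] obs_L2[OF l]] obs_lin[OF l]]
    L2_inner_lin[OF w obs_L2[OF l] obs_L2[OF l]] by simp

lemma inner_obs_le:
  "\<exists>M\<ge>0. \<forall>l\<le>p. \<forall>w U. L2_fun T w \<longrightarrow> \<bar>LINT t|lebesgue_on {0..T}. w t \<bullet> obs U l t\<bar> \<le> sqrt (L2_sq T w) * (M * tot U)"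
proof -
  obtain M where M: "M \<ge> 0" "\<And>U l. l \<le> p \<Longrightarrow> L2_sq T (obs U l) \<le> M * (tot U)\<^sup>2" using obs_bound by blast
  have "\<bar>LINT t|lebesgue_on {0..T}. w t \<bullet> obs U l t\<bar> \<le> sqrt (L2_sq T w) * (sqrt M * tot U)"
    if l: "l \<le> p" and w: "L2_fun T w" for l w U
  proof -
    have "sqrt (L2_sq T (obs U l)) \<le> sqrt M * tot U"
      using real_sqrt_le_mono[OF M(2)[OF l, of U]] tot_nonneg[of U] by (simp add: real_sqrt_mult)
    then show ?thesis
      using L2_cauchy_schwarz_abs[OF w obs_L2[OF l, of U]] by (meson L2_sq_nonneg mult_left_mono order_trans real_sqrt_ge_zero)
  qed
  then show ?thesis using M(1) by (intro exI[of _ "sqrt M"]) auto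
qed

lemma control_exists:
  "\<exists>v. (\<forall>l\<le>p. L2_fun T (v l) \<and> (\<forall>t. v l t \<in> G l)) \<and>
    (\<forall>U. (\<Sum>l\<le>p. LINT t|lebesgue_on {0..T}. v l t \<bullet> obs U l t) = - ip Z U)"
proof -
  define \<Lambda> where "\<Lambda> U V = (\<Sum>l\<le>p. LINT t|lebesgue_on {0..T}. obs U l t \<bullet> obs V l t)" for U V
  define \<phi> where "\<phi> U = - ip Z U" for U
  define comb where "comb x U y V = (\<lambda>i. x *\<^sub>R U i + y *\<^sub>R V i)" for x y :: real and U V :: "nat \<Rightarrow> 'h \<times> 'h"
  obtain C where C: "C \<ge> 0" "\<And>U. U \<in> D \<Longrightarrow> (tot U)\<^sup>2 \<le> C * (\<Sum>l\<le>p. L2_sq T (obs U l))" using observable by blast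
  have diag: "\<Lambda> U U = (\<Sum>l\<le>p. L2_sq T (obs U l))" for U
    by (simp add: \<Lambda>_def L2_sq_def power2_norm_eq_inner)
  have sym: "\<Lambda> U V = \<Lambda> V U" for U V by (simp add: \<Lambda>_def inner_commute)
  have lin': "\<Lambda> W (comb x U y V) = x * \<Lambda> W U + y * \<Lambda> W V" for W U V x y
    unfolding \<Lambda>_def comb_def sum_distrib_left sum.distrib[symmetric]
    by (intro sum.cong refl inner_obs_lin obs_L2) auto
  obtain V0 where V0: "V0 \<in> D" using D_dense by blast
  have ineq: "(\<phi> U)\<^sup>2 \<le> ((tot Z)\<^sup>2 * C) * \<Lambda> U U" if "U \<in> D" for U
  proof -
    have "(\<phi> U)\<^sup>2 = \<bar>ip Z U\<bar>\<^sup>2" by (simp add: \<phi>_def)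
    also have "\<dots> \<le> (tot Z * tot U)\<^sup>2" by (intro power_mono abs_ip_le) simp
    also have "\<dots> = (tot Z)\<^sup>2 * (tot U)\<^sup>2" by (simp add: power_mult_distrib)
    also have "\<dots> \<le> (tot Z)\<^sup>2 * (C * \<Lambda> U U)" unfolding diag by (intro mult_left_mono C(2) that) simp
    finally show ?thesis by (simp add: mult.assoc)
  qed
  have "\<exists>u::nat \<Rightarrow> nat \<Rightarrow> 'h \<times> 'h. (\<forall>k. u k \<in> D) \<and>
    (\<forall>e>0. \<exists>n. \<forall>i\<ge>n. \<forall>j\<ge>n. \<Lambda> (comb 1 (u i) (- 1) (u j)) (comb 1 (u i) (- 1) (u j)) < e) \<and>
    (\<forall>z\<in>D. (\<lambda>k. \<Lambda> (u k) z) \<longlonglongrightarrow> \<phi> z)"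
  proof (rule quadratic_minimizing_sequence[OF V0, where C="(tot Z)\<^sup>2 * C"])
    show "comb a x b y \<in> D" if "x \<in> D" "y \<in> D" for a x b y unfolding comb_def by (rule D_comb[OF that])
    show "\<Lambda> x y = \<Lambda> y x" for x y by (rule sym)
    show "\<Lambda> (comb a x b y) z = a * \<Lambda> x z + b * \<Lambda> y z" for a x b y z
      using lin'[of z a x b y] by (simp only: sym[of _ z])
    show "\<phi> (comb a x b y) = a * \<phi> x + b * \<phi> y" for a x b y
      unfolding \<phi>_def comb_def ip_lin by simp
    show "0 \<le> \<Lambda> x x" for x unfolding diag by (intro sum_nonneg) simp
    show "0 \<le> (tot Z)\<^sup>2 * C" using C(1) by simp
    show "(\<phi> x)\<^sup>2 \<le> (tot Z)\<^sup>2 * C * \<Lambda> x x" if "x \<in> D" for x by (rule ineq[OF that])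
  qed
  then obtain u where u: "\<And>k::nat. u k \<in> D"
    and cau: "\<And>e. e > 0 \<Longrightarrow> \<exists>n. \<forall>i\<ge>n. \<forall>j\<ge>n. \<Lambda> (comb 1 (u i) (- 1) (u j)) (comb 1 (u i) (- 1) (u j)) < e"
    and lim: "\<And>z. z \<in> D \<Longrightarrow> (\<lambda>k. \<Lambda> (u k) z) \<longlonglongrightarrow> \<phi> z" by blast
  have "\<exists>g. L2_fun T g \<and> (\<forall>t. g t \<in> G l) \<and> (\<lambda>k. L2_sq T (\<lambda>t. obs (u k) l t - g t)) \<longlonglongrightarrow> 0" if l: "l \<le> p" for l
  proof (rule L2_complete[OF obs_L2[OF l] _ G(1)[OF l] G(2)[OF l] G(3)[OF l]])
    fix e :: real assume "e > 0"
    then obtain n where n: "\<And>i j. i \<ge> n \<Longrightarrow> j \<ge> n \<Longrightarrow> \<Lambda> (comb 1 (u i) (- 1) (u j)) (comb 1 (u i) (- 1) (u j)) < e/2"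
      using cau[of "e/2"] by (auto simp del: neq0_conv)
    have "L2_sq T (\<lambda>t. obs (u i) l t - obs (u j) l t) < e" if "i \<ge> n" "j \<ge> n" for i j
    proof -
      have "L2_sq T (\<lambda>t. obs (u i) l t - obs (u j) l t) \<le> 2 * L2_sq T (obs (comb 1 (u i) (- 1) (u j)) l) +
          2 * L2_sq T (\<lambda>t. (obs (u i) l t - obs (u j) l t) - obs (comb 1 (u i) (- 1) (u j)) l t)"
        by (rule L2_sq_le2[OF L2_fun_diff[OF obs_L2[OF l] obs_L2[OF l]] obs_L2[OF l]])
      moreover have "L2_sq T (\<lambda>t. (obs (u i) l t - obs (u j) l t) - obs (comb 1 (u i) (- 1) (u j)) l t) = 0"
        using obs_lin[OF l, of 1 "u i" "- 1" "u j"] by (subst L2_sq_commute) (simp add: comb_def)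
      moreover have "L2_sq T (obs (comb 1 (u i) (- 1) (u j)) l) \<le> \<Lambda> (comb 1 (u i) (- 1) (u j)) (comb 1 (u i) (- 1) (u j))"
        unfolding diag by (rule member_le_sum) (use l in auto)
      ultimately show ?thesis using n[OF that] by linarith
    qed
    then show "\<exists>N. \<forall>i\<ge>N. \<forall>j\<ge>N. L2_sq T (\<lambda>t. obs (u i) l t - obs (u j) l t) < e" by blast
  qed
  then have "\<forall>l. \<exists>g. l \<le> p \<longrightarrow> L2_fun T g \<and> (\<forall>t. g t \<in> G l) \<and> (\<lambda>k. L2_sq T (\<lambda>t. obs (u k) l t - g t)) \<longlonglongrightarrow> 0"
    by blast
  from choice[OF this] obtain v where v': "\<forall>l. l \<le> p \<longrightarrow> L2_fun T (v l) \<and> (\<forall>t. v l t \<in> G l) \<and>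
    (\<lambda>k. L2_sq T (\<lambda>t. obs (u k) l t - v l t)) \<longlonglongrightarrow> 0" ..
  have v: "\<And>l. l \<le> p \<Longrightarrow> L2_fun T (v l)" "\<And>l t. l \<le> p \<Longrightarrow> v l t \<in> G l"
    "\<And>l. l \<le> p \<Longrightarrow> (\<lambda>k. L2_sq T (\<lambda>t. obs (u k) l t - v l t)) \<longlonglongrightarrow> 0" using v' by blast+
  define \<theta> where "\<theta> U = (\<Sum>l\<le>p. LINT t|lebesgue_on {0..T}. v l t \<bullet> obs U l t)" for U
  have onD: "\<theta> V = \<phi> V" if V: "V \<in> D" for V
  proof -
    have "(\<lambda>k. \<Lambda> V (u k)) \<longlonglongrightarrow> (\<Sum>l\<le>p. LINT t|lebesgue_on {0..T}. obs V l t \<bullet> v l t)"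
      unfolding \<Lambda>_def by (intro tendsto_sum L2_inner_tendsto obs_L2 v) auto
    then have "(\<lambda>k. \<Lambda> (u k) V) \<longlonglongrightarrow> \<theta> V" by (simp add: sym[of V] \<theta>_def inner_commute)
    then show ?thesis using lim[OF V] LIMSEQ_unique by blast
  qed
  obtain M where M: "M \<ge> 0" "\<And>l w U. l \<le> p \<Longrightarrow> L2_fun T w \<Longrightarrow>
    \<bar>LINT t|lebesgue_on {0..T}. w t \<bullet> obs U l t\<bar> \<le> sqrt (L2_sq T w) * (M * tot U)" using inner_obs_le by blast
  define B where "B = (\<Sum>l\<le>p. sqrt (L2_sq T (v l)) * M)"
  have \<theta>b: "\<bar>\<theta> U\<bar> \<le> B * tot U" for U
  proof -
    have "\<bar>\<theta> U\<bar> \<le> (\<Sum>l\<le>p. \<bar>LINT t|lebesgue_on {0..T}. v l t \<bullet> obs U l t\<bar>)" unfolding \<theta>_def by (rule sum_abs)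
    also have "\<dots> \<le> (\<Sum>l\<le>p. sqrt (L2_sq T (v l)) * (M * tot U))" by (intro sum_mono M(2) v) auto
    finally show ?thesis by (simp add: B_def sum_distrib_right mult.assoc)
  qed
  have \<theta>lin: "\<theta> (\<lambda>i. x *\<^sub>R U i + y *\<^sub>R V i) = x * \<theta> U + y * \<theta> V" for x U y V
    unfolding \<theta>_def sum_distrib_left sum.distrib[symmetric] by (intro sum.cong refl inner_obs_lin v) auto
  have "\<theta> U = - ip Z U" for U
  proof -
    obtain V where V: "\<And>k. V k \<in> D" "(\<lambda>k::nat. tot (\<lambda>i. 1 *\<^sub>R U i + (- 1) *\<^sub>R V k i)) \<longlonglongrightarrow> 0"
      using D_dense[of U] by blast
    have d: "\<bar>\<theta> U - \<phi> U\<bar> \<le> (B + tot Z) * tot (\<lambda>i. 1 *\<^sub>R U i + (- 1) *\<^sub>R V k i)" for k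
    proof -
      have "\<theta> U - \<phi> U = \<theta> (\<lambda>i. 1 *\<^sub>R U i + (- 1) *\<^sub>R V k i) + ip Z (\<lambda>i. 1 *\<^sub>R U i + (- 1) *\<^sub>R V k i)"
        unfolding \<theta>lin ip_lin using onD[OF V(1)[of k]] by (simp add: \<phi>_def)
      then show ?thesis
        using \<theta>b[of "\<lambda>i. 1 *\<^sub>R U i + (- 1) *\<^sub>R V k i"] abs_ip_le[of Z "\<lambda>i. 1 *\<^sub>R U i + (- 1) *\<^sub>R V k i"]
        unfolding distrib_right by linarith
    qed
    have "(\<lambda>k. (B + tot Z) * tot (\<lambda>i. 1 *\<^sub>R U i + (- 1) *\<^sub>R V k i)) \<longlonglongrightarrow> (B + tot Z) * 0"
      by (intro tendsto_intros V)
    then have "\<bar>\<theta> U - \<phi> U\<bar> \<le> (B + tot Z) * 0" by (rule LIMSEQ_le_const) (use d in auto)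
    then show ?thesis by (simp add: \<phi>_def)
  qed
  then show ?thesis using v(1,2) unfolding \<theta>_def by blast
qed

lemma sets_initial: "t \<in> {0..T} \<Longrightarrow> {0..t} \<in> sets (lebesgue_on {0..T})"
  by (subst sets_restrict_space_iff) auto

lemma integrable_initial:
  assumes v: "L2_fun T v" and t: "t \<in> {0..T}"
  shows "integrable (lebesgue_on {0..T}) (\<lambda>s. indicator {0..t} s * (norm (v s))\<^sup>2)"
  using integrable_mult_indicator[OF sets_initial[OF t], of "\<lambda>s. (norm (v s))\<^sup>2"] v by (simp add: L2_fun_iff)

lemma indicator_L2:
  assumes v: "L2_fun T v" and t: "t \<in> {0..T}"
  shows "L2_fun T (\<lambda>s. indicator {0..t} s *\<^sub>R v s)"
proof -
  have sm: "strongly_measurable T (\<lambda>s. indicator {0..t} s :: real)"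
    by (intro strongly_measurable_simple simple_function_indicator sets_initial t)
  have "strongly_measurable T (\<lambda>s. indicator {0..t} s *\<^sub>R v s)"
    using v sm by (intro strongly_measurable_comp[where h="\<lambda>x y. x *\<^sub>R y"]) (auto simp: L2_fun_iff intro: tendsto_scaleR)
  moreover have "integrable (lebesgue_on {0..T}) (\<lambda>s. indicator {0..t} s * (norm (v s))\<^sup>2)"
    by (rule integrable_initial[OF v t])
  moreover have "(\<lambda>s. (norm (indicator {0..t} s *\<^sub>R v s))\<^sup>2) = (\<lambda>s. indicator {0..t} s * (norm (v s))\<^sup>2)"
    by (auto simp: indicator_def)
  ultimately show ?thesis by (simp add: L2_fun_iff)
qed

lemma restrict_LINT:
  fixes f :: "real \<Rightarrow> real"
  assumes t: "t \<in> {0..T}"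
  shows "(LINT s|lebesgue_on {0..t}. f s) = (LINT s|lebesgue_on {0..T}. indicator {0..t} s * f s)"
proof -
  have "(LINT s|lebesgue_on {0..t}. f s) = (LINT s|lebesgue. indicator {0..t} s *\<^sub>R f s)"
    by (rule integral_restrict_space) simp
  also have "\<dots> = (LINT s|lebesgue. indicator {0..T} s *\<^sub>R (indicator {0..t} s * f s))"
    by (rule Bochner_Integration.integral_cong) (use t in \<open>auto simp: indicator_def\<close>)
  also have "\<dots> = (LINT s|lebesgue_on {0..T}. indicator {0..t} s * f s)"
    by (rule integral_restrict_space[symmetric]) simp
  finally show ?thesis .
qed

lemma L2_sq_indicator_diff:
  assumes v: "L2_fun T v" and st: "s \<in> {0..T}" "t \<in> {0..T}"
  shows "L2_sq T (\<lambda>r. indicator {0..t} r *\<^sub>R v r - indicator {0..s} r *\<^sub>R v r) = \<bar>L2_sq t v - L2_sq s v\<bar>"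
proof -
  have i: "integrable (lebesgue_on {0..T}) (\<lambda>r. indicator {0..x} r * (norm (v r))\<^sup>2)" if "x \<in> {0..T}" for x
    by (rule integrable_initial[OF v that])
  have *: "L2_sq T (\<lambda>r. indicator {0..t} r *\<^sub>R v r - indicator {0..s} r *\<^sub>R v r) = L2_sq t v - L2_sq s v"
    if st: "s \<in> {0..T}" "t \<in> {0..T}" "s \<le> t" for s t
  proof -
    have "(norm (indicator {0..t} r *\<^sub>R v r - indicator {0..s} r *\<^sub>R v r))\<^sup>2 =
        indicator {0..t} r * (norm (v r))\<^sup>2 - indicator {0..s} r * (norm (v r))\<^sup>2" for r
      using that by (auto simp: indicator_def)
    then show ?thesis unfolding L2_sq_def restrict_LINT[OF st(1)] restrict_LINT[OF st(2)] using i st by simp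
  qed
  show ?thesis
  proof (cases "s \<le> t")
    case True
    then show ?thesis using *[OF st True] L2_sq_nonneg[of T "\<lambda>r. indicator {0..t} r *\<^sub>R v r - indicator {0..s} r *\<^sub>R v r"] by simp
  next
    case False
    then show ?thesis using *[of t s] st
        L2_sq_nonneg[of T "\<lambda>r. indicator {0..s} r *\<^sub>R v r - indicator {0..t} r *\<^sub>R v r"]
      by (subst L2_sq_commute) simp
  qed
qed

lemma transposed_state_exists:
  assumes v: "\<And>l. l \<le> p \<Longrightarrow> L2_fun T (v l)"
  shows "\<exists>Y. (\<forall>i\<in>{1..N}. Y 0 i = Z i \<and> continuous_on {0..T} (\<lambda>t. Y t i)) \<and>
    (\<forall>t\<in>{0..T}. \<forall>U. ip (Y t) (flow t U) = ip Z U + (\<Sum>l\<le>p. LINT s|lebesgue_on {0..t}. v l s \<bullet> obs U l s))"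
proof -
  define vt where "vt t l s = (indicator {0..t} s :: real) *\<^sub>R v l s" for t l s
  have vtL: "L2_fun T (vt t l)" if "l \<le> p" "t \<in> {0..T}" for t l
    unfolding vt_def[abs_def] by (rule indicator_L2[OF v[OF that(1)] that(2)])
  define \<theta> where "\<theta> t U = ip Z U + (\<Sum>l\<le>p. LINT s|lebesgue_on {0..T}. vt t l s \<bullet> obs U l s)" for t U
  have \<theta>eq: "\<theta> t U = ip Z U + (\<Sum>l\<le>p. LINT s|lebesgue_on {0..t}. v l s \<bullet> obs U l s)" if "t \<in> {0..T}" for t U
    unfolding \<theta>_def vt_def restrict_LINT[OF that] by simp
  have \<theta>lin: "\<theta> t (\<lambda>i. x *\<^sub>R U i + y *\<^sub>R V i) = x * \<theta> t U + y * \<theta> t V" if t: "t \<in> {0..T}" for t x U y V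
  proof -
    have "(\<Sum>l\<le>p. LINT s|lebesgue_on {0..T}. vt t l s \<bullet> obs (\<lambda>i. x *\<^sub>R U i + y *\<^sub>R V i) l s) =
        x * (\<Sum>l\<le>p. LINT s|lebesgue_on {0..T}. vt t l s \<bullet> obs U l s) + y * (\<Sum>l\<le>p. LINT s|lebesgue_on {0..T}. vt t l s \<bullet> obs V l s)"
      unfolding sum_distrib_left sum.distrib[symmetric] by (intro sum.cong refl inner_obs_lin vtL t) auto
    then show ?thesis unfolding \<theta>_def ip_lin by (simp add: algebra_simps)
  qed
  obtain M where M: "M \<ge> 0" "\<And>l w U. l \<le> p \<Longrightarrow> L2_fun T w \<Longrightarrow>
    \<bar>LINT t|lebesgue_on {0..T}. w t \<bullet> obs U l t\<bar> \<le> sqrt (L2_sq T w) * (M * tot U)" using inner_obs_le by blast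
  define B where "B t = tot Z + (\<Sum>l\<le>p. sqrt (L2_sq T (vt t l)) * M)" for t
  have \<theta>b: "\<bar>\<theta> t U\<bar> \<le> B t * tot U" if t: "t \<in> {0..T}" for t U
  proof -
    have "\<bar>\<theta> t U\<bar> \<le> \<bar>ip Z U\<bar> + (\<Sum>l\<le>p. \<bar>LINT s|lebesgue_on {0..T}. vt t l s \<bullet> obs U l s\<bar>)"
      unfolding \<theta>_def by (rule order_trans[OF abs_triangle_ineq add_left_mono[OF sum_abs]])
    also have "\<dots> \<le> tot Z * tot U + (\<Sum>l\<le>p. sqrt (L2_sq T (vt t l)) * (M * tot U))"
      by (intro add_mono abs_ip_le sum_mono M(2) vtL t) auto
    finally show ?thesis by (simp add: B_def sum_distrib_right distrib_right mult.assoc)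
  qed
  obtain F where F: "F \<ge> 0" "\<And>t U i. \<bar>t\<bar> \<le> T \<Longrightarrow> i \<in> {1..N} \<Longrightarrow> norm (flow t U i) \<le> F * tot U"
    using flow_tot_bound[of T] by blast
  have tf: "tot (flow t U) \<le> real N * F * tot U" if "\<bar>t\<bar> \<le> T" for t U
  proof -
    have "tot (flow t U) \<le> (\<Sum>i=1..N. F * tot U)" unfolding tot_def[of "flow t U"] by (intro sum_mono F(2) that)
    then show ?thesis by simp
  qed
  define \<psi> where "\<psi> t V = \<theta> t (flow (- t) V)" for t V
  have \<theta>cong: "\<theta> t U = \<theta> t V" if t: "t \<in> {0..T}" and eq: "\<And>i. i \<in> {1..N} \<Longrightarrow> U i = V i" for t U V
  proof -
    have "tot (\<lambda>i. 1 *\<^sub>R U i + (- 1) *\<^sub>R V i) = 0" using eq by (simp add: tot_def)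
    then show ?thesis using \<theta>b[OF t, of "\<lambda>i. 1 *\<^sub>R U i + (- 1) *\<^sub>R V i"] \<theta>lin[OF t, of 1 U "- 1" V] by simp
  qed
  have "\<exists>Y. \<forall>V. \<psi> t V = ip Y V" if t: "t \<in> {0..T}" for t
  proof (rule functional_repr[where B="B t * (real N * F)"])
    show "\<psi> t (\<lambda>i. x *\<^sub>R U i + y *\<^sub>R V i) = x * \<psi> t U + y * \<psi> t V" for x U y V
      unfolding \<psi>_def \<theta>lin[OF t, symmetric] by (rule \<theta>cong[OF t flow_lin])
    have B0: "B t \<ge> 0" using M(1) tot_nonneg[of Z] by (simp add: B_def sum_nonneg)
    show "\<bar>\<psi> t V\<bar> \<le> B t * (real N * F) * tot V" for V
    proof -
      have "\<bar>\<psi> t V\<bar> \<le> B t * tot (flow (- t) V)" unfolding \<psi>_def by (rule \<theta>b[OF t])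
      also have "\<dots> \<le> B t * (real N * F * tot V)" using t by (intro mult_left_mono tf B0) auto
      finally show ?thesis by (simp add: mult.assoc)
    qed
  qed
  then obtain Y where Y: "\<And>t V. t \<in> {0..T} \<Longrightarrow> \<psi> t V = ip (Y t) V" by metis
  have main: "ip (Y t) (flow t U) = \<theta> t U" if t: "t \<in> {0..T}" for t U
  proof -
    have "ip (Y t) (flow t U) = \<theta> t (flow (- t) (flow t U))" using Y[OF t] by (simp add: \<psi>_def)
    also have "\<dots> = \<theta> t U" by (rule \<theta>cong[OF t]) (simp add: flow_flow flow_0)
    finally show ?thesis .
  qed
  have Y0: "Y 0 i = Z i" if i: "i \<in> {1..N}" for i
  proof (rule ip_ext[OF _ i])
    fix V
    have 0: "0 \<in> {0..T}" using T_pos by simp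
    have "(LINT s|lebesgue_on {0..0}. v l s \<bullet> obs V l s) = 0" if "l \<le> p" for l
    proof -
      have "integrable (lebesgue_on {0..0}) (\<lambda>s. v l s \<bullet> obs V l s)"
        using T_pos by (intro L2_inner_integrable L2_restrict(1)[OF v[OF that]] L2_restrict(1)[OF obs_L2[OF that]]) auto
      then show ?thesis by (subst lebesgue_integral_eq_integral) auto
    qed
    then have "\<theta> 0 V = ip Z V" using \<theta>eq[OF 0] by simp
    moreover have "ip (Y 0) V = \<theta> 0 (flow 0 V)" using Y[OF 0, of V] by (simp add: \<psi>_def)
    moreover have "\<theta> 0 (flow 0 V) = \<theta> 0 V" by (rule \<theta>cong[OF 0 flow_0])
    ultimately show "ip (Y 0) V = ip Z V" by simp
  qed
  have cont: "continuous_on {0..T} (\<lambda>t. Y t k)" if k: "k \<in> {1..N}" for k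
    unfolding continuous_on_iff
  proof (intro ballI allI impI)
    fix s and e :: real assume s: "s \<in> {0..T}" and e: "e > 0"
    obtain Q where Q: "\<And>U. \<theta> s U = ip Q U"
      using functional_repr[of "\<theta> s" "B s", OF \<theta>lin[OF s] \<theta>b[OF s]] by blast
    define e1 where "e1 = e / (2 * real N + 2)"
    have e1: "e1 > 0" using e by (simp add: e1_def)
    have "\<exists>d>0. \<forall>t. t \<in> {0..T} \<longrightarrow> \<bar>t - s\<bar> < d \<longrightarrow> (\<forall>U. \<bar>Q i \<bullet> (flow (- t) U i - flow (- s) U i)\<bar> \<le> e1 * tot U)" if i: "i \<in> {1..N}" for i
    proof -
      obtain d where d: "d > 0" "\<And>r t U. \<bar>r\<bar> \<le> T \<Longrightarrow> \<bar>t\<bar> \<le> T \<Longrightarrow> \<bar>r - t\<bar> < d \<Longrightarrow> \<bar>Q i \<bullet> (flow r U i - flow t U i)\<bar> \<le> e1 * tot U"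
        using weakly_uniform_all[OF i, of T "Q i"] e1 unfolding weakly_uniform_def by blast
      show ?thesis by (rule exI[of _ d]) (use d s in auto)
    qed
    then obtain d where d: "\<And>i. i \<in> {1..N} \<Longrightarrow> d i > 0"
      "\<And>i t U. i \<in> {1..N} \<Longrightarrow> t \<in> {0..T} \<Longrightarrow> \<bar>t - s\<bar> < d i \<Longrightarrow> \<bar>Q i \<bullet> (flow (- t) U i - flow (- s) U i)\<bar> \<le> e1 * tot U"
      by metis
    define dm where "dm = Min (d ` {1..N})"
    have dm: "dm > 0" "\<And>i. i \<in> {1..N} \<Longrightarrow> dm \<le> d i" using d(1) k by (auto simp: dm_def)
    define R where "R t = (\<Sum>l\<le>p. sqrt \<bar>L2_sq t (v l) - L2_sq s (v l)\<bar> * M) * (real N * F)" for t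
    have R0: "R t \<ge> 0" for t using M(1) F(1) by (auto simp: R_def intro!: mult_nonneg_nonneg sum_nonneg)
    have Rc: "continuous_on {0..T} R"
    proof -
      have "continuous_on {0..T} (\<lambda>t. L2_sq t (v l))" if "l \<le> p" for l
        unfolding L2_sq_def using v[OF that] T_pos
        by (intro indefinite_integral_continuous_real) (auto simp: L2_fun_iff)
      then show ?thesis unfolding R_def by (intro continuous_intros) auto
    qed
    have "R s = 0" by (simp add: R_def)
    then obtain dr where dr: "dr > 0" "\<And>t. t \<in> {0..T} \<Longrightarrow> dist t s < dr \<Longrightarrow> R t < e/2"
      using Rc s e R0 unfolding continuous_on_iff by (metis abs_of_nonneg diff_zero dist_real_def half_gt_zero)
    have "dist (Y t k) (Y s k) < e" if t: "t \<in> {0..T}" and ts: "dist t s < min dm dr" for t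
    proof -
      define z where "z = Y t k - Y s k"
      define W where "W = single k z"
      have tW: "tot W = norm z" unfolding W_def by (rule tot_single[OF k])
      have "norm z * norm z = \<psi> t W - \<psi> s W"
        unfolding Y[OF t] Y[OF s] W_def ip_single[OF k] inner_diff_left[symmetric]
        by (simp add: z_def[symmetric] power2_norm_eq_inner[unfolded power2_eq_square])
      also have "\<dots> = (\<theta> t (flow (- t) W) - \<theta> s (flow (- t) W)) + (\<theta> s (flow (- t) W) - \<theta> s (flow (- s) W))"
        by (simp add: \<psi>_def)
      also have "\<theta> s (flow (- t) W) - \<theta> s (flow (- s) W) = (\<Sum>i=1..N. Q i \<bullet> (flow (- t) W i - flow (- s) W i))"
        unfolding Q ip_def by (simp add: inner_diff_right sum_subtractf)
      also have "\<dots> \<le> (\<Sum>i=1..N. e1 * norm z)"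
      proof (rule sum_mono)
        fix i assume i: "i \<in> {1..N}"
        have "\<bar>Q i \<bullet> (flow (- t) W i - flow (- s) W i)\<bar> \<le> e1 * tot W"
          by (rule d(2)[OF i t]) (use ts dm(2)[OF i] in \<open>simp add: dist_real_def\<close>)
        then show "Q i \<bullet> (flow (- t) W i - flow (- s) W i) \<le> e1 * norm z" by (simp add: tW)
      qed
      also have "\<theta> t (flow (- t) W) - \<theta> s (flow (- t) W) \<le> R t * norm z"
      proof -
        define X where "X = flow (- t) W"
        have "\<theta> t X - \<theta> s X = (\<Sum>l\<le>p. LINT r|lebesgue_on {0..T}. (vt t l r - vt s l r) \<bullet> obs X l r)"
        proof -
          have "(LINT r|lebesgue_on {0..T}. (vt t l r - vt s l r) \<bullet> obs X l r) =
              (LINT r|lebesgue_on {0..T}. vt t l r \<bullet> obs X l r) - (LINT r|lebesgue_on {0..T}. vt s l r \<bullet> obs X l r)" if "l \<le> p" for l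
            using L2_inner_integrable[OF vtL[OF that t] obs_L2[OF that]] L2_inner_integrable[OF vtL[OF that s] obs_L2[OF that]]
            by (simp add: inner_diff_left)
          then show ?thesis by (simp add: \<theta>_def sum_subtractf)
        qed
        also have "\<dots> \<le> (\<Sum>l\<le>p. sqrt \<bar>L2_sq t (v l) - L2_sq s (v l)\<bar> * (M * tot X))"
        proof (rule sum_mono)
          fix l assume "l \<in> {..p}"
          then have l: "l \<le> p" by simp
          have "\<bar>LINT r|lebesgue_on {0..T}. (vt t l r - vt s l r) \<bullet> obs X l r\<bar> \<le> sqrt (L2_sq T (\<lambda>r. vt t l r - vt s l r)) * (M * tot X)"
            by (rule M(2)[OF l L2_fun_diff[OF vtL[OF l t] vtL[OF l s]]])
          also have "L2_sq T (\<lambda>r. vt t l r - vt s l r) = \<bar>L2_sq t (v l) - L2_sq s (v l)\<bar>"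
            unfolding vt_def by (rule L2_sq_indicator_diff[OF v[OF l] s t])
          finally show "(LINT r|lebesgue_on {0..T}. (vt t l r - vt s l r) \<bullet> obs X l r) \<le> sqrt \<bar>L2_sq t (v l) - L2_sq s (v l)\<bar> * (M * tot X)"
            by (rule order_trans[OF abs_ge_self])
        qed
        also have "\<dots> = (\<Sum>l\<le>p. sqrt \<bar>L2_sq t (v l) - L2_sq s (v l)\<bar> * M) * tot X"
          by (simp add: sum_distrib_right mult.assoc)
        also have "\<dots> \<le> (\<Sum>l\<le>p. sqrt \<bar>L2_sq t (v l) - L2_sq s (v l)\<bar> * M) * (real N * F * norm z)"
          using tf[of "- t" W] t M(1) by (intro mult_left_mono sum_nonneg) (auto simp: X_def tW)
        finally show ?thesis by (simp add: R_def X_def mult.assoc)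
      qed
      finally have "norm z * norm z \<le> (R t + real N * e1) * norm z" by (simp add: algebra_simps)
      then have "norm z \<le> R t + real N * e1"
        using R0[of t] e1 by (cases "norm z = 0") (auto simp: mult_le_cancel_right)
      also have "\<dots> < e/2 + e/2"
      proof (rule add_less_le_mono)
        show "R t < e/2" using dr(2)[OF t] ts by simp
        show "real N * e1 \<le> e/2" using e by (simp add: e1_def field_simps)
      qed
      finally show ?thesis by (simp add: z_def dist_norm)
    qed
    then show "\<exists>d>0. \<forall>t\<in>{0..T}. dist t s < d \<longrightarrow> dist (Y t k) (Y s k) < e"
      using dm(1) dr(1) by (intro exI[of _ "min dm dr"]) auto
  qed
  show ?thesis using Y0 cont main \<theta>eq by (intro exI[of _ Y]) auto
qed

end

section \<open>Cascades at a given regularity level\<close>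

context eigenbasis
begin

lemma bounded_on_H_conjugate:
  assumes b: "bounded_on_H A k R" and k: "0 \<le> k" and l: "l \<le> k"
  shows "bounded_linear (\<lambda>g. hpow A l (R (hpow A (- k) g)))" "\<And>g. R (hpow A (- k) g) \<in> Hdom A l"
proof -
  have lin: "lin_on (Hdom A k) R" and im: "R ` Hdom A k \<subseteq> Hdom A k" using b by (auto simp: bounded_on_H_def)
  obtain M where M: "\<And>u. u \<in> Hdom A k \<Longrightarrow> norm (hpow A k (R u)) \<le> M * norm (hpow A k u)"
    using b by (auto simp: bounded_on_H_def)
  have ink: "hpow A (- k) g \<in> Hdom A k" for g by (rule hpow_neg_in[OF k])
  have Rk: "R (hpow A (- k) g) \<in> Hdom A k" for g using im ink by blast
  show Rl: "R (hpow A (- k) g) \<in> Hdom A l" for g using Rk Hdom_mono[OF l] by blast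
  note lk = bounded_linear.linear[OF hpow_bounded_linear[of "- k"]]
  have eq: "hpow A l (R (hpow A (- k) g)) = hpow A (l - k) (hpow A k (R (hpow A (- k) g)))" for g
    using hpow_hpow[OF Rk[of g], where l="l - k"] Rl[of g] by simp
  show "bounded_linear (\<lambda>g. hpow A l (R (hpow A (- k) g)))"
    unfolding eq
  proof (rule bounded_linear_compose[OF hpow_bounded_linear])
    show "l - k \<le> 0" using l by simp
    show "bounded_linear (\<lambda>g. hpow A k (R (hpow A (- k) g)))"
    proof (rule bounded_linear_intro[where K=M])
      show "hpow A k (R (hpow A (- k) (x + y))) = hpow A k (R (hpow A (- k) x)) + hpow A k (R (hpow A (- k) y))" for x y
      proof -
        have "R (1 *\<^sub>R hpow A (- k) x + 1 *\<^sub>R hpow A (- k) y) = 1 *\<^sub>R R (hpow A (- k) x) + 1 *\<^sub>R R (hpow A (- k) y)"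
          using lin ink unfolding lin_on_def by blast
        then show ?thesis using k by (simp add: linear_add[OF lk] hpow_add[OF Rk Rk])
      qed
      show "hpow A k (R (hpow A (- k) (r *\<^sub>R x))) = r *\<^sub>R hpow A k (R (hpow A (- k) x))" for r x
      proof -
        have "R (r *\<^sub>R hpow A (- k) x + 0 *\<^sub>R hpow A (- k) x) = r *\<^sub>R R (hpow A (- k) x) + 0 *\<^sub>R R (hpow A (- k) x)"
          using lin ink unfolding lin_on_def by blast
        then show ?thesis using k by (simp add: linear_cmul[OF lk] hpow_scaleR[OF Rk])
      qed
      show "norm (hpow A k (R (hpow A (- k) x))) \<le> norm x * M" for x
        using M[OF ink, of x] hpow_onto[OF refl k, of x] by (simp add: mult.commute)
    qed
  qed
qed

lemma coupling_repr:
  assumes b: "bounded_on_H A (1 - k) R" and k: "k \<le> 1" and l: "- l \<le> 1 - k"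
  shows "\<exists>K. bounded_linear K \<and> (\<forall>h. \<forall>v\<in>smooth_vec A. R v \<in> Hdom A (- l) \<and> emb l h (R v) = K h \<bullet> hpow A (1 - k) v)"
proof -
  have k0: "0 \<le> 1 - k" using k by simp
  obtain K where K: "bounded_linear K" "\<And>h g. h \<bullet> hpow A (- l) (R (hpow A (- (1 - k)) g)) = K h \<bullet> g"
    using adjoint_repr[OF bounded_on_H_conjugate(1)[OF b k0 l]] by blast
  have "R v \<in> Hdom A (- l) \<and> emb l h (R v) = K h \<bullet> hpow A (1 - k) v" if v: "v \<in> smooth_vec A" for v h
  proof -
    have e: "hpow A (- (1 - k)) (hpow A (1 - k) v) = v" by (rule hpow_inv) (use v smooth_iff in blast)
    then have "R v \<in> Hdom A (- l)" using bounded_on_H_conjugate(2)[OF b k0 l, of "hpow A (1 - k) v"] by simp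
    then show ?thesis using K(2)[of h "hpow A (1 - k) v"] unfolding e by (simp add: emb_def)
  qed
  then show ?thesis using K(1) by blast
qed

lemma observation_operator_lin:
  assumes adm: "admissibility_hyp A G Bs" and u: "u \<in> Hdom A 2" "u' \<in> Hdom A 2"
  shows "Bs (x *\<^sub>R u + y *\<^sub>R u', x *\<^sub>R z + y *\<^sub>R z') = x *\<^sub>R Bs (u, z) + y *\<^sub>R Bs (u', z')"
proof -
  have "lin_on (Hdom A 2 \<times> UNIV) Bs" using adm by (simp add: admissibility_hyp_def)
  from this[unfolded lin_on_def, rule_format, of "(u, z)" "(u', z')" x y] show ?thesis using u by simp
qed

lemma S_trunc_Hdom: "S (trunc P u) \<in> Hdom A 2"
  using Hdom_hpow_iff[of "trunc P u" "- 1" 2] trunc_smooth by (simp add: Hdom_nonpos)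

lemma truncated_observation_continuous:
  assumes adm: "admissibility_hyp A G Bs" and a: "continuous_on {0..T} a" "continuous_on {0..T} b"
  shows "continuous_on {0..T} (\<lambda>t. Bs (S (trunc P (a t)), trunc P (b t)))"
proof -
  have fin: "(\<Sum>i<P. (m i * (u \<bullet> \<epsilon> i)) *\<^sub>R \<epsilon> i) = hpow A 1 (trunc P u)" for u
    by (rule coef_ext) (simp add: sum_coef hpow_coef[OF trunc_smooth] trunc_coef)
  have "hpow A (- 2) (hpow A 1 (trunc P u)) = S (trunc P u)" for u
    using hpow_hpow[OF trunc_smooth[of P u 1], where l="- 2"] by (simp add: Hdom_nonpos)
  then have eq: "Bs (S (trunc P (a t)), trunc P (b t)) =
      Bs (hpow A (- 2) (fst (\<Sum>i<P. (m i * (a t \<bullet> \<epsilon> i)) *\<^sub>R \<epsilon> i, trunc P (b t))), snd (\<Sum>i<P. (m i * (a t \<bullet> \<epsilon> i)) *\<^sub>R \<epsilon> i, trunc P (b t)))" for t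
    by (simp add: fin)
  show ?thesis unfolding eq
    by (rule bounded_linear.continuous_on[OF observation_operator(1)[OF adm]])
      (intro continuous_intros a bounded_linear.continuous_on[OF trunc_linear])
qed

lemma obs_lim_lin:
  assumes adm: "admissibility_hyp A G Bs"
    and c: "continuous_on {0..T} a" "continuous_on {0..T} b" "continuous_on {0..T} a'" "continuous_on {0..T} b'"
    and g: "obs_lim Bs T a b g" and g': "obs_lim Bs T a' b' g'"
    and h: "obs_lim Bs T (\<lambda>t. x *\<^sub>R a t + y *\<^sub>R a' t) (\<lambda>t. x *\<^sub>R b t + y *\<^sub>R b' t) h"
  shows "L2_sq T (\<lambda>t. h t - (x *\<^sub>R g t + y *\<^sub>R g' t)) = 0"
proof -
  define f where "f P t = Bs (S (trunc P (a t)), trunc P (b t))" for P t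
  define f' where "f' P t = Bs (S (trunc P (a' t)), trunc P (b' t))" for P t
  define k where "k P t = Bs (S (trunc P (x *\<^sub>R a t + y *\<^sub>R a' t)), trunc P (x *\<^sub>R b t + y *\<^sub>R b' t))" for P t
  note lt = bounded_linear.linear[OF trunc_linear] bounded_linear.linear[OF S_bounded_linear]
  have k: "k P t = x *\<^sub>R f P t + y *\<^sub>R f' P t" for P t
    unfolding k_def f_def f'_def using observation_operator_lin[OF adm S_trunc_Hdom S_trunc_Hdom]
    by (simp add: linear_add[OF lt(1)] linear_add[OF lt(2)] linear_cmul[OF lt(1)] linear_cmul[OF lt(2)])
  have L: "L2_fun T (f P)" "L2_fun T (f' P)" for P
    unfolding f_def f'_def by (intro L2_fun_continuous truncated_observation_continuous[OF adm] c)+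
  have Lg: "L2_fun T g" "L2_fun T g'" "L2_fun T h" using g g' h by (auto simp: obs_lim_def)
  have lim: "(\<lambda>P. L2_sq T (\<lambda>t. f P t - g t)) \<longlonglongrightarrow> 0" "(\<lambda>P. L2_sq T (\<lambda>t. f' P t - g' t)) \<longlonglongrightarrow> 0"
    "(\<lambda>P. L2_sq T (\<lambda>t. k P t - h t)) \<longlonglongrightarrow> 0"
    using g g' h unfolding obs_lim_def f_def f'_def k_def by blast+
  have Lk: "L2_fun T (k P)" for P unfolding k[abs_def] by (rule L2_fun_lin[OF L])
  have Lc: "L2_fun T (\<lambda>t. x *\<^sub>R g t + y *\<^sub>R g' t)" by (rule L2_fun_lin[OF Lg(1,2)])
  have est: "L2_sq T (\<lambda>t. h t - (x *\<^sub>R g t + y *\<^sub>R g' t)) \<le> 2 * L2_sq T (\<lambda>t. k P t - h t) +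
      2 * (2 * x\<^sup>2 * L2_sq T (\<lambda>t. f P t - g t) + 2 * y\<^sup>2 * L2_sq T (\<lambda>t. f' P t - g' t))" for P
  proof -
    have "L2_sq T (\<lambda>t. h t - (x *\<^sub>R g t + y *\<^sub>R g' t)) \<le> 2 * L2_sq T (\<lambda>t. h t - k P t) + 2 * L2_sq T (\<lambda>t. k P t - (x *\<^sub>R g t + y *\<^sub>R g' t))"
      by (rule L2_sq_triangle[OF Lg(3) Lk Lc])
    moreover have "(\<lambda>t. k P t - (x *\<^sub>R g t + y *\<^sub>R g' t)) = (\<lambda>t. x *\<^sub>R (f P t - g t) + y *\<^sub>R (f' P t - g' t))"
      by (simp add: k algebra_simps)
    moreover have "L2_sq T (\<lambda>t. x *\<^sub>R (f P t - g t) + y *\<^sub>R (f' P t - g' t)) \<le>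
        2 * x\<^sup>2 * L2_sq T (\<lambda>t. f P t - g t) + 2 * y\<^sup>2 * L2_sq T (\<lambda>t. f' P t - g' t)"
      by (rule L2_sq_lin_le[OF L2_fun_diff[OF L(1) Lg(1)] L2_fun_diff[OF L(2) Lg(2)]])
    ultimately show ?thesis by (simp add: L2_sq_commute)
  qed
  have "(\<lambda>P. 2 * L2_sq T (\<lambda>t. k P t - h t) + 2 * (2 * x\<^sup>2 * L2_sq T (\<lambda>t. f P t - g t) + 2 * y\<^sup>2 * L2_sq T (\<lambda>t. f' P t - g' t)))
      \<longlonglongrightarrow> 2 * 0 + 2 * (2 * x\<^sup>2 * 0 + 2 * y\<^sup>2 * 0)"
    by (intro tendsto_intros lim)
  then have "L2_sq T (\<lambda>t. h t - (x *\<^sub>R g t + y *\<^sub>R g' t)) \<le> 2 * 0 + 2 * (2 * x\<^sup>2 * 0 + 2 * y\<^sup>2 * 0)"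
    by (rule LIMSEQ_le_const) (use est in auto)
  then show ?thesis by (simp add: antisym)
qed

lemma obs_lim_restrict:
  assumes adm: "admissibility_hyp A G Bs" and c: "continuous_on {0..T} a" "continuous_on {0..T} b"
    and g: "obs_lim Bs T a b g" and t: "t \<le> T"
  shows "obs_lim Bs t a b g"
proof -
  have L: "L2_fun T g" and lim: "(\<lambda>P. L2_sq T (\<lambda>t. Bs (S (trunc P (a t)), trunc P (b t)) - g t)) \<longlonglongrightarrow> 0"
    using g by (auto simp: obs_lim_def)
  have Lf: "L2_fun T (\<lambda>t. Bs (S (trunc P (a t)), trunc P (b t)) - g t)" for P
    by (intro L2_fun_diff L L2_fun_continuous truncated_observation_continuous[OF adm] c)
  have "(\<lambda>P. L2_sq t (\<lambda>t. Bs (S (trunc P (a t)), trunc P (b t)) - g t)) \<longlonglongrightarrow> 0"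
    by (rule Lim_null_comparison[OF always_eventually lim]) (use L2_restrict(2)[OF Lf t] in auto)
  then show ?thesis using L2_restrict(1)[OF L t] by (simp add: obs_lim_def)
qed

lemma obs_lim_bound:
  assumes adm: "admissibility_hyp A G Bs" and T: "0 < T"
  shows "\<exists>D\<ge>0. \<forall>a b F g E. mild {0..T} a b F \<longrightarrow> continuous_on {0..T} F \<longrightarrow> obs_lim Bs T a b g \<longrightarrow>
    (\<forall>t\<in>{0..T}. norm (a t) \<le> E \<and> norm (b t) \<le> E \<and> norm (F t) \<le> E) \<longrightarrow> L2_sq T g \<le> D * E\<^sup>2"
proof -
  obtain D where D: "D > 0" "\<And>w w' f g. wave_vec A 1 T w w' f \<Longrightarrow> observation A Bs T w w' g \<Longrightarrow>
        L2_sq T g \<le> D * (energy A 1 (w 0) (w' 0) + energy A 1 (w T) (w' T) +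
                         (LINT t|lebesgue_on {0..T}. energy A 1 (w t) (w' t)) + L2_sq T f)"
    using adm T by (auto simp: admissibility_hyp_def)
  have "L2_sq T g \<le> (D * (2 + 2 * T)) * E\<^sup>2"
    if m: "mild {0..T} a b F" and F: "continuous_on {0..T} F" and g: "obs_lim Bs T a b g"
      and E: "\<And>t. t \<in> {0..T} \<Longrightarrow> norm (a t) \<le> E \<and> norm (b t) \<le> E \<and> norm (F t) \<le> E" for a b F g E
  proof -
    have T0: "0 \<le> T" using T by simp
    have E0: "0 \<le> E" using E[of 0] T by (auto intro: order_trans[OF norm_ge_zero])
    have h: "hpow A 1 (S u) = u" for u using hpow_inv[of u "- 1"] by (simp add: Hdom_nonpos)
    have e: "energy A 1 (S (a t)) (b t) \<le> E\<^sup>2" if "t \<in> {0..T}" for t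
    proof -
      have "(norm (a t))\<^sup>2 \<le> E\<^sup>2" "(norm (b t))\<^sup>2 \<le> E\<^sup>2" using E[OF that] by (auto intro: power_mono)
      then show ?thesis by (simp add: energy_def h)
    qed
    have wv: "wave_vec A 1 T (\<lambda>t. S (a t)) b F" using wave_vec_of_mild[OF T0 _ m F, of 1] by simp
    have "L2_sq T g \<le> D * (energy A 1 (S (a 0)) (b 0) + energy A 1 (S (a T)) (b T) +
        (LINT t|lebesgue_on {0..T}. energy A 1 (S (a t)) (b t)) + L2_sq T F)"
      by (rule D(2)[OF wv observation_of_obs_lim[OF T0 m F g]])
    also have "\<dots> \<le> D * (E\<^sup>2 + E\<^sup>2 + T * E\<^sup>2 + T * E\<^sup>2)"
      using D(1) T e E E0 by (intro mult_left_mono add_mono integral_le_bound L2_sq_le_bound) auto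
    finally show ?thesis by (simp add: algebra_simps)
  qed
  moreover have "D * (2 + 2 * T) \<ge> 0" using D T by simp
  ultimately show ?thesis by blast
qed

lemma observation_cong:
  assumes "\<And>u z. u \<in> Hdom A 2 \<Longrightarrow> Bs (u, z) = Bs' (u, z)" and "observation A Bs T w w' g"
  shows "observation A Bs' T w w' g"
proof -
  obtain f x x' \<phi> where f: "L2_fun T g" "wave_vec A 1 T w w' f" and x: "\<forall>j::nat. wave_vec A 2 T (x j) (x' j) (\<phi> j)"
    and xl: "uniform_limit {0..T} (\<lambda>j t. hpow A 1 (x j t)) (\<lambda>t. hpow A 1 (w t)) sequentially"
        "uniform_limit {0..T} x' w' sequentially"
    and xs: "(\<lambda>j. L2_sq T (\<lambda>t. \<phi> j t - f t)) \<longlonglongrightarrow> 0" "(\<lambda>j. L2_sq T (\<lambda>t. Bs (x j t, x' j t) - g t)) \<longlonglongrightarrow> 0"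
    using assms(2) unfolding observation_def by blast
  have "x j t \<in> Hdom A 2" if t: "t \<in> {0..T}" for j t
  proof -
    obtain a b where "\<forall>t\<in>{0..T}. x j t = hpow A (- 2) (a t)" using wave_vec_rep[of 2 T "x j" "x' j" "\<phi> j"] x by auto
    then show ?thesis using t hpow_neg_in[of 2] by simp
  qed
  then have "L2_sq T (\<lambda>t. Bs (x j t, x' j t) - g t) = L2_sq T (\<lambda>t. Bs' (x j t, x' j t) - g t)" for j
    using assms(1) by (intro L2_sq_cong) auto
  then have "(\<lambda>j. L2_sq T (\<lambda>t. Bs' (x j t, x' j t) - g t)) \<longlonglongrightarrow> 0" using xs(2) by simp
  then show ?thesis using f x xl xs(1) unfolding observation_def by blast
qed

end

context cascade
begin

lemma flow_src_bound:
  "\<exists>M\<ge>0. \<forall>t U. \<bar>t\<bar> \<le> T \<longrightarrow> (\<forall>i\<in>{1..N}. norm (src (\<lambda>i t. flow t U i) i t) \<le> M * (\<Sum>j\<in>{1..<i}. norm (U j)))"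
proof -
  obtain M where M0: "M \<ge> 0" and M: "\<And>t U i. \<bar>t\<bar> \<le> T \<Longrightarrow> i \<in> {1..N} \<Longrightarrow> norm (flow t U i) \<le> M * (\<Sum>j=1..i. norm (U j))"
    using flow_bound[of T] by blast
  define C where "C i = (\<Sum>j\<in>cw i. onorm (K i j))" for i
  have C0: "C i \<ge> 0" if "i \<in> {1..N}" for i
    unfolding C_def by (intro sum_nonneg onorm_pos_le K_bounded[OF that])
  define C' where "C' = (\<Sum>i=1..N. C i)"
  have "norm (src (\<lambda>i t. flow t U i) i t) \<le> (C' * M) * (\<Sum>j\<in>{1..<i}. norm (U j))" if t: "\<bar>t\<bar> \<le> T" and i: "i \<in> {1..N}" for t U i
  proof -
    define Q where "Q = (\<Sum>j\<in>{1..<i}. norm (U j))"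
    have Q0: "0 \<le> Q" by (simp add: Q_def sum_nonneg)
    have "norm (src (\<lambda>i t. flow t U i) i t) \<le> (\<Sum>j\<in>cw i. norm (K i j (fst (flow t U j))))"
      unfolding src_def norm_minus_cancel by (rule norm_sum)
    also have "\<dots> \<le> (\<Sum>j\<in>cw i. onorm (K i j) * (M * Q))"
    proof (rule sum_mono)
      fix j assume j: "j \<in> cw i"
      note ji = cw_in[OF i j]
      have "norm (K i j (fst (flow t U j))) \<le> onorm (K i j) * norm (fst (flow t U j))"
        by (rule onorm[OF K_bounded[OF i j]])
      also have "\<dots> \<le> onorm (K i j) * (M * Q)"
      proof (rule mult_left_mono)
        have "norm (fst (flow t U j)) \<le> norm (flow t U j)"
          using norm_fst_le[of "fst (flow t U j)" "snd (flow t U j)"] by simp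
        also have "\<dots> \<le> M * (\<Sum>k=1..j. norm (U k))" by (rule M[OF t]) (use ji in blast)
        also have "\<dots> \<le> M * Q" unfolding Q_def by (intro mult_left_mono sum_mono2 M0) (use ji in auto)
        finally show "norm (fst (flow t U j)) \<le> M * Q" .
      qed (rule onorm_pos_le[OF K_bounded[OF i j]])
      finally show "norm (K i j (fst (flow t U j))) \<le> onorm (K i j) * (M * Q)" .
    qed
    also have "\<dots> = C i * (M * Q)" by (simp add: C_def sum_distrib_right)
    also have "\<dots> \<le> C' * (M * Q)"
      unfolding C'_def using i C0 M0 Q0 by (intro mult_right_mono member_le_sum) auto
    finally show ?thesis by (simp add: Q_def mult.assoc)
  qed
  moreover have "0 \<le> C'" unfolding C'_def by (rule sum_nonneg) (rule C0)
  then have "C' * M \<ge> 0" using M0 by simp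
  ultimately show ?thesis by blast
qed

end

locale level_cascade = cascade A \<epsilon> m c K "coupled_with n" "n + p"
  for A :: "'h::{real_inner, complete_space} operator" and \<epsilon> m c K n p +
  fixes C :: "nat \<Rightarrow> nat \<Rightarrow> 'h \<Rightarrow> 'h" and \<kappa> :: "nat \<Rightarrow> int"
  assumes coupling: "i \<in> {1..n + p} \<Longrightarrow> j \<in> coupled_with n i \<Longrightarrow> v \<in> smooth_vec A \<Longrightarrow>
    adjoint (C i j) v \<in> Hdom A (- \<kappa> j) \<and> emb (\<kappa> j) h (adjoint (C i j) v) = K i j h \<bullet> hpow A (1 - \<kappa> i) v"
begin

lemma source_eq:
  assumes i: "i \<in> {1..n + p}" and v: "v \<in> smooth_vec A"
    and w: "\<And>j. j \<in> {1..n + p} \<Longrightarrow> w j s = emb (\<kappa> j) (fst (U j s))"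
  shows "- (\<Sum>j\<in>coupled_with n i. w j s (adjoint (C i j) v)) = src U i s \<bullet> hpow A (1 - \<kappa> i) v"
proof -
  have "(\<Sum>j\<in>coupled_with n i. w j s (adjoint (C i j) v)) = (\<Sum>j\<in>coupled_with n i. K i j (fst (U j s)) \<bullet> hpow A (1 - \<kappa> i) v)"
  proof (rule sum.cong[OF refl])
    fix j assume j: "j \<in> coupled_with n i"
    then show "w j s (adjoint (C i j) v) = K i j (fst (U j s)) \<bullet> hpow A (1 - \<kappa> i) v"
      using w[of j] cw_in[OF i j] coupling[OF i j v] by simp
  qed
  then show ?thesis by (simp add: src_def inner_sum_left)
qed

lemma cascade_of_csol:
  assumes U: "csol {0..t} U" and t: "0 \<le> t"
  shows "cascade_sol A C n p \<kappa> t (\<lambda>i s. emb (\<kappa> i) (fst (U i s))) (\<lambda>i s. emb (\<kappa> i - 1) (snd (U i s)))"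
  unfolding cascade_sol_def
proof
  fix i assume i: "i \<in> {1..n + p}"
  show "wave_sol A (\<kappa> i) t (\<lambda>s. emb (\<kappa> i) (fst (U i s))) (\<lambda>s. emb (\<kappa> i - 1) (snd (U i s)))
      (\<lambda>s v. - (\<Sum>j\<in>coupled_with n i. emb (\<kappa> j) (fst (U j s)) (adjoint (C i j) v)))"
  proof (rule wave_sol_of_mild[OF t])
    show "mild {0..t} (\<lambda>s. fst (U i s)) (\<lambda>s. snd (U i s)) (src U i)" using U i by (simp add: csol_def)
    show "continuous_on {0..t} (src U i)" by (rule csol_src_continuous[OF U i])
    show "- (\<Sum>j\<in>coupled_with n i. emb (\<kappa> j) (fst (U j s)) (adjoint (C i j) v)) = src U i s \<bullet> hpow A (1 - \<kappa> i) v"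
      if "v \<in> smooth_vec A" for s v
      by (rule source_eq[OF i that, where w="\<lambda>j s. emb (\<kappa> j) (fst (U j s))"]) (rule refl)
  qed auto
qed

lemma csol_of_cascade:
  assumes w: "cascade_sol A C n p \<kappa> t w w'" and t: "0 \<le> t"
  shows "\<exists>U. csol {0..t} U \<and> (\<forall>i\<in>{1..n + p}. \<forall>s\<in>{0..t}.
    w i s = emb (\<kappa> i) (fst (U i s)) \<and> w' i s = emb (\<kappa> i - 1) (snd (U i s)))"
proof -
  have ws: "wave_sol A (\<kappa> i) t (w i) (w' i) (\<lambda>s v. - (\<Sum>j\<in>coupled_with n i. w j s (adjoint (C i j) v)))"
    if "i \<in> {1..n + p}" for i using w that by (auto simp: cascade_sol_def)
  have "\<forall>i. \<exists>a. i \<in> {1..n + p} \<longrightarrow> continuous_on {0..t} a \<and> (\<forall>s\<in>{0..t}. w i s = emb (\<kappa> i) (a s))"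
    using ws unfolding wave_sol_def Hcont_iff by blast
  from choice[OF this] obtain a where a: "\<And>i. i \<in> {1..n + p} \<Longrightarrow> continuous_on {0..t} (a i)"
    "\<And>i s. i \<in> {1..n + p} \<Longrightarrow> s \<in> {0..t} \<Longrightarrow> w i s = emb (\<kappa> i) (a i s)" by blast
  define F where "F i s = src (\<lambda>j s. (a j s, 0)) i s" for i s
  have "\<forall>i. \<exists>b. i \<in> {1..n + p} \<longrightarrow> mild {0..t} (a i) b (F i) \<and> (\<forall>s\<in>{0..t}. w' i s = emb (\<kappa> i - 1) (b s))"
  proof (intro allI)
    fix i
    show "\<exists>b. i \<in> {1..n + p} \<longrightarrow> mild {0..t} (a i) b (F i) \<and> (\<forall>s\<in>{0..t}. w' i s = emb (\<kappa> i - 1) (b s))"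
    proof (cases "i \<in> {1..n + p}")
      case i: True
      have "\<exists>a' b. mild {0..t} a' b (F i) \<and> (\<forall>s\<in>{0..t}. w i s = emb (\<kappa> i) (a' s) \<and> w' i s = emb (\<kappa> i - 1) (b s))"
      proof (rule mild_of_wave_sol[OF t ws[OF i]])
        show "continuous_on {0..t} (F i)"
          unfolding F_def by (rule src_continuous[OF i]) (use a(1) cw_in[OF i] in auto)
        show "- (\<Sum>j\<in>coupled_with n i. w j s (adjoint (C i j) (\<epsilon> k))) = F i s \<bullet> hpow A (1 - \<kappa> i) (\<epsilon> k)"
          if "s \<in> {0..t}" for s k
          unfolding F_def by (rule source_eq[OF i eps_smooth]) (use a(2) that in auto)
      qed
      then obtain a' b where ab: "mild {0..t} a' b (F i)" "\<And>s. s \<in> {0..t} \<Longrightarrow> w i s = emb (\<kappa> i) (a' s) \<and> w' i s = emb (\<kappa> i - 1) (b s)"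
        by blast
      have "a' s = a i s" if "s \<in> {0..t}" for s
        using ab(2)[OF that] a(2)[OF i that] emb_inj[of "\<kappa> i" "a' s" "a i s"] by simp
      then have "mild {0..t} (a i) b (F i)"
        using ab(1) mild_cong[of "{0..t}" a' "a i" b b "F i" "F i"] by simp
      then show ?thesis using ab(2) by blast
    qed auto
  qed
  from choice[OF this] obtain b where b: "\<And>i. i \<in> {1..n + p} \<Longrightarrow> mild {0..t} (a i) (b i) (F i)"
    "\<And>i s. i \<in> {1..n + p} \<Longrightarrow> s \<in> {0..t} \<Longrightarrow> w' i s = emb (\<kappa> i - 1) (b i s)" by blast
  have "src (\<lambda>i s. (a i s, b i s)) i = F i" for i by (auto simp: F_def src_def)
  then have "csol {0..t} (\<lambda>i s. (a i s, b i s))" using b(1) by (simp add: csol_def)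
  then show ?thesis using a(2) b(2) by (intro exI[of _ "\<lambda>i s. (a i s, b i s)"]) simp
qed

end

section \<open>The mixed cascade\<close>

locale mixed_cascade = eigenbasis A \<epsilon> m c
  for A :: "'h::{real_inner, complete_space} operator" and \<epsilon> m c +
  fixes C :: "nat \<Rightarrow> nat \<Rightarrow> 'h \<Rightarrow> 'h" and G :: "nat \<Rightarrow> 'g::{real_inner, complete_space} set"
    and Bs :: "nat \<Rightarrow> 'h \<times> 'h \<Rightarrow> 'g" and B :: "nat \<Rightarrow> 'g \<Rightarrow> 'h gvec" and n p q :: nat
    and T\<^sub>0 :: "nat \<Rightarrow> real" and T' T :: real
  assumes n: "2 \<le> n" and q: "1 \<le> q" "q \<le> p"
    and C_below: "i \<in> {2..n} \<Longrightarrow> k \<in> {0..n - i + 1} \<Longrightarrow> bounded_on_H A (int k) (adjoint (C i (i - 1)))"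
    and C_above: "i \<in> {n + 1..n + p} \<Longrightarrow> j \<in> {n - 1..i - 1} \<Longrightarrow> r \<in> {0, 1} \<Longrightarrow> bounded_on_H A r (adjoint (C i j))"
    and adm: "l \<le> p \<Longrightarrow> admissibility_hyp A (G (n + l)) (Bs (n + l))"
    and obs_hyp: "l \<le> p \<Longrightarrow> observability_hyp A (Bs (n + l)) (T\<^sub>0 (n + l))"
    and time: "observability_time A C Bs n p T\<^sub>0 T'" and T: "T' < T"
    and B_low: "l \<le> q \<Longrightarrow> u \<in> Hdom A 2 \<Longrightarrow> Bs (n + l) (u, z) = control_adj (G (n + l)) (B (n + l)) u"
    and B_high: "l \<in> {q + 1..p} \<Longrightarrow> u \<in> Hdom A 2 \<Longrightarrow> Bs (n + l) (u, z) = control_adj (G (n + l)) (B (n + l)) z"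
begin

definition \<kappa> :: "nat \<Rightarrow> int" where "\<kappa> i = 1 - lev n q i"

lemma T_pos: "0 < T"
  using time T by (simp add: observability_time_def)

lemma \<kappa>_le: "\<kappa> i \<le> 1"
  by (auto simp: \<kappa>_def lev_def)

lemma \<kappa>_low: "l \<le> q \<Longrightarrow> \<kappa> (n + l) = 1"
  by (auto simp: \<kappa>_def lev_def)

lemma \<kappa>_high: "l \<in> {q + 1..p} \<Longrightarrow> \<kappa> (n + l) = 0"
  by (auto simp: \<kappa>_def lev_def)

lemma coupled_less: "i \<in> {1..n + p} \<Longrightarrow> coupled_with n i \<subseteq> {1..<i}"
  using n by (auto simp: coupled_with_def)

lemma coupling_bounded:
  assumes i: "i \<in> {1..n + p}" and j: "j \<in> coupled_with n i"
  shows "bounded_on_H A (1 - \<kappa> i) (adjoint (C i j))" "- \<kappa> j \<le> 1 - \<kappa> i" "bounded_on_H A 0 (adjoint (C i j))"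
proof -
  have "bounded_on_H A (1 - \<kappa> i) (adjoint (C i j)) \<and> - \<kappa> j \<le> 1 - \<kappa> i \<and> bounded_on_H A 0 (adjoint (C i j))"
  proof (cases "i \<le> n")
    case True
    then have ij: "2 \<le> i" "j = i - 1" using j by (auto simp: coupled_with_def split: if_splits)
    have k: "1 - \<kappa> i = int (n - i)" "- \<kappa> j = int (n - i)"
      using True ij by (auto simp: \<kappa>_def lev_def)
    show ?thesis
      using C_below[of i "n - i"] C_below[of i 0] True ij unfolding k by auto
  next
    case False
    then have j': "j \<in> {n - 1..i - 1}" using j n by (auto simp: coupled_with_def split: if_splits)
    have k: "1 - \<kappa> i \<in> {0, 1}" using False by (auto simp: \<kappa>_def lev_def)
    have "- \<kappa> j \<le> 0" using j' n by (auto simp: \<kappa>_def lev_def)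
    then show ?thesis using C_above[of i j] j' k False i by auto
  qed
  then show "bounded_on_H A (1 - \<kappa> i) (adjoint (C i j))" "- \<kappa> j \<le> 1 - \<kappa> i" "bounded_on_H A 0 (adjoint (C i j))"
    by auto
qed

definition coup :: "(nat \<Rightarrow> int) \<Rightarrow> nat \<Rightarrow> nat \<Rightarrow> 'h \<Rightarrow> 'h" where
  "coup r i j = (SOME K. bounded_linear K \<and> (\<forall>h. \<forall>v\<in>smooth_vec A.
    adjoint (C i j) v \<in> Hdom A (- r j) \<and> emb (r j) h (adjoint (C i j) v) = K h \<bullet> hpow A (1 - r i) v))"

sublocale dual: level_cascade A \<epsilon> m c "coup \<kappa>" n p C \<kappa>
proof (intro level_cascade.intro cascade.intro cascade_axioms.intro level_cascade_axioms.intro eigenbasis_axioms)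
  have s: "bounded_linear (coup \<kappa> i j) \<and> (\<forall>h. \<forall>v\<in>smooth_vec A.
    adjoint (C i j) v \<in> Hdom A (- \<kappa> j) \<and> emb (\<kappa> j) h (adjoint (C i j) v) = coup \<kappa> i j h \<bullet> hpow A (1 - \<kappa> i) v)"
    if "i \<in> {1..n + p}" "j \<in> coupled_with n i" for i j
    unfolding coup_def
    by (rule someI_ex[OF coupling_repr[OF coupling_bounded(1)[OF that] \<kappa>_le coupling_bounded(2)[OF that]]])
  show "bounded_linear (coup \<kappa> i j)" if "i \<in> {1..n + p}" "j \<in> coupled_with n i" for i j
    using s[OF that] by blast
  show "adjoint (C i j) v \<in> Hdom A (- \<kappa> j) \<and> emb (\<kappa> j) h (adjoint (C i j) v) = coup \<kappa> i j h \<bullet> hpow A (1 - \<kappa> i) v"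
    if "i \<in> {1..n + p}" "j \<in> coupled_with n i" "v \<in> smooth_vec A" for i j v h
    using s[OF that(1,2)] that(3) by blast
qed (rule coupled_less)

sublocale reg: level_cascade A \<epsilon> m c "coup (\<lambda>_. 1)" n p C "\<lambda>_. 1"
proof (intro level_cascade.intro cascade.intro cascade_axioms.intro level_cascade_axioms.intro eigenbasis_axioms)
  have s: "bounded_linear (coup (\<lambda>_. 1) i j) \<and> (\<forall>h. \<forall>v\<in>smooth_vec A.
    adjoint (C i j) v \<in> Hdom A (- 1) \<and> emb 1 h (adjoint (C i j) v) = coup (\<lambda>_. 1) i j h \<bullet> hpow A (1 - 1) v)"
    if "i \<in> {1..n + p}" "j \<in> coupled_with n i" for i j
    unfolding coup_def
    by (rule someI_ex[OF coupling_repr]) (use coupling_bounded(3)[OF that] in auto)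
  show "bounded_linear (coup (\<lambda>_. 1) i j)" if "i \<in> {1..n + p}" "j \<in> coupled_with n i" for i j
    using s[OF that] by blast
  show "adjoint (C i j) v \<in> Hdom A (- 1) \<and> emb 1 h (adjoint (C i j) v) = coup (\<lambda>_. 1) i j h \<bullet> hpow A (1 - 1) v"
    if "i \<in> {1..n + p}" "j \<in> coupled_with n i" "v \<in> smooth_vec A" for i j v h
    using s[OF that(1,2)] that(3) by blast
qed (rule coupled_less)

definition lift :: "(nat \<Rightarrow> 'h \<times> 'h) \<Rightarrow> nat \<Rightarrow> 'h \<times> 'h" where
  "lift V i = (hpow A (\<kappa> i - 1) (fst (V i)), hpow A (\<kappa> i - 1) (snd (V i)))"

lemma lift_bounded: "bounded_linear (hpow A (\<kappa> i - 1))"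
  by (rule hpow_bounded_linear) (use \<kappa>_le[of i] in simp)

lemma hpow_\<kappa>_coef: "hpow A (\<kappa> i - 1) u \<bullet> \<epsilon> j = m j powi (\<kappa> i - 1) * (u \<bullet> \<epsilon> j)"
  using \<kappa>_le[of i] by (intro hpow_coef) (simp add: Hdom_nonpos)

lemma coup_lift:
  assumes i: "i \<in> {1..n + p}" and j: "j \<in> coupled_with n i"
  shows "coup \<kappa> i j (hpow A (\<kappa> j - 1) h) = hpow A (\<kappa> i - 1) (coup (\<lambda>_. 1) i j h)"
proof (rule coef_ext)
  fix k
  have d: "adjoint (C i j) (\<epsilon> k) \<in> Hdom A (- \<kappa> j)"
    "emb (\<kappa> j) (hpow A (\<kappa> j - 1) h) (adjoint (C i j) (\<epsilon> k)) = coup \<kappa> i j (hpow A (\<kappa> j - 1) h) \<bullet> hpow A (1 - \<kappa> i) (\<epsilon> k)"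
    using dual.coupling[OF i j eps_smooth] by blast+
  have r: "emb 1 h (adjoint (C i j) (\<epsilon> k)) = coup (\<lambda>_. 1) i j h \<bullet> \<epsilon> k"
    using reg.coupling[OF i j eps_smooth, of k h] by simp
  have "m k powi (1 - \<kappa> i) * (coup \<kappa> i j (hpow A (\<kappa> j - 1) h) \<bullet> \<epsilon> k) = coup (\<lambda>_. 1) i j h \<bullet> \<epsilon> k"
    using d(2) emb_restrict[OF \<kappa>_le d(1), of h] r by (simp add: hpow_eps)
  moreover have "m k powi (\<kappa> i - 1) * m k powi (1 - \<kappa> i) = 1"
    using powi_add[of k "\<kappa> i - 1" "1 - \<kappa> i"] by simp
  ultimately show "coup \<kappa> i j (hpow A (\<kappa> j - 1) h) \<bullet> \<epsilon> k = hpow A (\<kappa> i - 1) (coup (\<lambda>_. 1) i j h) \<bullet> \<epsilon> k"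
    unfolding hpow_\<kappa>_coef by (metis mult.assoc mult.left_neutral)
qed

lemma flow_lift: "i \<in> {1..n + p} \<Longrightarrow> dual.flow t (lift V) i = lift (reg.flow t V) i"
proof (rule dual.flow_unique[symmetric, where I=UNIV])
  show "dual.csol UNIV (\<lambda>i t. lift (reg.flow t V) i)"
    unfolding dual.csol_def
  proof
    fix i assume i: "i \<in> {1..n + p}"
    have "mild UNIV (\<lambda>t. fst (reg.flow t V i)) (\<lambda>t. snd (reg.flow t V i)) (reg.src (\<lambda>i t. reg.flow t V i) i)"
      using reg.flow_csol[of V] i by (simp add: reg.csol_def)
    from mild_diagonal[OF lift_bounded hpow_\<kappa>_coef this]
    have "mild UNIV (\<lambda>t. fst (lift (reg.flow t V) i)) (\<lambda>t. snd (lift (reg.flow t V) i))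
        (\<lambda>t. hpow A (\<kappa> i - 1) (reg.src (\<lambda>i t. reg.flow t V i) i t))"
      by (simp add: lift_def)
    moreover have "hpow A (\<kappa> i - 1) (reg.src (\<lambda>i t. reg.flow t V i) i t) = dual.src (\<lambda>i t. lift (reg.flow t V) i) i t" for t
      unfolding reg.src_def dual.src_def lift_def
      using bounded_linear.linear[OF lift_bounded[of i]]
      by (simp add: linear_neg linear_sum coup_lift[OF i])
    ultimately show "mild UNIV (\<lambda>t. fst (lift (reg.flow t V) i)) (\<lambda>t. snd (lift (reg.flow t V) i)) (dual.src (\<lambda>i t. lift (reg.flow t V) i) i)"
      by simp
  qed
  show "lift (reg.flow 0 V) i = lift V i" if "i \<in> {1..n + p}" for i
    using reg.flow_0[OF that] by (simp add: lift_def)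
qed auto

lemma dual_mild:
  assumes "i \<in> {1..n + p}"
  shows "mild I (\<lambda>t. fst (dual.flow t U i)) (\<lambda>t. snd (dual.flow t U i)) (dual.src (\<lambda>i t. dual.flow t U i) i)"
    "continuous_on I (dual.src (\<lambda>i t. dual.flow t U i) i)"
    "continuous_on I (\<lambda>t. fst (dual.flow t U i))" "continuous_on I (\<lambda>t. snd (dual.flow t U i))"
proof -
  show m: "mild I (\<lambda>t. fst (dual.flow t U i)) (\<lambda>t. snd (dual.flow t U i)) (dual.src (\<lambda>i t. dual.flow t U i) i)"
    using mild_subset[OF _ subset_UNIV] dual.flow_csol[of U] assms unfolding dual.csol_def by blast
  show "continuous_on I (dual.src (\<lambda>i t. dual.flow t U i) i)"
    by (rule continuous_on_subset[OF dual.csol_src_continuous[OF dual.flow_csol assms] subset_UNIV])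
  show "continuous_on I (\<lambda>t. fst (dual.flow t U i))" "continuous_on I (\<lambda>t. snd (dual.flow t U i))"
    using m by (auto simp: mild_def)
qed

lemma Bs_velocity_bounded:
  assumes l: "l \<le> p" shows "bounded_linear (\<lambda>z. Bs (n + l) (0, z))"
proof -
  have "bounded_linear (\<lambda>z. (0::'h, z::'h))"
    by (intro bounded_linear_Pair bounded_linear_ident bounded_linear_zero)
  from bounded_linear_compose[OF observation_operator(1)[OF adm[OF l]] this] show ?thesis
    by (simp add: linear_0[OF bounded_linear.linear[OF hpow_bounded_linear]])
qed

lemma zero_Hdom: "0 \<in> Hdom A k"
  using Hdom_scaleR[OF eps_Hdom, of 0 _ k] by simp

definition obs :: "(nat \<Rightarrow> 'h \<times> 'h) \<Rightarrow> nat \<Rightarrow> real \<Rightarrow> 'g" where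
  "obs U l = (if l \<le> q
     then (SOME g. obs_lim (Bs (n + l)) T (\<lambda>t. fst (dual.flow t U (n + l))) (\<lambda>t. snd (dual.flow t U (n + l))) g \<and> (\<forall>t. g t \<in> G (n + l)))
     else (\<lambda>t. Bs (n + l) (0, fst (dual.flow t U (n + l)))))"

lemma in_range: "l \<le> p \<Longrightarrow> n + l \<in> {1..n + p}"
  using n by simp

lemma obs_low:
  assumes "l \<le> q"
  shows "obs_lim (Bs (n + l)) T (\<lambda>t. fst (dual.flow t U (n + l))) (\<lambda>t. snd (dual.flow t U (n + l))) (obs U l)"
    "obs U l t \<in> G (n + l)"
proof -
  have l: "l \<le> p" using assms q by simp
  show "obs_lim (Bs (n + l)) T (\<lambda>t. fst (dual.flow t U (n + l))) (\<lambda>t. snd (dual.flow t U (n + l))) (obs U l)"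
    "obs U l t \<in> G (n + l)"
    using someI_ex[OF obs_lim_exists[OF adm[OF l] T_pos dual_mild(1,2)[OF in_range[OF l]]], of U] assms
    by (simp_all add: obs_def)
qed

lemma obs_high: "q < l \<Longrightarrow> obs U l t = Bs (n + l) (0, fst (dual.flow t U (n + l)))"
  by (simp add: obs_def)

lemma obs_high_continuous: "q < l \<Longrightarrow> l \<le> p \<Longrightarrow> continuous_on I (obs U l)"
  using bounded_linear.continuous_on[OF Bs_velocity_bounded dual_mild(3)[OF in_range]] by (simp add: obs_def)

lemma obs_in_L2: "l \<le> p \<Longrightarrow> L2_fun T (obs U l)"
  using obs_low(1)[of l U] obs_high_continuous[of l] L2_fun_continuous[of T "obs U l"]
  by (cases "l \<le> q") (auto simp: obs_lim_def)

lemma obs_linear: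
  assumes l: "l \<le> p"
  shows "L2_sq T (\<lambda>t. obs (\<lambda>i. x *\<^sub>R U i + y *\<^sub>R V i) l t - (x *\<^sub>R obs U l t + y *\<^sub>R obs V l t)) = 0"
proof -
  have fl: "dual.flow t (\<lambda>i. x *\<^sub>R U i + y *\<^sub>R V i) (n + l) = x *\<^sub>R dual.flow t U (n + l) + y *\<^sub>R dual.flow t V (n + l)" for t
    by (rule dual.flow_lin[OF in_range[OF l]])
  show ?thesis
  proof (cases "l \<le> q")
    case True
    show ?thesis
    proof (rule obs_lim_lin[OF adm[OF l] dual_mild(3,4)[OF in_range[OF l]] dual_mild(3,4)[OF in_range[OF l]] obs_low(1)[OF True] obs_low(1)[OF True]])
      show "obs_lim (Bs (n + l)) T (\<lambda>t. x *\<^sub>R fst (dual.flow t U (n + l)) + y *\<^sub>R fst (dual.flow t V (n + l)))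
          (\<lambda>t. x *\<^sub>R snd (dual.flow t U (n + l)) + y *\<^sub>R snd (dual.flow t V (n + l))) (obs (\<lambda>i. x *\<^sub>R U i + y *\<^sub>R V i) l)"
        using obs_low(1)[OF True, of "\<lambda>i. x *\<^sub>R U i + y *\<^sub>R V i"] by (simp add: fl)
    qed
  next
    case False
    have "obs (\<lambda>i. x *\<^sub>R U i + y *\<^sub>R V i) l t = x *\<^sub>R obs U l t + y *\<^sub>R obs V l t" for t
      using False linear_add[OF bounded_linear.linear[OF Bs_velocity_bounded[OF l]], of "x *\<^sub>R fst (dual.flow t U (n + l))" "y *\<^sub>R fst (dual.flow t V (n + l))"]
        linear_cmul[OF bounded_linear.linear[OF Bs_velocity_bounded[OF l]]]
      by (simp add: obs_high fl)
    then show ?thesis by simp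
  qed
qed

lemma src_le_tot: "\<exists>M\<ge>0. \<forall>t\<in>{0..T}. \<forall>U. \<forall>i\<in>{1..n + p}.
    norm (dual.flow t U i) \<le> M * dual.tot U \<and> norm (dual.src (\<lambda>i t. dual.flow t U i) i t) \<le> M * dual.tot U"
proof -
  obtain M where M: "M \<ge> 0" "\<And>t U i. \<bar>t\<bar> \<le> T \<Longrightarrow> i \<in> {1..n + p} \<Longrightarrow> norm (dual.flow t U i) \<le> M * dual.tot U"
    using dual.flow_tot_bound[of T] by blast
  obtain L where L: "L \<ge> 0" "\<And>t U i. \<bar>t\<bar> \<le> T \<Longrightarrow> i \<in> {1..n + p} \<Longrightarrow>
    norm (dual.src (\<lambda>i t. dual.flow t U i) i t) \<le> L * (\<Sum>j\<in>{1..<i}. norm (U j))"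
    using dual.flow_src_bound[of T] by blast
  have "norm (dual.flow t U i) \<le> (M + L) * dual.tot U \<and> norm (dual.src (\<lambda>i t. dual.flow t U i) i t) \<le> (M + L) * dual.tot U"
    if t: "t \<in> {0..T}" and i: "i \<in> {1..n + p}" for t U i
  proof -
    have s: "(\<Sum>j\<in>{1..<i}. norm (U j)) \<le> dual.tot U"
      unfolding dual.tot_def by (rule sum_mono2) (use i in auto)
    have "norm (dual.src (\<lambda>i t. dual.flow t U i) i t) \<le> L * (\<Sum>j\<in>{1..<i}. norm (U j))" using L(2) t i by auto
    also have "\<dots> \<le> L * dual.tot U" using s L(1) by (rule mult_left_mono)
    finally have "norm (dual.src (\<lambda>i t. dual.flow t U i) i t) \<le> L * dual.tot U" .
    moreover have "norm (dual.flow t U i) \<le> M * dual.tot U" using M(2) t i by auto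
    moreover have "0 \<le> L * dual.tot U" "0 \<le> M * dual.tot U" using L(1) M(1) dual.tot_nonneg by auto
    ultimately show ?thesis unfolding distrib_right by linarith
  qed
  then show ?thesis using M(1) L(1) by (intro exI[of _ "M + L"]) auto
qed

lemma obs_tot_bound: "\<exists>M\<ge>0. \<forall>U. \<forall>l\<le>p. L2_sq T (obs U l) \<le> M * (dual.tot U)\<^sup>2"
proof -
  obtain M where M: "M \<ge> 0" "\<And>t U i. t \<in> {0..T} \<Longrightarrow> i \<in> {1..n + p} \<Longrightarrow> norm (dual.flow t U i) \<le> M * dual.tot U"
    "\<And>t U i. t \<in> {0..T} \<Longrightarrow> i \<in> {1..n + p} \<Longrightarrow> norm (dual.src (\<lambda>i t. dual.flow t U i) i t) \<le> M * dual.tot U"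
    using src_le_tot by blast
  have comp: "norm (fst (dual.flow t U i)) \<le> M * dual.tot U" "norm (snd (dual.flow t U i)) \<le> M * dual.tot U"
    if "t \<in> {0..T}" "i \<in> {1..n + p}" for t U i
    using M(2)[OF that, of U] norm_fst_le[of "fst (dual.flow t U i)" "snd (dual.flow t U i)"]
      norm_snd_le[of "snd (dual.flow t U i)" "fst (dual.flow t U i)"] by auto
  have "\<exists>D\<ge>0. \<forall>U. L2_sq T (obs U l) \<le> D * (dual.tot U)\<^sup>2" if l: "l \<le> p" for l
  proof (cases "l \<le> q")
    case True
    obtain D where D: "D \<ge> 0" "\<And>a b F g E. mild {0..T} a b F \<Longrightarrow> continuous_on {0..T} F \<Longrightarrow> obs_lim (Bs (n + l)) T a b g \<Longrightarrow>
      (\<forall>t\<in>{0..T}. norm (a t) \<le> E \<and> norm (b t) \<le> E \<and> norm (F t) \<le> E) \<Longrightarrow> L2_sq T g \<le> D * E\<^sup>2"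
      using obs_lim_bound[OF adm[OF l] T_pos] by blast
    have "L2_sq T (obs U l) \<le> D * (M * dual.tot U)\<^sup>2" for U
      by (rule D(2)[OF dual_mild(1,2)[OF in_range[OF l]] obs_low(1)[OF True]]) (use comp M(3) in_range[OF l] in blast)
    then show ?thesis using D(1) by (intro exI[of _ "D * M\<^sup>2"]) (auto simp: power_mult_distrib mult.assoc)
  next
    case False
    obtain b where b: "b \<ge> 0" "\<And>z. norm (Bs (n + l) (0, z)) \<le> norm z * b"
      using bounded_linear.nonneg_bounded[OF Bs_velocity_bounded[OF l]] by blast
    have "L2_sq T (obs U l) \<le> T * (M * dual.tot U * b)\<^sup>2" for U
    proof (rule L2_sq_le_bound)
      show "norm (obs U l t) \<le> M * dual.tot U * b" if "t \<in> {0..T}" for t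
        using False b(2)[of "fst (dual.flow t U (n + l))"] mult_right_mono[OF comp(1)[OF that in_range[OF l]] b(1)]
        by (simp add: obs_high) (meson order_trans)
      show "0 \<le> M * dual.tot U * b" using M(1) b(1) dual.tot_nonneg by simp
    qed (use T_pos in simp)
    then show ?thesis using T_pos by (intro exI[of _ "T * M\<^sup>2 * b\<^sup>2"]) (auto simp: power_mult_distrib algebra_simps)
  qed
  then have "\<forall>l. \<exists>D. l \<le> p \<longrightarrow> D \<ge> 0 \<and> (\<forall>U. L2_sq T (obs U l) \<le> D * (dual.tot U)\<^sup>2)" by blast
  from choice[OF this] obtain D where D: "\<And>l. l \<le> p \<Longrightarrow> D l \<ge> 0" "\<And>l U. l \<le> p \<Longrightarrow> L2_sq T (obs U l) \<le> D l * (dual.tot U)\<^sup>2"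
    by blast
  have "L2_sq T (obs U l) \<le> (\<Sum>l\<le>p. D l) * (dual.tot U)\<^sup>2" if l: "l \<le> p" for l U
  proof -
    have "D l \<le> (\<Sum>l\<le>p. D l)" by (rule member_le_sum) (use l D(1) in auto)
    from mult_right_mono[OF this zero_le_power2] show ?thesis using D(2)[OF l, of U] by (meson order_trans)
  qed
  moreover have "0 \<le> (\<Sum>l\<le>p. D l)" by (rule sum_nonneg) (use D(1) in auto)
  ultimately show ?thesis by blast
qed

lemma energy_level:
  assumes "k \<le> 1" shows "energy A k (S a) b = (norm (hpow A (k - 1) a, hpow A (k - 1) b))\<^sup>2 / 2"
proof -
  have "hpow A k (S a) = hpow A (k - 1) a"
    using hpow_hpow[of a "- 1" k] assms by (simp add: Hdom_nonpos)
  then show ?thesis by (simp add: energy_def norm_prod_def)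
qed

abbreviation total_obs :: "(nat \<Rightarrow> 'h \<times> 'h) \<Rightarrow> real" where
  "total_obs U \<equiv> (\<Sum>l\<le>p. L2_sq T (obs U l))"

lemma observable_low:
  "\<exists>D\<ge>0. \<forall>V. \<forall>i\<in>{1..n + q}. (norm (lift V i))\<^sup>2 \<le> D * total_obs (lift V)"
proof -
  obtain d \<rho> L where L: "\<forall>T>T'.
        (\<forall>i\<in>{1..n}. d i T > 0) \<and> (\<forall>k\<in>{1..p}. \<rho> k T > 0) \<and>
        (\<forall>i\<in>{1..n - 1}. d i T \<le> L / T ^ 3) \<and> d n T \<le> L / T \<and>
        (\<forall>x x' g.
           cascade_sol A C n p (\<lambda>_. 1) T (\<lambda>i t v. x i t \<bullet> v) (\<lambda>i t v. x' i t \<bullet> v) \<and>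
           (\<forall>l\<in>{0..p}. observation A (Bs (n + l)) T (x (n + l)) (x' (n + l)) (g l)) \<longrightarrow>
           (\<forall>i\<in>{1..n}.
              energy A (1 + int i - int n) (x i 0) (x' i 0) \<le> d i T * L2_sq T (g 0)) \<and>
           (\<forall>k\<in>{1..p}.
              energy A 1 (x (n + k) 0) (x' (n + k) 0) \<le> \<rho> k T * (\<Sum>l=0..k. L2_sq T (g l))))"
    using time unfolding observability_time_def by (elim conjE exE) blast
  have pos: "\<And>i. i \<in> {1..n} \<Longrightarrow> d i T > 0" "\<And>k. k \<in> {1..p} \<Longrightarrow> \<rho> k T > 0"
    and main: "\<And>x x' g. cascade_sol A C n p (\<lambda>_. 1) T (\<lambda>i t v. x i t \<bullet> v) (\<lambda>i t v. x' i t \<bullet> v) \<Longrightarrow>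
           (\<forall>l\<in>{0..p}. observation A (Bs (n + l)) T (x (n + l)) (x' (n + l)) (g l)) \<Longrightarrow>
           (\<forall>i\<in>{1..n}. energy A (1 + int i - int n) (x i 0) (x' i 0) \<le> d i T * L2_sq T (g 0)) \<and>
           (\<forall>k\<in>{1..p}. energy A 1 (x (n + k) 0) (x' (n + k) 0) \<le> \<rho> k T * (\<Sum>l=0..k. L2_sq T (g l)))"
    using L[rule_format, OF T] by blast+
  define D where "D = 2 * (\<Sum>i=1..n. d i T) + 2 * (\<Sum>k=1..p. \<rho> k T)"
  have s: "0 \<le> (\<Sum>i=1..n. d i T)" "0 \<le> (\<Sum>k=1..p. \<rho> k T)"
    by (rule sum_nonneg, erule less_imp_le[OF pos(1)]) (rule sum_nonneg, erule less_imp_le[OF pos(2)])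
  have dle: "2 * d i T \<le> D" if "i \<in> {1..n}" for i
    using member_le_sum[of i "{1..n}" "\<lambda>i. d i T"] that pos s by (auto simp: D_def less_imp_le)
  have \<rho>le: "2 * \<rho> k T \<le> D" if "k \<in> {1..p}" for k
    using member_le_sum[of k "{1..p}" "\<lambda>k. \<rho> k T"] that pos s by (auto simp: D_def less_imp_le)
  have "(norm (lift V i))\<^sup>2 \<le> D * total_obs (lift V)" if i: "i \<in> {1..n + q}" for V i
  proof -
    define x where "x i t = S (fst (reg.flow t V i))" for i t
    define x' where "x' = (\<lambda>i t. snd (reg.flow t V i))"
    have cs: "cascade_sol A C n p (\<lambda>_. 1) T (\<lambda>i t v. x i t \<bullet> v) (\<lambda>i t v. x' i t \<bullet> v)"
      using reg.cascade_of_csol[OF reg.csol_subset[OF reg.flow_csol[of V] subset_UNIV], of T] T_pos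
      by (simp add: emb_nonneg x_def x'_def)
    have rm: "mild {0..T} (\<lambda>t. fst (reg.flow t V (n + l))) (x' (n + l)) (reg.src (\<lambda>i t. reg.flow t V i) (n + l))"
      "continuous_on {0..T} (reg.src (\<lambda>i t. reg.flow t V i) (n + l))" if "l \<le> p" for l
      using reg.csol_subset[OF reg.flow_csol[of V] subset_UNIV, of "{0..T}"] in_range[OF that]
        reg.csol_src_continuous[OF reg.csol_subset[OF reg.flow_csol[of V] subset_UNIV, of "{0..T}"]]
      by (auto simp: reg.csol_def x'_def)
    have "\<forall>l. \<exists>g. l \<le> p \<longrightarrow> obs_lim (Bs (n + l)) T (\<lambda>t. fst (reg.flow t V (n + l))) (x' (n + l)) g"
      using obs_lim_exists[OF adm T_pos rm] by blast
    from choice[OF this] obtain g0 where g0: "\<And>l. l \<le> p \<Longrightarrow> obs_lim (Bs (n + l)) T (\<lambda>t. fst (reg.flow t V (n + l))) (x' (n + l)) (g0 l)"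
      by blast
    define g where "g l = (if l \<le> q then obs (lift V) l else g0 l)" for l
    have gl: "obs_lim (Bs (n + l)) T (\<lambda>t. fst (reg.flow t V (n + l))) (x' (n + l)) (g l)" if l: "l \<le> p" for l
    proof (cases "l \<le> q")
      case True
      have "dual.flow t (lift V) (n + l) = reg.flow t V (n + l)" for t
        using flow_lift[OF in_range[OF l], of t V] \<kappa>_low[OF True] by (simp add: lift_def)
      then show ?thesis using obs_low(1)[OF True, of "lift V"] True by (simp add: g_def x'_def)
    qed (use g0[OF l] in \<open>simp add: g_def\<close>)
    have ob: "\<forall>l\<in>{0..p}. observation A (Bs (n + l)) T (x (n + l)) (x' (n + l)) (g l)"
      unfolding x_def using observation_of_obs_lim[OF _ rm gl] T_pos by auto
    note m = main[OF cs ob]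
    have x0: "x i 0 = S (fst (V i))" "x' i 0 = snd (V i)" if "i \<in> {1..n + p}" for i
      using reg.flow_0[OF that] by (simp_all add: x_def x'_def)
    have tn: "0 \<le> total_obs (lift V)" by (simp add: sum_nonneg)
    show ?thesis
    proof (cases "i \<le> n")
      case True
      then have k: "\<kappa> i = 1 + int i - int n" by (simp add: \<kappa>_def lev_def)
      have "(norm (lift V i))\<^sup>2 / 2 = energy A (1 + int i - int n) (x i 0) (x' i 0)"
        using energy_level[OF \<kappa>_le, of i "fst (V i)" "snd (V i)"] x0[of i] i True unfolding k[symmetric] by (simp add: lift_def)
      also have "\<dots> \<le> d i T * L2_sq T (g 0)" using m i True by auto
      also have "\<dots> \<le> d i T * total_obs (lift V)"
        using pos(1)[of i] i True member_le_sum[of 0 "{..p}" "\<lambda>l. L2_sq T (obs (lift V) l)"]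
        by (intro mult_left_mono) (auto simp: g_def)
      finally have "(norm (lift V i))\<^sup>2 \<le> (2 * d i T) * total_obs (lift V)" by simp
      also have "\<dots> \<le> D * total_obs (lift V)" using dle[of i] i True tn by (intro mult_right_mono) auto
      finally show ?thesis .
    next
      case False
      define k where "k = i - n"
      have k: "k \<in> {1..q}" "i = n + k" using i False by (auto simp: k_def)
      have kp: "k \<in> {1..p}" using k q by auto
      have "(norm (lift V i))\<^sup>2 / 2 = energy A 1 (x (n + k) 0) (x' (n + k) 0)"
        using energy_level[of 1 "fst (V i)" "snd (V i)"] x0[of i] k q \<kappa>_low[of k] by (simp add: lift_def)
      also have "\<dots> \<le> \<rho> k T * (\<Sum>l=0..k. L2_sq T (g l))" using m kp by blast
      also have "\<dots> \<le> \<rho> k T * total_obs (lift V)"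
      proof (rule mult_left_mono)
        have "(\<Sum>l=0..k. L2_sq T (g l)) = (\<Sum>l=0..k. L2_sq T (obs (lift V) l))"
          using k by (intro sum.cong) (auto simp: g_def)
        also have "\<dots> \<le> total_obs (lift V)" by (rule sum_mono2) (use kp in auto)
        finally show "(\<Sum>l=0..k. L2_sq T (g l)) \<le> total_obs (lift V)" .
        show "0 \<le> \<rho> k T" using pos(2)[OF kp] by simp
      qed
      finally have "(norm (lift V i))\<^sup>2 \<le> (2 * \<rho> k T) * total_obs (lift V)" by simp
      also have "\<dots> \<le> D * total_obs (lift V)" using \<rho>le[OF kp] tn by (rule mult_right_mono)
      finally show ?thesis .
    qed
  qed
  moreover have "D \<ge> 0" using s by (simp add: D_def)
  ultimately show ?thesis by blast
qed

text \<open>For \<open>k > q\<close> the component is at level \<open>0\<close>. Its free part is the velocity of a finite energy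
  wave, to which the observability inequality applies; the remainder is controlled by the
  previous components.\<close>

lemma observable_high:
  assumes k: "k \<in> {q + 1..p}"
  shows "\<exists>D\<ge>0. \<forall>U. (norm (U (n + k)))\<^sup>2 \<le> D * (L2_sq T (obs U k) + (\<Sum>j\<in>{1..<n + k}. norm (U j))\<^sup>2)"
proof -
  have kp: "k \<le> p" "q < k" and i: "n + k \<in> {1..n + p}" using k n by auto
  obtain L where L: "L \<ge> 0" "\<And>t U i. \<bar>t\<bar> \<le> T \<Longrightarrow> i \<in> {1..n + p} \<Longrightarrow>
    norm (dual.src (\<lambda>i t. dual.flow t U i) i t) \<le> L * (\<Sum>j\<in>{1..<i}. norm (U j))"
    using dual.flow_src_bound[of T] by blast
  have "T\<^sub>0 (n + k) < T" proof -
    have "\<forall>j\<in>{1..p}. T\<^sub>0 (n + j) \<le> T'" using time unfolding observability_time_def by (elim conjE)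
    from bspec[OF this, of k] show ?thesis using T kp by simp
  qed
  then obtain R where R: "R > 0" "\<And>w w' g. wave_vec A 1 T w w' (\<lambda>_. 0) \<Longrightarrow> observation A (Bs (n + k)) T w w' g \<Longrightarrow>
    L2_sq T g \<ge> R * energy A 1 (w 0) (w' 0)"
    using obs_hyp[OF kp(1)] unfolding observability_hyp_def by blast
  obtain b where b: "b \<ge> 0" "\<And>z. norm (Bs (n + k) (0, z)) \<le> norm z * b"
    using bounded_linear.nonneg_bounded[OF Bs_velocity_bounded[OF kp(1)]] by blast
  note lB = bounded_linear.linear[OF Bs_velocity_bounded[OF kp(1)]]
  have T0: "0 \<le> T" using T_pos by simp
  define D where "D = 4 / R * (1 + T * (2 * T * L * b)\<^sup>2)"
  have "(norm (U (n + k)))\<^sup>2 \<le> D * (L2_sq T (obs U k) + (\<Sum>j\<in>{1..<n + k}. norm (U j))\<^sup>2)" for U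
  proof -
    define Q where "Q = (\<Sum>j\<in>{1..<n + k}. norm (U j))"
    define F where "F = dual.src (\<lambda>i t. dual.flow t U i) (n + k)"
    have Q0: "0 \<le> Q" by (simp add: Q_def sum_nonneg)
    obtain a z where az: "mild UNIV a z (\<lambda>_. 0)" "a 0 = fst (U (n + k))" "z 0 = snd (U (n + k))"
      using mild_exists[of "\<lambda>_. 0" "fst (U (n + k))" "snd (U (n + k))"] by auto
    have Fc: "continuous_on UNIV F" unfolding F_def by (rule dual_mild(2)[OF i])
    obtain r s where rs: "mild UNIV r s F" "r 0 = 0" "s 0 = 0"
      and rb: "\<forall>T M. (\<forall>s. \<bar>s\<bar> \<le> T \<longrightarrow> norm (F s) \<le> M) \<longrightarrow>
        (\<forall>t. \<bar>t\<bar> \<le> T \<longrightarrow> norm (r t) \<le> norm (0::'h) + norm (0::'h) + 2 * T * M \<and> norm (s t) \<le> norm (0::'h) + norm (0::'h) + 2 * T * M)"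
      using mild_exists[OF Fc, of 0 0] by blast
    have rle: "norm (r t) \<le> 2 * T * (L * Q)" if "t \<in> {0..T}" for t
    proof -
      have "\<forall>s. \<bar>s\<bar> \<le> T \<longrightarrow> norm (F s) \<le> L * Q" unfolding F_def Q_def using L(2)[OF _ i] by blast
      then show ?thesis using rb that by auto
    qed
    have df: "fst (dual.flow t U (n + k)) - a t = r t" for t
    proof -
      have "mild UNIV (\<lambda>t. fst (dual.flow t U (n + k)) - a t) (\<lambda>t. snd (dual.flow t U (n + k)) - z t) (\<lambda>t. F t - 0)"
        unfolding F_def by (rule mild_diff[OF dual_mild(1)[OF i] az(1)])
      then have "mild UNIV (\<lambda>t. fst (dual.flow t U (n + k)) - a t) (\<lambda>t. snd (dual.flow t U (n + k)) - z t) F" by simp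
      then show ?thesis
        by (rule mild_unique(1)[OF _ rs(1) convex_UNIV, of _ _ 0 t]) (use az rs dual.flow_0[OF i] in auto)
    qed
    define g where "g t = Bs (n + k) (0, a t)" for t
    have ca: "continuous_on {0..T} a" using mild_subset[OF az(1) subset_UNIV] by (simp add: mild_def)
    have gL: "L2_fun T g"
      unfolding g_def by (intro L2_fun_continuous bounded_linear.continuous_on[OF Bs_velocity_bounded[OF kp(1)]] ca)
    have zm: "mild {0..T} (\<lambda>t. - z t) a (\<lambda>_. 0)"
    proof -
      have m: "mild {0..T} a z (\<lambda>_. 0)" by (rule mild_subset[OF az(1) subset_UNIV])
      show ?thesis unfolding mild_def
      proof (intro conjI allI ballI)
        show "continuous_on {0..T} (\<lambda>t. - z t)" "continuous_on {0..T} a"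
          using m by (auto simp: mild_def intro: continuous_on_minus)
        fix j t assume t: "t \<in> {0..T}"
        have A: "((\<lambda>s. a s \<bullet> \<epsilon> j) has_real_derivative m j * (z t \<bullet> \<epsilon> j)) (at t within {0..T})"
          "((\<lambda>s. z s \<bullet> \<epsilon> j) has_real_derivative 0 \<bullet> \<epsilon> j - m j * (a t \<bullet> \<epsilon> j)) (at t within {0..T})"
          using m t unfolding mild_def by blast+
        show "((\<lambda>s. - z s \<bullet> \<epsilon> j) has_real_derivative m j * (a t \<bullet> \<epsilon> j)) (at t within {0..T})"
          using DERIV_minus[OF A(2)] by simp
        show "((\<lambda>s. a s \<bullet> \<epsilon> j) has_real_derivative 0 \<bullet> \<epsilon> j - m j * (- z t \<bullet> \<epsilon> j)) (at t within {0..T})"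
          using A(1) by simp
      qed
    qed
    have Bind: "Bs (n + k) (u, y) = Bs (n + k) (0, y)" if "u \<in> Hdom A 2" for u y
      using B_high[OF k that] B_high[OF k zero_Hdom] by simp
    have ol: "obs_lim (Bs (n + k)) T (\<lambda>t. - z t) a g"
      unfolding obs_lim_def
    proof (intro conjI gL LIMSEQ_I)
      fix e :: real assume e: "e > 0"
      define d where "d = sqrt (e / (2 * (T + 1))) / (b + 1)"
      have d: "d > 0" using e T0 b(1) by (simp add: d_def)
      have db: "T * (d * b)\<^sup>2 < e"
      proof -
        have "(d * b)\<^sup>2 \<le> (d * (b + 1))\<^sup>2" using d b(1) by (intro power_mono mult_left_mono) auto
        also have "\<dots> = e / (2 * (T + 1))" using e T0 b(1) by (simp add: d_def)
        finally have "T * (d * b)\<^sup>2 \<le> T * (e / (2 * (T + 1)))" using T0 by (intro mult_left_mono)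
        also have "\<dots> < e" using e T0 by (auto simp: field_simps intro!: add_nonneg_pos)
        finally show ?thesis .
      qed
      obtain P0 where P0: "\<And>P t. P \<ge> P0 \<Longrightarrow> t \<in> {0..T} \<Longrightarrow> norm (trunc P (a t) - a t) < d"
        using uniform_limitD[OF trunc_uniform[OF ca] d] unfolding eventually_sequentially dist_norm by blast
      have "L2_sq T (\<lambda>t. Bs (n + k) (S (trunc P (- z t)), trunc P (a t)) - g t) < e" if "P \<ge> P0" for P
      proof -
        have "norm (Bs (n + k) (S (trunc P (- z t)), trunc P (a t)) - g t) \<le> d * b" if t: "t \<in> {0..T}" for t
        proof -
          have "Bs (n + k) (S (trunc P (- z t)), trunc P (a t)) - g t = Bs (n + k) (0, trunc P (a t) - a t)"
            unfolding g_def Bind[OF S_trunc_Hdom] by (simp add: linear_diff[OF lB])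
          then show ?thesis using b(2)[of "trunc P (a t) - a t"] P0[OF \<open>P \<ge> P0\<close> t] b(1)
            by (metis less_imp_le mult_right_mono order_trans)
        qed
        then have "L2_sq T (\<lambda>t. Bs (n + k) (S (trunc P (- z t)), trunc P (a t)) - g t) \<le> T * (d * b)\<^sup>2"
          using d b(1) T0 by (intro L2_sq_le_bound) auto
        then show ?thesis using db by simp
      qed
      then show "\<exists>no. \<forall>P\<ge>no. norm (L2_sq T (\<lambda>t. Bs (n + k) (S (trunc P (- z t)), trunc P (a t)) - g t) - 0) < e" by auto
    qed
    have "observation A (Bs (n + k)) T (\<lambda>t. S (- z t)) a g"
      by (rule observation_of_obs_lim[OF T0 zm continuous_on_const ol])
    moreover have "wave_vec A 1 T (\<lambda>t. S (- z t)) a (\<lambda>_. 0)"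
      using wave_vec_of_mild[OF T0 _ zm continuous_on_const, of 1] by simp
    ultimately have "R * energy A 1 (S (- z 0)) (a 0) \<le> L2_sq T g" by (rule R(2)[rotated])
    moreover have "energy A 1 (S (- z 0)) (a 0) = (norm (U (n + k)))\<^sup>2 / 2"
      unfolding energy_level[OF order_refl] az by (simp add: norm_prod_def add.commute)
    ultimately have lo: "R * ((norm (U (n + k)))\<^sup>2 / 2) \<le> L2_sq T g" by simp
    have "L2_sq T g \<le> 2 * L2_sq T (obs U k) + 2 * L2_sq T (\<lambda>t. g t - obs U k t)"
      by (rule L2_sq_le2[OF gL obs_in_L2[OF kp(1)]])
    moreover have "L2_sq T (\<lambda>t. g t - obs U k t) \<le> T * (2 * T * (L * Q) * b)\<^sup>2"
    proof (rule L2_sq_le_bound[OF T0])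
      show "0 \<le> 2 * T * (L * Q) * b" using T0 L(1) Q0 b(1) by simp
      fix t assume t: "t \<in> {0..T}"
      have "g t - obs U k t = Bs (n + k) (0, a t - fst (dual.flow t U (n + k)))"
        using kp by (simp add: g_def obs_high linear_diff[OF lB])
      also have "a t - fst (dual.flow t U (n + k)) = - r t" using df[of t] by (metis minus_diff_eq)
      finally show "norm (g t - obs U k t) \<le> 2 * T * (L * Q) * b"
        using b(2)[of "- r t"] mult_right_mono[OF rle[OF t] b(1)] by simp
    qed
    moreover have "T * (2 * T * (L * Q) * b)\<^sup>2 = (T * (2 * T * L * b)\<^sup>2) * Q\<^sup>2"
      by (simp add: power_mult_distrib algebra_simps)
    ultimately have "R * ((norm (U (n + k)))\<^sup>2 / 2) \<le> 2 * L2_sq T (obs U k) + 2 * ((T * (2 * T * L * b)\<^sup>2) * Q\<^sup>2)"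
      using lo by linarith
    also have "\<dots> \<le> 2 * (1 + T * (2 * T * L * b)\<^sup>2) * (L2_sq T (obs U k) + Q\<^sup>2)"
    proof -
      have "0 \<le> T * (2 * T * L * b)\<^sup>2 * L2_sq T (obs U k)" using T0 by simp
      then show ?thesis using zero_le_power2[of Q] by (simp add: algebra_simps)
    qed
    finally show ?thesis using R(1) unfolding Q_def[symmetric] D_def by (simp add: field_simps)
  qed
  moreover have "D \<ge> 0" using R(1) T0 by (simp add: D_def)
  ultimately show ?thesis by blast
qed

lemma observable_all:
  "\<exists>D\<ge>0. \<forall>V. (dual.tot (lift V))\<^sup>2 \<le> D * total_obs (lift V)"
proof -
  have tn: "0 \<le> total_obs U" for U by (simp add: sum_nonneg)
  have "r \<le> p - q \<Longrightarrow> \<exists>D\<ge>0. \<forall>V. \<forall>i\<in>{1..n + q + r}. (norm (lift V i))\<^sup>2 \<le> D * total_obs (lift V)" for r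
  proof (induction r)
    case 0
    then show ?case using observable_low by simp
  next
    case (Suc r)
    then obtain D where D: "D \<ge> 0" "\<And>V i. i \<in> {1..n + q + r} \<Longrightarrow> (norm (lift V i))\<^sup>2 \<le> D * total_obs (lift V)" by auto
    define k where "k = q + Suc r"
    have k: "k \<in> {q + 1..p}" using Suc.prems q by (auto simp: k_def)
    obtain D' where D': "D' \<ge> 0" "\<And>U. (norm (U (n + k)))\<^sup>2 \<le> D' * (L2_sq T (obs U k) + (\<Sum>j\<in>{1..<n + k}. norm (U j))\<^sup>2)"
      using observable_high[OF k] by blast
    define M where "M = real (n + k)"
    have "(norm (lift V i))\<^sup>2 \<le> (D + D' * (1 + M\<^sup>2 * D)) * total_obs (lift V)" if i: "i \<in> {1..n + q + Suc r}" for V i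
    proof (cases "i \<in> {1..n + q + r}")
      case True
      have "0 \<le> D' * (1 + M\<^sup>2 * D) * total_obs (lift V)" using D(1) D'(1) tn by simp
      then show ?thesis using D(2)[OF True, of V] unfolding distrib_right[of D] by linarith
    next
      case False
      then have ik: "i = n + k" using i by (auto simp: k_def)
      have "norm (lift V j) \<le> sqrt (D * total_obs (lift V))" if "j \<in> {1..<n + k}" for j
        using D(2)[of j V] that by (intro real_le_rsqrt) (auto simp: k_def)
      then have "(\<Sum>j\<in>{1..<n + k}. norm (lift V j)) \<le> (\<Sum>j\<in>{1..<n + k}. sqrt (D * total_obs (lift V)))" by (rule sum_mono)
      also have "\<dots> \<le> M * sqrt (D * total_obs (lift V))"
        unfolding sum_constant using D(1) tn[of "lift V"] by (intro mult_right_mono) (auto simp: M_def)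
      finally have "(\<Sum>j\<in>{1..<n + k}. norm (lift V j))\<^sup>2 \<le> (M * sqrt (D * total_obs (lift V)))\<^sup>2"
        by (intro power_mono sum_nonneg) auto
      also have "\<dots> = M\<^sup>2 * (D * total_obs (lift V))" using D(1) tn[of "lift V"] by (simp add: power_mult_distrib)
      finally have s: "(\<Sum>j\<in>{1..<n + k}. norm (lift V j))\<^sup>2 \<le> M\<^sup>2 * (D * total_obs (lift V))" .
      have "L2_sq T (obs (lift V) k) \<le> total_obs (lift V)"
        by (rule member_le_sum) (use k in auto)
      then have "D' * (L2_sq T (obs (lift V) k) + (\<Sum>j\<in>{1..<n + k}. norm (lift V j))\<^sup>2) \<le> D' * (total_obs (lift V) + M\<^sup>2 * (D * total_obs (lift V)))"
        using s D'(1) by (intro mult_left_mono add_mono)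
      then have "(norm (lift V i))\<^sup>2 \<le> D' * (total_obs (lift V) + M\<^sup>2 * (D * total_obs (lift V)))"
        unfolding ik using D'(2)[of "lift V"] by (rule order_trans[rotated])
      also have "\<dots> = (D' * (1 + M\<^sup>2 * D)) * total_obs (lift V)" by (simp add: algebra_simps)
      also have "\<dots> \<le> (D + D' * (1 + M\<^sup>2 * D)) * total_obs (lift V)" using D(1) tn by (intro mult_right_mono) auto
      finally show ?thesis .
    qed
    moreover have "0 \<le> D + D' * (1 + M\<^sup>2 * D)" using D(1) D'(1) by simp
    ultimately show ?case by blast
  qed
  from this[of "p - q"] obtain D where D: "D \<ge> 0" "\<And>V i. i \<in> {1..n + p} \<Longrightarrow> (norm (lift V i))\<^sup>2 \<le> D * total_obs (lift V)"
    using q by auto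
  have "(dual.tot (lift V))\<^sup>2 \<le> ((real (n + p))\<^sup>2 * D) * total_obs (lift V)" for V
  proof -
    have "dual.tot (lift V) \<le> (\<Sum>i=1..n + p. sqrt (D * total_obs (lift V)))"
      unfolding dual.tot_def by (intro sum_mono real_le_rsqrt D(2))
    then have "dual.tot (lift V) \<le> real (n + p) * sqrt (D * total_obs (lift V))" by simp
    then have "(dual.tot (lift V))\<^sup>2 \<le> (real (n + p) * sqrt (D * total_obs (lift V)))\<^sup>2"
      by (intro power_mono dual.tot_nonneg)
    then show ?thesis using D(1) tn[of "lift V"] by (simp add: power_mult_distrib)
  qed
  then show ?thesis using D(1) by (intro exI[of _ "(real (n + p))\<^sup>2 * D"]) simp
qed

lemma lift_dense:
  "\<exists>V. (\<forall>k. V k \<in> range lift) \<and> (\<lambda>k::nat. dual.tot (\<lambda>i. 1 *\<^sub>R U i + (- 1) *\<^sub>R V k i)) \<longlonglongrightarrow> 0"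
proof (intro exI[of _ "\<lambda>k i. (trunc k (fst (U i)), trunc k (snd (U i)))"] conjI allI)
  fix k
  have "hpow A (\<kappa> i - 1) (hpow A (1 - \<kappa> i) (trunc k u)) = trunc k u" for i u
    using hpow_inv[OF trunc_smooth, of "1 - \<kappa> i"] by simp
  then have "(\<lambda>i. (trunc k (fst (U i)), trunc k (snd (U i)))) =
      lift (\<lambda>i. (hpow A (1 - \<kappa> i) (trunc k (fst (U i))), hpow A (1 - \<kappa> i) (trunc k (snd (U i)))))"
    by (auto simp: lift_def)
  then show "(\<lambda>i. (trunc k (fst (U i)), trunc k (snd (U i)))) \<in> range lift" by blast
next
  have "(\<lambda>k. (trunc k (fst (U i)), trunc k (snd (U i)))) \<longlonglongrightarrow> (fst (U i), snd (U i))" for i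
    by (intro tendsto_Pair trunc_tendsto)
  then have t: "(\<lambda>k. (trunc k (fst (U i)), trunc k (snd (U i)))) \<longlonglongrightarrow> U i" for i by simp
  have "(\<lambda>k. dual.tot (\<lambda>i. 1 *\<^sub>R U i + (- 1) *\<^sub>R (trunc k (fst (U i)), trunc k (snd (U i))))) \<longlonglongrightarrow>
      (\<Sum>i=1..n + p. norm (1 *\<^sub>R U i + (- 1) *\<^sub>R U i))"
    unfolding dual.tot_def by (intro tendsto_intros t)
  then show "(\<lambda>k. dual.tot (\<lambda>i. 1 *\<^sub>R U i + (- 1) *\<^sub>R (trunc k (fst (U i)), trunc k (snd (U i))))) \<longlonglongrightarrow> 0" by simp
qed

sublocale oc: observed_cascade A \<epsilon> m c "coup \<kappa>" "coupled_with n" "n + p" T p "\<lambda>l. G (n + l)" obs "range lift"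
proof unfold_locales
  show "0 < T" by (rule T_pos)
  show "closed (G (n + l))" "subspace (G (n + l))" if "l \<le> p" for l
    using admissibility_subspace[OF adm[OF that]] by auto
  show "obs U l t \<in> G (n + l)" if l: "l \<le> p" for U l t
  proof (cases "l \<le> q")
    case False
    then show ?thesis using observation_operator(2)[OF adm[OF l] zero_Hdom] by (simp add: obs_high)
  qed (rule obs_low(2))
  show "L2_fun T (obs U l)" if "l \<le> p" for U l by (rule obs_in_L2[OF that])
  show "L2_sq T (\<lambda>t. obs (\<lambda>i. x *\<^sub>R U i + y *\<^sub>R V i) l t - (x *\<^sub>R obs U l t + y *\<^sub>R obs V l t)) = 0"
    if "l \<le> p" for l x U y V by (rule obs_linear[OF that])
  show "\<exists>M\<ge>0. \<forall>U. \<forall>l\<le>p. L2_sq T (obs U l) \<le> M * (dual.tot U)\<^sup>2" by (rule obs_tot_bound)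
  show "(\<lambda>i. x *\<^sub>R U i + y *\<^sub>R V i) \<in> range lift" if UV': "U \<in> range lift" "V \<in> range lift" for U V x y
  proof -
    obtain U' V' where UV: "U = lift U'" "V = lift V'" using UV' by (elim rangeE)
    have "(\<lambda>i. x *\<^sub>R U i + y *\<^sub>R V i) = lift (\<lambda>i. x *\<^sub>R U' i + y *\<^sub>R V' i)"
      unfolding UV lift_def using bounded_linear.linear[OF lift_bounded]
      by (auto simp: linear_add linear_cmul)
    then show ?thesis by blast
  qed
  show "\<exists>V. (\<forall>k. V k \<in> range lift) \<and> (\<lambda>k::nat. dual.tot (\<lambda>i. 1 *\<^sub>R U i + (- 1) *\<^sub>R V k i)) \<longlonglongrightarrow> 0" for U
    by (rule lift_dense)
  show "\<exists>C\<ge>0. \<forall>U\<in>range lift. (dual.tot U)\<^sup>2 \<le> C * total_obs U" using observable_all by blast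
qed

definition represents :: "(nat \<Rightarrow> 'h gvec) \<Rightarrow> (nat \<Rightarrow> 'h gvec) \<Rightarrow> (nat \<Rightarrow> 'h \<times> 'h) \<Rightarrow> bool" where
  "represents y y' Z \<longleftrightarrow> (\<forall>i\<in>{1..n + p}. y i = emb (lev n q i) (- snd (Z i)) \<and> y' i = emb (lev n q i - 1) (fst (Z i)))"

lemma represents_exists:
  assumes "\<And>i. i \<in> {1..n + p} \<Longrightarrow> y i \<in> Hs A (lev n q i) \<and> y' i \<in> Hs A (lev n q i - 1)"
  shows "\<exists>Z. represents y y' Z"
proof -
  have "\<forall>i. \<exists>z. i \<in> {1..n + p} \<longrightarrow> y i = emb (lev n q i) (- snd z) \<and> y' i = emb (lev n q i - 1) (fst z)"
  proof
    fix i
    show "\<exists>z. i \<in> {1..n + p} \<longrightarrow> y i = emb (lev n q i) (- snd z) \<and> y' i = emb (lev n q i - 1) (fst z)"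
    proof (cases "i \<in> {1..n + p}")
      case True
      obtain a b where "y i = emb (lev n q i) a" "y' i = emb (lev n q i - 1) b"
        using assms[OF True] unfolding Hs_eq by (elim conjE rangeE)
      then show ?thesis by (intro exI[of _ "(b, - a)"]) simp
    qed blast
  qed
  from choice[OF this] show ?thesis unfolding represents_def by blast
qed

lemma state_pair_ip:
  assumes y: "represents y y' Z"
    and w: "\<And>i. i \<in> {1..n + p} \<Longrightarrow> w i = emb (\<kappa> i) (fst (U i)) \<and> w' i = emb (\<kappa> i - 1) (snd (U i))"
  shows "state_pair n p q y y' w w' = dual.ip Z U"
  unfolding state_pair_def dual.ip_def
proof (rule sum.cong[OF refl])
  fix i assume i: "i \<in> {1..n + p}"
  have k: "\<kappa> i = - (lev n q i - 1)" "\<kappa> i - 1 = - lev n q i" by (simp_all add: \<kappa>_def)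
  have "dpair (lev n q i - 1) (y' i) (w i) = fst (Z i) \<bullet> fst (U i)"
    using dpair_emb[of "lev n q i - 1" "fst (Z i)" "fst (U i)"] y i w[OF i] unfolding represents_def k(1) by simp
  moreover have "dpair (lev n q i) (y i) (w' i) = - snd (Z i) \<bullet> snd (U i)"
    using dpair_emb[of "lev n q i" "- snd (Z i)" "snd (U i)"] y i w[OF i] unfolding represents_def k(2) by simp
  ultimately show "dpair (lev n q i - 1) (y' i) (w i) - dpair (lev n q i) (y i) (w' i) = Z i \<bullet> U i"
    by (simp add: inner_prod_def)
qed

lemma obs_observation:
  assumes "l \<le> q" "t \<in> {0..T}"
  shows "observation A (Bs (n + l)) t (\<lambda>s. S (fst (dual.flow s U (n + l)))) (\<lambda>s. snd (dual.flow s U (n + l))) (obs U l)"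
proof -
  have l: "l \<le> p" using assms q by simp
  show ?thesis
    using assms(2) observation_of_obs_lim[OF _ dual_mild(1,2)[OF in_range[OF l]]
      obs_lim_restrict[OF adm[OF l] dual_mild(3,4)[OF in_range[OF l]] obs_low(1)[OF assms(1)]]]
    by simp
qed

lemma obs_control_adj:
  assumes "l \<in> {q + 1..p}"
  shows "obs U l s = control_adj (G (n + l)) (B (n + l)) (fst (dual.flow s U (n + l)))"
  using assms B_high[OF assms zero_Hdom] by (simp add: obs_high)

lemma dual_solution_observed:
  assumes w: "cascade_sol A C n p (\<lambda>i. 1 - lev n q i) t w w'" and t: "t \<in> {0..T}"
    and low: "\<And>l. l \<le> q \<Longrightarrow> observation A (\<lambda>(u, z). control_adj (G (n + l)) (B (n + l)) u) t
             (\<lambda>s. riesz (w (n + l) s)) (\<lambda>s. riesz (w' (n + l) s)) (g l)"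
    and high: "\<And>l s. l \<in> {q + 1..p} \<Longrightarrow> s \<in> {0..t} \<Longrightarrow> g l s = control_adj (G (n + l)) (B (n + l)) (riesz (w (n + l) s))"
  obtains U where "\<And>i s. i \<in> {1..n + p} \<Longrightarrow> s \<in> {0..t} \<Longrightarrow>
      w i s = emb (\<kappa> i) (fst (dual.flow s U i)) \<and> w' i s = emb (\<kappa> i - 1) (snd (dual.flow s U i))"
    "\<And>l. l \<le> p \<Longrightarrow> L2_fun t (g l) \<and> L2_sq t (\<lambda>s. g l s - obs U l s) = 0"
proof -
  have t0: "0 \<le> t" using t by simp
  have "(\<lambda>i. 1 - lev n q i) = \<kappa>" by (simp add: fun_eq_iff \<kappa>_def)
  then obtain W where W: "dual.csol {0..t} W"
    "\<forall>i\<in>{1..n + p}. \<forall>s\<in>{0..t}. w i s = emb (\<kappa> i) (fst (W i s)) \<and> w' i s = emb (\<kappa> i - 1) (snd (W i s))"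
    using dual.csol_of_cascade[OF _ t0, of w w'] w by auto
  define U where "U i = W i 0" for i
  have WU: "W i s = dual.flow s U i" if "i \<in> {1..n + p}" "s \<in> {0..t}" for i s
    by (rule dual.flow_unique[OF W(1) _ _ _ that]) (use t0 in \<open>auto simp: U_def\<close>)
  show thesis
  proof (rule that)
    show wU: "w i s = emb (\<kappa> i) (fst (dual.flow s U i)) \<and> w' i s = emb (\<kappa> i - 1) (snd (dual.flow s U i))"
      if "i \<in> {1..n + p}" "s \<in> {0..t}" for i s
      using W(2) that WU[OF that] by simp
    show "L2_fun t (g l) \<and> L2_sq t (\<lambda>s. g l s - obs U l s) = 0" if l: "l \<le> p" for l
    proof (cases "l \<le> q")
      case True
      have o: "observation A (Bs (n + l)) t (\<lambda>s. riesz (w (n + l) s)) (\<lambda>s. riesz (w' (n + l) s)) (g l)"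
        by (rule observation_cong[OF _ low[OF True]]) (simp add: B_low[OF True])
      have "L2_sq t (\<lambda>s. g l s - obs U l s) = 0"
      proof (cases "t = 0")
        case False
        show ?thesis
          by (rule observation_unique[OF adm[OF l] _ o obs_observation[OF True t]])
            (use False t0 wU[OF in_range[OF l]] \<kappa>_low[OF True] riesz_level in auto)
      qed (use L2_sq_eq_0[OF t0] in auto)
      then show ?thesis using o by (simp add: observation_def)
    next
      case False
      then have lq: "l \<in> {q + 1..p}" using l by simp
      have e: "g l s = obs U l s" if "s \<in> {0..t}" for s
        using high[OF lq that] wU[OF in_range[OF l] that] by (simp add: obs_control_adj[OF lq] \<kappa>_high[OF lq] riesz_level)
      have "L2_fun t (obs U l)" by (rule L2_restrict(1)[OF obs_in_L2[OF l]]) (use t in simp)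
      then show ?thesis using L2_fun_cong[of t "obs U l" "g l"] e L2_sq_eq_0[OF t0, of "\<lambda>s. g l s - obs U l s"] by simp
    qed
  qed
qed

lemma flow_is_observed_solution:
  fixes U :: "nat \<Rightarrow> 'h \<times> 'h"
  assumes t: "t \<in> {0..T}"
  defines "w \<equiv> \<lambda>i s. emb (\<kappa> i) (fst (dual.flow s U i))" and "w' \<equiv> \<lambda>i s. emb (\<kappa> i - 1) (snd (dual.flow s U i))"
  shows "cascade_sol A C n p (\<lambda>i. 1 - lev n q i) t w w'"
    "l \<le> q \<Longrightarrow> observation A (\<lambda>(u, z). control_adj (G (n + l)) (B (n + l)) u) t
             (\<lambda>s. riesz (w (n + l) s)) (\<lambda>s. riesz (w' (n + l) s)) (obs U l)"
    "l \<in> {q + 1..p} \<Longrightarrow> obs U l s = control_adj (G (n + l)) (B (n + l)) (riesz (w (n + l) s))"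
proof -
  have "(\<lambda>i. 1 - lev n q i) = \<kappa>" by (simp add: fun_eq_iff \<kappa>_def)
  then show "cascade_sol A C n p (\<lambda>i. 1 - lev n q i) t w w'"
    using dual.cascade_of_csol[OF dual.csol_subset[OF dual.flow_csol subset_UNIV]] t unfolding w_def w'_def by simp
  show "observation A (\<lambda>(u, z). control_adj (G (n + l)) (B (n + l)) u) t
             (\<lambda>s. riesz (w (n + l) s)) (\<lambda>s. riesz (w' (n + l) s)) (obs U l)" if "l \<le> q"
    unfolding w_def w'_def \<kappa>_low[OF that] riesz_level diff_self
    by (rule observation_cong[OF _ obs_observation[OF that t]]) (simp add: B_low[OF that])
  show "obs U l s = control_adj (G (n + l)) (B (n + l)) (riesz (w (n + l) s))" if "l \<in> {q + 1..p}"
    unfolding w_def \<kappa>_high[OF that] riesz_level by (rule obs_control_adj[OF that])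
qed

lemma LINT_observed:
  assumes v: "\<And>l. l \<le> p \<Longrightarrow> L2_fun T (v (n + l))" and t: "t \<in> {0..T}"
    and g: "\<And>l. l \<le> p \<Longrightarrow> L2_fun t (g l) \<and> L2_sq t (\<lambda>s. g l s - obs U l s) = 0"
  shows "(LINT s|lebesgue_on {0..t}. (\<Sum>l=0..p. v (n + l) s \<bullet> g l s)) =
    (\<Sum>l\<le>p. LINT s|lebesgue_on {0..t}. v (n + l) s \<bullet> obs U l s)"
proof -
  have L: "L2_fun t (v (n + l))" "L2_fun t (obs U l)" if "l \<le> p" for l
    using L2_restrict(1)[OF v[OF that], of t] L2_restrict(1)[OF obs_in_L2[OF that], of t] t by auto
  have "(LINT s|lebesgue_on {0..t}. (\<Sum>l=0..p. v (n + l) s \<bullet> g l s)) = (\<Sum>l=0..p. LINT s|lebesgue_on {0..t}. v (n + l) s \<bullet> g l s)"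
    by (rule Bochner_Integration.integral_sum) (use L2_inner_integrable[OF L(1)] g in auto)
  also have "\<dots> = (\<Sum>l\<le>p. LINT s|lebesgue_on {0..t}. v (n + l) s \<bullet> obs U l s)"
    unfolding atMost_atLeast0
    by (rule sum.cong[OF refl], rule L2_inner_eq) (use L g in auto)
  finally show ?thesis .
qed

lemma transposition_sol_exists:
  assumes v: "\<And>l. l \<le> p \<Longrightarrow> L2_fun T (v (n + l))" and Z: "represents y0 y1 Z"
  shows "\<exists>y y'. transposition_sol A C G B n p q T v y0 y1 y y'"
proof -
  obtain Y where Y: "\<forall>i\<in>{1..n + p}. Y 0 i = Z i \<and> continuous_on {0..T} (\<lambda>t. Y t i)"
    "\<forall>t\<in>{0..T}. \<forall>U. dual.ip (Y t) (dual.flow t U) = dual.ip Z U + (\<Sum>l\<le>p. LINT s|lebesgue_on {0..t}. v (n + l) s \<bullet> obs U l s)"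
    using oc.transposed_state_exists[of "\<lambda>l. v (n + l)" Z] v by blast
  define y where "y i t = emb (lev n q i) (- snd (Y t i))" for i t
  define y' where "y' i t = emb (lev n q i - 1) (fst (Y t i))" for i t
  have r: "represents (\<lambda>i. y i t) (\<lambda>i. y' i t) (Y t)" for t
    by (simp add: represents_def y_def y'_def)
  have "transposition_sol A C G B n p q T v y0 y1 y y'"
    unfolding transposition_sol_def
  proof (intro conjI ballI allI impI)
    fix i assume i: "i \<in> {1..n + p}"
    have c: "continuous_on {0..T} (\<lambda>t. - snd (Y t i))" "continuous_on {0..T} (\<lambda>t. fst (Y t i))"
      using Y(1) i by (auto intro!: continuous_intros)
    show "Hcont A (lev n q i) T (y i)" unfolding Hcont_iff by (rule exI, rule conjI[OF c(1)]) (simp add: y_def)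
    show "Hcont A (lev n q i - 1) T (y' i)" unfolding Hcont_iff by (rule exI, rule conjI[OF c(2)]) (simp add: y'_def)
    show "y i 0 = y0 i" "y' i 0 = y1 i" using Y(1) Z i by (simp_all add: y_def y'_def represents_def)
  next
    fix t w w' g
    assume t: "t \<in> {0..T}" and a: "cascade_sol A C n p (\<lambda>i. 1 - lev n q i) t w w' \<and>
        (\<forall>l\<in>{0..q}. observation A (\<lambda>(u, z). control_adj (G (n + l)) (B (n + l)) u) t
             (\<lambda>s. riesz (w (n + l) s)) (\<lambda>s. riesz (w' (n + l) s)) (g l)) \<and>
        (\<forall>l\<in>{q + 1..p}. \<forall>s\<in>{0..t}. g l s = control_adj (G (n + l)) (B (n + l)) (riesz (w (n + l) s)))"
    obtain U where U: "\<And>i s. i \<in> {1..n + p} \<Longrightarrow> s \<in> {0..t} \<Longrightarrow>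
        w i s = emb (\<kappa> i) (fst (dual.flow s U i)) \<and> w' i s = emb (\<kappa> i - 1) (snd (dual.flow s U i))"
      and g: "\<And>l. l \<le> p \<Longrightarrow> L2_fun t (g l) \<and> L2_sq t (\<lambda>s. g l s - obs U l s) = 0"
      by (rule dual_solution_observed[OF conjunct1[OF a] t, of g]) (use a in auto)
    have "state_pair n p q (\<lambda>k. y k t) (\<lambda>k. y' k t) (\<lambda>k. w k t) (\<lambda>k. w' k t) = dual.ip (Y t) (dual.flow t U)"
      by (rule state_pair_ip[OF r]) (use U t in auto)
    moreover have "state_pair n p q y0 y1 (\<lambda>k. w k 0) (\<lambda>k. w' k 0) = dual.ip Z U"
      by (rule state_pair_ip[OF Z]) (use U[of _ 0] t dual.flow_0 in auto)
    ultimately show "(LINT s|lebesgue_on {0..t}. (\<Sum>l=0..p. v (n + l) s \<bullet> g l s)) =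
          state_pair n p q (\<lambda>k. y k t) (\<lambda>k. y' k t) (\<lambda>k. w k t) (\<lambda>k. w' k t) -
          state_pair n p q y0 y1 (\<lambda>k. w k 0) (\<lambda>k. w' k 0)"
      using LINT_observed[of v t g U, OF v t g] Y(2) t by simp
  qed
  then show ?thesis by blast
qed

lemma transposition_sol_identity:
  assumes s: "transposition_sol A C G B n p q T v y0 y1 y y'" and t: "t \<in> {0..T}"
    and v: "\<And>l. l \<le> p \<Longrightarrow> L2_fun T (v (n + l))"
    and Z: "represents y0 y1 Z" and Y: "represents (\<lambda>i. y i t) (\<lambda>i. y' i t) Y"
  shows "(\<Sum>l\<le>p. LINT s|lebesgue_on {0..t}. v (n + l) s \<bullet> obs U l s) = dual.ip Y (dual.flow t U) - dual.ip Z U"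
proof -
  let ?w = "\<lambda>i s. emb (\<kappa> i) (fst (dual.flow s U i))" and ?w' = "\<lambda>i s. emb (\<kappa> i - 1) (snd (dual.flow s U i))"
  have id: "\<And>w w' g. cascade_sol A C n p (\<lambda>i. 1 - lev n q i) t w w' \<Longrightarrow>
        (\<forall>l\<in>{0..q}. observation A (\<lambda>(u, z). control_adj (G (n + l)) (B (n + l)) u) t
             (\<lambda>s. riesz (w (n + l) s)) (\<lambda>s. riesz (w' (n + l) s)) (g l)) \<Longrightarrow>
        (\<forall>l\<in>{q + 1..p}. \<forall>s\<in>{0..t}. g l s = control_adj (G (n + l)) (B (n + l)) (riesz (w (n + l) s))) \<Longrightarrow>
        (LINT s|lebesgue_on {0..t}. (\<Sum>l=0..p. v (n + l) s \<bullet> g l s)) =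
          state_pair n p q (\<lambda>k. y k t) (\<lambda>k. y' k t) (\<lambda>k. w k t) (\<lambda>k. w' k t) -
          state_pair n p q y0 y1 (\<lambda>k. w k 0) (\<lambda>k. w' k 0)"
    using bspec[OF conjunct2[OF s[unfolded transposition_sol_def]] t] by simp
  have "(LINT s|lebesgue_on {0..t}. (\<Sum>l=0..p. v (n + l) s \<bullet> obs U l s)) =
      state_pair n p q (\<lambda>k. y k t) (\<lambda>k. y' k t) (\<lambda>k. ?w k t) (\<lambda>k. ?w' k t) -
      state_pair n p q y0 y1 (\<lambda>k. ?w k 0) (\<lambda>k. ?w' k 0)"
    by (rule id) (use flow_is_observed_solution[OF t, where U=U] in auto)
  also have "state_pair n p q (\<lambda>k. y k t) (\<lambda>k. y' k t) (\<lambda>k. ?w k t) (\<lambda>k. ?w' k t) = dual.ip Y (dual.flow t U)"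
    by (rule state_pair_ip[OF Y]) simp
  also have "state_pair n p q y0 y1 (\<lambda>k. ?w k 0) (\<lambda>k. ?w' k 0) = dual.ip Z U"
    by (rule state_pair_ip[OF Z]) (simp add: dual.flow_0)
  finally show ?thesis
    using LINT_observed[of v t "obs U" U, OF v t] L2_restrict(1)[OF obs_in_L2, of _ t U] t by auto
qed

lemma null_controllable:
  assumes y01: "(y0, y1) \<in> state_space A n p q"
  shows "\<exists>v. (\<forall>k\<in>{0..p}. L2_fun T (v (n + k)) \<and> (\<forall>t\<in>{0<..<T}. v (n + k) t \<in> G (n + k))) \<and>
     (\<exists>y y'. transposition_sol A C G B n p q T v y0 y1 y y') \<and>
     (\<forall>y y'. transposition_sol A C G B n p q T v y0 y1 y y' \<longrightarrow>
        (\<forall>i\<in>{1..n + p}. y i T = (\<lambda>_. 0) \<and> y' i T = (\<lambda>_. 0)))"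
proof -
  have "\<And>i. i \<in> {1..n + p} \<Longrightarrow> y0 i \<in> Hs A (lev n q i) \<and> y1 i \<in> Hs A (lev n q i - 1)"
    using y01 by (simp add: state_space_def)
  then obtain Z where Z: "represents y0 y1 Z" using represents_exists by blast
  obtain v' where v': "\<forall>l\<le>p. L2_fun T (v' l) \<and> (\<forall>t. v' l t \<in> G (n + l))"
    "\<forall>U. (\<Sum>l\<le>p. LINT t|lebesgue_on {0..T}. v' l t \<bullet> obs U l t) = - dual.ip Z U"
    using oc.control_exists[of Z] by blast
  define v where "v j = v' (j - n)" for j
  have vL: "L2_fun T (v (n + l))" if "l \<le> p" for l using v'(1) that by (simp add: v_def)
  have T: "T \<in> {0..T}" using T_pos by simp
  have "y i T = (\<lambda>_. 0) \<and> y' i T = (\<lambda>_. 0)"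
    if s: "transposition_sol A C G B n p q T v y0 y1 y y'" and i: "i \<in> {1..n + p}" for y y' i
  proof -
    have "\<And>i. i \<in> {1..n + p} \<Longrightarrow> y i T \<in> Hs A (lev n q i) \<and> y' i T \<in> Hs A (lev n q i - 1)"
      using bspec[OF conjunct1[OF s[unfolded transposition_sol_def]]] T unfolding Hcont_def by simp
    then obtain Y where Y: "represents (\<lambda>i. y i T) (\<lambda>i. y' i T) Y"
      using represents_exists[of "\<lambda>i. y i T" "\<lambda>i. y' i T"] by blast
    have "dual.ip Y V = dual.ip (\<lambda>_. 0) V" for V
    proof -
      have "dual.ip Y (dual.flow T (dual.flow (- T) V)) = 0"
        using transposition_sol_identity[OF s T vL Z Y, of "dual.flow (- T) V"] v'(2) by (simp add: v_def)
      moreover have "dual.ip Y (dual.flow T (dual.flow (- T) V)) = dual.ip Y V"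
        unfolding dual.ip_def by (rule sum.cong[OF refl]) (simp add: dual.flow_flow dual.flow_0)
      ultimately show ?thesis by (simp add: dual.ip_def)
    qed
    from dual.ip_ext[OF this i] show ?thesis using Y i by (simp add: represents_def emb_0_iff)
  qed
  then show ?thesis
    using transposition_sol_exists[of v, OF vL Z] v'(1) vL
    by (intro exI[of _ v]) (auto simp: v_def)
qed

end

theorem theorem3p6:
  fixes A :: "'h::{real_inner, complete_space} operator"
    and C :: "nat \<Rightarrow> nat \<Rightarrow> 'h \<Rightarrow> 'h"
    and P :: "nat \<Rightarrow> 'h \<Rightarrow> 'h"
    and G :: "nat \<Rightarrow> 'g::{real_inner, complete_space} set"
    and Bs :: "nat \<Rightarrow> 'h \<times> 'h \<Rightarrow> 'g"
    and B :: "nat \<Rightarrow> 'g \<Rightarrow> 'h gvec"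
    and n p q :: nat
    and \<omega> T' :: real
    and T\<^sub>0 :: "nat \<Rightarrow> real"
  assumes "n \<ge> 2" and "p \<ge> 1" and "q \<in> {1..p}"
    and "selfadjoint_op A" and "positive_op A" and "compact_resolvent A"
    and "\<omega> > 0" and "\<forall>(u, f)\<in>A. norm f \<ge> \<omega> * norm u"
    and "coupling_hyp A C P n"
    and "coupling_observability_hyp A P n"
    and "\<forall>i\<in>{n + 1..n + p}. \<forall>j\<in>{n - 1..i - 1}. \<forall>k\<in>{0, 1}.
           bounded_on_H A k (C i j) \<and> bounded_on_H A k (adjoint (C i j))"
    and "\<forall>j\<in>{0..p}. admissibility_hyp A (G (n + j)) (Bs (n + j))"
    and "\<forall>j\<in>{0..p}. observability_hyp A (Bs (n + j)) (T\<^sub>0 (n + j))"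
    and "observability_time A C Bs n p T\<^sub>0 T'"
    and "\<forall>k\<in>{0..q}. bounded_into_H A (- 2) (G (n + k)) (B (n + k)) \<and>
           (\<forall>u\<in>Hdom A 2. \<forall>z. Bs (n + k) (u, z) = control_adj (G (n + k)) (B (n + k)) u)"
    and "\<forall>k\<in>{q + 1..p}. bounded_into_H A 0 (G (n + k)) (B (n + k)) \<and>
           (\<forall>u\<in>Hdom A 2. \<forall>z. Bs (n + k) (u, z) = control_adj (G (n + k)) (B (n + k)) z)"
  shows "\<forall>T>T'. \<forall>(y0, y1)\<in>state_space A n p q.
           \<exists>v. (\<forall>k\<in>{0..p}. L2_fun T (v (n + k)) \<and> (\<forall>t\<in>{0<..<T}. v (n + k) t \<in> G (n + k))) \<and>
               (\<exists>y y'. transposition_sol A C G B n p q T v y0 y1 y y') \<and>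
               (\<forall>y y'. transposition_sol A C G B n p q T v y0 y1 y y' \<longrightarrow>
                  (\<forall>i\<in>{1..n + p}. y i T = (\<lambda>_. 0) \<and> y' i T = (\<lambda>_. 0)))"
proof (intro allI impI ballI, clarify)
  fix T y0 y1 assume T: "T' < T" and y: "(y0, y1) \<in> state_space A n p q"
  obtain \<epsilon> m c where e: "eigenbasis A \<epsilon> m c"
    using eigenbasis_exists[OF assms(4-8)] by blast
  have "mixed_cascade A \<epsilon> m c C G Bs B n p q T\<^sub>0 T' T"
  proof (intro mixed_cascade.intro mixed_cascade_axioms.intro e)
    show "2 \<le> n" "1 \<le> q" "q \<le> p" "T' < T" "observability_time A C Bs n p T\<^sub>0 T'"
      using assms(1,3,14) T by auto
    show "bounded_on_H A (int k) (adjoint (C i (i - 1)))" if "i \<in> {2..n}" "k \<in> {0..n - i + 1}" for i k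
      using assms(9) that unfolding coupling_hyp_def by blast
    show "bounded_on_H A r (adjoint (C i j))" if "i \<in> {n + 1..n + p}" "j \<in> {n - 1..i - 1}" "r \<in> {0, 1}" for i j r
      using assms(11) that by blast
    show "admissibility_hyp A (G (n + l)) (Bs (n + l))" "observability_hyp A (Bs (n + l)) (T\<^sub>0 (n + l))" if "l \<le> p" for l
      using assms(12,13) that by auto
    show "Bs (n + l) (u, z) = control_adj (G (n + l)) (B (n + l)) u" if "l \<le> q" "u \<in> Hdom A 2" for l u z
      using assms(15) that by simp
    show "Bs (n + l) (u, z) = control_adj (G (n + l)) (B (n + l)) z" if "l \<in> {q + 1..p}" "u \<in> Hdom A 2" for l u z
      using assms(16) that by simp
  qed
  from mixed_cascade.null_controllable[OF this y]
  show "\<exists>v. (\<forall>k\<in>{0..p}. L2_fun T (v (n + k)) \<and> (\<forall>t\<in>{0<..<T}. v (n + k) t \<in> G (n + k))) \<and>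
     (\<exists>y y'. transposition_sol A C G B n p q T v y0 y1 y y') \<and>
     (\<forall>y y'. transposition_sol A C G B n p q T v y0 y1 y y' \<longrightarrow>
        (\<forall>i\<in>{1..n + p}. y i T = (\<lambda>_. 0) \<and> y' i T = (\<lambda>_. 0)))" .
qed

end
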